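(* Let $X=G\backslash\tilde X$ be a regular quotient of a Hadamard space, and let $\alpha,\beta$ be rays in $X$ with origins $a,b$. Then: (i) $\alpha\prec\beta$ if and only if $\alpha\prec_G\beta$; (ii) $B_\alpha=B_\beta$ if and only if $\alpha\prec_G\beta$, $\beta\prec_G\alpha$ and $B_\alpha(a,b)=B_\beta(a,b)$.
   Context: A Hadamard space is a complete simply connected Riemannian manifold $\tilde X$ of nonpositive sectional curvature; a regular quotient $X=G\backslash\tilde X$ is its quotient by a discrete, torsion-free group $G$ of isometries, with projection $\pi:\tilde X\to X$. Geodesics are parametrized by arc-length. The length excess of a half-geodesic $\alpha:[0,\infty)\to X$ is $\Delta(\alpha)=\sup_{t,s}\big(|t-s|-d(\alpha(t),\alpha(s))\big)$; $\alpha$ is a quasi-ray if $\Delta(\alpha)<\infty$ and a ray if $\Delta(\alpha)=0$. The Busemann function of a quasi-ray is $B_\alpha(x,y)=\lim_{t\to\infty}\big(d(x,\alpha(t))-d(\alpha(t),y)\big)$. Coray relation: a half-geodesic $\alpha$ with origin $a$ is a coray to a quasi-ray $\beta$, written $\alpha\prec\beta$, if there is a sequence of minimizing geodesic segments $\alpha_n=[a_n,b_n]$ with $a_n\to a$, $b_n=\beta(t_n)$, $t_n\to\infty$, such that $\alpha_n\to\alpha$ uniformly on compact sets. Weak $G$-equivalence: let $\alpha,\beta$ be quasi-rays with origins $a,b$ and lift them to rays $\tilde\alpha,\tilde\beta$ of $\tilde X$ with origins $\tilde a,\tilde b$ and points at infinity $\tilde\alpha^+,\tilde\beta^+\in\partial\tilde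 X$. One writes $\alpha\prec_G\beta$ if there is a sequence $g_n\in G$ such that $g_n\tilde\beta^+\to\tilde\alpha^+$ in $\partial\tilde X$ and the quasi-rays $\alpha_n=\pi([\tilde a,g_n\tilde\beta^+])$ have $\Delta(\alpha_n)\to 0$, where $[\tilde a,\xi]$ is the unique ray of $\tilde X$ from $\tilde a$ with point at infinity $\xi$. *)

theory Defs
  imports "HOL-Analysis.Analysis" "HOL-Algebra.Bij"
begin

section \<open>Riemannian manifolds\<close>

text \<open>
  The underlying set of a manifold is a type; its topology is that of the type. A chart is a pair
  \<open>(U, \<phi>)\<close>, where \<open>\<phi>\<close> is only relevant on the open set \<open>U\<close>, with values in a Euclidean space \<open>'e\<close>
  (so the dimension \<open>DIM('e)\<close> is arbitrary, but positive: the one-point manifold, which contains no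
  half-geodesic, is not covered).
\<close>

type_synonym ('a, 'e) chart = "'a set \<times> ('a \<Rightarrow> 'e)"

text \<open>Meant for open sets \<open>S\<close>.\<close>

fun Ck_on :: "nat \<Rightarrow> 'e::euclidean_space set \<Rightarrow> ('e \<Rightarrow> 'f::real_normed_vector) \<Rightarrow> bool" where
  "Ck_on 0 S f \<longleftrightarrow> continuous_on S f"
| "Ck_on (Suc k) S f \<longleftrightarrow> (\<forall>x\<in>S. f differentiable (at x)) \<and>
     (\<forall>v. Ck_on k S (\<lambda>x. frechet_derivative f (at x) v))"

definition smooth_on :: "'e::euclidean_space set \<Rightarrow> ('e \<Rightarrow> 'f::real_normed_vector) \<Rightarrow> bool" where
  "smooth_on S f \<longleftrightarrow> (\<forall>k. Ck_on k S f)"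

definition transition :: "('a, 'e) chart \<Rightarrow> ('a, 'e) chart \<Rightarrow> 'e \<Rightarrow> 'e" where
  "transition c c' = snd c' \<circ> inv_into (fst c) (snd c)"

definition smooth_atlas ::
  "('a::topological_space, 'e::euclidean_space) chart set \<Rightarrow> bool" where
  "smooth_atlas A \<longleftrightarrow>
     (\<Union>c\<in>A. fst c) = UNIV \<and>
     (\<forall>(U, \<phi>)\<in>A. open U \<and> open (\<phi> ` U) \<and> homeomorphism U (\<phi> ` U) \<phi> (inv_into U \<phi>)) \<and>
     (\<forall>c\<in>A. \<forall>c'\<in>A. smooth_on (snd c ` (fst c \<inter> fst c')) (transition c c'))"

text \<open>
  A metric tensor is given by its local expressions: \<open>g c p\<close> is the inner product
  on the tangent space at the point with coordinates \<open>p\<close> in the chart \<open>c\<close>. Tangent vectors at a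
  point of \<open>fst c\<close> are identified with elements of \<open>'e\<close> via \<open>c\<close>; the last condition says that the
  local expressions define the same tensor on overlaps.
\<close>

type_synonym ('a, 'e) metric_tensor = "('a, 'e) chart \<Rightarrow> 'e \<Rightarrow> 'e \<Rightarrow> 'e \<Rightarrow> real"

definition riemannian_metric ::
  "('a, 'e::euclidean_space) chart set \<Rightarrow> ('a, 'e) metric_tensor \<Rightarrow> bool" where
  "riemannian_metric A g \<longleftrightarrow>
     (\<forall>c\<in>A.
        (\<forall>p\<in>snd c ` fst c. bilinear (g c p) \<and> (\<forall>u v. g c p u v = g c p v u) \<and>
                            (\<forall>u. u \<noteq> 0 \<longrightarrow> 0 < g c p u u)) \<and>
        (\<forall>u v. smooth_on (snd c ` fst c) (\<lambda>p. g c p u v))) \<and>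
     (\<forall>c\<in>A. \<forall>c'\<in>A. \<forall>x\<in>fst c \<inter> fst c'. \<forall>u v.
        let D = frechet_derivative (transition c c') (at (snd c x))
        in g c (snd c x) u v = g c' (snd c' x) (D u) (D v))"

subsection \<open>Riemannian distance\<close>

definition C1_arc ::
  "('a::topological_space, 'e::euclidean_space) chart set \<Rightarrow> (real \<Rightarrow> 'a) \<Rightarrow> real \<Rightarrow> real \<Rightarrow> bool" where
  "C1_arc A \<gamma> a b \<longleftrightarrow> continuous_on {a..b} \<gamma> \<and>
     (\<forall>(U, \<phi>)\<in>A. \<exists>D. continuous_on {t\<in>{a..b}. \<gamma> t \<in> U} D \<and>
        (\<forall>t\<in>{a..b}. \<gamma> t \<in> U \<longrightarrow>
           ((\<lambda>s. \<phi> (\<gamma> s)) has_vector_derivative D t) (at t within {a..b})))"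

definition piecewise_C1_path ::
  "('a::topological_space, 'e::euclidean_space) chart set \<Rightarrow> (real \<Rightarrow> 'a) \<Rightarrow> bool" where
  "piecewise_C1_path A \<gamma> \<longleftrightarrow>
     (\<exists>T. finite T \<and> {0, 1} \<subseteq> T \<and> T \<subseteq> {0..1} \<and>
        (\<forall>a\<in>T. \<forall>b\<in>T. a < b \<and> T \<inter> {a<..<b} = {} \<longrightarrow> C1_arc A \<gamma> a b))"

text \<open>
  The speed does not depend on the chosen chart, except possibly at the finitely many break
  points, which do not affect the integral.
\<close>

definition speed :: "('a, 'e::euclidean_space) chart set \<Rightarrow> ('a, 'e) metric_tensor \<Rightarrow>
    (real \<Rightarrow> 'a) \<Rightarrow> real \<Rightarrow> real" where
  "speed A g \<gamma> t =
     (let c = (SOME c. c \<in> A \<and> \<gamma> t \<in> fst c);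
          v = vector_derivative (\<lambda>s. snd c (\<gamma> s)) (at t)
      in sqrt (g c (snd c (\<gamma> t)) v v))"

definition curve_length :: "('a, 'e::euclidean_space) chart set \<Rightarrow> ('a, 'e) metric_tensor \<Rightarrow>
    (real \<Rightarrow> 'a) \<Rightarrow> real" where
  "curve_length A g \<gamma> = integral {0..1} (speed A g \<gamma>)"

definition riemannian_dist :: "('a::topological_space, 'e::euclidean_space) chart set \<Rightarrow>
    ('a, 'e) metric_tensor \<Rightarrow> 'a \<Rightarrow> 'a \<Rightarrow> real" where
  "riemannian_dist A g x y =
     Inf {curve_length A g \<gamma> |\<gamma>. piecewise_C1_path A \<gamma> \<and> pathstart \<gamma> = x \<and> pathfinish \<gamma> = y}"

subsection \<open>Curvature\<close>

text \<open>
  Christoffel symbols of the Levi-Civita connection in a chart \<open>c\<close>, as a map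
  \<open>(u, v) \<mapsto> \<nabla>\<^sub>u v\<close> for constant coordinate vector fields \<open>u, v\<close> (Koszul formula).
\<close>

definition christoffel ::
  "('a, 'e::euclidean_space) metric_tensor \<Rightarrow> ('a, 'e) chart \<Rightarrow> 'e \<Rightarrow> 'e \<Rightarrow> 'e \<Rightarrow> 'e" where
  "christoffel g c p u v =
     (let D = (\<lambda>w a b. frechet_derivative (\<lambda>q. g c q a b) (at p) w)
      in THE z. \<forall>w. g c p z w = (D u v w + D v u w - D w u v) / 2)"

text \<open>\<open>R(u, v) w = \<nabla>\<^sub>u \<nabla>\<^sub>v w - \<nabla>\<^sub>v \<nabla>\<^sub>u w\<close> for constant coordinate vector fields.\<close>

definition riemann_curvature ::
  "('a, 'e::euclidean_space) metric_tensor \<Rightarrow> ('a, 'e) chart \<Rightarrow> 'e \<Rightarrow> 'e \<Rightarrow> 'e \<Rightarrow> 'e \<Rightarrow> 'e" where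
  "riemann_curvature g c p u v w =
     (let \<Gamma> = christoffel g c
      in frechet_derivative (\<lambda>q. \<Gamma> q v w) (at p) u - frechet_derivative (\<lambda>q. \<Gamma> q u w) (at p) v
         + \<Gamma> p u (\<Gamma> p v w) - \<Gamma> p v (\<Gamma> p u w))"

definition sectional_curvature ::
  "('a, 'e::euclidean_space) metric_tensor \<Rightarrow> ('a, 'e) chart \<Rightarrow> 'e \<Rightarrow> 'e \<Rightarrow> 'e \<Rightarrow> real" where
  "sectional_curvature g c p u v =
     g c p (riemann_curvature g c p u v v) u / (g c p u u * g c p v v - (g c p u v)\<^sup>2)"

subsection \<open>Hadamard spaces\<close>

text \<open>
  The distance of the type is required to be the Riemannian one, so \<open>complete\<close> is completeness
  of the Riemannian distance. The library's \<open>simply_connected\<close> includes path-connectedness.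
\<close>

locale hadamard_space =
  fixes A :: "('a::metric_space, 'e::euclidean_space) chart set"
    and g :: "('a, 'e) metric_tensor"
  assumes smooth_atlas: "smooth_atlas A"
    and riemannian_metric: "riemannian_metric A g"
    and dist_eq_riemannian_dist: "\<And>x y. dist x y = riemannian_dist A g x y"
    and complete_UNIV: "complete (UNIV :: 'a set)"
    and simply_connected_UNIV: "simply_connected (UNIV :: 'a set)"
    and nonpositive_curvature:
      "\<And>c p u v. c \<in> A \<Longrightarrow> p \<in> snd c ` fst c \<Longrightarrow> u \<noteq> v \<Longrightarrow> independent {u, v} \<Longrightarrow>
         sectional_curvature g c p u v \<le> 0"

section \<open>Half-geodesics, quasi-rays and Busemann functions\<close>

text \<open>
  These are defined for an arbitrary distance function \<open>d\<close> on a set \<open>X\<close>. Half-geodesics are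
  functions on the reals of which only the values on \<open>[0, \<infinity>)\<close> matter. A geodesic is a curve
  parametrized by arc-length which is locally distance-realizing.
\<close>

definition half_geodesic :: "'b set \<Rightarrow> ('b \<Rightarrow> 'b \<Rightarrow> real) \<Rightarrow> (real \<Rightarrow> 'b) \<Rightarrow> bool" where
  "half_geodesic X d \<alpha> \<longleftrightarrow>
     (\<forall>t\<ge>0. \<alpha> t \<in> X) \<and>
     (\<forall>t\<ge>0. \<exists>\<epsilon>>0. \<forall>r\<ge>0. \<forall>s\<ge>0. \<bar>r - t\<bar> < \<epsilon> \<and> \<bar>s - t\<bar> < \<epsilon> \<longrightarrow> d (\<alpha> r) (\<alpha> s) = \<bar>r - s\<bar>)"

definition length_excess :: "('b \<Rightarrow> 'b \<Rightarrow> real) \<Rightarrow> (real \<Rightarrow> 'b) \<Rightarrow> ereal" where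
  "length_excess d \<alpha> = (SUP (t, s)\<in>{0..} \<times> {0..}. ereal (\<bar>t - s\<bar> - d (\<alpha> t) (\<alpha> s)))"

definition quasi_ray :: "'b set \<Rightarrow> ('b \<Rightarrow> 'b \<Rightarrow> real) \<Rightarrow> (real \<Rightarrow> 'b) \<Rightarrow> bool" where
  "quasi_ray X d \<alpha> \<longleftrightarrow> half_geodesic X d \<alpha> \<and> length_excess d \<alpha> < \<infinity>"

definition ray :: "'b set \<Rightarrow> ('b \<Rightarrow> 'b \<Rightarrow> real) \<Rightarrow> (real \<Rightarrow> 'b) \<Rightarrow> bool" where
  "ray X d \<alpha> \<longleftrightarrow> half_geodesic X d \<alpha> \<and> length_excess d \<alpha> = 0"

definition busemann :: "('b \<Rightarrow> 'b \<Rightarrow> real) \<Rightarrow> (real \<Rightarrow> 'b) \<Rightarrow> 'b \<Rightarrow> 'b \<Rightarrow> real" where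
  "busemann d \<alpha> x y = Lim at_top (\<lambda>t. d x (\<alpha> t) - d (\<alpha> t) y)"

definition minimizing_segment ::
  "'b set \<Rightarrow> ('b \<Rightarrow> 'b \<Rightarrow> real) \<Rightarrow> (real \<Rightarrow> 'b) \<Rightarrow> real \<Rightarrow> 'b \<Rightarrow> 'b \<Rightarrow> bool" where
  "minimizing_segment X d \<sigma> l x y \<longleftrightarrow>
     0 \<le> l \<and> \<sigma> 0 = x \<and> \<sigma> l = y \<and> (\<forall>t\<in>{0..l}. \<sigma> t \<in> X) \<and>
     (\<forall>t\<in>{0..l}. \<forall>s\<in>{0..l}. d (\<sigma> t) (\<sigma> s) = \<bar>t - s\<bar>)"

text \<open>
  In the last clause, \<open>T \<le> l n\<close> says that \<open>\<sigma> n\<close> is defined on all of \<open>[0, T]\<close>; it holds for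
  large \<open>n\<close> since the endpoints \<open>\<beta> (t n)\<close> go to infinity.
\<close>

definition coray ::
  "'b set \<Rightarrow> ('b \<Rightarrow> 'b \<Rightarrow> real) \<Rightarrow> (real \<Rightarrow> 'b) \<Rightarrow> (real \<Rightarrow> 'b) \<Rightarrow> bool" where
  "coray X d \<alpha> \<beta> \<longleftrightarrow> half_geodesic X d \<alpha> \<and> quasi_ray X d \<beta> \<and>
     (\<exists>(\<sigma> :: nat \<Rightarrow> real \<Rightarrow> 'b) l a t.
        (\<forall>n. 0 \<le> t n \<and> minimizing_segment X d (\<sigma> n) (l n) (a n) (\<beta> (t n))) \<and>
        (\<lambda>n. d (a n) (\<alpha> 0)) \<longlonglongrightarrow> 0 \<and>
        filterlim t at_top sequentially \<and>
        (\<forall>T\<ge>0. \<forall>\<epsilon>>0. \<forall>\<^sub>F n in sequentially. T \<le> l n \<and> (\<forall>s\<in>{0..T}. d (\<sigma> n s) (\<alpha> s) < \<epsilon>)))"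

section \<open>The boundary at infinity of a Hadamard space\<close>

text \<open>
  A point at infinity is a class of asymptotic rays, regardless of their values at negative
  arguments.
\<close>

definition point_at_infinity :: "(real \<Rightarrow> 'a::metric_space) \<Rightarrow> (real \<Rightarrow> 'a) set" where
  "point_at_infinity \<gamma> = {\<gamma>'. ray UNIV dist \<gamma>' \<and> (\<exists>C. \<forall>t\<ge>0. dist (\<gamma> t) (\<gamma>' t) \<le> C)}"

definition boundary_at_infinity :: "(real \<Rightarrow> 'a::metric_space) set set" where
  "boundary_at_infinity = {point_at_infinity \<gamma> |\<gamma>. ray UNIV dist \<gamma>}"

text \<open>\<open>ray_to x \<xi>\<close> is the ray \<open>[x, \<xi>]\<close>; extensionality fixes its values outside \<open>[0, \<infinity>)\<close>.\<close>

definition ray_to :: "'a::metric_space \<Rightarrow> (real \<Rightarrow> 'a) set \<Rightarrow> real \<Rightarrow> 'a" where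
  "ray_to x \<xi> = (THE \<gamma>. \<gamma> \<in> \<xi> \<and> \<gamma> 0 = x \<and> \<gamma> \<in> extensional {0..})"

text \<open>
  The cone topology: \<open>\<xi>\<^sub>n\<close> converges to \<open>\<xi>\<close> iff \<open>[x, \<xi>\<^sub>n]\<close> converges to \<open>[x, \<xi>]\<close> uniformly on
  compact sets, for one (equivalently every) \<open>x\<close>.
\<close>

definition cone_topology :: "(real \<Rightarrow> 'a::metric_space) set topology" where
  "cone_topology = topology_generated_by
     {{\<eta> \<in> boundary_at_infinity. dist (ray_to x \<eta> T) (ray_to x \<xi> T) < \<epsilon>} |x \<xi> T \<epsilon>.
        \<xi> \<in> boundary_at_infinity \<and> 0 \<le> T \<and> 0 < \<epsilon>}"

definition act_boundary ::
  "('a \<Rightarrow> 'a) \<Rightarrow> (real \<Rightarrow> 'a) set \<Rightarrow> (real \<Rightarrow> 'a) set" where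
  "act_boundary h \<xi> = (\<lambda>\<gamma>. h \<circ> \<gamma>) ` \<xi>"

section \<open>Regular quotients\<close>

text \<open>
  Discreteness refers to the topology of pointwise convergence, which on isometries coincides with
  the compact-open topology.
\<close>

locale regular_quotient = hadamard_space A g
  for A :: "('a::metric_space, 'e::euclidean_space) chart set" and g :: "('a, 'e) metric_tensor" +
  fixes G :: "('a \<Rightarrow> 'a) set"
  assumes subgroup_G: "subgroup G (BijGroup UNIV)"
    and isometry_G: "\<And>h x y. h \<in> G \<Longrightarrow> dist (h x) (h y) = dist x y"
    and discrete_G: "discrete G"
    and torsion_free_G: "\<And>h n. h \<in> G \<Longrightarrow> h \<noteq> id \<Longrightarrow> 0 < n \<Longrightarrow> h ^^ n \<noteq> id"

text \<open>
  The points of the quotient are the orbits; the distance of two orbits is the infimum of the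
  distances of their elements.
\<close>

definition proj :: "('a \<Rightarrow> 'a) set \<Rightarrow> 'a \<Rightarrow> 'a set" where
  "proj G x = {h x |h. h \<in> G}"

definition quotient_space :: "('a \<Rightarrow> 'a) set \<Rightarrow> 'a set set" where
  "quotient_space G = range (proj G)"

definition quotient_dist :: "'a::metric_space set \<Rightarrow> 'a set \<Rightarrow> real" where
  "quotient_dist P Q = setdist P Q"

definition ray_lift ::
  "('a::metric_space \<Rightarrow> 'a) set \<Rightarrow> (real \<Rightarrow> 'a set) \<Rightarrow> (real \<Rightarrow> 'a) \<Rightarrow> bool" where
  "ray_lift G \<alpha> \<gamma> \<longleftrightarrow> ray UNIV dist \<gamma> \<and> (\<forall>t\<ge>0. proj G (\<gamma> t) = \<alpha> t)"

text \<open>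
  Lifts are unique up to the action of \<open>G\<close>, and the condition below does not depend on their choice.
\<close>

definition weakly_equivalent ::
  "('a::metric_space \<Rightarrow> 'a) set \<Rightarrow> (real \<Rightarrow> 'a set) \<Rightarrow> (real \<Rightarrow> 'a set) \<Rightarrow> bool" where
  "weakly_equivalent G \<alpha> \<beta> \<longleftrightarrow>
     quasi_ray (quotient_space G) quotient_dist \<alpha> \<and>
     quasi_ray (quotient_space G) quotient_dist \<beta> \<and>
     (\<exists>\<alpha>' \<beta>' h. ray_lift G \<alpha> \<alpha>' \<and> ray_lift G \<beta> \<beta>' \<and> (\<forall>n::nat. h n \<in> G) \<and>
        (let \<xi> = (\<lambda>n. act_boundary (h n) (point_at_infinity \<beta>'));
             \<alpha>s = (\<lambda>n. proj G \<circ> ray_to (\<alpha>' 0) (\<xi> n))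
         in limitin cone_topology \<xi> (point_at_infinity \<alpha>') sequentially \<and>
            (\<forall>n. quasi_ray (quotient_space G) quotient_dist (\<alpha>s n)) \<and>
            (\<lambda>n. length_excess quotient_dist (\<alpha>s n)) \<longlonglongrightarrow> 0))"

end

theory Submission
  imports Defs
begin

text \<open>
  Lift \<open>\<beta>\<close> to a ray with point at infinity \<open>\<xi>\<close>. The lift of the Busemann function of \<open>\<beta>\<close> is the infimum over \<open>h \<in> G\<close>
  of the Busemann functions of the rays towards \<open>h \<xi>\<close>. Both \<open>\<alpha> \<prec> \<beta>\<close> and \<open>\<alpha> \<prec>\<^sub>G \<beta>\<close> are shown to be equivalent to the
  Busemann function of \<open>\<beta>\<close> decreasing at unit speed along \<open>\<alpha>\<close>: elements \<open>h\<close> which almost realize the infimum at a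
  distant point of \<open>\<alpha>\<close> give rays of small excess that converge to \<open>\<alpha>\<close>, because geodesics do not branch and closed
  balls are compact. Part (ii) follows since the Busemann function of \<open>\<alpha>\<close> is, up to a constant, the largest function
  with this decrease along \<open>\<alpha>\<close> and Lipschitz constant 1.

  The geometry used is that of CAT(0) spaces. Convexity of the norm of Jacobi fields shows that the exponential map
  does not decrease distances, which gives the inequality of Bruhat and Tits locally; simple connectedness is used
  through the monodromy of local geodesics, as in the theorem of Cartan and Hadamard, to make it global.
\<close>

text \<open>Both relations speak of sequences of almost minimizers, of distances to far points of
  \<beta> in one case and of an infimum over \<open>G\<close> in the other; unit decrease of one
  function along \<alpha> removes the sequences. For weak equivalence the link is quantitative: the
  projected ray from x towards h \<xi> has as excess exactly the gap at x between the Busemann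
  function of h \<xi> and the infimum. For corays the obstacle sits at the origin: several corays
  may issue from \<alpha>(0), and only after a positive time s does \<alpha> prescribe its
  continuation. The approximating segments therefore start at \<alpha>(s), and s tends to 0. This is
  the one place where geodesics must not branch. The manifold gives curvature information only
  infinitesimally, so every metric property is proved in small balls and then globalized. No angles
  or comparison triangles appear: all curvature estimates are inequalities between squared
  distances, obtained from one inequality for the point dividing a segment. The hypothesis on
  curvature itself is used only for the sign of the curvature term in the Jacobi equation.\<close>

section \<open>Convexity from local midpoint inequalities\<close>

lemma local_midpoint_convex_le_chord:
  fixes h :: "real \<Rightarrow> real"
  assumes cont: "continuous_on {a..b} h" and ab: "a < b" and mid: "\<And>t. a < t \<Longrightarrow> t < b \<Longrightarrow>
      \<exists>e>0. a \<le> t - e \<and> t + e \<le> b \<and> 2 * h t \<le> h (t - e) + h (t + e)" and t: "t \<in> {a..b}"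
  shows "(b - a) * h t \<le> (b - t) * h a + (t - a) * h b"
proof (rule ccontr)
  assume contra: "\<not> ?thesis"
  define k where "k s = (b - a) * h s - ((b - s) * h a + (s - a) * h b)" for s
  have kc: "continuous_on {a..b} k" unfolding k_def by (intro continuous_intros cont)
  obtain m where m: "m \<in> {a..b}" "\<And>s. s \<in> {a..b} \<Longrightarrow> k s \<le> k m" using continuous_attains_sup[OF compact_Icc _ kc] t by auto
  define M where "M = {s \<in> {a..b}. k s = k m}"
  have "closed M" unfolding M_def by (rule continuous_closed_preimage_constant[OF kc closed_atLeastAtMost])
  moreover have "M \<noteq> {}" "bdd_below M" using m unfolding M_def by (auto intro: bdd_belowI[of _ a])
  ultimately have "Inf M \<in> M" using closed_contains_Inf by blast
  then have s: "Inf M \<in> {a..b}" "k (Inf M) = k m" unfolding M_def by auto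
  have pos: "0 < k m" using contra m(2)[OF t] unfolding k_def by auto
  have "k a = 0" "k b = 0" unfolding k_def by (auto simp: algebra_simps)
  with s pos have "a \<noteq> Inf M" "b \<noteq> Inf M" by auto
  then have "a < Inf M" "Inf M < b" using s by auto
  then obtain e where e: "e > 0" "a \<le> Inf M - e" "Inf M + e \<le> b"
    "2 * h (Inf M) \<le> h (Inf M - e) + h (Inf M + e)" using mid by blast
  have "(b - a) * (2 * h (Inf M)) \<le> (b - a) * (h (Inf M - e) + h (Inf M + e))" using e(4) ab by (intro mult_left_mono) auto
  then have "2 * k (Inf M) \<le> k (Inf M - e) + k (Inf M + e)" unfolding k_def by (simp add: algebra_simps)
  moreover have "k (Inf M + e) \<le> k m" using m e s by auto
  moreover have "k (Inf M - e) < k m"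
  proof -
    have "Inf M - e \<notin> M" using \<open>bdd_below M\<close> e(1) cInf_lower[of "Inf M - e" M] by auto
    then show ?thesis using m(2)[of "Inf M - e"] e s unfolding M_def by force
  qed
  ultimately show False using s by simp
qed

section \<open>The inequality of Bruhat and Tits\<close>

text \<open>The inequality in Stewart's form, for all ratios \<open>l\<close>. The dividing point
  \<open>n\<close> is not asked to lie in \<open>S\<close>, so the property can be used on a ball
  before anything is known about its convexity, and it passes to subsets.\<close>

definition cn_on :: "'a::metric_space set \<Rightarrow> bool" where
  "cn_on S \<longleftrightarrow> (\<forall>x\<in>S. \<forall>y\<in>S. \<forall>z\<in>S. \<forall>n l. 0 \<le> l \<and> l \<le> 1 \<and>
     dist x n = l * dist x y \<and> dist n y = (1 - l) * dist x y \<longrightarrow>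
     (dist z n)^2 \<le> (1 - l) * (dist z x)^2 + l * (dist z y)^2 - l * (1 - l) * (dist x y)^2)"

lemma cn_onD:
  assumes "cn_on S" "x \<in> S" "y \<in> S" "z \<in> S" "0 \<le> l" "l \<le> 1"
    "dist x n = l * dist x y" "dist n y = (1 - l) * dist x y"
  shows "(dist z n)^2 \<le> (1 - l) * (dist z x)^2 + l * (dist z y)^2 - l * (1 - l) * (dist x y)^2"
  using assms unfolding cn_on_def by blast

lemma cn_on_subset: "cn_on S \<Longrightarrow> T \<subseteq> S \<Longrightarrow> cn_on T" unfolding cn_on_def by blast

text \<open>The inequality is used twice: for the segment \<open>[o', z']\<close> seen from
  \<open>p\<close>, and for \<open>[o', z]\<close> seen from \<open>z'\<close>. The right-hand side
  is the value of the squared distance in a Euclidean triangle with the same sides.\<close>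

lemma cn_on_two_sides:
  assumes cn: "cn_on S" and S: "o' \<in> S" "z \<in> S" "z' \<in> S" "p \<in> S" and l: "0 \<le> l" "l \<le> 1" "0 \<le> l'" "l' \<le> 1"
    and p: "dist o' p = l * dist o' z" "dist p z = (1 - l) * dist o' z"
    and p': "dist o' p' = l' * dist o' z'" "dist p' z' = (1 - l') * dist o' z'"
  shows "(dist p p')^2 \<le> l * l' * (dist z z')^2 + l * (l - l') * (dist o' z)^2 + l' * (l' - l) * (dist o' z')^2"
proof -
  have 1: "(dist p p')^2 \<le> (1 - l') * (dist p o')^2 + l' * (dist p z')^2 - l' * (1 - l') * (dist o' z')^2"
    using assms by (intro cn_onD[OF cn]) auto
  have 2: "(dist z' p)^2 \<le> (1 - l) * (dist z' o')^2 + l * (dist z' z)^2 - l * (1 - l) * (dist o' z)^2"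
    using assms by (intro cn_onD[OF cn]) auto
  have "l' * (dist p z')^2 \<le> l' * ((1 - l) * (dist o' z')^2 + l * (dist z z')^2 - l * (1 - l) * (dist o' z)^2)"
    using 2 l by (intro mult_left_mono) (simp_all add: dist_commute)
  with 1 have "(dist p p')^2 \<le> (1 - l') * (l * dist o' z)^2 +
      l' * ((1 - l) * (dist o' z')^2 + l * (dist z z')^2 - l * (1 - l) * (dist o' z)^2)
      - l' * (1 - l') * (dist o' z')^2" using p by (simp add: dist_commute)
  then show ?thesis by (simp add: power2_eq_square algebra_simps)
qed

lemma cn_on_two_sides_eq:
  assumes cn: "cn_on S" and S: "o' \<in> S" "z \<in> S" "z' \<in> S" "p \<in> S" and l: "0 \<le> l" "l \<le> 1"
    and p: "dist o' p = l * dist o' z" "dist p z = (1 - l) * dist o' z"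
    and p': "dist o' p' = l * dist o' z'" "dist p' z' = (1 - l) * dist o' z'"
  shows "dist p p' \<le> l * dist z z'"
proof -
  have "(dist p p')^2 \<le> (l * dist z z')^2"
    using cn_on_two_sides[OF cn S l l p p'] by (simp add: power2_eq_square algebra_simps)
  then show ?thesis by (rule power2_le_imp_le) (use l in simp)
qed

definition geodesic_space :: "'a::metric_space itself \<Rightarrow> bool" where
  "geodesic_space _ \<longleftrightarrow> (\<forall>(x::'a) y. \<exists>c. c 0 = x \<and> c (dist x y) = y \<and>
     (\<forall>s\<in>{0..dist x y}. \<forall>t\<in>{0..dist x y}. dist (c s) (c t) = \<bar>s - t\<bar>))"

lemma geodesic_spaceD:
  fixes x y :: "'a::metric_space"
  assumes "geodesic_space TYPE('a)" "0 \<le> l" "l \<le> 1" obtains n where "dist x n = l * dist x y" "dist n y = (1 - l) * dist x y"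
proof -
  obtain c where c: "c 0 = x" "c (dist x y) = y"
    "\<forall>s\<in>{0..dist x y}. \<forall>t\<in>{0..dist x y}. dist (c s) (c t) = \<bar>s - t\<bar>" using assms unfolding geodesic_space_def by metis
  have in': "l * dist x y \<in> {0..dist x y}" using assms by (auto simp: mult_left_le_one_le)
  have "dist (c 0) (c (l * dist x y)) = l * dist x y" using c(3)[rule_format, of 0 "l * dist x y"] in' by auto
  moreover have "dist (c (l * dist x y)) (c (dist x y)) = (1 - l) * dist x y"
    using c(3)[rule_format, OF in', of "dist x y"] in' by (auto simp: algebra_simps)
  ultimately show ?thesis using that c by auto
qed

text \<open>The diagonal \<open>[x, y']\<close> cuts the quadrilateral into two triangles; its
  dividing point \<open>n\<close> is compared with \<open>p\<close> in one of them and with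
  \<open>p'\<close> in the other.\<close>

lemma cn_on_convex_dist:
  fixes S :: "'a::metric_space set"
  assumes geo: "geodesic_space TYPE('a)" and cn: "cn_on S" and S: "x \<in> S" "y \<in> S" "x' \<in> S" "y' \<in> S" "p \<in> S" "p' \<in> S"
    and l: "0 \<le> l" "l \<le> 1" and p: "dist x p = l * dist x y" "dist p y = (1 - l) * dist x y"
    and p': "dist x' p' = l * dist x' y'" "dist p' y' = (1 - l) * dist x' y'"
  shows "dist p p' \<le> (1 - l) * dist x x' + l * dist y y'"
proof -
  obtain n where n: "dist x n = l * dist x y'" "dist n y' = (1 - l) * dist x y'" using geodesic_spaceD[OF geo l] by blast
  have "dist p n \<le> l * dist y y'" using cn_on_two_sides_eq[OF cn _ _ _ _ l p n] S by auto
  moreover have "dist p' n \<le> (1 - l) * dist x' x"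
    by (rule cn_on_two_sides_eq[OF cn, of y']) (use S l n p' in \<open>simp_all add: dist_commute\<close>)
  ultimately show ?thesis using dist_triangle[of p p' n] by (simp add: dist_commute)
qed

lemma sum_sq_le_weighted:
  fixes a b :: real
  assumes "0 < m" "m < 1"
  shows "(a + b)^2 \<le> a^2 / m + b^2 / (1 - m)"
proof -
  define u v where "u = a / m" and "v = b / (1 - m)"
  have ab: "a = m * u" "b = (1 - m) * v" using assms unfolding u_def v_def by auto
  have "m * u^2 + (1 - m) * v^2 - (m * u + (1 - m) * v)^2 = m * (1 - m) * (u - v)^2"
    by (simp add: power2_eq_square algebra_simps)
  moreover have "0 \<le> m * (1 - m) * (u - v)^2" using assms by simp
  moreover have "a^2 / m = m * u^2" "b^2 / (1 - m) = (1 - m) * v^2" unfolding ab using assms by (auto simp: power2_eq_square)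
  ultimately show ?thesis unfolding ab(1) ab(2) by simp
qed

text \<open>The diagonals are compared at the point of the diagonal \<open>[q, p']\<close> dividing it in the ratio of the sides
  \<open>[p, q]\<close> and \<open>[p', q']\<close>.\<close>

lemma cn_on_diagonals:
  fixes S :: "'a::metric_space set"
  assumes geo: "geodesic_space TYPE('a)" and cn: "cn_on S" and S: "p \<in> S" "q \<in> S" "p' \<in> S" "q' \<in> S"
  shows "(dist q p')^2 + (dist p q')^2 \<le> (dist p p')^2 + (dist q q')^2 + 2 * dist p q * dist p' q'"
proof (cases "dist p q = 0 \<or> dist p' q' = 0")
  case True
  then show ?thesis by (auto simp: dist_commute)
next
  case False
  then have d: "0 < dist p q" "0 < dist p' q'" by auto
  \<comment> \<open>The ratio is such that both weighted squares,
    \<open>((1 - m) / m) * (dist p q)^2\<close> and \<open>(m / (1 - m)) * (dist p' q')^2\<close>,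
    become the product of the two sides.\<close>
  define m where "m = dist p q / (dist p q + dist p' q')"
  have m: "0 < m" "m < 1" "(1 - m) / m = dist p' q' / dist p q" "m / (1 - m) = dist p q / dist p' q'"
  proof -
    have s: "dist p q + dist p' q' > 0" using d by (rule add_pos_pos)
    show "0 < m" "m < 1" using d s unfolding m_def by simp_all
    have "1 - m = dist p' q' / (dist p q + dist p' q')"
      using diff_divide_eq_iff[of "dist p q + dist p' q'" 1 "dist p q"] s unfolding m_def by (simp add: field_simps)
    then show "(1 - m) / m = dist p' q' / dist p q" "m / (1 - m) = dist p q / dist p' q'"
      using d s unfolding m_def by simp_all
  qed
  obtain n where n: "dist q n = m * dist q p'" "dist n p' = (1 - m) * dist q p'"
    using geodesic_spaceD[OF geo, of m] m by (metis less_imp_le)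
  have 1: "(dist p n)^2 \<le> (1 - m) * (dist p q)^2 + m * (dist p p')^2 - m * (1 - m) * (dist q p')^2"
    by (rule cn_onD[OF cn]) (use S m n in auto)
  have 2: "(dist q' n)^2 \<le> (1 - m) * (dist q' q)^2 + m * (dist q' p')^2 - m * (1 - m) * (dist q p')^2"
    by (rule cn_onD[OF cn]) (use S m n in auto)
  have "(dist p q')^2 \<le> (dist p n + dist n q')^2" by (intro power_mono dist_triangle) auto
  also have "\<dots> \<le> (dist p n)^2 / m + (dist q' n)^2 / (1 - m)" using sum_sq_le_weighted[OF m(1,2)] by (simp add: dist_commute)
  also have "\<dots> \<le> ((1 - m) * (dist p q)^2 + m * (dist p p')^2 - m * (1 - m) * (dist q p')^2) / m
      + ((1 - m) * (dist q' q)^2 + m * (dist q' p')^2 - m * (1 - m) * (dist q p')^2) / (1 - m)"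
    using 1 2 m by (intro add_mono divide_right_mono) auto
  also have "\<dots> = ((1 - m) / m) * (dist p q)^2 + (dist p p')^2 - (1 - m) * (dist q p')^2
      + (dist q' q)^2 + (m / (1 - m)) * (dist q' p')^2 - m * (dist q p')^2"
  proof -
    have "((1 - m) * X + m * Y - m * (1 - m) * Z) / m = ((1 - m) / m) * X + Y - (1 - m) * Z" for X Y Z
      using m(1) by (simp add: field_simps)
    moreover have "((1 - m) * X + m * Y - m * (1 - m) * Z) / (1 - m) = X + (m / (1 - m)) * Y - m * Z" for X Y Z
    proof -
      have "(1 - m) * X + ((1 - m) * k) * Y - m * (1 - m) * Z = (1 - m) * (X + k * Y - m * Z)" for k
        by (simp add: algebra_simps)
      from this[of "m / (1 - m)"]
      have "(1 - m) * X + m * Y - m * (1 - m) * Z = (1 - m) * (X + (m / (1 - m)) * Y - m * Z)" using m(2) by simp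
      then show ?thesis using m(2) by simp
    qed
    ultimately show ?thesis by simp
  qed
  also have "\<dots> = (dist p p')^2 + (dist q q')^2 + 2 * dist p q * dist p' q' - (dist q p')^2"
    unfolding m(3,4) using d by (simp add: power2_eq_square dist_commute algebra_simps)
  finally show ?thesis by simp
qed

text \<open>Three uses of the inequality leave the squared diagonals on the right, which
  \<open>cn_on_diagonals\<close> trades for sides. The gain over plain convexity is the last term,
  the squared change of width, which \<open>midpoint_inequality\<close> sums over a subdivided
  triangle.\<close>

lemma cn_on_midpoints:
  fixes S :: "'a::metric_space set"
  assumes geo: "geodesic_space TYPE('a)" and cn: "cn_on S" and S: "p \<in> S" "q \<in> S" "p' \<in> S" "q' \<in> S" "m \<in> S"
    and m: "dist p m = dist p q / 2" "dist m q = dist p q / 2"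
    and m': "dist p' m' = dist p' q' / 2" "dist m' q' = dist p' q' / 2"
  shows "(dist m m')^2 \<le> (dist p p')^2 / 2 + (dist q q')^2 / 2 - (dist p q - dist p' q')^2 / 4"
proof -
  have A: "(dist z m)^2 \<le> (dist z p)^2 / 2 + (dist z q)^2 / 2 - (dist p q)^2 / 4" if "z \<in> S" for z
    using cn_onD[OF cn S(1,2) that, of "1/2" m] m by simp
  have "(dist m m')^2 \<le> (dist m p')^2 / 2 + (dist m q')^2 / 2 - (dist p' q')^2 / 4"
    using cn_onD[OF cn S(3,4,5), of "1/2" m'] m' by simp
  moreover have "(dist m p')^2 \<le> (dist p p')^2 / 2 + (dist q p')^2 / 2 - (dist p q)^2 / 4"
    "(dist m q')^2 \<le> (dist p q')^2 / 2 + (dist q q')^2 / 2 - (dist p q)^2 / 4"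
    using A[OF S(3)] A[OF S(4)] by (simp_all add: dist_commute)
  moreover note cn_on_diagonals[OF geo cn S(1-4)]
  moreover have "(dist p q - dist p' q')^2 = (dist p q)^2 + (dist p' q')^2 - 2 * dist p q * dist p' q'"
    by (simp add: power2_eq_square algebra_simps)
  ultimately show ?thesis by linarith
qed

definition nonbranching_on :: "'a::metric_space set \<Rightarrow> bool" where
  "nonbranching_on S \<longleftrightarrow> (\<forall>x\<in>S. \<forall>n\<in>S. \<forall>y\<in>S. \<forall>y'\<in>S. x \<noteq> n \<and> dist x y = dist x n + dist n y \<and>
     dist x y' = dist x n + dist n y' \<and> dist n y = dist n y' \<longrightarrow> y = y')"

section \<open>The theorem of Hopf and Rinow\<close>

text \<open>Finitely many values are chosen one after the other; compactness gives all of them.\<close>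

lemma isometric_curve_exists:
  fixes Q :: "real \<Rightarrow> 'a::metric_space \<Rightarrow> bool"
  assumes proper: "\<And>(x :: 'a) r. compact (cball x r)" and I: "0 \<in> I" "I \<subseteq> {0..}"
    and cl: "\<And>t. t \<in> I \<Longrightarrow> closed {z. Q t z}" and x: "Q 0 x"
    and extend: "\<And>s t z. s \<in> I \<Longrightarrow> t \<in> I \<Longrightarrow> s < t \<Longrightarrow> Q s z \<Longrightarrow> \<exists>w. Q t w \<and> dist z w = t - s"
    and lower: "\<And>s t z w. s \<in> I \<Longrightarrow> t \<in> I \<Longrightarrow> s < t \<Longrightarrow> Q s z \<Longrightarrow> Q t w \<Longrightarrow> t - s \<le> dist z w"
  obtains c where "c 0 = x" "\<And>t. t \<in> I \<Longrightarrow> Q t (c t)" "\<And>s t. s \<in> I \<Longrightarrow> t \<in> I \<Longrightarrow> dist (c s) (c t) = \<bar>s - t\<bar>"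
proof -
  define N where "N F c \<longleftrightarrow> c 0 = x \<and> (\<forall>t\<in>insert 0 F. Q t (c t)) \<and> (\<forall>s\<in>insert 0 F. \<forall>t\<in>insert 0 F. dist (c s) (c t) = \<bar>s - t\<bar>)" for F c
  have fin: "\<exists>c. N F c" if "finite F" "F \<subseteq> I - {0}" for F using that
  proof (induction F rule: finite_linorder_max_induct)
    case empty
    show ?case using x by (intro exI[of _ "\<lambda>_. x"]) (simp add: N_def)
  next
    case (insert b F)
    then obtain c where c: "N F c" by blast
    define m where "m = Max (insert 0 F)"
    have m: "m \<in> insert 0 F" "\<And>s. s \<in> insert 0 F \<Longrightarrow> s \<le> m" unfolding m_def using insert.hyps Max_in[of "insert 0 F"] by auto
    have FI: "insert 0 F \<subseteq> I" "b \<in> I" "0 < b" using insert.prems I by force+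
    have less: "s < b" if "s \<in> insert 0 F" for s using that insert.hyps FI(3) by auto
    obtain y where y: "Q b y" "dist (c m) y = b - m"
      using extend[of m b "c m"] m(1) FI less[OF m(1)] c unfolding N_def by blast
    \<comment> \<open>Only the distance to the largest earlier parameter is prescribed; for the
      others the triangle inequality gives one bound and \<open>lower\<close> the other.\<close>
    have dy: "dist (c s) y = b - s" if s: "s \<in> insert 0 F" for s
    proof (rule order_antisym)
      have "dist (c s) (c m) = m - s" using c s m(1) m(2)[OF s] unfolding N_def by auto
      then show "dist (c s) y \<le> b - s" using dist_triangle[of "c s" y "c m"] y(2) by simp
      show "b - s \<le> dist (c s) y" using lower[OF _ FI(2) less[OF s] _ y(1)] s FI(1) c unfolding N_def by blast
    qed
    have c': "c 0 = x" "\<And>t. t \<in> insert 0 F \<Longrightarrow> Q t (c t)" "\<And>s t. s \<in> insert 0 F \<Longrightarrow> t \<in> insert 0 F \<Longrightarrow> dist (c s) (c t) = \<bar>s - t\<bar>"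
      using c unfolding N_def by blast+
    have "N (insert b F) (c(b := y))" unfolding N_def
    proof (intro conjI ballI)
      show "(c(b := y)) 0 = x" using c'(1) FI by simp
      show "Q t ((c(b := y)) t)" if "t \<in> insert 0 (insert b F)" for t using that y(1) c'(2)[of t] by auto
      fix s t assume "s \<in> insert 0 (insert b F)" "t \<in> insert 0 (insert b F)"
      then have "s = b \<or> s \<in> insert 0 F" "t = b \<or> t \<in> insert 0 F" by auto
      then show "dist ((c(b := y)) s) ((c(b := y)) t) = \<bar>s - t\<bar>"
        using dy less c'(3)[of s t] by (fastforce simp: dist_commute)
    qed
    then show ?case by blast
  qed
  \<comment> \<open>Off \<open>I\<close> the value is pinned to \<open>x\<close>, so the candidates
    form a product of compact sets over the whole real line, compact by Tychonoff's theorem.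
    Finitely many distance conditions are met by \<open>fin\<close>, filled up with the arbitrary
    points \<open>e t\<close>.\<close>
  define K where "K t = (if t \<in> I then {z. Q t z} \<inter> cball x t else {x})" for t
  have "\<exists>z. z \<in> K t" for t
  proof (cases "t \<in> I \<and> t \<noteq> 0")
    case True
    then show ?thesis using extend[of 0 t x] I x unfolding K_def by fastforce
  qed (use x in \<open>auto simp: K_def\<close>)
  then obtain e where e: "\<And>t. e t \<in> K t" by metis
  have "compact (K t)" for t unfolding K_def using closed_Int_compact[OF cl proper] by simp
  then have "compactin (product_topology (\<lambda>_. euclidean) UNIV) (PiE UNIV K)" unfolding compactin_PiE by simp
  moreover have "PiE UNIV K = {c. \<forall>t. c t \<in> K t}" by (auto simp: PiE_def)
  ultimately have comp: "compact {c. \<forall>t. c t \<in> K t}" by (simp add: euclidean_product_topology)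
  define C where "C F = {c :: real \<Rightarrow> 'a. \<forall>s\<in>F. \<forall>t\<in>F. dist (c s) (c t) = \<bar>s - t\<bar>}" for F
  have "{c. \<forall>t. c t \<in> K t} \<inter> \<Inter>(C ` {F. finite F \<and> F \<subseteq> I}) \<noteq> {}"
  proof (rule compact_imp_fip[OF comp])
    have "C F = (\<Inter>s\<in>F. \<Inter>t\<in>F. {c. dist (c s) (c t) = \<bar>s - t\<bar>})" for F unfolding C_def by auto
    also have "closed (\<dots> F)" for F
      by (intro closed_INT ballI closed_Collect_eq continuous_on_dist continuous_on_product_coordinates continuous_on_const)
    finally show "closed T" if "T \<in> C ` {F. finite F \<and> F \<subseteq> I}" for T using that by auto
    fix \<F> assume \<F>: "finite \<F>" "\<F> \<subseteq> C ` {F. finite F \<and> F \<subseteq> I}"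
    then obtain \<G> where \<G>: "\<G> \<subseteq> {F. finite F \<and> F \<subseteq> I}" "finite \<G>" "\<F> = C ` \<G>"
      using finite_subset_image[OF \<F>(1), of C "{F. finite F \<and> F \<subseteq> I}"] by auto
    then have F: "finite (\<Union>\<G> - {0})" "\<Union>\<G> - {0} \<subseteq> I - {0}" by auto
    from fin[OF this] obtain c where c: "N (\<Union>\<G> - {0}) c" by blast
    define c' where "c' t = (if t \<in> \<Union>\<G> then c t else e t)" for t
    have "c' t \<in> K t" for t
    proof (cases "t \<in> \<Union>\<G>")
      case True
      then have "t \<in> insert 0 (\<Union>\<G> - {0})" "t \<in> I" using F(2) I by auto
      moreover from this have "dist (c 0) (c t) = \<bar>0 - t\<bar>" using c unfolding N_def by blast
      ultimately show ?thesis using True c I unfolding N_def K_def c'_def by auto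
    qed (simp add: c'_def e del: Union_iff)
    moreover have "c' \<in> C F" if "F \<in> \<G>" for F using c that unfolding N_def C_def c'_def by fastforce
    ultimately show "{c. \<forall>t. c t \<in> K t} \<inter> \<Inter>\<F> \<noteq> {}" unfolding \<G>(3) by blast
  qed
  then obtain c where c: "\<And>t. c t \<in> K t" "\<And>F. finite F \<Longrightarrow> F \<subseteq> I \<Longrightarrow> c \<in> C F" by blast
  show ?thesis
  proof (rule that)
    show "c 0 = x" using c(1)[of 0] I(1) unfolding K_def by simp
    show "Q t (c t)" if "t \<in> I" for t using c(1)[of t] that unfolding K_def by simp
    show "dist (c s) (c t) = \<bar>s - t\<bar>" if "s \<in> I" "t \<in> I" for s t using c(2)[of "{s, t}"] that unfolding C_def by auto
  qed
qed

text \<open>\<open>intermediate\<close> is what an almost shortest curve yields: a point at the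
  exact distance \<open>r\<close> from \<open>x\<close>, by the intermediate value theorem, whose
  remaining distance to \<open>y\<close> is right up to the surplus length.\<close>

locale length_space =
  fixes X :: "'a::metric_space itself"
  assumes complete_space: "complete (UNIV :: 'a set)" and locally_compact: "\<And>x :: 'a. \<exists>r>0. compact (cball x r)"
    and intermediate: "\<And>(x :: 'a) y r \<epsilon>. 0 < \<epsilon> \<Longrightarrow> 0 \<le> r \<Longrightarrow> r \<le> dist x y \<Longrightarrow>
      \<exists>z. dist x z = r \<and> dist z y \<le> dist x y - r + \<epsilon>"
begin

lemma compact_cball_mono: "compact (cball (x :: 'a) r) \<Longrightarrow> s \<le> r \<Longrightarrow> compact (cball x s)"
proof -
  assume "compact (cball x r)" "s \<le> r"
  moreover from this have "cball x s = cball x r \<inter> cball x s" by auto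
  ultimately show "compact (cball x s)" using compact_Int_closed[of "cball x r" "cball x s"] by auto
qed

lemma retract_to_ball:
  assumes "0 \<le> r" "dist (x :: 'a) z \<le> r + d" "0 < d"
  shows "\<exists>y. dist x y \<le> r \<and> dist y z \<le> 2 * d"
proof (cases "dist x z \<le> r")
  case True
  then show ?thesis using assms by (intro exI[of _ z]) auto
next
  case False
  then obtain y where "dist x y = r" "dist y z \<le> dist x z - r + d" using intermediate[of d r x z] assms by auto
  then show ?thesis using assms by (intro exI[of _ y]) auto
qed

text \<open>A finite cover of the compact ball by compact balls, taken at half radius, has room to
  spare: points slightly outside lie within \<open>2 * d\<close> of the ball and hence in one of the
  full balls.\<close>

lemma compact_cball_extend:
  assumes K: "compact (cball (x :: 'a) r)" and r: "0 \<le> r"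
  shows "\<exists>d>0. compact (cball x (r + d))"
proof -
  obtain e where e: "\<And>y :: 'a. 0 < e y" "\<And>y :: 'a. compact (cball y (e y))" using locally_compact by metis
  have "cball x r \<subseteq> (\<Union>y\<in>cball x r. ball y (e y / 2))" using e(1) by fastforce
  then obtain F where F: "F \<subseteq> cball x r" "finite F" "cball x r \<subseteq> (\<Union>y\<in>F. ball y (e y / 2))"
    using compactE_image[OF K, of "cball x r" "\<lambda>y. ball y (e y / 2)"] by auto
  have "F \<noteq> {}" using F(3) r by force
  define d where "d = Min (e ` F) / 4"
  have d: "0 < d" "\<And>y. y \<in> F \<Longrightarrow> 2 * d \<le> e y / 2"
    unfolding d_def using F(2) \<open>F \<noteq> {}\<close> e(1) Min_le[of "e ` F"] by (auto simp: field_simps)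
  have "cball x (r + d) \<subseteq> (\<Union>y\<in>F. cball y (e y))"
  proof
    fix z assume "z \<in> cball x (r + d)"
    then obtain w where w: "dist x w \<le> r" "dist w z \<le> 2 * d" using retract_to_ball[OF r _ d(1), of x z] by auto
    then have "w \<in> (\<Union>y\<in>F. ball y (e y / 2))" using F(3) by force
    then obtain y where y: "y \<in> F" "dist y w < e y / 2" by auto
    then have "dist y z \<le> e y" using dist_triangle[of y z w] w(2) d(2)[OF y(1)] by simp
    then show "z \<in> (\<Union>y\<in>F. cball y (e y))" using y by auto
  qed
  moreover have "compact (\<Union>y\<in>F. cball y (e y))" using F(2) e(2) by (intro compact_UN) auto
  ultimately have "compact (cball x (r + d))"
    using compact_Int_closed[of "\<Union>y\<in>F. cball y (e y)" "cball x (r + d)"] by (simp add: Int_absorb1)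
  then show ?thesis using d(1) by blast
qed

text \<open>A finite net of a slightly smaller ball at scale \<open>e / 2\<close> is a net of the
  whole ball at scale \<open>e\<close>, since points can be moved into the smaller ball by at most
  \<open>2 * d\<close>. Completeness turns total boundedness into compactness.\<close>

lemma compact_cball_limit:
  assumes "\<And>s. s < r \<Longrightarrow> compact (cball (x :: 'a) s)" and r: "0 < r"
  shows "compact (cball x r)" unfolding compact_eq_totally_bounded
proof (intro conjI allI impI)
  show "complete (cball x r)" using complete_closed_subset[OF closed_cball subset_UNIV complete_space] .
  fix e :: real assume e: "0 < e"
  define d where "d = min r (e / 4)"
  have d: "0 < d" "d \<le> r" "4 * d \<le> e" unfolding d_def using r e by auto
  have "compact (cball x (r - d))" using assms(1) d by simp
  then obtain k where k: "finite k" "cball x (r - d) \<subseteq> (\<Union>y\<in>k. ball y (e / 2))"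
    using e unfolding compact_eq_totally_bounded by (meson half_gt_zero)
  have "cball x r \<subseteq> (\<Union>y\<in>k. ball y e)"
  proof
    fix z assume "z \<in> cball x r"
    then obtain w where w: "dist x w \<le> r - d" "dist w z \<le> 2 * d" using retract_to_ball[of "r - d" x z d] d by auto
    then obtain y where "y \<in> k" "dist y w < e / 2" using k(2) by force
    then show "z \<in> (\<Union>y\<in>k. ball y e)" using dist_triangle[of y z w] w(2) d(3) by force
  qed
  then show "\<exists>k. finite k \<and> cball x r \<subseteq> (\<Union>x\<in>k. ball x e)" using k(1) by blast
qed

theorem proper: "compact (cball (x :: 'a) r)"
proof (rule ccontr)
  assume nc: "\<not> compact (cball x r)"
  define S where "S = {s. 0 \<le> s \<and> compact (cball x s)}"
  have bdd: "bdd_above S" unfolding S_def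
  proof (rule bdd_aboveI[of _ r])
    fix s assume "s \<in> {s. 0 \<le> s \<and> compact (cball x s)}"
    then have "\<not> r \<le> s" using nc compact_cball_mono[of x s r] by blast
    then show "s \<le> r" by simp
  qed
  obtain e where e: "0 < e" "compact (cball x e)" using locally_compact by blast
  then have eS: "e \<in> S" unfolding S_def by simp
  have "e \<le> Sup S" by (rule cSup_upper[OF eS bdd])
  have "compact (cball x s)" if sS: "s < Sup S" for s
  proof -
    have "S \<noteq> {}" using eS by auto
    obtain s' where "s' \<in> S" "s < s'" using less_cSup_iff[OF \<open>S \<noteq> {}\<close> bdd, of s] sS by auto
    then show ?thesis using compact_cball_mono[of x s' s] unfolding S_def by auto
  qed
  then have "compact (cball x (Sup S))" using compact_cball_limit \<open>e \<le> Sup S\<close> e(1) by force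
  then obtain d where "0 < d" "compact (cball x (Sup S + d))" using compact_cball_extend \<open>e \<le> Sup S\<close> e(1) by force
  moreover have "0 \<le> Sup S + d" using \<open>0 < d\<close> \<open>e \<le> Sup S\<close> e(1) by simp
  ultimately have "Sup S + d \<in> S" unfolding S_def by blast
  then show False using cSup_upper[OF _ bdd, of "Sup S + d"] \<open>0 < d\<close> by simp
qed

lemma intermediate_exact:
  assumes r: "0 \<le> r" "r \<le> dist (x :: 'a) y"
  shows "\<exists>z. dist x z = r \<and> dist z y = dist x y - r"
proof -
  define S where "S = {z. dist x z = r}"
  have "closed S" unfolding S_def by (intro closed_Collect_eq continuous_intros)
  moreover have "S = cball x r \<inter> S" unfolding S_def by auto
  ultimately have "compact S" using compact_Int_closed[OF proper] by metis
  moreover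
  obtain z0 where "dist x z0 = r" "dist z0 y \<le> dist x y - r + 1" using intermediate[of 1 r x y] r by auto
  then have "S \<noteq> {}" unfolding S_def by auto
  moreover have "continuous_on S (\<lambda>z. dist z y)" by (intro continuous_intros)
  ultimately obtain z where z: "z \<in> S" "\<And>w. w \<in> S \<Longrightarrow> dist z y \<le> dist w y"
    using continuous_attains_inf[of S "\<lambda>z. dist z y"] by auto
  have "dist z y \<le> dist x y - r"
  proof (rule field_le_epsilon)
    fix e :: real assume "0 < e"
    then obtain w where "dist x w = r" "dist w y \<le> dist x y - r + e" using intermediate[of e r x y] r by auto
    then show "dist z y \<le> dist x y - r + e" using z(2)[of w] unfolding S_def by simp
  qed
  moreover have "dist x z = r" using z(1) unfolding S_def by simp
  ultimately show ?thesis using dist_triangle[of x y z] by (intro exI[of _ z]) auto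
qed

theorem geodesic: "geodesic_space TYPE('a)" unfolding geodesic_space_def
proof (intro allI)
  fix x y :: 'a
  define D where "D = dist x y"
  show "\<exists>c. c 0 = x \<and> c (dist x y) = y \<and> (\<forall>s\<in>{0..dist x y}. \<forall>t\<in>{0..dist x y}. dist (c s) (c t) = \<bar>s - t\<bar>)"
  \<comment> \<open>The remaining distance to \<open>y\<close> serves as the clock: points with
    \<open>dist z y = D - t\<close> can be reached one from another, and the triangle inequality
    through \<open>y\<close> bounds their mutual distances from below.\<close>
  proof (rule isometric_curve_exists[of "{0..D}" "\<lambda>t z. dist z y = D - t" x, OF proper])
    show "closed {z. dist z y = D - t}" for t by (intro closed_Collect_eq continuous_intros)
    fix s t z assume st: "s \<in> {0..D}" "t \<in> {0..D}" "s < t" and z: "dist z y = D - s"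
    show "\<exists>w. dist w y = D - t \<and> dist z w = t - s" using intermediate_exact[of "t - s" z y] st z by auto
    show "t - s \<le> dist z w" if "dist w y = D - t" for w using dist_triangle[of z y w] z that by simp
  next
    fix c assume c: "c 0 = x" "\<And>t. t \<in> {0..D} \<Longrightarrow> dist (c t) y = D - t"
      "\<And>s t. s \<in> {0..D} \<Longrightarrow> t \<in> {0..D} \<Longrightarrow> dist (c s) (c t) = \<bar>s - t\<bar>"
    have "0 \<le> D" unfolding D_def by simp
    then have "c D = y" using c(2)[of D] by simp
    then show "\<exists>c. c 0 = x \<and> c (dist x y) = y \<and> (\<forall>s\<in>{0..dist x y}. \<forall>t\<in>{0..dist x y}. dist (c s) (c t) = \<bar>s - t\<bar>)"
      using c(1,3) unfolding D_def[symmetric] by blast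
  qed (auto simp: D_def)
qed

end

section \<open>Local geodesics\<close>

text \<open>Constant speed \<open>L\<close> instead of unit speed lets curves of different lengths
  share one parameter interval. The scale \<open>\<delta>\<close> is uniform over the
  interval.\<close>

definition lgeo :: "real \<Rightarrow> real \<Rightarrow> real \<Rightarrow> (real \<Rightarrow> 'a::metric_space) \<Rightarrow> bool" where
  "lgeo L a b c \<longleftrightarrow> 0 \<le> L \<and> (\<exists>\<delta>>0. \<forall>s\<in>{a..b}. \<forall>t\<in>{a..b}. \<bar>s - t\<bar> < \<delta> \<longrightarrow> dist (c s) (c t) = L * \<bar>s - t\<bar>)"

lemma lgeo_dist_le:
  assumes c: "lgeo L a b c" and s: "s \<in> {a..b}" and t: "t \<in> {a..b}"
  shows "dist (c s) (c t) \<le> L * \<bar>s - t\<bar>"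
proof -
  obtain e where e: "0 < e" "\<And>s t. s \<in> {a..b} \<Longrightarrow> t \<in> {a..b} \<Longrightarrow> \<bar>s - t\<bar> < e \<Longrightarrow> dist (c s) (c t) = L * \<bar>s - t\<bar>"
    using c unfolding lgeo_def by blast
  have L: "0 \<le> L" using c unfolding lgeo_def by blast
  have step: "s \<in> {a..b} \<Longrightarrow> t \<in> {a..b} \<Longrightarrow> s \<le> t \<Longrightarrow> t - s \<le> real n * (e / 2) \<Longrightarrow> dist (c s) (c t) \<le> L * (t - s)" for n s t
  proof (induction n arbitrary: t)
    case 0
    then show ?case by simp
  next
    case (Suc n)
    define u where "u = max s (t - e / 2)"
    have u: "u \<in> {a..b}" "s \<le> u" "u \<le> t" "t - u < e" "u - s \<le> real n * (e / 2)"
      unfolding u_def using Suc.prems e(1) by (auto simp: algebra_simps max_def)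
    have "dist (c s) (c t) \<le> dist (c s) (c u) + dist (c u) (c t)" by (rule dist_triangle)
    also have "\<dots> \<le> L * (u - s) + L * (t - u)"
      using Suc.IH[OF Suc.prems(1) u(1,2,5)] e(2)[OF u(1) Suc.prems(2)] u by (simp add: abs_minus_commute)
    finally show ?case by (simp add: algebra_simps)
  qed
  have le: "dist (c s) (c t) \<le> L * (t - s)" if "s \<in> {a..b}" "t \<in> {a..b}" "s \<le> t" for s t
  proof -
    obtain n where "(t - s) / (e / 2) \<le> real n" using real_arch_simple by blast
    then have "t - s \<le> real n * (e / 2)" using e(1) by (simp add: field_simps)
    from step[OF that this] show ?thesis .
  qed
  show ?thesis using le[OF s t] le[OF t s] by (cases "s \<le> t") (auto simp: dist_commute)
qed

lemma lgeo_continuous: assumes c: "lgeo L a b c" shows "continuous_on {a..b} c"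
proof -
  have "L-lipschitz_on {a..b} c" by (rule lipschitz_onI) (use lgeo_dist_le[OF c] c in \<open>auto simp: dist_real_def lgeo_def\<close>)
  then show ?thesis by (rule lipschitz_on_continuous_on)
qed

lemma lgeo_subset: "lgeo L a b c \<Longrightarrow> a \<le> a' \<Longrightarrow> b' \<le> b \<Longrightarrow> lgeo L a' b' c"
  unfolding lgeo_def by (meson atLeastAtMost_iff order_trans)

lemma lgeo_cong:
  assumes "lgeo L a b c" "\<And>t. t \<in> {a..b} \<Longrightarrow> c t = c' t"
  shows "lgeo L a b c'" using assms unfolding lgeo_def by metis

lemma lgeo_overlap_eq:
  assumes "lgeo L a q c" "lgeo L' p b c" "a \<le> p" "p < q" "q \<le> b"
  shows "L = L'"
proof -
  obtain e e' where e: "0 < e" "0 < e'"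
    "\<And>s t. s \<in> {a..q} \<Longrightarrow> t \<in> {a..q} \<Longrightarrow> \<bar>s - t\<bar> < e \<Longrightarrow> dist (c s) (c t) = L * \<bar>s - t\<bar>"
    "\<And>s t. s \<in> {p..b} \<Longrightarrow> t \<in> {p..b} \<Longrightarrow> \<bar>s - t\<bar> < e' \<Longrightarrow> dist (c s) (c t) = L' * \<bar>s - t\<bar>"
    using assms(1,2) unfolding lgeo_def by metis
  define h where "h = min (q - p) (min e e' / 2)"
  have h: "0 < h" "h \<le> q - p" "h < e" "h < e'" unfolding h_def using e(1,2) assms by auto
  have "L * h = L' * h" using e(3)[of p "p + h"] e(4)[of p "p + h"] h assms by auto
  then show ?thesis using h by simp
qed

lemma lgeo_glue:
  assumes "lgeo L a q c" "lgeo L p b c" "a \<le> p" "p < q" "q \<le> b"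
  shows "lgeo L a b c"
proof -
  obtain e e' where e: "0 < e" "0 < e'"
    "\<And>s t. s \<in> {a..q} \<Longrightarrow> t \<in> {a..q} \<Longrightarrow> \<bar>s - t\<bar> < e \<Longrightarrow> dist (c s) (c t) = L * \<bar>s - t\<bar>"
    "\<And>s t. s \<in> {p..b} \<Longrightarrow> t \<in> {p..b} \<Longrightarrow> \<bar>s - t\<bar> < e' \<Longrightarrow> dist (c s) (c t) = L * \<bar>s - t\<bar>"
    using assms(1,2) unfolding lgeo_def by metis
  \<comment> \<open>The bound by the length of the overlap puts any two parameters closer than
    \<open>h\<close> into a common one of the two intervals.\<close>
  define h where "h = min (q - p) (min e e')"
  have h: "0 < h" "h \<le> q - p" "h \<le> e" "h \<le> e'" unfolding h_def using e(1,2) assms by auto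
  have "dist (c s) (c t) = L * \<bar>s - t\<bar>" if st: "s \<in> {a..b}" "t \<in> {a..b}" "\<bar>s - t\<bar> < h" for s t
  proof -
    have "s \<in> {a..q} \<and> t \<in> {a..q} \<or> s \<in> {p..b} \<and> t \<in> {p..b}" using st h(2) assms by (simp add: abs_less_iff) linarith
    then show ?thesis using e(3,4)[of s t] st h by auto
  qed
  then show ?thesis using h(1) assms(1) unfolding lgeo_def by blast
qed

lemma lgeo_of_isometric:
  assumes "0 \<le> L" "\<And>s t. s \<in> {a..b} \<Longrightarrow> t \<in> {a..b} \<Longrightarrow> dist (c s) (c t) = L * \<bar>s - t\<bar>"
  shows "lgeo L a b c" unfolding lgeo_def using assms zero_less_one by blast

section \<open>Locally CAT(0) spaces: convexity and continuation of local geodesics\<close>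

locale locally_cat0 =
  fixes X :: "'a::metric_space itself"
  assumes proper: "\<And>(x :: 'a) r. compact (cball x r)" and geodesic: "geodesic_space TYPE('a)"
    and local_cn: "\<And>x :: 'a. \<exists>\<sigma>>0. cn_on (ball x \<sigma>)" and simply_connected_space: "simply_connected (UNIV :: 'a set)"
begin

lemma geodesic_on:
  assumes "a < b" obtains c where "c a = (x :: 'a)" "c b = y"
    "\<And>s t. s \<in> {a..b} \<Longrightarrow> t \<in> {a..b} \<Longrightarrow> dist (c s) (c t) = dist x y / (b - a) * \<bar>s - t\<bar>"
proof -
  define D where "D = dist x y"
  obtain c where c: "c 0 = x" "c D = y" "\<And>s t. s \<in> {0..D} \<Longrightarrow> t \<in> {0..D} \<Longrightarrow> dist (c s) (c t) = \<bar>s - t\<bar>"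
    using geodesic unfolding geodesic_space_def D_def by blast
  define k where "k = D / (b - a)"
  have k: "0 \<le> k" "k * (b - a) = D" unfolding k_def D_def using assms by auto
  have mem: "k * (s - a) \<in> {0..D}" if "s \<in> {a..b}" for s
  proof -
    have "k * (s - a) \<le> k * (b - a)" using that k(1) by (intro mult_left_mono) auto
    then show ?thesis using that k by auto
  qed
  show ?thesis
  proof (rule that[of "\<lambda>t. c (k * (t - a))"])
    show "c (k * (a - a)) = x" "c (k * (b - a)) = y" using c k by auto
    fix s t assume st: "s \<in> {a..b}" "t \<in> {a..b}"
    have "\<bar>k * (s - a) - k * (t - a)\<bar> = k * \<bar>s - t\<bar>" using k(1) by (simp add: right_diff_distrib[symmetric] abs_mult)
    then show "dist (c (k * (s - a))) (c (k * (t - a))) = dist x y / (b - a) * \<bar>s - t\<bar>"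
      using c(3)[OF mem[OF st(1)] mem[OF st(2)]] unfolding k_def D_def by simp
  qed
qed

lemma uniform_cn:
  assumes K: "compact (K :: 'a set)" obtains r where "0 < r" "\<And>y. y \<in> K \<Longrightarrow> cn_on (ball y r)"
proof -
  obtain e where e: "\<And>y :: 'a. 0 < e y" "\<And>y :: 'a. cn_on (ball y (e y))" using local_cn by metis
  have "K \<subseteq> (\<Union>y\<in>K. ball y (e y / 2))" using e(1) by fastforce
  then obtain F where F: "F \<subseteq> K" "finite F" "K \<subseteq> (\<Union>y\<in>F. ball y (e y / 2))"
    using compactE_image[OF K, of K "\<lambda>y. ball y (e y / 2)"] by auto
  define r where "r = Min (insert 1 ((\<lambda>y. e y / 2) ` F))"
  have r: "0 < r" unfolding r_def using F(2) e(1) by auto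
  have r2: "r \<le> e y / 2" if "y \<in> F" for y unfolding r_def by (rule Min_le) (use F(2) that in auto)
  have "cn_on (ball y r)" if yK: "y \<in> K" for y
  proof -
    obtain z where z: "z \<in> F" "dist z y < e z / 2" using F(3) yK by auto
    have "ball y r \<subseteq> ball z (e z)"
    proof
      fix w assume "w \<in> ball y r"
      then show "w \<in> ball z (e z)" using z(2) r2[OF z(1)] dist_triangle[of z w y] by simp
    qed
    then show ?thesis using cn_on_subset[OF e(2)] by blast
  qed
  then show ?thesis using that r by blast
qed

text \<open>The curves may be long, but the claim is local in the parameter: around each
  \<open>t\<close> short pieces of both lie in \<open>ball (c t) r\<close>, where
  \<open>cn_on_convex_dist\<close> gives the midpoint inequality.\<close>

lemma lgeo_convex:
  assumes c: "lgeo L a b c" and c': "lgeo L' a b (c' :: real \<Rightarrow> 'a)" and ab: "a < b" and r: "0 < r"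
    and cn: "\<And>t. t \<in> {a..b} \<Longrightarrow> cn_on (ball (c t) r)" and near: "\<And>t. t \<in> {a..b} \<Longrightarrow> dist (c t) (c' t) < r / 2"
    and t: "t \<in> {a..b}"
  shows "(b - a) * dist (c t) (c' t) \<le> (b - t) * dist (c a) (c' a) + (t - a) * dist (c b) (c' b)"
proof (rule local_midpoint_convex_le_chord[OF _ ab _ t])
  show "continuous_on {a..b} (\<lambda>t. dist (c t) (c' t))"
    by (intro continuous_intros lgeo_continuous[OF c] lgeo_continuous[OF c'])
  fix t assume t: "a < t" "t < b"
  obtain e e' where e: "0 < e" "0 < e'"
    "\<And>s t. s \<in> {a..b} \<Longrightarrow> t \<in> {a..b} \<Longrightarrow> \<bar>s - t\<bar> < e \<Longrightarrow> dist (c s) (c t) = L * \<bar>s - t\<bar>"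
    "\<And>s t. s \<in> {a..b} \<Longrightarrow> t \<in> {a..b} \<Longrightarrow> \<bar>s - t\<bar> < e' \<Longrightarrow> dist (c' s) (c' t) = L' * \<bar>s - t\<bar>" using c c' unfolding lgeo_def by metis
  have L: "0 \<le> L" "0 \<le> L'" using c c' unfolding lgeo_def by auto
  \<comment> \<open>The scale keeps \<open>t - h\<close> and \<open>t + h\<close> in the interval,
    keeps both curves isometric up to speed between these parameters (hence \<open>e / 3\<close>, as
    they are \<open>2 * h\<close> apart), and makes both pieces shorter than
    \<open>r / 2\<close>.\<close>
  define h where "h = min (min (t - a) (b - t)) (min (min (e / 3) (e' / 3)) (r / (2 * (L + L' + 1))))"
  have h0: "0 < h" unfolding h_def using t e(1,2) r L by auto
  have "h \<le> t - a" "h \<le> b - t" "h \<le> e / 3" "h \<le> e' / 3" "h \<le> r / (2 * (L + L' + 1))" unfolding h_def by linarith+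
  note h = h0 this
  have "(L + L' + 1) * h \<le> (L + L' + 1) * (r / (2 * (L + L' + 1)))" using h(6) L by (intro mult_left_mono) auto
  also have "\<dots> = r / 2" using L by (simp add: field_simps add_nonneg_pos)
  finally have "L * h + L' * h + h \<le> r / 2" by (simp add: algebra_simps)
  then have Lh: "L * h < r / 2" "L' * h < r / 2" using h(1) L by (smt (verit) mult_nonneg_nonneg)+
  define S where "S = ball (c t) r"
  have mem: "t - h \<in> {a..b}" "t + h \<in> {a..b}" "t \<in> {a..b}" using h t by auto
  have d: "dist (c (t - h)) (c t) = L * h" "dist (c t) (c (t + h)) = L * h" "dist (c (t - h)) (c (t + h)) = 2 * (L * h)"
    using e(3)[OF mem(1,3)] e(3)[OF mem(3,2)] e(3)[OF mem(1,2)] h e(1) by auto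
  have d': "dist (c' (t - h)) (c' t) = L' * h" "dist (c' t) (c' (t + h)) = L' * h" "dist (c' (t - h)) (c' (t + h)) = 2 * (L' * h)"
    using e(4)[OF mem(1,3)] e(4)[OF mem(3,2)] e(4)[OF mem(1,2)] h e(2) by auto
  have nt: "dist (c t) (c' t) < r / 2" by (rule near[OF mem(3)])
  have S: "c (t - h) \<in> S" "c (t + h) \<in> S" "c' (t - h) \<in> S" "c' (t + h) \<in> S" "c t \<in> S" "c' t \<in> S"
    unfolding S_def using d(1,2) d'(1,2) Lh nt r dist_triangle[of "c t" "c' (t - h)" "c' t"] dist_triangle[of "c t" "c' (t + h)" "c' t"]
    by (auto simp: dist_commute)
  have "dist (c t) (c' t) \<le> (1 - 1 / 2) * dist (c (t - h)) (c' (t - h)) + 1 / 2 * dist (c (t + h)) (c' (t + h))"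
    by (rule cn_on_convex_dist[OF geodesic cn[OF mem(3), folded S_def]]) (use S d d' in auto)
  then show "\<exists>h>0. a \<le> t - h \<and> t + h \<le> b \<and> 2 * dist (c t) (c' t) \<le> dist (c (t - h)) (c' (t - h)) + dist (c (t + h)) (c' (t + h))"
    using h(1-3) by (intro exI[of _ h]) auto
qed

lemma lgeo_near_bound:
  assumes "lgeo L a b c" "lgeo L' a b (c' :: real \<Rightarrow> 'a)" "a < b" "0 < r"
    "\<And>t. t \<in> {a..b} \<Longrightarrow> cn_on (ball (c t) r)" "\<And>t. t \<in> {a..b} \<Longrightarrow> dist (c t) (c' t) < r / 2"
    and e: "dist (c a) (c' a) \<le> e" "dist (c b) (c' b) \<le> e" and t: "t \<in> {a..b}"
  shows "dist (c t) (c' t) \<le> e"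
proof -
  have "(b - a) * dist (c t) (c' t) \<le> (b - t) * dist (c a) (c' a) + (t - a) * dist (c b) (c' b)"
    using lgeo_convex[OF assms(1-6) t] by blast
  also have "\<dots> \<le> (b - t) * e + (t - a) * e" using e t by (intro add_mono mult_left_mono) auto
  also have "\<dots> = (b - a) * e" by (simp add: algebra_simps)
  finally show ?thesis using \<open>a < b\<close> by simp
qed

text \<open>Existence of nearby local geodesics with prescribed end points: the interval is covered by two overlapping
  intervals of two thirds of its length, and the point of the overlap is found by the contraction principle.\<close>

lemma lgeo_continuation_step:
  fixes n :: nat
  assumes r: "0 < r"
  shows "lgeo L a b c \<Longrightarrow> a < b \<Longrightarrow> L * (b - a) \<le> (3 / 2) ^ n * (r / 16) \<Longrightarrow>
    (\<And>t. t \<in> {a..b} \<Longrightarrow> cn_on (ball (c t :: 'a) r)) \<Longrightarrow> dist (c a) x \<le> r / 16 \<Longrightarrow> dist (c b) y \<le> r / 16 \<Longrightarrow>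
    \<exists>L' c'. lgeo L' a b c' \<and> c' a = x \<and> c' b = y \<and> (\<forall>t\<in>{a..b}. dist (c t) (c' t) \<le> r / 16)"
proof (induction n arbitrary: a b x y)
  case 0
  define e where "e = r / 16"
  have e: "0 < e" "r = 16 * e" unfolding e_def using r by auto
  \<comment> \<open>In the base case the curve has length at most \<open>e\<close> and its ends move
    by at most \<open>e\<close>, so an ordinary minimizing segment is close enough.\<close>
  obtain c' where c': "c' a = x" "c' b = y"
    "\<And>s t. s \<in> {a..b} \<Longrightarrow> t \<in> {a..b} \<Longrightarrow> dist (c' s) (c' t) = dist x y / (b - a) * \<bar>s - t\<bar>" using geodesic_on[OF 0(2)] by blast
  have lg': "lgeo (dist x y / (b - a)) a b c'" by (rule lgeo_of_isometric[OF _ c'(3)]) (use 0(2) in auto)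
  have L0: "0 \<le> L" using 0(1) unfolding lgeo_def by blast
  have cle: "dist (c a) (c t) \<le> e" if "t \<in> {a..b}" for t
  proof -
    have "dist (c a) (c t) \<le> L * \<bar>a - t\<bar>" using lgeo_dist_le[OF 0(1) _ that, of a] 0(2) by simp
    also have "\<dots> \<le> L * (b - a)" using that L0 by (intro mult_left_mono) auto
    finally show ?thesis using 0(3) unfolding e_def by simp
  qed
  have xy: "dist x y \<le> 3 * e"
    using 0(5,6) cle[of b] 0(2) dist_triangle[of x y "c a"] dist_triangle[of "c a" y "c b"] unfolding e_def by (simp add: dist_commute)
  have near: "dist (c t) (c' t) < r / 2" if t: "t \<in> {a..b}" for t
  proof -
    have "dist x (c' t) = dist x y / (b - a) * \<bar>a - t\<bar>" using c'(1) c'(3)[of a t] t 0(2) by auto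
    also have "\<dots> \<le> dist x y / (b - a) * (b - a)" using t 0(2) by (intro mult_left_mono) auto
    also have "\<dots> = dist x y" using 0(2) by simp
    finally have "dist x (c' t) \<le> 3 * e" using xy by simp
    then show ?thesis using cle[OF t] 0(5) e dist_triangle[of "c t" "c' t" "c a"] dist_triangle[of "c a" "c' t" x]
      unfolding e_def[symmetric] by (simp add: dist_commute)
  qed
  have "dist (c t) (c' t) \<le> r / 16" if "t \<in> {a..b}" for t
    by (rule lgeo_near_bound[OF 0(1) lg' 0(2) r 0(4) near _ _ that]) (use c' 0 in auto)
  then show ?case using lg' c' by blast
next
  case (Suc n)
  define e where "e = r / 16"
  have e: "0 < e" "r = 16 * e" unfolding e_def using r by auto
  define p where "p = a + (b - a) / 3"
  define q where "q = a + 2 * (b - a) / 3"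
  have pq: "a < p" "p < q" "q < b" "q - a = 2 * (b - a) / 3" "b - p = 2 * (b - a) / 3" "p - a = (q - a) / 2" "b - q = (b - p) / 2"
    unfolding p_def q_def using Suc.prems(2) by (auto simp: field_simps)
  have "L * (2 * (b - a) / 3) = 2 / 3 * (L * (b - a))" by simp
  also have "\<dots> \<le> 2 / 3 * ((3 / 2) ^ Suc n * (r / 16))" using Suc.prems(3) by (intro mult_left_mono) auto
  also have "\<dots> = (3 / 2) ^ n * (r / 16)" by simp
  finally have len: "L * (q - a) \<le> (3 / 2) ^ n * (r / 16)" "L * (b - p) \<le> (3 / 2) ^ n * (r / 16)" by (simp_all only: pq(4,5))
  have c1: "lgeo L a q c" "lgeo L p b c" using lgeo_subset[OF Suc.prems(1)] pq by auto
  have "\<exists>L' c'. lgeo L' a q c' \<and> c' a = x \<and> c' q = z \<and> (\<forall>t\<in>{a..q}. dist (c t) (c' t) \<le> r / 16)" if "z \<in> cball (c q) e" for z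
    by (rule Suc.IH[OF c1(1) _ len(1)]) (use pq(1-3) Suc.prems(4-6) that in \<open>auto simp: e_def\<close>)
  then obtain L1 g1 where g1: "\<And>z. z \<in> cball (c q) e \<Longrightarrow> lgeo (L1 z) a q (g1 z) \<and> g1 z a = x \<and> g1 z q = z \<and>
      (\<forall>t\<in>{a..q}. dist (c t) (g1 z t) \<le> e)" unfolding e_def by metis
  have "\<exists>L' c'. lgeo L' p b c' \<and> c' p = w \<and> c' b = y \<and> (\<forall>t\<in>{p..b}. dist (c t) (c' t) \<le> r / 16)" if "w \<in> cball (c p) e" for w
    by (rule Suc.IH[OF c1(2) _ len(2)]) (use pq(1-3) Suc.prems(4-6) that in \<open>auto simp: e_def\<close>)
  then obtain L2 g2 where g2: "\<And>w. w \<in> cball (c p) e \<Longrightarrow> lgeo (L2 w) p b (g2 w) \<and> g2 w p = w \<and> g2 w b = y \<and>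
      (\<forall>t\<in>{p..b}. dist (c t) (g2 w t) \<le> e)" unfolding e_def by metis
  \<comment> \<open>Curves within \<open>e = r / 16\<close> of \<open>c\<close> inherit the
    inequality on balls of radius \<open>r / 2\<close>, and two such curves are within
    \<open>2 * e < r / 4\<close> of each other, as \<open>lgeo_convex\<close> requires.\<close>
  have cn': "cn_on (ball u (r / 2))" if "t \<in> {a..b}" "dist (c t) u \<le> e" for t u
  proof (rule cn_on_subset[OF Suc.prems(4)[OF that(1)]])
    show "ball u (r / 2) \<subseteq> ball (c t) r"
    proof
      fix v assume "v \<in> ball u (r / 2)"
      then show "v \<in> ball (c t) r" using that(2) e dist_triangle[of "c t" v u] by simp
    qed
  qed
  have close: "dist u v < r / 2 / 2" if "dist (c t) u \<le> e" "dist (c t) v \<le> e" for t u v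
    using that dist_triangle[of u v "c t"] e by (simp add: dist_commute)
  have g1p: "g1 z p \<in> cball (c p) e" if "z \<in> cball (c q) e" for z using g1[OF that] pq by auto
  have g2q: "g2 w q \<in> cball (c q) e" if "w \<in> cball (c p) e" for w using g2[OF that] pq by auto
  have contr1: "dist (g1 z p) (g1 z' p) \<le> dist z z' / 2" if z: "z \<in> cball (c q) e" "z' \<in> cball (c q) e" for z z'
  proof -
    have "(q - a) * dist (g1 z p) (g1 z' p) \<le> (q - p) * dist (g1 z a) (g1 z' a) + (p - a) * dist (g1 z q) (g1 z' q)"
    proof (rule lgeo_convex[where r = "r / 2"])
      show "cn_on (ball (g1 z t) (r / 2))" if "t \<in> {a..q}" for t using cn'[of t] g1[OF z(1)] that pq by auto
      show "dist (g1 z t) (g1 z' t) < r / 2 / 2" if "t \<in> {a..q}" for t using close g1[OF z(1)] g1[OF z(2)] that by blast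
    qed (use g1 z pq r in auto)
    then have "(q - a) * dist (g1 z p) (g1 z' p) \<le> (q - a) * (dist z z' / 2)" using g1 z pq(6) by simp
    then show ?thesis using pq by simp
  qed
  have contr2: "dist (g2 w q) (g2 w' q) \<le> dist w w' / 2" if w: "w \<in> cball (c p) e" "w' \<in> cball (c p) e" for w w'
  proof -
    have "(b - p) * dist (g2 w q) (g2 w' q) \<le> (b - q) * dist (g2 w p) (g2 w' p) + (q - p) * dist (g2 w b) (g2 w' b)"
    proof (rule lgeo_convex[where r = "r / 2"])
      show "cn_on (ball (g2 w t) (r / 2))" if "t \<in> {p..b}" for t using cn'[of t] g2[OF w(1)] that pq by auto
      show "dist (g2 w t) (g2 w' t) < r / 2 / 2" if "t \<in> {p..b}" for t using close g2[OF w(1)] g2[OF w(2)] that by blast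
    qed (use g2 w pq r in auto)
    then have "(b - p) * dist (g2 w q) (g2 w' q) \<le> (b - p) * (dist w w' / 2)" using g2 w pq(7) by simp
    then show ?thesis using pq by simp
  qed
  \<comment> \<open>As \<open>p\<close> is the midpoint of \<open>[a, q]\<close> and
    \<open>q\<close> that of \<open>[p, b]\<close>, each of the two maps halves distances. At a
    fixed point \<open>z\<close>, the geodesic over \<open>[p, b]\<close> that starts where the one
    over \<open>[a, q]\<close> passes at time \<open>p\<close> arrives at \<open>z\<close> at time
    \<open>q\<close>.\<close>
  have "\<exists>!z\<in>cball (c q) e. g2 (g1 z p) q = z"
  proof (rule Banach_fix[where c = "1 / 2"])
    show "complete (cball (c q) e)" using proper compact_imp_complete by blast
    show "cball (c q) e \<noteq> {}" using e by simp
    show "(\<lambda>z. g2 (g1 z p) q) ` cball (c q) e \<subseteq> cball (c q) e" using g1p g2q by blast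
    show "dist (g2 (g1 z p) q) (g2 (g1 z' p) q) \<le> 1 / 2 * dist z z'" if "z \<in> cball (c q) e" "z' \<in> cball (c q) e" for z z'
      using contr2[OF g1p[OF that(1)] g1p[OF that(2)]] contr1[OF that] zero_le_dist[of z z'] by linarith
  qed auto
  then obtain z where z: "z \<in> cball (c q) e" "g2 (g1 z p) q = z" by blast
  define w where "w = g1 z p"
  have w: "w \<in> cball (c p) e" unfolding w_def by (rule g1p[OF z(1)])
  note G1 = g1[OF z(1)] and G2 = g2[OF w]
  \<comment> \<open>Both geodesics agree at \<open>p\<close> and at \<open>q\<close>; convexity of
    their distance makes them agree on the overlap, so they can be glued.\<close>
  have eq: "g1 z t = g2 w t" if t: "t \<in> {p..q}" for t
  proof -
    have "dist (g1 z t) (g2 w t) \<le> 0"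
    proof (rule lgeo_near_bound[where r = "r / 2" and a = p and b = q])
      show "lgeo (L1 z) p q (g1 z)" "lgeo (L2 w) p q (g2 w)" using lgeo_subset G1 G2 pq by (meson less_imp_le order_refl)+
      show "cn_on (ball (g1 z t) (r / 2))" if "t \<in> {p..q}" for t using cn'[of t] G1 that pq by auto
      show "dist (g1 z t) (g2 w t) < r / 2 / 2" if "t \<in> {p..q}" for t using close[of t] G1 G2 that pq by auto
      show "dist (g1 z p) (g2 w p) \<le> 0" "dist (g1 z q) (g2 w q) \<le> 0" using G1 G2 z w_def by auto
    qed (use pq r t in auto)
    then show ?thesis by simp
  qed
  define c' where "c' t = (if t \<le> q then g1 z t else g2 w t)" for t
  have c'2: "c' t = g2 w t" if "t \<in> {p..b}" for t unfolding c'_def using eq that by auto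
  have l1: "lgeo (L1 z) a q c'" using G1 by (rule lgeo_cong[OF conjunct1]) (auto simp: c'_def)
  have l2: "lgeo (L2 w) p b c'" using G2 by (rule lgeo_cong[OF conjunct1]) (simp add: c'2)
  have "L1 z = L2 w" using lgeo_overlap_eq[OF l1 l2] pq by simp
  then have "lgeo (L1 z) a b c'" using lgeo_glue[OF l1] l2 pq by simp
  moreover have "c' a = x" "c' b = y" using G1 G2 pq unfolding c'_def by auto
  moreover have "dist (c t) (c' t) \<le> r / 16" if "t \<in> {a..b}" for t using G1 G2 that pq unfolding c'_def e_def by auto
  ultimately show ?case by blast
qed

lemma lgeo_continuation:
  assumes r: "0 < r" and c: "lgeo L a b c" "a < b"
    and cn: "\<And>t. t \<in> {a..b} \<Longrightarrow> cn_on (ball (c t :: 'a) r)" and "dist (c a) x \<le> r / 16" "dist (c b) y \<le> r / 16"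
  shows "\<exists>L' c'. lgeo L' a b c' \<and> c' a = x \<and> c' b = y \<and> (\<forall>t\<in>{a..b}. dist (c t) (c' t) \<le> r / 16)"
proof -
  obtain n where "L * (b - a) / (r / 16) < (3 / 2) ^ n" using real_arch_pow[of "3 / 2"] by auto
  then have "L * (b - a) \<le> (3 / 2) ^ n * (r / 16)" using r by (simp add: field_simps)
  from lgeo_continuation_step[OF r c this cn assms(5,6)] show ?thesis .
qed


section \<open>Local geodesics with a fixed origin and their end points\<close>

text \<open>These curves play the part of the tangent space at \<open>x\<close>, with
  \<open>c \<mapsto> c 1\<close> as exponential map; \<open>R\<close> bounds the length. Pinning the
  values off \<open>[0, 1]\<close> makes equality of functions mean equality of curves.\<close>

definition LG :: "'a \<Rightarrow> real \<Rightarrow> (real \<Rightarrow> 'a) \<Rightarrow> bool" where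
  "LG x R c \<longleftrightarrow> c 0 = x \<and> (\<exists>L\<le>R. lgeo L 0 1 c) \<and> (\<forall>t. t \<notin> {0..1} \<longrightarrow> c t = x)"

lemma LG_mono: "LG x R c \<Longrightarrow> R \<le> R' \<Longrightarrow> LG x R' c" unfolding LG_def by (meson order_trans)

lemma LG_eqI: "LG x R c \<Longrightarrow> LG x R' c' \<Longrightarrow> (\<And>t. t \<in> {0..1} \<Longrightarrow> c t = c' t) \<Longrightarrow> c = c'" unfolding LG_def by (metis ext)

lemma LG_of_lgeo:
  assumes "lgeo L 0 1 c" "c 0 = x" "L \<le> R"
  shows "LG x R (\<lambda>t. if t \<in> {0..1} then c t else x)"
  using assms lgeo_cong[OF assms(1), of "\<lambda>t. if t \<in> {0..1} then c t else x"] unfolding LG_def by auto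

lemma LG_in_cball:
  assumes c: "LG x R c" and t: "t \<in> {0..1}"
  shows "c t \<in> cball x R"
proof -
  obtain L where L: "L \<le> R" "lgeo L 0 1 c" "c 0 = x" using c unfolding LG_def by blast
  then have "dist (c 0) (c t) \<le> L * \<bar>0 - t\<bar>" using t by (intro lgeo_dist_le) auto
  also have "\<dots> \<le> L" using t L(2) unfolding lgeo_def by (simp add: mult_left_le)
  finally show ?thesis using L by simp
qed

lemma LG_convex:
  assumes r: "0 < r" and cn: "\<And>w. w \<in> cball x R \<Longrightarrow> cn_on (ball w r)" and c: "LG x R c" and c': "LG x R' c'"
    and near: "\<And>t. t \<in> {0..1} \<Longrightarrow> dist (c t) (c' t) < r / 2" and t: "t \<in> {0..1}"
  shows "dist (c t) (c' t) \<le> t * dist (c 1) (c' 1)"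
proof -
  obtain L L' where L: "lgeo L 0 1 c" "lgeo L' 0 1 c'" using c c' unfolding LG_def by blast
  have "c 0 = x" "c' 0 = x" using c c' unfolding LG_def by auto
  then show ?thesis using lgeo_convex[OF L _ r _ near t] cn LG_in_cball[OF c] by simp
qed

lemma LG_eq_of_near:
  assumes "0 < r" "\<And>w. w \<in> cball x R \<Longrightarrow> cn_on (ball w r)" "LG x R c" "LG x R' c'" "c 1 = c' 1"
    "\<And>t. t \<in> {0..1} \<Longrightarrow> dist (c t) (c' t) < r / 2"
  shows "c = c'" by (rule LG_eqI[OF assms(3,4)]) (use LG_convex[OF assms(1-4,6)] assms(5) in auto)

text \<open>Continuation supplies the curve, and convexity from the common origin shows that it
  moves no more than its end point. The same estimate at a short time, where the new curve is
  isometric up to its speed, bounds the new speed.\<close>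

lemma LG_near:
  assumes r: "0 < r" and cn: "\<And>w. w \<in> cball x R \<Longrightarrow> cn_on (ball w r)" and c: "LG x R c" and y: "dist (c 1) y \<le> r / 16"
  shows "\<exists>c'. LG x (R + dist (c 1) y) c' \<and> c' 1 = y \<and> (\<forall>t\<in>{0..1}. dist (c t) (c' t) \<le> dist (c 1) y)"
proof -
  obtain L where L: "L \<le> R" "lgeo L 0 1 c" "c 0 = x" using c unfolding LG_def by blast
  obtain L' c' where c': "lgeo L' 0 1 c'" "c' 0 = x" "c' 1 = y" "\<And>t. t \<in> {0..1} \<Longrightarrow> dist (c t) (c' t) \<le> r / 16"
    using lgeo_continuation[OF r L(2) _ _ _ y, of x] cn LG_in_cball[OF c] L r by auto
  have conv: "dist (c t) (c' t) \<le> t * dist (c 1) y" if "t \<in> {0..1}" for t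
  proof -
    have "(1 - 0) * dist (c t) (c' t) \<le> (1 - t) * dist (c 0) (c' 0) + (t - 0) * dist (c 1) (c' 1)"
      by (rule lgeo_convex[OF L(2) c'(1) _ r]) (use cn LG_in_cball[OF c] c'(4) r that in force)+
    then show ?thesis using c' L by simp
  qed
  obtain e where e: "0 < e" "\<And>s t. s \<in> {0..1} \<Longrightarrow> t \<in> {0..1} \<Longrightarrow> \<bar>s - t\<bar> < e \<Longrightarrow> dist (c' s) (c' t) = L' * \<bar>s - t\<bar>"
    using c'(1) unfolding lgeo_def by blast
  define t where "t = min 1 (e / 2)"
  have t: "0 < t" "t \<le> 1" "t < e" unfolding t_def using e(1) by auto
  have "L' * t = dist x (c' t)" using e(2)[of 0 t] t c'(2) by simp
  also have "\<dots> \<le> dist x (c t) + dist (c t) (c' t)" by (rule dist_triangle)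
  also have "\<dots> \<le> L * t + t * dist (c 1) y" using lgeo_dist_le[OF L(2), of 0 t] L(3) conv[of t] t by simp
  finally have "L' * t \<le> (L + dist (c 1) y) * t" by (simp add: algebra_simps)
  then have "L' \<le> R + dist (c 1) y" using t(1) L(1) by simp
  note lg = LG_of_lgeo[OF c'(1,2) this]
  have "dist (c t) (c' t) \<le> dist (c 1) y" if "t \<in> {0..1}" for t
    using conv[OF that] mult_left_le_one_le[of "dist (c 1) y" t] that by simp
  then show ?thesis using lg c'(3) by (intro exI[of _ "\<lambda>t. if t \<in> {0..1} then c' t else x"]) simp
qed

subsection \<open>Monodromy\<close>

text \<open>A path in the space of local geodesics from \<open>x\<close>, continuous for uniform
  convergence; it lifts the path \<open>u \<mapsto> f u 1\<close> through the end-point map.\<close>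

definition lifting :: "'a \<Rightarrow> (real \<Rightarrow> real \<Rightarrow> 'a) \<Rightarrow> bool" where
  "lifting x f \<longleftrightarrow> (\<exists>R. \<forall>u\<in>{0..1}. LG x R (f u)) \<and>
     (\<forall>\<eta>>0. \<exists>\<delta>>0. \<forall>u\<in>{0..1}. \<forall>v\<in>{0..1}. \<bar>u - v\<bar> < \<delta> \<longrightarrow> (\<forall>t\<in>{0..1}. dist (f u t) (f v t) < \<eta>))"

text \<open>Agreement propagates from one parameter to a nearby one: both lifts have moved little,
  so they are close to each other with equal end points, and \<open>LG_eq_of_near\<close> applies.
  The step size is uniform since all curves stay in one compact ball.\<close>

lemma lifting_unique:
  assumes f: "lifting x f" and f': "lifting x f'" and e: "\<And>u. u \<in> {0..1} \<Longrightarrow> f u 1 = f' u 1" and "f 0 = f' 0"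
  shows "f 1 = f' 1"
proof -
  obtain R1 R2 where "\<forall>u\<in>{0..1}. LG x R1 (f u)" "\<forall>u\<in>{0..1}. LG x R2 (f' u)" using f f' unfolding lifting_def by blast
  then have R: "LG x (max R1 R2) (f u)" "LG x (max R1 R2) (f' u)" if "u \<in> {0..1}" for u
    using LG_mono that by (meson max.cobounded1 max.cobounded2)+
  obtain \<rho> where \<rho>: "0 < \<rho>" "\<And>w. w \<in> cball x (max R1 R2) \<Longrightarrow> cn_on (ball w \<rho>)" using uniform_cn[OF proper] by blast
  have \<rho>4: "0 < \<rho> / 4" using \<rho>(1) by simp
  obtain r where r: "0 < r" "\<And>u v t. u \<in> {0..1} \<Longrightarrow> v \<in> {0..1} \<Longrightarrow> \<bar>u - v\<bar> < r \<Longrightarrow> t \<in> {0..1} \<Longrightarrow> dist (f u t) (f v t) < \<rho> / 4"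
    using f \<rho>4 unfolding lifting_def by meson
  obtain r' where r': "0 < r'" "\<And>u v t. u \<in> {0..1} \<Longrightarrow> v \<in> {0..1} \<Longrightarrow> \<bar>u - v\<bar> < r' \<Longrightarrow> t \<in> {0..1} \<Longrightarrow> dist (f' u t) (f' v t) < \<rho> / 4"
    using f' \<rho>4 unfolding lifting_def by meson
  obtain N where N: "inverse (real (Suc N)) < min r r'" using reals_Archimedean[of "min r r'"] r(1) r'(1) by auto
  have "f (real k / real (Suc N)) = f' (real k / real (Suc N))" if "k \<le> Suc N" for k using that
  proof (induction k)
    case 0
    then show ?case using assms(4) by simp
  next
    case (Suc k)
    define u v where "u = real k / real (Suc N)" and "v = real (Suc k) / real (Suc N)"
    have uv: "u \<in> {0..1}" "v \<in> {0..1}" using Suc.prems unfolding u_def v_def by (auto simp: field_simps)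
    have "v - u = inverse (real (Suc N))" unfolding u_def v_def by (simp add: field_simps)
    then have "\<bar>u - v\<bar> = inverse (real (Suc N))" by (simp add: abs_minus_commute[of u v] del: of_nat_Suc)
    then have d: "\<bar>u - v\<bar> < r" "\<bar>u - v\<bar> < r'" using N by simp_all
    have "f v = f' v"
    proof (rule LG_eq_of_near[OF \<rho> R(1)[OF uv(2)] R(2)[OF uv(2)] e[OF uv(2)]])
      fix t :: real assume t: "t \<in> {0..1}"
      have "f u t = f' u t" using Suc unfolding u_def by simp
      then show "dist (f v t) (f' v t) < \<rho> / 2"
        using r(2)[OF uv d(1) t] r'(2)[OF uv d(2) t] dist_triangle[of "f v t" "f' v t" "f u t"] by (simp add: dist_commute)
    qed auto
    then show ?case unfolding v_def .
  qed
  from this[of "Suc N"] show ?thesis by simp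
qed

text \<open>A local inverse of the end-point map over a ball; the last clause is its continuity, in
  the strong form that small distances do not increase in the uniform metric.\<close>

definition lift_section :: "'a \<Rightarrow> 'a \<Rightarrow> real \<Rightarrow> ('a \<Rightarrow> real \<Rightarrow> 'a) \<Rightarrow> bool" where
  "lift_section x y r s \<longleftrightarrow> (\<exists>R. \<forall>z\<in>ball y r. LG x R (s z)) \<and> (\<forall>z\<in>ball y r. s z 1 = z) \<and>
     (\<exists>\<epsilon>>0. \<forall>z\<in>ball y r. \<forall>z'\<in>ball y r. dist z z' < \<epsilon> \<longrightarrow> (\<forall>t\<in>{0..1}. dist (s z t) (s z' t) \<le> dist z z'))"

text \<open>The section is extended step by step along the radial contraction of the ball.\<close>

lemma lift_section_exists:
  assumes c: "LG x R c" and r: "0 < r" and cn: "cn_on (ball (c 1) r)"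
  shows "\<exists>s. lift_section x (c 1) r s \<and> s (c 1) = c"
proof -
  define y where "y = c 1"
  \<comment> \<open>This bounds the lengths of all curves met on the way, so that one radius
    \<open>\<rho>\<close> serves at every step.\<close>
  define R' where "R' = R + r"
  obtain \<rho> where \<rho>: "0 < \<rho>" "\<And>w. w \<in> cball x R' \<Longrightarrow> cn_on (ball w \<rho>)" using uniform_cn[OF proper] by blast
  define e where "e = \<rho> / 16"
  have e: "0 < e" unfolding e_def using \<rho> by simp
  obtain N where "inverse (real (Suc N)) < e / r" using reals_Archimedean[of "e / r"] e r by auto
  then have N: "r / real (Suc N) < e" using r by (simp add: field_simps)
  have "\<forall>z. \<exists>q. q 0 = y \<and> q 1 = z \<and> (\<forall>s\<in>{0..1}. \<forall>t\<in>{0..1}. dist (q s) (q t) = dist y z * \<bar>s - t\<bar>)"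
  proof
    fix z
    obtain q where "q 0 = y" "q 1 = z" "\<And>s t. s \<in> {0..1} \<Longrightarrow> t \<in> {0..1} \<Longrightarrow> dist (q s) (q t) = dist y z / (1 - 0) * \<bar>s - t\<bar>"
      using geodesic_on[of 0 1 y z, OF zero_less_one] by metis
    then have "q 0 = y \<and> q 1 = z \<and> (\<forall>s\<in>{0..1}. \<forall>t\<in>{0..1}. dist (q s) (q t) = dist y z * \<bar>s - t\<bar>)" by simp
    then show "\<exists>q. q 0 = y \<and> q 1 = z \<and> (\<forall>s\<in>{0..1}. \<forall>t\<in>{0..1}. dist (q s) (q t) = dist y z * \<bar>s - t\<bar>)" by blast
  qed
  then obtain q where q: "\<And>z. q z 0 = y" "\<And>z. q z 1 = z"
    "\<And>z s t. s \<in> {0..1} \<Longrightarrow> t \<in> {0..1} \<Longrightarrow> dist (q z s) (q z t) = dist y z * \<bar>s - t\<bar>" by metis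
  \<comment> \<open>The radial contraction of the ball does not increase distances, by the
    inequality of Bruhat and Tits on the ball; this keeps neighbouring lifts together during the
    extension.\<close>
  have lip: "dist (q z t) (q z' t) \<le> dist z z'" if z: "z \<in> ball y r" "z' \<in> ball y r" and t: "t \<in> {0..1}" for z z' t
  proof -
    have p: "dist y (q w t) = t * dist y w" "dist (q w t) w = (1 - t) * dist y w" for w
      using q(3)[of 0 t w] q(3)[of t 1 w] q(1,2)[of w] t by auto
    have "t * dist y z \<le> dist y z" using t by (simp add: mult_left_le_one_le)
    then have "q z t \<in> ball y r" using p(1)[of z] z(1) by simp
    then have "dist (q z t) (q z' t) \<le> t * dist z z'" using cn_on_two_sides_eq[OF cn[folded y_def] _ z _ _ _ p p] r t by simp
    also have "\<dots> \<le> dist z z'" using t by (simp add: mult_left_le_one_le)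
    finally show ?thesis .
  qed
  define v where "v k = real k / real (Suc N)" for k
  have v: "v k \<in> {0..1}" if "k \<le> Suc N" for k using that unfolding v_def by (auto simp: field_simps)
  have "\<exists>s. (\<forall>z\<in>ball y r. LG x (R + r * v k) (s z) \<and> s z 1 = q z (v k)) \<and> s y = c \<and>
      (\<forall>z\<in>ball y r. \<forall>z'\<in>ball y r. dist z z' < e \<longrightarrow> (\<forall>t\<in>{0..1}. dist (s z t) (s z' t) \<le> dist z z'))"
    if "k \<le> Suc N" for k using that
  proof (induction k)
    case 0
    have "v 0 = 0" unfolding v_def by simp
    then show ?case using c q(1) by (intro exI[of _ "\<lambda>z. c"]) (simp add: y_def)
  next
    case (Suc k)
    then obtain s where s0: "(\<forall>z\<in>ball y r. LG x (R + r * v k) (s z) \<and> s z 1 = q z (v k)) \<and> s y = c \<and>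
      (\<forall>z\<in>ball y r. \<forall>z'\<in>ball y r. dist z z' < e \<longrightarrow> (\<forall>t\<in>{0..1}. dist (s z t) (s z' t) \<le> dist z z'))" using Suc_leD by blast
    then have s: "\<And>z. z \<in> ball y r \<Longrightarrow> LG x (R + r * v k) (s z)" "\<And>z. z \<in> ball y r \<Longrightarrow> s z 1 = q z (v k)"
      "s y = c" "\<And>z z' t. z \<in> ball y r \<Longrightarrow> z' \<in> ball y r \<Longrightarrow> dist z z' < e \<Longrightarrow> t \<in> {0..1} \<Longrightarrow> dist (s z t) (s z' t) \<le> dist z z'"
      by blast+
    have vk: "v k \<in> {0..1}" "v (Suc k) \<in> {0..1}" using v Suc.prems by auto
    have vd: "\<bar>v k - v (Suc k)\<bar> = 1 / real (Suc N)" unfolding v_def by (simp add: diff_divide_distrib[symmetric])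
    have rk: "R + r * v k \<le> R'" using vk(1) r unfolding R'_def by (simp add: mult_left_le)
    have step: "dist (s z 1) (q z (v (Suc k))) \<le> r / real (Suc N)" if z: "z \<in> ball y r" for z
    proof -
      have "dist (s z 1) (q z (v (Suc k))) = dist y z * (1 / real (Suc N))" using s(2)[OF z] q(3)[OF vk, of z] vd by simp
      also have "\<dots> \<le> r * (1 / real (Suc N))" using z by (intro mult_right_mono) auto
      finally show ?thesis by simp
    qed
    have "\<exists>c'. LG x (R + r * v (Suc k)) c' \<and> c' 1 = q z (v (Suc k)) \<and>
        (\<forall>t\<in>{0..1}. dist (s z t) (c' t) \<le> dist (s z 1) (q z (v (Suc k))))" if z: "z \<in> ball y r" for z
    proof -
      have cn': "cn_on (ball w \<rho>)" if "w \<in> cball x (R + r * v k)" for w using \<rho>(2)[of w] that rk by simp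
      have "dist (s z 1) (q z (v (Suc k))) \<le> \<rho> / 16" using step[OF z] N unfolding e_def by linarith
      from LG_near[OF \<rho>(1) cn' s(1)[OF z] this] obtain c' where c': "LG x (R + r * v k + dist (s z 1) (q z (v (Suc k)))) c'" "c' 1 = q z (v (Suc k))"
        "\<forall>t\<in>{0..1}. dist (s z t) (c' t) \<le> dist (s z 1) (q z (v (Suc k)))" by blast
      have "r * v k + r / real (Suc N) = r * v (Suc k)"
        unfolding v_def times_divide_eq_right add_divide_distrib[symmetric] by (simp add: algebra_simps)
      then have "LG x (R + r * v (Suc k)) c'" using LG_mono[OF c'(1)] step[OF z] by simp
      then show ?thesis using c' by blast
    qed
    then obtain s' where s': "\<And>z. z \<in> ball y r \<Longrightarrow> LG x (R + r * v (Suc k)) (s' z)" "\<And>z. z \<in> ball y r \<Longrightarrow> s' z 1 = q z (v (Suc k))"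
      "\<And>z t. z \<in> ball y r \<Longrightarrow> t \<in> {0..1} \<Longrightarrow> dist (s z t) (s' z t) \<le> dist (s z 1) (q z (v (Suc k)))" by metis
    have rk': "R + r * v (Suc k) \<le> R'" using vk(2) r unfolding R'_def by (simp add: mult_left_le)
    have "dist (s' z t) (s' z' t) \<le> dist z z'" if z: "z \<in> ball y r" "z' \<in> ball y r" "dist z z' < e" and t: "t \<in> {0..1}" for z z' t
    proof -
      have "dist (s' z t) (s' z' t) < \<rho> / 2" if t: "t \<in> {0..1}" for t
        using s'(3)[OF z(1) t] s'(3)[OF z(2) t] s(4)[OF z t] step[OF z(1)] step[OF z(2)] N z(3) \<rho>(1)
          dist_triangle[of "s' z t" "s' z' t" "s z t"] dist_triangle[of "s z t" "s' z' t" "s z' t"]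
        unfolding e_def by (simp add: dist_commute)
      then have "dist (s' z t) (s' z' t) \<le> t * dist (s' z 1) (s' z' 1)"
        using LG_convex[OF \<rho> LG_mono[OF s'(1)[OF z(1)] rk'] s'(1)[OF z(2)] _ t] by blast
      also have "\<dots> \<le> dist (s' z 1) (s' z' 1)" using t by (simp add: mult_left_le_one_le)
      also have "\<dots> \<le> dist z z'" using lip[OF z(1,2) vk(2)] s'(2) z by simp
      finally show ?thesis .
    qed
    moreover have "s' y = c"
    proof -
      have y: "y \<in> ball y r" using r by simp
      have "q y t = y" if "t \<in> {0..1}" for t using q(3)[of 0 t y] q(1)[of y] that by simp
      then have "dist (s y 1) (q y (v (Suc k))) = 0" using s(2)[OF y] vk by simp
      then have "s y t = s' y t" if "t \<in> {0..1}" for t using s'(3)[OF y that] by simp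
      then show ?thesis using LG_eqI[OF s(1)[OF y] s'(1)[OF y]] s(3) by simp
    qed
    ultimately show ?case using s' by (intro exI[of _ s']) auto
  qed
  from this[of "Suc N"] obtain s where s: "(\<forall>z\<in>ball y r. LG x (R + r * v (Suc N)) (s z) \<and> s z 1 = q z (v (Suc N))) \<and> s y = c \<and>
    (\<forall>z\<in>ball y r. \<forall>z'\<in>ball y r. dist z z' < e \<longrightarrow> (\<forall>t\<in>{0..1}. dist (s z t) (s z' t) \<le> dist z z'))" by blast
  have "v (Suc N) = 1" unfolding v_def by simp
  then have "\<forall>z\<in>ball y r. LG x (R + r * v (Suc N)) (s z)" "\<forall>z\<in>ball y r. s z 1 = z" using s q(2) by simp_all
  then have "lift_section x y r s" unfolding lift_section_def using s e by blast
  then show ?thesis using s unfolding y_def by blast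
qed

lemma lifting_of_section:
  assumes s: "lift_section x y r s" and q: "continuous_on {0..1} q" "q ` {0..1} \<subseteq> ball y r"
  shows "lifting x (\<lambda>u. s (q u))"
proof -
  obtain R e where R: "\<And>z. z \<in> ball y r \<Longrightarrow> LG x R (s z)" and e: "0 < e"
    "\<And>z z' t. z \<in> ball y r \<Longrightarrow> z' \<in> ball y r \<Longrightarrow> dist z z' < e \<Longrightarrow> t \<in> {0..1} \<Longrightarrow> dist (s z t) (s z' t) \<le> dist z z'"
    using s unfolding lift_section_def by meson
  have uc: "uniformly_continuous_on {0..1} q" using compact_uniformly_continuous[OF q(1)] by simp
  have "\<exists>\<delta>>0. \<forall>u\<in>{0..1}. \<forall>v\<in>{0..1}. \<bar>u - v\<bar> < \<delta> \<longrightarrow> (\<forall>t\<in>{0..1}. dist (s (q u) t) (s (q v) t) < h)" if "0 < h" for h :: real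
  proof -
    obtain \<delta> where \<delta>: "0 < \<delta>" "\<And>u v. u \<in> {0..1} \<Longrightarrow> v \<in> {0..1} \<Longrightarrow> dist v u < \<delta> \<Longrightarrow> dist (q v) (q u) < min e h"
      using uc \<open>0 < h\<close> e(1) unfolding uniformly_continuous_on_def by (metis min_less_iff_conj)
    have "dist (s (q u) t) (s (q v) t) < h" if "u \<in> {0..1}" "v \<in> {0..1}" "\<bar>u - v\<bar> < \<delta>" "t \<in> {0..1}" for u v t
    proof -
      have "dist (q u) (q v) < min e h" using \<delta>(2)[OF that(2,1)] that(3) by (simp add: dist_real_def)
      moreover have "q u \<in> ball y r" "q v \<in> ball y r" using q(2) that by blast+
      ultimately show ?thesis using e(2)[of "q u" "q v" t] that(4) by simp
    qed
    then show ?thesis using \<delta>(1) by blast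
  qed
  moreover have "\<forall>u\<in>{0..1}. LG x R (s (q u))" using R q(2) by blast
  ultimately show ?thesis unfolding lifting_def by blast
qed

end

context locally_cat0
begin

text \<open>Uniqueness of lifts, applied to \<open>f\<close> and to the lift that the section makes
  of the path of end points of \<open>f\<close>.\<close>

lemma section_follow:
  assumes s: "lift_section x y r s" and f: "lifting x f" and fb: "\<And>u. u \<in> {0..1} \<Longrightarrow> f u 1 \<in> ball y r" and "s (f 0 1) = f 0"
  shows "s (f 1 1) = f 1"
proof -
  have "continuous_on {0..1} (\<lambda>u. f u 1)" unfolding continuous_on_iff
  proof (intro ballI allI impI)
    fix u e :: real assume u: "u \<in> {0..1}" and "0 < e"
    then obtain d where d: "0 < d" "\<forall>u\<in>{0..1}. \<forall>v\<in>{0..1}. \<bar>u - v\<bar> < d \<longrightarrow> (\<forall>t\<in>{0..1}. dist (f u t) (f v t) < e)"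
      using f unfolding lifting_def by meson
    then show "\<exists>d>0. \<forall>v\<in>{0..1}. dist v u < d \<longrightarrow> dist (f v 1) (f u 1) < e"
      using u by (intro exI[of _ d]) (simp add: dist_real_def)
  qed
  then have l: "lifting x (\<lambda>u. s (f u 1))" using lifting_of_section[OF s] fb by blast
  show ?thesis by (rule lifting_unique[OF l f]) (use assms s in \<open>auto simp: lift_section_def\<close>)
qed

section \<open>Uniqueness of local geodesics in a simply connected space\<close>

text \<open>The initial piece of \<open>c\<close> up to time \<open>u\<close>, rescaled to
  \<open>[0, 1]\<close>. As \<open>u\<close> grows, these pieces form the lift of the path
  \<open>c\<close> itself that begins with the constant curve.\<close>

definition trunc :: "'a \<Rightarrow> (real \<Rightarrow> 'a) \<Rightarrow> real \<Rightarrow> real \<Rightarrow> 'a" where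
  "trunc x c u = (\<lambda>t. if t \<in> {0..1} then c (u * t) else x)"

lemma LG_trunc:
  assumes c: "LG x R c" and u: "u \<in> {0..1}"
  shows "LG x R (trunc x c u)"
proof -
  obtain L where L: "L \<le> R" "lgeo L 0 1 c" "c 0 = x" using c unfolding LG_def by blast
  obtain r where r: "0 < r" "\<And>s t. s \<in> {0..1} \<Longrightarrow> t \<in> {0..1} \<Longrightarrow> \<bar>s - t\<bar> < r \<Longrightarrow> dist (c s) (c t) = L * \<bar>s - t\<bar>"
    using L unfolding lgeo_def by blast
  have "dist (c (u * s)) (c (u * t)) = L * u * \<bar>s - t\<bar>" if "s \<in> {0..1}" "t \<in> {0..1}" "\<bar>s - t\<bar> < r" for s t
  proof -
    have e: "\<bar>u * s - u * t\<bar> = u * \<bar>s - t\<bar>" using u by (simp add: right_diff_distrib[symmetric] abs_mult)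
    also have "\<dots> \<le> \<bar>s - t\<bar>" using u by (simp add: mult_left_le_one_le)
    finally have "\<bar>u * s - u * t\<bar> < r" using that by simp
    moreover have "u * s \<in> {0..1}" "u * t \<in> {0..1}" using u that by (auto simp: mult_le_one)
    ultimately show ?thesis using r(2)[of "u * s" "u * t"] e by simp
  qed
  moreover have "0 \<le> L * u" using L u unfolding lgeo_def by simp
  ultimately have "lgeo (L * u) 0 1 (\<lambda>t. c (u * t))" using r(1) unfolding lgeo_def by blast
  moreover have "L * u \<le> R" using L u mult_left_le[of u L] unfolding lgeo_def by simp
  ultimately show ?thesis unfolding trunc_def using LG_of_lgeo[of "L * u" "\<lambda>t. c (u * t)" x R] L(3) by simp
qed

lemma lifting_trunc:
  assumes c: "LG x R c" and ab: "a \<in> {0..1}" "b \<in> {0..1}"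
  shows "lifting x (\<lambda>v. trunc x c (a + v * (b - a)))"
proof -
  obtain L where L: "L \<le> R" "lgeo L 0 1 c" "c 0 = x" using c unfolding LG_def by blast
  have L0: "0 \<le> L" using L unfolding lgeo_def by blast
  have m: "a + v * (b - a) \<in> {0..1}" if "v \<in> {0..1}" for v
  proof -
    have "a + v * (b - a) = (1 - v) * a + v * b" by (simp add: algebra_simps)
    moreover have "(1 - v) * a + v * b \<le> (1 - v) * 1 + v * 1" using that ab by (intro add_mono mult_left_mono) auto
    ultimately show ?thesis using that ab by auto
  qed
  have lip: "dist (trunc x c (a + u * (b - a)) t) (trunc x c (a + v * (b - a)) t) \<le> (L + 1) * \<bar>u - v\<bar>"
    if uv: "u \<in> {0..1}" "v \<in> {0..1}" and t: "t \<in> {0..1}" for u v t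
  proof -
    have "(a + u * (b - a)) * t \<in> {0..1}" "(a + v * (b - a)) * t \<in> {0..1}"
      using m[OF uv(1)] m[OF uv(2)] t by (auto intro: mult_le_one)
    then have "dist (trunc x c (a + u * (b - a)) t) (trunc x c (a + v * (b - a)) t)
        \<le> L * \<bar>(a + u * (b - a)) * t - (a + v * (b - a)) * t\<bar>" unfolding trunc_def using t lgeo_dist_le[OF L(2)] by simp
    also have "(a + u * (b - a)) * t - (a + v * (b - a)) * t = (u - v) * ((b - a) * t)" by (simp add: algebra_simps)
    also have "L * \<bar>(u - v) * ((b - a) * t)\<bar> \<le> L * (\<bar>u - v\<bar> * 1)"
      unfolding abs_mult using ab t L0 by (intro mult_left_mono mult_le_one) auto
    also have "\<dots> \<le> (L + 1) * \<bar>u - v\<bar>" by (simp add: algebra_simps)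
    finally show ?thesis .
  qed
  have "\<exists>e>0. \<forall>u\<in>{0..1}. \<forall>v\<in>{0..1}. \<bar>u - v\<bar> < e \<longrightarrow>
      (\<forall>t\<in>{0..1}. dist (trunc x c (a + u * (b - a)) t) (trunc x c (a + v * (b - a)) t) < h)" if "0 < h" for h :: real
  proof (intro exI[of _ "h / (L + 1)"] conjI ballI impI)
    show "0 < h / (L + 1)" using that L0 by simp
    fix u v t :: real assume *: "u \<in> {0..1}" "v \<in> {0..1}" "\<bar>u - v\<bar> < h / (L + 1)" "t \<in> {0..1}"
    have "(L + 1) * \<bar>u - v\<bar> < h" using *(3) L0 by (simp add: field_simps)
    then show "dist (trunc x c (a + u * (b - a)) t) (trunc x c (a + v * (b - a)) t) < h" using lip[OF *(1,2,4)] by simp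
  qed
  moreover have "\<forall>v\<in>{0..1}. LG x R (trunc x c (a + v * (b - a)))" using LG_trunc[OF c] m by blast
  ultimately show ?thesis unfolding lifting_def by blast
qed

text \<open>Injectivity of the exponential map, as in the theorem of Cartan and Hadamard. Two
  geodesics with the same ends form a contractible loop. Transport of geodesics over a fine grid on
  the homotopy shows that the lift of this loop closes up. Its first half consists of the pieces of
  \<open>c\<close>, its second half, read backwards from the end, of those of \<open>c'\<close>; at
  the middle both are the whole geodesics.\<close>

lemma LG_unique:
  assumes c: "LG x R c" and c': "LG x R' c'" and e1: "c 1 = c' 1"
  shows "c = c'"
proof -
  have c0: "c 0 = x" "c' 0 = x" using c c' unfolding LG_def by auto
  have cc: "continuous_on {0..1} c" "continuous_on {0..1} c'" using c c' lgeo_continuous unfolding LG_def by blast+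
  define \<gamma> where "\<gamma> t = (if t \<le> 1 / 2 then c (2 * t) else c' (2 - 2 * t))" for t
  have cont: "continuous_on {0..1} \<gamma>" unfolding \<gamma>_def
  proof (rule continuous_on_cases_1)
    show "continuous_on {t \<in> {0..1}. t \<le> 1 / 2} (\<lambda>t. c (2 * t))"
      by (rule continuous_on_compose2[OF cc(1)]) (auto intro!: continuous_intros)
    show "continuous_on {t \<in> {0..1}. 1 / 2 \<le> t} (\<lambda>t. c' (2 - 2 * t))"
      by (rule continuous_on_compose2[OF cc(2)]) (auto intro!: continuous_intros)
  qed (use e1 in auto)
  have \<gamma>1: "\<gamma> (u / 2) = c u" "\<gamma> (1 - u / 2) = c' u" if "u \<in> {0..1}" for u using that e1 unfolding \<gamma>_def by auto
  have path: "path \<gamma>" "pathstart \<gamma> = x" "pathfinish \<gamma> = x"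
    using cont \<gamma>1[of 0] c0 by (auto simp: path_def pathstart_def pathfinish_def)
  \<comment> \<open>The homotopy is through free loops, so base points move; \<open>col\<close>
    below follows them, and what matters for each row is only that its two ends lie over the same
    point.\<close>
  have "homotopic_loops UNIV \<gamma> (\<lambda>_. x)"
    using simply_connected_space path unfolding simply_connected_def by (auto simp: path_def pathstart_def pathfinish_def)
  then obtain h :: "real \<times> real \<Rightarrow> 'a" where h0: "continuous_on ({0..1} \<times> {0..1}) h" "\<forall>t\<in>{0..1}. h (0, t) = \<gamma> t"
    "\<forall>t\<in>{0..1}. h (1, t) = x" "\<forall>s\<in>{0..1}. pathfinish (h \<circ> Pair s) = pathstart (h \<circ> Pair s)"
    unfolding homotopic_loops by blast
  note h = h0(1) h0(2)[rule_format] h0(3)[rule_format] h0(4)[rule_format, unfolded pathstart_def pathfinish_def comp_def, symmetric]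
  have sq: "compact ({0..1::real} \<times> {0..1::real})" by (intro compact_Times) auto
  have K: "compact (h ` ({0..1} \<times> {0..1}))" by (rule compact_continuous_image[OF h(1) sq])
  then obtain r where r: "0 < r" "\<And>y. y \<in> h ` ({0..1} \<times> {0..1}) \<Longrightarrow> cn_on (ball y r)" using uniform_cn by blast
  have "uniformly_continuous_on ({0..1} \<times> {0..1}) h" by (rule compact_uniformly_continuous[OF h(1) sq])
  then obtain \<delta> where \<delta>: "0 < \<delta>" "\<And>z z'. z \<in> {0..1} \<times> {0..1} \<Longrightarrow> z' \<in> {0..1} \<times> {0..1} \<Longrightarrow> dist z' z < \<delta> \<Longrightarrow> dist (h z') (h z) < r / 3"
    using r(1) unfolding uniformly_continuous_on_def by (metis divide_pos_pos zero_less_numeral)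
  obtain m where m: "inverse (real (Suc m)) < \<delta>" using reals_Archimedean[OF \<delta>(1)] by blast
  \<comment> \<open>\<open>N\<close> is even, so that the middle of the loop, where \<open>c\<close>
    ends, is a grid point; a diagonal step of the grid is at most
    \<open>2 / N = 1 / M < \<delta>\<close>.\<close>
  define M where "M = Suc m"
  define N where "N = 2 * M"
  have M: "0 < M" "inverse (real M) < \<delta>" "real N = 2 * real M" unfolding M_def N_def using m by auto
  have near: "dist (h (a, b)) (h (a', b')) < r / 3"
    if "a \<in> {0..1}" "a' \<in> {0..1}" "b \<in> {0..1}" "b' \<in> {0..1}" "\<bar>a - a'\<bar> \<le> 1 / real N" "\<bar>b - b'\<bar> \<le> 1 / real N" for a a' b b'
  proof -
    have "dist (a, b) (a', b') \<le> \<bar>a - a'\<bar> + \<bar>b - b'\<bar>" unfolding dist_Pair_Pair dist_real_def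
      using sqrt_sum_squares_le_sum_abs[of "a - a'" "b - b'"] by simp
    also have "\<dots> \<le> 1 / real N + 1 / real N" using that by linarith
    also have "\<dots> = inverse (real M)" using M(3) by (simp add: field_simps)
    finally show ?thesis using \<delta>(2)[of "(a', b')" "(a, b)"] that M(2) by simp
  qed
  define E where "E c = (\<exists>R. LG x R c)" for c
  \<comment> \<open>\<open>move c q\<close> transports the geodesic \<open>c\<close> to the end
    point \<open>q\<close> along a local section chosen for \<open>c\<close>.\<close>
  have "\<exists>s. lift_section x (c 1) r s \<and> s (c 1) = c" if "E c" "c 1 \<in> h ` ({0..1} \<times> {0..1})" for c
    using that lift_section_exists r unfolding E_def by blast
  then obtain move where mv: "\<And>c. E c \<Longrightarrow> c 1 \<in> h ` ({0..1} \<times> {0..1}) \<Longrightarrow> lift_section x (c 1) r (move c)"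
    "\<And>c. E c \<Longrightarrow> c 1 \<in> h ` ({0..1} \<times> {0..1}) \<Longrightarrow> move c (c 1) = c" by metis
  define n where "n i = real i / real N" for i
  have N0: "0 < real N" using M by simp
  have n: "n i \<in> {0..1}" if "i \<le> N" for i using that N0 unfolding n_def by (auto simp: field_simps)
  have nS: "\<bar>n i - n (Suc i)\<bar> \<le> 1 / real N" "\<bar>n (Suc i) - n i\<bar> \<le> 1 / real N" for i
    unfolding n_def by (simp_all add: diff_divide_distrib[symmetric])
  define p where "p i j = h (n i, n j)" for i j
  have pK: "p i j \<in> h ` ({0..1} \<times> {0..1})" if "i \<le> N" "j \<le> N" for i j unfolding p_def using n that by blast
  have mvE: "E (move c q) \<and> move c q 1 = q" if "E c" "c 1 \<in> h ` ({0..1} \<times> {0..1})" "dist (c 1) q < r / 3" for c q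
    using mv(1)[OF that(1,2)] that(3) r(1) unfolding lift_section_def E_def by force
  \<comment> \<open>Transport by way of \<open>q\<close> agrees with direct transport: the segment
    from \<open>q\<close> to \<open>q'\<close> stays in both balls of radius \<open>r\<close>, and
    two lifts of it that agree at \<open>q\<close> agree at \<open>q'\<close>. Steps shorter than
    \<open>r / 3\<close> leave room for this.\<close>
  have comp: "move (move c q) q' = move c q'"
    if cE: "E c" "c 1 \<in> h ` ({0..1} \<times> {0..1})" and q: "q \<in> h ` ({0..1} \<times> {0..1})" "dist (c 1) q < r / 3" "dist (c 1) q' < r / 3" for c q q'
  proof -
    obtain w where w: "w 0 = q" "w 1 = q'" "\<And>s t. s \<in> {0..1} \<Longrightarrow> t \<in> {0..1} \<Longrightarrow> dist (w s) (w t) = dist q q' / (1 - 0) * \<bar>s - t\<bar>"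
      using geodesic_on[OF zero_less_one, of q q'] by metis
    have qq: "dist q q' < 2 * r / 3" using q dist_triangle[of q q' "c 1"] by (simp add: dist_commute)
    have wq: "dist q (w t) < 2 * r / 3" if "t \<in> {0..1}" for t
    proof -
      have "dist q (w t) = dist q q' * t" using w(1) w(3)[of 0 t] that by simp
      also have "\<dots> \<le> dist q q'" using that by (simp add: mult_left_le)
      finally show ?thesis using qq by simp
    qed
    note c'E = mvE[OF cE q(2)]
    have "lift_section x q r (move (move c q))" using mv(1)[of "move c q"] c'E q(1) by simp
    moreover have "continuous_on {0..1} w"
      by (rule lgeo_continuous[of "dist q q'"], rule lgeo_of_isometric) (use w(3) in auto)
    moreover have wb: "w t \<in> ball q r" "w t \<in> ball (c 1) r" if "t \<in> {0..1}" for t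
      using wq[OF that] r(1) q(2) dist_triangle[of "c 1" "w t" q] by auto
    ultimately have l: "lifting x (\<lambda>u. move (move c q) (w u))" by (intro lifting_of_section) auto
    have e: "move (move c q) (w u) 1 = w u" if "u \<in> {0..1}" for u
      using \<open>lift_section x q r (move (move c q))\<close> wb[OF that] unfolding lift_section_def by blast
    have "move c (move (move c q) (w 1) 1) = move (move c q) (w 1)"
    proof (rule section_follow[OF mv(1)[OF cE] l])
      show "move (move c q) (w u) 1 \<in> ball (c 1) r" if "u \<in> {0..1}" for u using e[OF that] wb[OF that] by simp
      show "move c (move (move c q) (w 0) 1) = move (move c q) (w 0)" using e[of 0] w(1) mv(2)[of "move c q"] c'E q(1) by simp
    qed
    then show ?thesis using e[of 1] w(2) by simp
  qed
  \<comment> \<open>\<open>col\<close> follows the base points of the loops from row to row,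
    \<open>C i\<close> runs along the loop in row \<open>i\<close>.\<close>
  define col where "col = rec_nat (\<lambda>t. x) (\<lambda>i c. move c (p (Suc i) 0))"
  define C where "C i = rec_nat (col i) (\<lambda>j c. move c (p i (Suc j)))" for i
  have col: "col 0 = (\<lambda>t. x)" "col (Suc i) = move (col i) (p (Suc i) 0)" for i unfolding col_def by simp_all
  have C: "C i 0 = col i" "C i (Suc j) = move (C i j) (p i (Suc j))" for i j unfolding C_def by simp_all
  have const: "E (\<lambda>t. x)"
    unfolding E_def LG_def lgeo_def by (intro exI[of _ 0] exI[of _ 1] conjI) (auto intro: exI[of _ 0] exI[of _ 1])
  have p1: "p 0 j = \<gamma> (n j)" "p N j = x" "p j 0 = p j N" if "j \<le> N" for j
    unfolding p_def using h(2-4)[OF n[OF that]] N0 by (simp_all add: n_def)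
  have d1: "dist (p i j) (p i' j') < r / 3"
    if "i \<le> N" "j \<le> N" "i' \<le> N" "j' \<le> N" "i' = i \<or> i' = Suc i \<or> i = Suc i'" "j' = j \<or> j' = Suc j \<or> j = Suc j'" for i j i' j'
    unfolding p_def by (rule near) (use that nS n in auto)
  have G1: "E (col i) \<and> col i 1 = p i 0" if "i \<le> N" for i using that
  proof (induction i)
    case 0
    then show ?case using col const p1(1)[of 0] \<gamma>1(1)[of 0] c0 by (simp add: n_def)
  next
    case (Suc i)
    then show ?case unfolding col using mvE[of "col i" "p (Suc i) 0"] d1 pK by simp
  qed
  have G2: "E (C i j) \<and> C i j 1 = p i j" if "i \<le> N" "j \<le> N" for i j using that(2)
  proof (induction j)
    case 0
    then show ?case using G1[OF that(1)] by (simp add: C)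
  next
    case (Suc j)
    then show ?case unfolding C(2) using mvE[of "C i j" "p i (Suc j)"] d1 pK that(1) by simp
  qed
  have comp': "move (move (C i j) (p i' j')) (p i'' j'') = move (C i j) (p i'' j'')"
    if "i \<le> N" "j \<le> N" "i' \<le> N" "j' \<le> N" "dist (p i j) (p i' j') < r / 3" "dist (p i j) (p i'' j'') < r / 3" for i j i' j' i'' j''
    using comp[of "C i j" "p i' j'" "p i'' j''"] G2[OF that(1,2)] pK[OF that(1,2)] pK[OF that(3,4)] that(5,6) by simp
  have mvC: "move (C i j) (p i j) = C i j" if "i \<le> N" "j \<le> N" for i j using mv(2)[of "C i j"] G2[OF that] pK[OF that] by simp
  \<comment> \<open>Each grid square commutes, because both ways round equal the direct transport
    across its diagonal.\<close>
  have H1: "C (Suc i) j = move (C i j) (p (Suc i) j)" if i: "Suc i \<le> N" and "j \<le> N" for i j using that(2)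
  proof (induction j)
    case 0
    then show ?case by (simp add: C col)
  next
    case (Suc j)
    have "C (Suc i) (Suc j) = move (move (C i j) (p (Suc i) j)) (p (Suc i) (Suc j))" using Suc by (simp add: C)
    also have "\<dots> = move (C i j) (p (Suc i) (Suc j))" by (rule comp') (use i Suc.prems d1 in auto)
    also have "\<dots> = move (move (C i j) (p i (Suc j))) (p (Suc i) (Suc j))" by (rule comp'[symmetric]) (use i Suc.prems d1 in auto)
    finally show ?case by (simp add: C)
  qed
  have H2: "C N j = C N 0" if "j \<le> N" for j using that
  proof (induction j)
    case (Suc j)
    then show ?case using mvC[of N j] p1(2)[of j] p1(2)[of "Suc j"] by (simp add: C)
  qed simp
  \<comment> \<open>The last row is constant, so its lift closes up. The property descends row by
    row: row \<open>i\<close> is recovered from row \<open>i + 1\<close> by transport, and both ends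
    of a row lie over the same point.\<close>
  have H3': "C (N - k) N = C (N - k) 0" if "k \<le> N" for k using that
  proof (induction k)
    case 0
    show ?case using H2[of N] by simp
  next
    case (Suc k)
    define i where "i = N - Suc k"
    have "Suc i = N - k" using Suc.prems unfolding i_def by simp
    then have IH: "C (Suc i) N = C (Suc i) 0" using Suc.IH Suc.prems by simp
    have i: "i < N" using Suc.prems unfolding i_def by simp
    have "C i j = move (C (Suc i) j) (p i j)" if "j \<le> N" for j
    proof -
      have "move (C (Suc i) j) (p i j) = move (C i j) (p i j)"
        unfolding H1[OF Suc_leI[OF i] that] by (rule comp') (use i that d1 r(1) in auto)
      then show ?thesis using mvC i that by simp
    qed
    from this[of N] this[of 0] have "C i N = C i 0" using IH p1(3)[of i] i by simp
    then show ?case unfolding i_def .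
  qed
  from H3'[of N] have H3: "C 0 N = C 0 0" by simp
  have rev_step: "C 0 j = move (C 0 (Suc j)) (p 0 j)" if "Suc j \<le> N" for j
  proof -
    have "move (C 0 (Suc j)) (p 0 j) = move (C 0 j) (p 0 j)" unfolding C by (rule comp') (use that d1 r(1) in auto)
    then show ?thesis using mvC[of 0 j] that by simp
  qed
  have follow: "move (trunc x e a) (e b) = trunc x e b"
    if e: "LG x R e" and ab: "a \<in> {0..1}" "b \<in> {0..1}" and K: "e a \<in> h ` ({0..1} \<times> {0..1})"
      and eb: "\<And>u. u \<in> {0..1} \<Longrightarrow> \<bar>u - a\<bar> \<le> \<bar>b - a\<bar> \<Longrightarrow> dist (e a) (e u) < r" for e R a b
  proof -
    have "trunc x e u 1 = e u" for u unfolding trunc_def by simp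
    note t1 = this
    have s: "lift_section x (e a) r (move (trunc x e a))" "move (trunc x e a) (e a) = trunc x e a"
      using mv[of "trunc x e a"] LG_trunc[OF e ab(1)] K unfolding E_def t1 by auto
    have "move (trunc x e a) (trunc x e (a + 1 * (b - a)) 1) = trunc x e (a + 1 * (b - a))"
    proof (rule section_follow[OF s(1) lifting_trunc[OF e ab]])
      show "move (trunc x e a) (trunc x e (a + 0 * (b - a)) 1) = trunc x e (a + 0 * (b - a))" using s(2) t1 by simp
      fix u :: real assume u: "u \<in> {0..1}"
      have "a + u * (b - a) = (1 - u) * a + u * b" by (simp add: algebra_simps)
      moreover have "(1 - u) * a + u * b \<le> (1 - u) * 1 + u * 1" using u ab by (intro add_mono mult_left_mono) auto
      ultimately have "a + u * (b - a) \<in> {0..1}" using u ab by auto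
      moreover have "\<bar>a + u * (b - a) - a\<bar> \<le> \<bar>b - a\<bar>" using u by (simp add: abs_mult mult_left_le_one_le)
      ultimately show "trunc x e (a + u * (b - a)) 1 \<in> ball (e a) r" unfolding t1 using eb by simp
    qed
    then show ?thesis unfolding t1 by simp
  qed
  have near\<gamma>: "dist (\<gamma> s) (\<gamma> t) < r" if "s \<in> {0..1}" "t \<in> {0..1}" "\<bar>s - t\<bar> \<le> 1 / real N" for s t
    using near[of 0 0 s t] h(2) that r(1) by simp
  have \<mu>: "real k / real M \<in> {0..1}" if "k \<le> M" for k using that M(1) by auto
  have \<mu>S: "\<bar>real (Suc k) / real M - real k / real M\<bar> = 1 / real M" for k by (simp add: diff_divide_distrib[symmetric])
  have advance: "move (trunc x e (real j / real M)) (e (real (Suc j) / real M)) = trunc x e (real (Suc j) / real M)"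
    if e: "LG x Q e" and \<phi>: "\<And>u. u \<in> {0..1} \<Longrightarrow> \<gamma> (\<phi> u) = e u \<and> \<phi> u \<in> {0..1}" "\<And>u v. \<bar>\<phi> u - \<phi> v\<bar> \<le> \<bar>u - v\<bar> / 2"
      and j: "Suc j \<le> M" for e Q \<phi> j
  proof (rule follow[OF e])
    have jM: "real j / real M \<in> {0..1}" using \<mu> j by simp
    then show "real j / real M \<in> {0..1}" .
    show "real (Suc j) / real M \<in> {0..1}" using \<mu> j by simp
    show "e (real j / real M) \<in> h ` ({0..1} \<times> {0..1})"
      using \<phi>(1)[OF jM] h(2)[of "\<phi> (real j / real M)"] by (intro image_eqI[of _ _ "(0, \<phi> (real j / real M))"]) auto
    fix u :: real assume u: "u \<in> {0..1}" "\<bar>u - real j / real M\<bar> \<le> \<bar>real (Suc j) / real M - real j / real M\<bar>"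
    have "\<bar>\<phi> (real j / real M) - \<phi> u\<bar> \<le> 1 / real M / 2"
      using \<phi>(2)[of "real j / real M" u] u(2) \<mu>S[of j] by (simp add: abs_minus_commute)
    then have "\<bar>\<phi> (real j / real M) - \<phi> u\<bar> \<le> 1 / real N" using M(3) by simp
    then show "dist (e (real j / real M)) (e u) < r" using near\<gamma> \<phi>(1)[OF jM] \<phi>(1)[OF u(1)] by metis
  qed
  have pc: "p 0 j = c (real j / real M)" if "j \<le> M" for j
  proof -
    have "p 0 j = \<gamma> (real j / real M / 2)" using p1(1)[of j] that M(3) unfolding N_def n_def by (simp add: mult.commute)
    then show ?thesis using \<gamma>1(1)[OF \<mu>[OF that]] by simp
  qed
  have pc': "p 0 (N - k) = c' (real k / real M)" if "k \<le> M" for k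
  proof -
    have "n (N - k) = 1 - real k / real M / 2" using that M unfolding N_def n_def by (simp add: of_nat_diff field_simps)
    then show ?thesis using \<gamma>1(2)[OF \<mu>[OF that]] p1(1)[of "N - k"] by simp
  qed
  have const': "trunc x c 0 = (\<lambda>t. x)" "trunc x c' 0 = (\<lambda>t. x)" unfolding trunc_def using c0 by auto
  have F1: "C 0 j = trunc x c (real j / real M)" if "j \<le> M" for j using that
  proof (induction j)
    case 0
    then show ?case using const' by (simp add: C col)
  next
    case (Suc j)
    have "C 0 (Suc j) = move (trunc x c (real j / real M)) (c (real (Suc j) / real M))"
      using Suc pc[of "Suc j"] by (simp add: C)
    also have "\<dots> = trunc x c (real (Suc j) / real M)"
    proof (rule advance[OF c, of "\<lambda>u. u / 2"])
      show "\<bar>u / 2 - v / 2\<bar> \<le> \<bar>u - v\<bar> / 2" for u v :: real by (auto simp: abs_if)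
    qed (use Suc.prems \<gamma>1(1) in auto)
    finally show ?case .
  qed
  \<comment> \<open>As the lift of the loop closes up, walking it backwards from the end also begins
    with the constant curve, and then it traces the pieces of \<open>c'\<close>.\<close>
  have F2: "C 0 (N - k) = trunc x c' (real k / real M)" if "k \<le> M" for k using that
  proof (induction k)
    case 0
    then show ?case using const' H3 by (simp add: C col)
  next
    case (Suc k)
    have "Suc (N - Suc k) = N - k" using Suc.prems unfolding N_def by simp
    then have "C 0 (N - Suc k) = move (trunc x c' (real k / real M)) (c' (real (Suc k) / real M))"
      using Suc pc'[of "Suc k"] rev_step[of "N - Suc k"] by simp
    also have "\<dots> = trunc x c' (real (Suc k) / real M)"
    proof (rule advance[OF c', of "\<lambda>u. 1 - u / 2"])
      show "\<bar>(1 - u / 2) - (1 - v / 2)\<bar> \<le> \<bar>u - v\<bar> / 2" for u v :: real by (auto simp: abs_if)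
    qed (use Suc.prems \<gamma>1(2) in auto)
    finally show ?case .
  qed
  have "trunc x c 1 = trunc x c' 1" using F1[of M] F2[of M] M(1) unfolding N_def by simp
  then have "c t = c' t" if "t \<in> {0..1}" for t using that unfolding trunc_def by (metis mult_1)
  then show ?thesis using LG_eqI[OF c c'] by blast
qed

end

context locally_cat0
begin

section \<open>The inequality of Bruhat and Tits in the large\<close>

text \<open>The local geodesic found by continuation and the minimizing one have the same ends,
  hence coincide by \<open>LG_unique\<close>. Minimizing segments from \<open>x\<close> thus vary
  continuously with their end points, which is how simple connectedness enters the distance
  estimates.\<close>

lemma geodesic_near:
  assumes r: "0 < r" and cn: "\<And>w. w \<in> cball x R \<Longrightarrow> cn_on (ball w r)"
    and c: "c 0 = (x :: 'a)" "\<And>s t. s \<in> {0..1} \<Longrightarrow> t \<in> {0..1} \<Longrightarrow> dist (c s) (c t) = dist x (c 1) * \<bar>s - t\<bar>"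
    and c': "c' 0 = x" "\<And>s t. s \<in> {0..1} \<Longrightarrow> t \<in> {0..1} \<Longrightarrow> dist (c' s) (c' t) = dist x (c' 1) * \<bar>s - t\<bar>"
    and R: "dist x (c 1) \<le> R" and d: "dist (c 1) (c' 1) \<le> r / 16" and t: "t \<in> {0..1}"
  shows "dist (c t) (c' t) \<le> dist (c 1) (c' 1)"
proof -
  define N where "N e = (\<lambda>t :: real. if t \<in> {0..1} then e t else x)" for e
  have lg: "LG x R (N c)" "LG x (dist x (c' 1)) (N c')" unfolding N_def
    using LG_of_lgeo[OF lgeo_of_isometric[OF zero_le_dist c(2)] c(1) R]
      LG_of_lgeo[OF lgeo_of_isometric[OF zero_le_dist c'(2)] c'(1) order_refl] by auto
  have N1: "N e 1 = e 1" for e unfolding N_def by simp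
  obtain e where e: "LG x (R + dist (c 1) (c' 1)) e" "e 1 = c' 1" "\<forall>t\<in>{0..1}. dist (N c t) (e t) \<le> dist (c 1) (c' 1)"
    using LG_near[OF r cn lg(1), of "c' 1"] d unfolding N1 by blast
  have "e = N c'" by (rule LG_unique[OF e(1) lg(2)]) (simp add: e(2) N1)
  then show ?thesis using e(3) t unfolding N_def by auto
qed

text \<open>The geodesics from \<open>z\<close> to two nearby points are cut into short pieces; the quadrilateral inequality for
  consecutive pieces is summed with the Cauchy--Schwarz inequality.\<close>

lemma midpoint_inequality:
  assumes r: "0 < r" and cn: "\<And>w. w \<in> cball z R \<Longrightarrow> cn_on (ball (w :: 'a) r)" and R: "dist z m \<le> R"
    and m: "dist p m = h" "dist m q = h" "dist p q = 2 * h" and h: "h \<le> r / 16"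
  shows "2 * (dist z m)^2 \<le> (dist z p)^2 + (dist z q)^2 - 2 * h^2"
proof -
  have "\<exists>\<gamma>. \<gamma> 0 = z \<and> \<gamma> 1 = y \<and> (\<forall>s\<in>{0..1}. \<forall>t\<in>{0..1}. dist (\<gamma> s) (\<gamma> t) = dist z y * \<bar>s - t\<bar>)" for y
  proof -
    obtain \<gamma> where "\<gamma> 0 = z" "\<gamma> 1 = y" "\<And>s t. s \<in> {0..1} \<Longrightarrow> t \<in> {0..1} \<Longrightarrow> dist (\<gamma> s) (\<gamma> t) = dist z y / (1 - 0) * \<bar>s - t\<bar>"
      using geodesic_on[of 0 1 z y, OF zero_less_one] by metis
    then show ?thesis by (intro exI[of _ \<gamma>]) simp
  qed
  then obtain \<gamma> where \<gamma>: "\<And>y. \<gamma> y 0 = z" "\<And>y. \<gamma> y 1 = y"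
    "\<And>y s t. s \<in> {0..1} \<Longrightarrow> t \<in> {0..1} \<Longrightarrow> dist (\<gamma> y s) (\<gamma> y t) = dist z y * \<bar>s - t\<bar>" by metis
  have g: "dist (\<gamma> m t) (\<gamma> y t) \<le> h" if "dist m y = h" "t \<in> {0..1}" for y t
    using geodesic_near[OF r cn, of z R "\<gamma> m" "\<gamma> y" t] \<gamma> R h that by simp
  have h0: "0 \<le> h" using m(1) zero_le_dist[of p m] by simp
  have "0 < r / (R + 1)" using r R zero_le_dist[of z m] by (intro divide_pos_pos) linarith+
  then obtain n where n: "inverse (real (Suc n)) < r / (R + 1) / 16" using reals_Archimedean[of "r / (R + 1) / 16"] by (metis half_gt_zero divide_pos_pos zero_less_numeral)
  define N where "N = Suc n"
  have N: "0 < real N" "R / real N \<le> r / 16"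
  proof -
    show "0 < real N" unfolding N_def by simp
    have R0: "0 \<le> R" using R zero_le_dist[of z m] by linarith
    have "R / real N \<le> (R + 1) * inverse (real N)" using \<open>0 < real N\<close> R0 by (simp add: field_simps)
    also have "\<dots> \<le> (R + 1) * (r / (R + 1) / 16)" using n R0 unfolding N_def by (intro mult_left_mono) auto
    also have "\<dots> = r / 16" using R0 by (simp add: field_simps add_nonneg_pos)
    finally show "R / real N \<le> r / 16" .
  qed
  define v where "v i = real i / real N" for i
  have v: "v i \<in> {0..1}" if "i \<le> N" for i using that N(1) unfolding v_def by (auto simp: field_simps)
  have vS: "\<bar>v i - v (Suc i)\<bar> = 1 / real N" for i unfolding v_def by (simp add: diff_divide_distrib[symmetric])
  define P Q where "P i = \<gamma> p (v i)" and "Q i = \<gamma> q (v i)" for i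
  have mid: "\<exists>w. dist (P i) w = dist (P i) (Q i) / 2 \<and> dist w (Q i) = dist (P i) (Q i) / 2" for i
  proof -
    obtain w where "dist (P i) w = 1 / 2 * dist (P i) (Q i)" "dist w (Q i) = (1 - 1 / 2) * dist (P i) (Q i)"
      by (rule geodesic_spaceD[OF geodesic, of "1 / 2" "P i" "Q i"]) auto
    then show ?thesis by (intro exI[of _ w]) simp
  qed
  \<comment> \<open>At the last index the given midpoint \<open>m\<close> is taken, elsewhere any
    midpoint.\<close>
  define M where "M i = (if i = N then m else SOME w. dist (P i) w = dist (P i) (Q i) / 2 \<and> dist w (Q i) = dist (P i) (Q i) / 2)" for i
  have ends: "P 0 = z" "Q 0 = z" "P N = p" "Q N = q" "M N = m" unfolding P_def Q_def M_def v_def using \<gamma> N by auto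
  have M: "dist (P i) (M i) = dist (P i) (Q i) / 2" "dist (M i) (Q i) = dist (P i) (Q i) / 2" for i
    using someI_ex[OF mid[of i]] m ends unfolding M_def by auto
  have M0: "M 0 = z" using M(1)[of 0] ends by simp
  define w where "w i = dist (P i) (Q i)" for i
  define A B where "A = dist z p" and "B = dist z q"
  have step: "(dist (M i) (M (Suc i)))^2 \<le> (A / N)^2 / 2 + (B / N)^2 / 2 - (w (Suc i) - w i)^2 / 4" if i: "i < N" for i
  proof -
    define C where "C i = \<gamma> m (v i)" for i
    have PC: "dist (C i) (P i) \<le> r / 16" "dist (C i) (Q i) \<le> r / 16" if "i \<le> N" for i
      using g[of p "v i"] g[of q "v i"] m v[OF that] h unfolding C_def P_def Q_def by (simp_all add: dist_commute)
    have MC: "dist (C i) (M i) \<le> 3 * r / 16" if "i \<le> N" for i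
      using PC[OF that] M(1)[of i] dist_triangle[of "C i" "M i" "P i"] dist_triangle[of "P i" "Q i" "C i"] dist_commute[of "P i" "C i"] dist_commute[of "M i" "P i"] r by linarith
    have CC: "dist (C i) (C (Suc i)) \<le> r / 16"
    proof -
      have "dist (C i) (C (Suc i)) = dist z m * (1 / real N)" unfolding C_def using \<gamma>(3) v i vS by simp
      also have "\<dots> \<le> R * (1 / real N)" using R N by (intro mult_right_mono) auto
      also have "\<dots> = R / real N" by simp
      finally show ?thesis using N(2) by linarith
    qed
    define S where "S = ball (C i) r"
    have "dist z (C i) \<le> R"
      using \<gamma>(3)[of 0 "v i" m] \<gamma>(1)[of m] v[of i] i R mult_left_le[of "v i" "dist z m"] unfolding C_def by simp
    then have cnS: "cn_on S" unfolding S_def using cn by simp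
    have mem: "P i \<in> S" "Q i \<in> S" "P (Suc i) \<in> S" "Q (Suc i) \<in> S" "M i \<in> S"
      unfolding S_def using PC[of i] PC[of "Suc i"] MC[of i] CC i r dist_triangle[of "C i" "P (Suc i)" "C (Suc i)"]
        dist_triangle[of "C i" "Q (Suc i)" "C (Suc i)"] by auto
    have "(dist (M i) (M (Suc i)))^2 \<le> (dist (P i) (P (Suc i)))^2 / 2 + (dist (Q i) (Q (Suc i)))^2 / 2
        - (dist (P i) (Q i) - dist (P (Suc i)) (Q (Suc i)))^2 / 4" by (rule cn_on_midpoints[OF geodesic cnS mem M M])
    moreover have "dist (P i) (P (Suc i)) = A / N" "dist (Q i) (Q (Suc i)) = B / N"
      unfolding P_def Q_def A_def B_def using \<gamma>(3) v i vS by simp_all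
    ultimately show ?thesis unfolding w_def by (simp add: power2_commute)
  qed
  have "dist z m \<le> (\<Sum>i<N. dist (M i) (M (Suc i)))"
  proof -
    have "dist (M 0) (M k) \<le> (\<Sum>i<k. dist (M i) (M (Suc i)))" for k
    proof (induction k)
      case (Suc k)
      then show ?case using dist_triangle[of "M 0" "M (Suc k)" "M k"] by simp
    qed simp
    from this[of N] show ?thesis using M0 ends by simp
  qed
  then have "(dist z m)^2 \<le> (\<Sum>i<N. dist (M i) (M (Suc i)) * 1)^2" by (intro power_mono) auto
  also have "\<dots> \<le> (\<Sum>i<N. (dist (M i) (M (Suc i)))^2) * (\<Sum>i<N. 1^2)" by (rule Cauchy_Schwarz_ineq_sum)
  also have "\<dots> = N * (\<Sum>i<N. (dist (M i) (M (Suc i)))^2)" by simp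
  also have "\<dots> \<le> N * (\<Sum>i<N. (A / N)^2 / 2 + (B / N)^2 / 2 - (w (Suc i) - w i)^2 / 4)"
    using step by (intro mult_left_mono sum_mono) auto
  also have "\<dots> = N * (N * ((A / N)^2 / 2 + (B / N)^2 / 2)) - N * (\<Sum>i<N. (w (Suc i) - w i)^2) / 4"
    by (simp add: sum_subtractf sum_divide_distrib[symmetric] algebra_simps)
  also have "N * (N * ((A / N)^2 / 2 + (B / N)^2 / 2)) = A^2 / 2 + B^2 / 2"
    using N(1) by (simp add: power2_eq_square field_simps)
  finally have 1: "(dist z m)^2 \<le> A^2 / 2 + B^2 / 2 - N * (\<Sum>i<N. (w (Suc i) - w i)^2) / 4" .
  \<comment> \<open>The widths \<open>w\<close> grow from 0 to \<open>2 * h\<close>, so the squares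
    of their increments sum to at least \<open>4 * h^2 / N\<close>; this produces the term
    \<open>2 * h^2\<close>.\<close>
  have "(\<Sum>i<N. w (Suc i) - w i) = 2 * h" using sum_lessThan_telescope[of w N] ends m unfolding w_def by simp
  then have "(2 * h)^2 \<le> (\<Sum>i<N. (w (Suc i) - w i)^2) * (\<Sum>i<N. 1^2)"
    using Cauchy_Schwarz_ineq_sum[of "\<lambda>i. w (Suc i) - w i" "\<lambda>i. 1" "{..<N}"] by simp
  then have "4 * h^2 \<le> N * (\<Sum>i<N. (w (Suc i) - w i)^2)" by (simp add: power2_eq_square mult.commute)
  then show ?thesis using 1 unfolding A_def B_def by simp
qed

text \<open>Equivalently, the squared distance minus \<open>D^2 * s^2\<close> lies below its chord.
  \<open>midpoint_inequality\<close> gives this on small scales around every point, and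
  \<open>local_midpoint_convex_le_chord\<close> passes to the whole segment.\<close>

lemma cn_geodesic:
  assumes c: "\<And>s t. s \<in> {0..1} \<Longrightarrow> t \<in> {0..1} \<Longrightarrow> dist (c s) (c t) = D * \<bar>s - t\<bar>" and t: "t \<in> {0..1}"
  shows "(dist (z :: 'a) (c t))^2 \<le> (1 - t) * (dist z (c 0))^2 + t * (dist z (c 1))^2 - t * (1 - t) * D^2"
proof -
  define f where "f s = (dist z (c s))^2 - D^2 * s^2" for s
  have D: "0 \<le> D" using c[of 0 1] zero_le_dist[of "c 0" "c 1"] by simp
  define R where "R = dist z (c 0) + D"
  obtain r where r: "0 < r" "\<And>w. w \<in> cball z R \<Longrightarrow> cn_on (ball w r)" using uniform_cn[OF proper] by blast
  have "(1 - 0) * f t \<le> (1 - t) * f 0 + (t - 0) * f 1"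
  proof (rule local_midpoint_convex_le_chord[OF _ _ _ t])
    show "continuous_on {0..1} f" unfolding f_def
      by (intro continuous_intros lgeo_continuous[OF lgeo_of_isometric[OF D c]]) auto
    fix s :: real assume s: "0 < s" "s < 1"
    define h where "h = min (min s (1 - s)) (r / 16 / (D + 1))"
    have h0: "0 < h" unfolding h_def using s r(1) D by simp
    have h: "h \<le> s" "h \<le> 1 - s" "h \<le> r / 16 / (D + 1)" unfolding h_def by linarith+
    have "D * h \<le> (D + 1) * h" using h0 by (simp add: algebra_simps)
    also have "\<dots> \<le> (D + 1) * (r / 16 / (D + 1))" using h(3) D by (intro mult_left_mono) auto
    also have "\<dots> = r / 16" using D by (simp add: field_simps add_nonneg_pos)
    finally have Dh: "D * h \<le> r / 16" .
    have mem: "s \<in> {0..1}" "s - h \<in> {0..1}" "s + h \<in> {0..1}" using s h h0 by auto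
    have "D * s \<le> D" using s D by (simp add: mult_left_le)
    then have "dist z (c s) \<le> R" using dist_triangle[of z "c s" "c 0"] c[of 0 s] s unfolding R_def by simp
    then have "2 * (dist z (c s))^2 \<le> (dist z (c (s - h)))^2 + (dist z (c (s + h)))^2 - 2 * (D * h)^2"
      using midpoint_inequality[OF r(1), of z R "c s" "c (s - h)" "D * h" "c (s + h)"] r(2) c[OF mem(2,1)] c[OF mem(1,3)] c[OF mem(2,3)] h0 Dh by simp
    then have "2 * f s \<le> f (s - h) + f (s + h)" unfolding f_def by (simp add: power2_eq_square algebra_simps)
    then show "\<exists>e>0. 0 \<le> s - e \<and> s + e \<le> 1 \<and> 2 * f s \<le> f (s - e) + f (s + e)" using h0 h by (intro exI[of _ h]) auto
  qed simp
  then show ?thesis unfolding f_def by (simp add: power2_eq_square algebra_simps)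
qed

theorem cn_UNIV: "cn_on (UNIV :: 'a set)" unfolding cn_on_def
proof (intro ballI allI impI, elim conjE)
  fix x y z n :: 'a and l :: real
  assume l: "0 \<le> l" "l \<le> 1" and n: "dist x n = l * dist x y" "dist n y = (1 - l) * dist x y"
  define D where "D = dist x y"
  show "(dist z n)^2 \<le> (1 - l) * (dist z x)^2 + l * (dist z y)^2 - l * (1 - l) * (dist x y)^2"
  proof (cases "l = 0 \<or> l = 1")
    case True
    then show ?thesis using n by auto
  next
    case False
    then have l: "0 < l" "l < 1" using l by auto
    have e: "dist x n / (l - 0) = D" "dist n y / (1 - l) = D" using n l unfolding D_def by auto
    \<comment> \<open>The point \<open>n\<close> is known only through its distances, so a segment
      through it is built from two pieces; the triangle inequality between \<open>x\<close> and
      \<open>y\<close> forces the equality in \<open>mixed\<close>.\<close>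
    obtain c1 where c1: "c1 0 = x" "c1 l = n" "\<And>s t. s \<in> {0..l} \<Longrightarrow> t \<in> {0..l} \<Longrightarrow> dist (c1 s) (c1 t) = D * \<bar>s - t\<bar>"
      using geodesic_on[OF l(1), of x n] unfolding e by metis
    obtain c2 where c2: "c2 l = n" "c2 1 = y" "\<And>s t. s \<in> {l..1} \<Longrightarrow> t \<in> {l..1} \<Longrightarrow> dist (c2 s) (c2 t) = D * \<bar>s - t\<bar>"
      using geodesic_on[OF l(2), of n y] unfolding e by metis
    define c where "c t = (if t \<le> l then c1 t else c2 t)" for t
    have mixed: "dist (c1 s) (c2 t) = D * (t - s)" if st: "s \<in> {0..l}" "t \<in> {l..1}" for s t
    proof -
      have "dist x (c1 s) = D * s" "dist (c1 s) n = D * (l - s)" "dist n (c2 t) = D * (t - l)" "dist (c2 t) y = D * (1 - t)"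
        using c1(3)[of 0 s] c1(3)[of s l] c2(3)[of l t] c2(3)[of t 1] c1(1,2) c2(1,2) st l by auto
      then show ?thesis
        using dist_triangle[of "c1 s" "c2 t" n] dist_triangle[of x y "c1 s"] dist_triangle[of "c1 s" y "c2 t"]
        unfolding D_def[symmetric] by (simp add: algebra_simps)
    qed
    have "dist (c s) (c t) = D * \<bar>s - t\<bar>" if "s \<in> {0..1}" "t \<in> {0..1}" for s t
      using that c1(3)[of s t] c2(3)[of s t] mixed[of s t] mixed[of t s] unfolding c_def by (auto simp: dist_commute)
    moreover have "c 0 = x" "c 1 = y" "c l = n" unfolding c_def using c1 c2 l by auto
    ultimately show ?thesis using cn_geodesic[of c D l z] l unfolding D_def by simp
  qed
qed

end

section \<open>Rays and Busemann functions in a pseudometric space\<close>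

locale pseudo_metric =
  fixes X :: "'b set" and d :: "'b \<Rightarrow> 'b \<Rightarrow> real"
  assumes refl: "x \<in> X \<Longrightarrow> d x x = 0" and sym: "x \<in> X \<Longrightarrow> y \<in> X \<Longrightarrow> d x y = d y x"
    and triangle: "x \<in> X \<Longrightarrow> y \<in> X \<Longrightarrow> z \<in> X \<Longrightarrow> d x z \<le> d x y + d y z"
begin

text \<open>The bound is additive over adjacent intervals and holds on short ones, so a bisection
  argument applies.\<close>

lemma half_geodesic_dist_le:
  assumes \<alpha>: "half_geodesic X d \<alpha>" and st: "0 \<le> s" "0 \<le> t"
  shows "d (\<alpha> s) (\<alpha> t) \<le> \<bar>s - t\<bar>"
proof -
  have X: "\<alpha> t \<in> X" if "0 \<le> t" for t using \<alpha> that unfolding half_geodesic_def by blast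
  have le: "d (\<alpha> s) (\<alpha> t) \<le> t - s" if "0 \<le> s" "s \<le> t" for s t
  proof -
    define P where "P = (\<lambda>(a, b). 0 \<le> a \<longrightarrow> a \<le> b \<longrightarrow> d (\<alpha> a) (\<alpha> b) \<le> b - a)"
    have "P (s, t)"
    proof (rule Bolzano[OF that(2)])
      fix a b c assume "P (a, b)" "P (b, c)" "a \<le> b" "b \<le> c"
      then show "P (a, c)" unfolding P_def using triangle[OF X[of a] X[of b] X[of c]] by auto
    next
      fix x assume x: "s \<le> x" "x \<le> t"
      then obtain e where e: "0 < e" "\<And>r s. 0 \<le> r \<Longrightarrow> 0 \<le> s \<Longrightarrow> \<bar>r - x\<bar> < e \<Longrightarrow> \<bar>s - x\<bar> < e \<Longrightarrow> d (\<alpha> r) (\<alpha> s) = \<bar>r - s\<bar>"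
        using \<alpha> \<open>0 \<le> s\<close> unfolding half_geodesic_def by (meson order_trans)
      show "\<exists>e>0. \<forall>a b. a \<le> x \<and> x \<le> b \<and> b - a < e \<longrightarrow> P (a, b)" using e unfolding P_def by (intro exI[of _ e]) auto
    qed
    then show ?thesis unfolding P_def using that by simp
  qed
  show ?thesis using le[of s t] le[of t s] st sym[OF X X] by (cases "s \<le> t") auto
qed

lemma le_length_excess: "0 \<le> s \<Longrightarrow> 0 \<le> t \<Longrightarrow> ereal (\<bar>t - s\<bar> - d (\<alpha> t) (\<alpha> s)) \<le> length_excess d \<alpha>"
  unfolding length_excess_def by (rule SUP_upper2[of "(t, s)"]) auto

lemma length_excess_le:
  "(\<And>s t. 0 \<le> s \<Longrightarrow> 0 \<le> t \<Longrightarrow> \<bar>t - s\<bar> - d (\<alpha> t) (\<alpha> s) \<le> e) \<Longrightarrow> length_excess d \<alpha> \<le> ereal e"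
  unfolding length_excess_def by (rule SUP_least) auto

lemma length_excess_nonneg: "half_geodesic X d \<alpha> \<Longrightarrow> 0 \<le> length_excess d \<alpha>"
  using le_length_excess[of 0 0 \<alpha>] refl unfolding half_geodesic_def by (simp add: zero_ereal_def)

lemma ray_iff: "ray X d \<alpha> \<longleftrightarrow> (\<forall>t\<ge>0. \<alpha> t \<in> X) \<and> (\<forall>s\<ge>0. \<forall>t\<ge>0. d (\<alpha> s) (\<alpha> t) = \<bar>s - t\<bar>)"
proof
  assume r: "ray X d \<alpha>"
  then have hg: "half_geodesic X d \<alpha>" and e: "length_excess d \<alpha> = 0" unfolding ray_def by auto
  have "\<bar>s - t\<bar> \<le> d (\<alpha> s) (\<alpha> t)" if "0 \<le> s" "0 \<le> t" for s t
    using le_length_excess[OF that(2,1), of \<alpha>] e by (simp add: zero_ereal_def)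
  then show "(\<forall>t\<ge>0. \<alpha> t \<in> X) \<and> (\<forall>s\<ge>0. \<forall>t\<ge>0. d (\<alpha> s) (\<alpha> t) = \<bar>s - t\<bar>)"
    using half_geodesic_dist_le[OF hg] hg unfolding half_geodesic_def by (meson order_antisym)
next
  assume r: "(\<forall>t\<ge>0. \<alpha> t \<in> X) \<and> (\<forall>s\<ge>0. \<forall>t\<ge>0. d (\<alpha> s) (\<alpha> t) = \<bar>s - t\<bar>)"
  then have hg: "half_geodesic X d \<alpha>" unfolding half_geodesic_def using zero_less_one by blast
  have "length_excess d \<alpha> \<le> ereal 0" by (rule length_excess_le) (use r in \<open>auto simp: abs_minus_commute\<close>)
  then show "ray X d \<alpha>" unfolding ray_def using hg length_excess_nonneg[OF hg] by (simp add: zero_ereal_def)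
qed

lemma ray_quasi_ray: "ray X d \<alpha> \<Longrightarrow> quasi_ray X d \<alpha>" unfolding ray_def quasi_ray_def by simp

section \<open>Busemann functions and calibrated curves\<close>

text \<open>For a ray this is \<open>busemann d \<alpha> x (\<alpha> 0)\<close>: subtracting
  \<open>t\<close> normalizes at the origin and makes the limit one of a decreasing
  function.\<close>

definition horo :: "(real \<Rightarrow> 'b) \<Rightarrow> 'b \<Rightarrow> real" where
  "horo \<alpha> x = Lim at_top (\<lambda>t. d x (\<alpha> t) - t)"

text \<open>Gradient lines of the Busemann function of \<open>\<beta>\<close>, in integrated form:
  equality in the Lipschitz bound replaces a statement about derivatives.\<close>

definition calibrated :: "(real \<Rightarrow> 'b) \<Rightarrow> (real \<Rightarrow> 'b) \<Rightarrow> bool" where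
  "calibrated \<alpha> \<beta> \<longleftrightarrow> (\<forall>t\<ge>0. horo \<beta> (\<alpha> 0) - horo \<beta> (\<alpha> t) = t)"

context
  fixes \<alpha> assumes ray: "ray X d \<alpha>"
begin

lemma ray_in: "0 \<le> t \<Longrightarrow> \<alpha> t \<in> X" and ray_dist: "0 \<le> s \<Longrightarrow> 0 \<le> t \<Longrightarrow> d (\<alpha> s) (\<alpha> t) = \<bar>s - t\<bar>" using ray unfolding ray_iff by auto

lemma dist_ray_antimono: "x \<in> X \<Longrightarrow> 0 \<le> s \<Longrightarrow> s \<le> t \<Longrightarrow> d x (\<alpha> t) - t \<le> d x (\<alpha> s) - s"
  using triangle[OF _ ray_in[of s] ray_in[of t], of x] ray_dist[of s t] by simp

lemma horo_tendsto:
  assumes x: "x \<in> X"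
  shows "((\<lambda>t. d x (\<alpha> t) - t) \<longlongrightarrow> horo \<alpha> x) at_top"
proof -
  \<comment> \<open>Clamping the parameter at 0 makes the function decreasing on the whole
    line.\<close>
  define f where "f t = d x (\<alpha> (max 0 t)) - max 0 t" for t
  define l where "l = (INF t. f t)"
  have lb: "- d (\<alpha> 0) x \<le> f t" for t
    unfolding f_def using triangle[OF ray_in[of 0] x ray_in[of "max 0 t"]] ray_dist[of 0 "max 0 t"] by linarith
  have anti: "f t \<le> f s" if "s \<le> t" for s t
    unfolding f_def using dist_ray_antimono[OF x, of "max 0 s" "max 0 t"] that by simp
  have "(f \<longlongrightarrow> l) at_top"
  proof (rule decreasing_tendsto)
    show "\<forall>\<^sub>F t in at_top. l \<le> f t" unfolding l_def using lb by (intro always_eventually allI cINF_lower bdd_belowI[of _ "- d (\<alpha> 0) x"]) auto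
    fix y assume "l < y"
    moreover have "bdd_below (range f)" using lb by (intro bdd_belowI[of _ "- d (\<alpha> 0) x"]) auto
    ultimately obtain s where "f s < y" unfolding l_def using cINF_less_iff[of UNIV f y] by auto
    then show "\<forall>\<^sub>F t in at_top. f t < y" using anti by (intro eventually_at_top_linorderI[of s]) (meson le_less_trans)
  qed
  then have "((\<lambda>t. d x (\<alpha> t) - t) \<longlongrightarrow> l) at_top"
    by (rule Lim_transform_eventually) (auto simp: f_def intro: eventually_at_top_linorderI[of 0])
  then show ?thesis unfolding horo_def using tendsto_Lim[OF trivial_limit_at_top_linorder] by blast
qed

lemma horo_le: "x \<in> X \<Longrightarrow> 0 \<le> t \<Longrightarrow> horo \<alpha> x \<le> d x (\<alpha> t) - t"
  by (rule tendsto_upperbound[OF horo_tendsto _ trivial_limit_at_top_linorder])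
    (auto intro!: eventually_at_top_linorderI[of t] dist_ray_antimono)

lemma horo_lipschitz:
  assumes "x \<in> X" "y \<in> X"
  shows "horo \<alpha> x - horo \<alpha> y \<le> d x y"
proof (rule tendsto_upperbound[OF tendsto_diff[OF horo_tendsto[OF assms(1)] horo_tendsto[OF assms(2)]] _ trivial_limit_at_top_linorder])
  show "\<forall>\<^sub>F t in at_top. d x (\<alpha> t) - t - (d y (\<alpha> t) - t) \<le> d x y"
    using triangle[OF assms ray_in] by (intro eventually_at_top_linorderI[of 0]) (simp add: algebra_simps)
qed

lemma horo_ray:
  assumes s: "0 \<le> s"
  shows "horo \<alpha> (\<alpha> s) = - s"
proof (rule tendsto_unique[OF trivial_limit_at_top_linorder horo_tendsto[OF ray_in[OF s]]])
  show "((\<lambda>t. d (\<alpha> s) (\<alpha> t) - t) \<longlongrightarrow> - s) at_top"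
    using ray_dist s by (intro tendsto_eventually eventually_at_top_linorderI[of s]) simp
qed

lemma busemann_eq_horo:
  assumes "x \<in> X" "y \<in> X"
  shows "busemann d \<alpha> x y = horo \<alpha> x - horo \<alpha> y"
proof -
  have "((\<lambda>t. (d x (\<alpha> t) - t) - (d y (\<alpha> t) - t)) \<longlongrightarrow> horo \<alpha> x - horo \<alpha> y) at_top" by (intro tendsto_diff horo_tendsto assms)
  then have "((\<lambda>t. d x (\<alpha> t) - d (\<alpha> t) y) \<longlongrightarrow> horo \<alpha> x - horo \<alpha> y) at_top" by (rule Lim_transform_eventually)
      (auto intro!: eventually_at_top_linorderI[of 0] simp: sym[OF assms(2) ray_in])
  then show ?thesis unfolding busemann_def by (rule tendsto_Lim[OF trivial_limit_at_top_linorder])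
qed

end

text \<open>Along a minimizing segment to \<open>\<beta> (\<tau> n)\<close> the distance to that
  point drops at unit speed. Replacing the segment by \<open>\<alpha>\<close> costs \<open>e\<close>
  at the origin and \<open>e\<close> at time \<open>t\<close>, and \<open>horo \<beta>\<close> is
  the limit of these distances; the Lipschitz bound supplies the other inequality.\<close>

lemma coray_calibrated:
  assumes cor: "coray X d \<alpha> \<beta>" and \<beta>: "ray X d \<beta>"
  shows "calibrated \<alpha> \<beta>" unfolding calibrated_def
proof (intro allI impI)
  fix t :: real assume t: "0 \<le> t"
  have hg: "half_geodesic X d \<alpha>" using cor unfolding coray_def by blast
  have X: "\<alpha> t \<in> X" if "0 \<le> t" for t using hg that unfolding half_geodesic_def by blast
  obtain \<sigma> l a \<tau> where \<sigma>0: "\<forall>n :: nat. 0 \<le> \<tau> n \<and> minimizing_segment X d (\<sigma> n) (l n) (a n) (\<beta> (\<tau> n))"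
    and a: "(\<lambda>n. d (a n) (\<alpha> 0)) \<longlonglongrightarrow> 0" and \<tau>: "filterlim \<tau> at_top sequentially"
    and conv0: "\<forall>T\<ge>0. \<forall>e>0. \<forall>\<^sub>F n in sequentially. T \<le> l n \<and> (\<forall>s\<in>{0..T}. d (\<sigma> n s) (\<alpha> s) < e)"
    using cor unfolding coray_def by blast
  note \<sigma> = conjunct1[OF \<sigma>0[rule_format]] conjunct2[OF \<sigma>0[rule_format]] and conv = conv0[rule_format]
  have lim: "(\<lambda>n. (d x (\<beta> (\<tau> n)) - \<tau> n)) \<longlonglongrightarrow> horo \<beta> x" if "x \<in> X" for x using filterlim_compose[OF horo_tendsto[OF \<beta> that] \<tau>] .
  have "t - 2 * e \<le> horo \<beta> (\<alpha> 0) - horo \<beta> (\<alpha> t)" if e: "0 < e" for e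
  proof (rule tendsto_lowerbound[OF tendsto_diff[OF lim[OF X[of 0]] lim[OF X[OF t]]]])
    have "\<forall>\<^sub>F n in sequentially. d (a n) (\<alpha> 0) < e" using order_tendstoD(2)[OF a e] .
    then show "\<forall>\<^sub>F n in sequentially. t - 2 * e \<le> d (\<alpha> 0) (\<beta> (\<tau> n)) - \<tau> n - (d (\<alpha> t) (\<beta> (\<tau> n)) - \<tau> n)" using conv[OF t e]
    proof eventually_elim
      case (elim n)
      have ms: "\<sigma> n 0 = a n" "\<sigma> n (l n) = \<beta> (\<tau> n)" "\<And>s. s \<in> {0..l n} \<Longrightarrow> \<sigma> n s \<in> X"
        "\<And>r s. r \<in> {0..l n} \<Longrightarrow> s \<in> {0..l n} \<Longrightarrow> d (\<sigma> n r) (\<sigma> n s) = \<bar>r - s\<bar>"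
        using \<sigma>(2)[of n] unfolding minimizing_segment_def by auto
      have l: "0 \<in> {0..l n}" "t \<in> {0..l n}" "l n \<in> {0..l n}" using elim t by auto
      have mem: "a n \<in> X" "\<sigma> n t \<in> X" "\<beta> (\<tau> n) \<in> X" using ms(3)[OF l(1)] ms(3)[OF l(2)] ms(1) ray_in[OF \<beta> \<sigma>(1)] by auto
      have "d (a n) (\<beta> (\<tau> n)) = \<bar>0 - l n\<bar>" "d (\<sigma> n t) (\<beta> (\<tau> n)) = \<bar>t - l n\<bar>"
        using ms(4)[OF l(1,3)] ms(4)[OF l(2,3)] ms(1,2) by auto
      moreover have "d (\<sigma> n t) (\<alpha> t) < e" using elim t by simp
      ultimately show ?case using triangle[OF mem(1) X[of 0] mem(3)] triangle[OF X[OF t] mem(2,3)] sym[OF mem(2) X[OF t]] elim t by auto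
    qed
  qed auto
  from this[of "e / 2" for e] have "t \<le> horo \<beta> (\<alpha> 0) - horo \<beta> (\<alpha> t) + e" if "0 < e" for e using that by (simp add: algebra_simps)
  then have "t \<le> horo \<beta> (\<alpha> 0) - horo \<beta> (\<alpha> t)" by (rule field_le_epsilon)
  moreover have "horo \<beta> (\<alpha> 0) - horo \<beta> (\<alpha> t) \<le> t"
    using horo_lipschitz[OF \<beta> X[of 0] X[OF t]] half_geodesic_dist_le[OF hg, of 0 t] t by simp
  ultimately show "horo \<beta> (\<alpha> 0) - horo \<beta> (\<alpha> t) = t" by simp
qed

text \<open>The function \<open>horo \<beta>\<close> is 1-Lipschitz and equals
  \<open>horo \<beta> (\<alpha> 0) - t\<close> at \<open>\<alpha> t\<close>; letting
  \<open>t\<close> tend to infinity in the resulting bound at \<open>x\<close> produces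
  \<open>horo \<alpha> x\<close>.\<close>

lemma calibrated_horo_le:
  assumes \<alpha>: "ray X d \<alpha>" and \<beta>: "ray X d \<beta>" and step: "calibrated \<alpha> \<beta>" and x: "x \<in> X"
  shows "horo \<beta> x - horo \<beta> (\<alpha> 0) \<le> horo \<alpha> x"
proof (rule tendsto_lowerbound[OF horo_tendsto[OF \<alpha> x]])
  have "horo \<beta> x - horo \<beta> (\<alpha> 0) \<le> d x (\<alpha> t) - t" if "0 \<le> t" for t
    using horo_lipschitz[OF \<beta> x ray_in[OF \<alpha> that]] step that unfolding calibrated_def by fastforce
  then show "\<forall>\<^sub>F t in at_top. horo \<beta> x - horo \<beta> (\<alpha> 0) \<le> d x (\<alpha> t) - t" by (rule eventually_at_top_linorderI)
qed auto

text \<open>If each ray is calibrated for the other, \<open>calibrated_horo_le\<close> encloses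
  \<open>horo \<alpha> - horo \<beta>\<close> between the constants
  \<open>- horo \<beta> (\<alpha> 0)\<close> and \<open>horo \<alpha> (\<beta> 0)\<close>. The
  condition on the origins says that these constants agree.\<close>

lemma busemann_eq_iff:
  assumes \<alpha>: "ray X d \<alpha>" and \<beta>: "ray X d \<beta>"
  shows "(\<forall>x\<in>X. \<forall>y\<in>X. busemann d \<alpha> x y = busemann d \<beta> x y) \<longleftrightarrow>
    calibrated \<alpha> \<beta> \<and> calibrated \<beta> \<alpha> \<and> busemann d \<alpha> (\<alpha> 0) (\<beta> 0) = busemann d \<beta> (\<alpha> 0) (\<beta> 0)"
proof -
  have B: "busemann d \<alpha> x y = horo \<alpha> x - horo \<alpha> y" "busemann d \<beta> x y = horo \<beta> x - horo \<beta> y" if "x \<in> X" "y \<in> X" for x y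
    using busemann_eq_horo[OF \<alpha> that] busemann_eq_horo[OF \<beta> that] by auto
  have X: "0 \<le> t \<Longrightarrow> \<alpha> t \<in> X" "0 \<le> t \<Longrightarrow> \<beta> t \<in> X" for t using ray_in[OF \<alpha>] ray_in[OF \<beta>] by auto
  show ?thesis
  proof
    assume e: "\<forall>x\<in>X. \<forall>y\<in>X. busemann d \<alpha> x y = busemann d \<beta> x y"
    have *: "horo \<alpha> x - horo \<alpha> y = horo \<beta> x - horo \<beta> y" if "x \<in> X" "y \<in> X" for x y using e B that by metis
    have "calibrated \<alpha> \<beta>" "calibrated \<beta> \<alpha>"
      unfolding calibrated_def using *[OF X(1)[of 0] X(1)] *[OF X(2)[of 0] X(2)] horo_ray[OF \<alpha>] horo_ray[OF \<beta>] by simp_all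
    then show "calibrated \<alpha> \<beta> \<and> calibrated \<beta> \<alpha> \<and> busemann d \<alpha> (\<alpha> 0) (\<beta> 0) = busemann d \<beta> (\<alpha> 0) (\<beta> 0)" using e X by simp
  next
    assume r: "calibrated \<alpha> \<beta> \<and> calibrated \<beta> \<alpha> \<and> busemann d \<alpha> (\<alpha> 0) (\<beta> 0) = busemann d \<beta> (\<alpha> 0) (\<beta> 0)"
    have eq: "horo \<alpha> x = horo \<beta> x - horo \<beta> (\<alpha> 0)" if "x \<in> X" for x
      using calibrated_horo_le[OF \<alpha> \<beta> _ that] calibrated_horo_le[OF \<beta> \<alpha> _ that] r B[OF X(1)[of 0] X(2)[of 0]]
        horo_ray[OF \<alpha>, of 0] horo_ray[OF \<beta>, of 0] by simp
    show "\<forall>x\<in>X. \<forall>y\<in>X. busemann d \<alpha> x y = busemann d \<beta> x y" using B eq by simp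
  qed
qed

end

section \<open>Rays in complete CAT(0) spaces\<close>

interpretation dist_metric: pseudo_metric "UNIV :: 'a::metric_space set" dist
  by standard (auto simp: dist_commute dist_triangle)

definition asymptotic :: "(real \<Rightarrow> 'a::metric_space) \<Rightarrow> (real \<Rightarrow> 'a) \<Rightarrow> bool" where
  "asymptotic \<gamma> \<gamma>' \<longleftrightarrow> (\<exists>C. \<forall>t\<ge>0. dist (\<gamma> t) (\<gamma>' t) \<le> C)"

lemma asymptoticI: "(\<And>t. 0 \<le> t \<Longrightarrow> dist (q t) (q' t) \<le> C) \<Longrightarrow> asymptotic q q'" unfolding asymptotic_def by blast

lemma asymptotic_sym: "asymptotic q q' \<Longrightarrow> asymptotic q' q" unfolding asymptotic_def by (simp add: dist_commute)

lemma asymptotic_trans: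
  assumes "asymptotic q q'" "asymptotic q' q''"
  shows "asymptotic q q''"
proof -
  obtain C C' where C: "\<forall>t\<ge>0. dist (q t) (q' t) \<le> C" "\<forall>t\<ge>0. dist (q' t) (q'' t) \<le> C'"
    using assms unfolding asymptotic_def by (elim exE)
  show ?thesis
  proof (rule asymptoticI)
    show "dist (q t) (q'' t) \<le> C + C'" if "0 \<le> t" for t
      using C[rule_format, OF that] dist_triangle[of "q t" "q'' t" "q' t"] by linarith
  qed
qed

lemma mem_point_at_infinity: "q' \<in> point_at_infinity q \<longleftrightarrow> ray UNIV dist q' \<and> asymptotic q q'"
  unfolding point_at_infinity_def asymptotic_def by simp

lemma point_at_infinity_eq: "asymptotic q q' \<Longrightarrow> point_at_infinity q = point_at_infinity q'"
  unfolding set_eq_iff mem_point_at_infinity by (metis asymptotic_sym asymptotic_trans)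

text \<open>Nonbranching is independent of the curvature condition: trees satisfy the inequality of
  Bruhat and Tits, and their geodesics branch.\<close>

locale cat0_space =
  fixes X :: "'a::metric_space itself"
  assumes proper: "\<And>(x :: 'a) r. compact (cball x r)" and geodesic: "geodesic_space TYPE('a)"
    and cn: "cn_on (UNIV :: 'a set)" and local_nonbranching: "\<And>x :: 'a. \<exists>\<sigma>>0. nonbranching_on (ball x \<sigma>)"
begin

definition seg :: "'a \<Rightarrow> 'a \<Rightarrow> real \<Rightarrow> 'a" where
  "seg x y = (SOME c. c 0 = x \<and> c (dist x y) = y \<and> (\<forall>s\<in>{0..dist x y}. \<forall>t\<in>{0..dist x y}. dist (c s) (c t) = \<bar>s - t\<bar>))"

lemma seg: "seg x y 0 = x" "seg x y (dist x y) = y"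
    "s \<in> {0..dist x y} \<Longrightarrow> t \<in> {0..dist x y} \<Longrightarrow> dist (seg x y s) (seg x y t) = \<bar>s - t\<bar>"
proof -
  have "\<exists>c. c 0 = x \<and> c (dist x y) = y \<and> (\<forall>s\<in>{0..dist x y}. \<forall>t\<in>{0..dist x y}. dist (c s) (c t) = \<bar>s - t\<bar>)"
    using geodesic unfolding geodesic_space_def by blast
  from someI_ex[OF this] show "seg x y 0 = x" "seg x y (dist x y) = y"
    "s \<in> {0..dist x y} \<Longrightarrow> t \<in> {0..dist x y} \<Longrightarrow> dist (seg x y s) (seg x y t) = \<bar>s - t\<bar>" unfolding seg_def by blast+
qed

lemma seg_dist: "0 \<le> t \<Longrightarrow> t \<le> dist x y \<Longrightarrow> dist x (seg x y t) = t" "0 \<le> t \<Longrightarrow> t \<le> dist x y \<Longrightarrow> dist (seg x y t) y = dist x y - t"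
  using seg(3)[of 0 x y t] seg(3)[of t x y "dist x y"] seg(1,2)[of x y] by auto

text \<open>The segments from \<open>q\<close> to \<open>y\<close> and to \<open>y'\<close> agree up
  to a last time \<open>T\<close>. A point \<open>p'\<close> slightly before the place reached then,
  and points slightly after it, lie in a small ball, and \<open>p'\<close> inherits the equalities
  of distances from \<open>p\<close>; local nonbranching extends the agreement past
  \<open>T\<close>.\<close>

lemma nonbranching:
  assumes pq: "(p :: 'a) \<noteq> q" and y: "dist p y = dist p q + dist q y" "dist p y' = dist p q + dist q y'" "dist q y = dist q y'"
  shows "y = y'"
proof (rule ccontr)
  assume ne: "y \<noteq> y'"
  define D where "D = dist q y"
  define S where "S = {t \<in> {0..D}. dist (seg q y t) (seg q y' t) = 0}"
  have D': "dist q y' = D" unfolding D_def using y by simp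
  have cont: "continuous_on {0..D} (seg q y)" "continuous_on {0..D} (seg q y')"
    by (rule lgeo_continuous[OF lgeo_of_isometric[of 1]], use seg(3)[of _ q y] seg(3)[of _ q y'] D' in \<open>auto simp: D_def\<close>)+
  have "closed S" unfolding S_def
    using continuous_closed_preimage_constant[of "{0..D}" "\<lambda>t. dist (seg q y t) (seg q y' t)" 0] cont
    by (auto intro: continuous_intros)
  moreover have "bounded S" by (rule bounded_subset[of "{0..D}"]) (auto simp: S_def)
  ultimately have "compact S" by (simp add: compact_eq_bounded_closed)
  moreover have "0 \<in> S" unfolding S_def using seg(1) by (auto simp: D_def)
  ultimately obtain T where T: "T \<in> S" "\<And>t. t \<in> S \<Longrightarrow> t \<le> T" using compact_attains_sup[of S] by blast
  have T0: "0 \<le> T" "T \<le> D" "seg q y T = seg q y' T" using T(1) unfolding S_def by auto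
  have "T \<noteq> D" using T0(3) seg(2)[of q y] seg(2)[of q y'] D' ne unfolding D_def by auto
  then have TD: "T < D" using T0 by simp
  define m where "m = seg q y T"
  obtain r where r: "0 < r" "nonbranching_on (ball m r)" using local_nonbranching by blast
  define h where "h = min (r / 2) (dist p q)"
  define e where "e = min (r / 2) (D - T)"
  have h: "0 < h" "h \<le> r / 2" "h \<le> dist p q" unfolding h_def using r(1) pq by auto
  have e: "0 < e" "e \<le> r / 2" "e \<le> D - T" unfolding e_def using r(1) TD by (simp, linarith, linarith)
  have m: "dist q m = T" unfolding m_def using seg_dist(1)[of T q y] T0 unfolding D_def by simp
  have along: "dist p (seg q w t) = dist p q + t"
    if "dist p w = dist p q + D" "dist q w = D" "0 \<le> t" "t \<le> D" for w t
    using seg_dist[of t q w] that dist_triangle[of p "seg q w t" q] dist_triangle[of p w "seg q w t"] by simp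
  have py: "dist p y = dist p q + D" "dist p y' = dist p q + D" using y unfolding D_def by auto
  have pm: "dist p m = dist p q + T" unfolding m_def using along[OF py(1) _ T0(1,2)] D_def by simp
  define p' where "p' = seg p m (dist p m - h)"
  have p': "dist p p' = dist p m - h" "dist p' m = h" unfolding p'_def using seg_dist[of "dist p m - h" p m] h pm T0 by auto
  have ext: "dist m (seg q w (T + e)) = e \<and> dist p' (seg q w (T + e)) = h + e"
    if w: "dist p w = dist p q + D" "dist q w = D" and mw: "seg q w T = m" for w
  proof -
    have 1: "dist m (seg q w (T + e)) = e" using seg(3)[of T q w "T + e"] mw w(2) T0 e by simp
    have "dist p (seg q w (T + e)) = dist p q + (T + e)" using along[OF w] T0 e by simp
    then have "dist p' (seg q w (T + e)) = h + e"
      using dist_triangle[of p "seg q w (T + e)" p'] dist_triangle[of p' "seg q w (T + e)" m] p' pm 1 by simp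
    then show ?thesis using 1 by blast
  qed
  note e1 = ext[OF py(1) D_def[symmetric] m_def[symmetric]] and e2 = ext[OF py(2) D' T0(3)[symmetric, folded m_def]]
  have "p' \<in> ball m r" "m \<in> ball m r" "seg q y (T + e) \<in> ball m r" "seg q y' (T + e) \<in> ball m r" "p' \<noteq> m"
    using p' h e r e1 e2 by (auto simp: dist_commute)
  then have "seg q y (T + e) = seg q y' (T + e)" using r(2) e1 e2 p' unfolding nonbranching_on_def by metis
  then have "T + e \<in> S" unfolding S_def using T0 e by auto
  then show False using T(2) e(1) by fastforce
qed

text \<open>In a Euclidean triangle both sides are equal, by the law of cosines: the bracket is
  twice the product of the sides times \<open>1 - cos\<close> of the angle at \<open>o'\<close>.
  Hence this is monotonicity of comparison angles, written without angles or quotients.\<close>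

lemma fan:
  assumes r: "0 \<le> r" "r \<le> dist o' z" "r \<le> dist o' z'" "0 < dist o' z" "0 < dist o' z'"
    and p: "dist o' p = r" "dist p z = dist o' z - r" and p': "dist (o' :: 'a) p' = r" "dist p' z' = dist o' z' - r"
  shows "(dist p p')^2 * (dist o' z * dist o' z') \<le> r^2 * ((dist z z')^2 - (dist o' z - dist o' z')^2)"
proof -
  define D D' N where "D = dist o' z" and "D' = dist o' z'" and "N = dist z z'"
  have D: "0 < D" "0 < D'" using r unfolding D_def D'_def by auto
  define l l' where "l = r / D" and "l' = r / D'"
  have l: "0 \<le> l" "l \<le> 1" "0 \<le> l'" "l' \<le> 1" "r = l * D" "r = l' * D'"
    unfolding l_def l'_def using r D unfolding D_def D'_def by auto
  have "(dist p p')^2 \<le> l * l' * N^2 + l * (l - l') * D^2 + l' * (l' - l) * D'^2" unfolding D_def D'_def N_def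
  proof (rule cn_on_two_sides[OF cn _ _ _ _ l(1-4)])
    show "dist o' p = l * dist o' z" "dist p z = (1 - l) * dist o' z" using p l(5) unfolding D_def by (auto simp: algebra_simps)
    show "dist o' p' = l' * dist o' z'" "dist p' z' = (1 - l') * dist o' z'" using p' l(6) unfolding D'_def by (auto simp: algebra_simps)
  qed auto
  then have "(dist p p')^2 * (D * D') \<le> (l * l' * N^2 + l * (l - l') * D^2 + l' * (l' - l) * D'^2) * (D * D')"
    using D by (intro mult_right_mono) auto
  also have "\<dots> = (l * D) * (l' * D') * N^2 + (l * D) * ((l * D) * D' - (l' * D') * D) * D + (l' * D') * ((l' * D') * D - (l * D) * D') * D'"
    by (simp add: power2_eq_square algebra_simps)
  also have "\<dots> = r^2 * (N^2 - (D - D')^2)" unfolding l(5)[symmetric] l(6)[symmetric] by (simp add: power2_eq_square algebra_simps)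
  finally show ?thesis unfolding D_def D'_def N_def .
qed

text \<open>Together with the triangle inequality: replacing the target \<open>z\<close> by the
  point \<open>p\<close> at distance \<open>r\<close> on \<open>[y, z]\<close> changes the
  difference of the distances from \<open>x\<close> and \<open>y\<close> by at most
  \<open>a^2 / r\<close>, whatever \<open>z\<close> is. This is the rate at which such differences
  approach a Busemann function.\<close>

lemma excess_bound:
  assumes p: "dist (y :: 'a) p = r" "dist p z = dist y z - r" and a: "dist x y \<le> a" "2 * a \<le> r" "0 < r" "r \<le> dist y z"
  shows "dist x p \<le> dist x z - (dist y z - r) + a^2 / r"
proof -
  define D m u where "D = dist y z" and "m = dist x z" and "u = m - (D - r)"
  have D: "0 < D" "r \<le> D" using a unfolding D_def by auto
  define l where "l = r / D"
  have l: "0 \<le> l" "l \<le> 1" "r = l * D" unfolding l_def using D a by auto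
  have a0: "0 \<le> a" using a(1) zero_le_dist[of x y] by linarith
  have "D \<le> a + m" using dist_triangle[of y z x] a(1) unfolding D_def m_def by (simp add: dist_commute)
  then have u: "r / 2 \<le> u" unfolding u_def using a(2) by simp
  have "(dist x p)^2 \<le> (1 - l) * (dist x y)^2 + l * m^2 - l * (1 - l) * D^2" unfolding D_def m_def
    by (rule cn_onD[OF cn _ _ _ l(1,2)]) (use p l(3) in \<open>auto simp: D_def algebra_simps\<close>)
  also have "\<dots> \<le> a^2 + (l * m^2 - l * (1 - l) * D^2)"
  proof -
    have "(1 - l) * (dist x y)^2 \<le> 1 * a^2" using l a by (intro mult_mono power_mono) auto
    then show ?thesis by simp
  qed
  \<comment> \<open>Written with \<open>u = m - (D - r)\<close> and \<open>r = l * D\<close>, the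
    weighted terms are at most \<open>u^2\<close>, because \<open>2 * u * r - r^2\<close> is at most
    \<open>u^2\<close>.\<close>
  also have "l * m^2 - l * (1 - l) * D^2 = l * u^2 + (1 - l) * (2 * u * (l * D) - (l * D)^2)"
  proof -
    have "m = u + (D - l * D)" unfolding u_def l(3)[symmetric] by simp
    then show ?thesis by (simp only:) (simp add: power2_eq_square algebra_simps)
  qed
  also have "\<dots> \<le> l * u^2 + (1 - l) * u^2"
  proof -
    have "0 \<le> (u - l * D)^2" by simp
    then have "2 * u * (l * D) - (l * D)^2 \<le> u^2" unfolding power2_diff by linarith
    then show ?thesis using l by (intro add_left_mono mult_left_mono) auto
  qed
  also have "l * u^2 + (1 - l) * u^2 = u^2" by (simp add: algebra_simps)
  also have "a^2 + u^2 \<le> (u + a^2 / r)^2"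
  proof -
    have "a^2 = 2 * (r / 2) * (a^2 / r)" using a(3) by simp
    also have "\<dots> \<le> 2 * u * (a^2 / r)" using u a(3) by (intro mult_right_mono) auto
    finally have "a^2 \<le> 2 * u * (a^2 / r)" .
    moreover have "0 \<le> (a^2 / r)^2" by simp
    ultimately show ?thesis unfolding power2_sum by linarith
  qed
  finally have "(dist x p)^2 \<le> (u + a^2 / r)^2" by simp
  then have "dist x p \<le> u + a^2 / r" by (rule power2_le_imp_le) (use u a in auto)
  then show ?thesis unfolding u_def m_def D_def .
qed


subsection \<open>Asymptotic rays\<close>

lemma ray_unit_speed: "ray UNIV dist q \<Longrightarrow> 0 \<le> s \<Longrightarrow> 0 \<le> t \<Longrightarrow> dist (q s) (q t) = \<bar>s - t\<bar>" by (rule dist_metric.ray_dist)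

text \<open>A bounded convex function on a half-line does not increase. With \<open>T\<close> beyond
  \<open>t * C / e\<close>, the bound \<open>C\<close> at time \<open>T\<close> contributes at most
  \<open>e\<close> at time \<open>t\<close>.\<close>

lemma asymptotic_dist_le:
  assumes q: "ray UNIV dist q" "ray UNIV dist q'" and C: "\<And>t. 0 \<le> t \<Longrightarrow> dist (q t) (q' t) \<le> C" and t: "0 \<le> t"
  shows "dist (q t :: 'a) (q' t) \<le> dist (q 0) (q' 0)"
proof (rule field_le_epsilon)
  fix e :: real assume e: "0 < e"
  have C0: "0 \<le> C" using C[of 0] zero_le_dist[of "q 0" "q' 0"] by linarith
  define T where "T = t + t * C / e + 1"
  have "0 \<le> t * C / e" using t C0 e by simp
  then have T: "0 < T" "t \<le> T" "t * C / e \<le> T" unfolding T_def using t by linarith+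
  define l where "l = t / T"
  have l: "0 \<le> l" "l \<le> 1" "t = l * T" unfolding l_def using T t by auto
  have sp: "dist (q 0) (q t) = l * dist (q 0) (q T)" "dist (q t) (q T) = (1 - l) * dist (q 0) (q T)"
    if "ray UNIV dist q" for q :: "real \<Rightarrow> 'a" using ray_unit_speed[OF that] t T l(3) by (auto simp: algebra_simps)
  have "dist (q t) (q' t) \<le> (1 - l) * dist (q 0) (q' 0) + l * dist (q T) (q' T)"
    by (rule cn_on_convex_dist[OF geodesic cn _ _ _ _ _ _ l(1,2)]) (use sp q in auto)
  also have "\<dots> \<le> 1 * dist (q 0) (q' 0) + l * C" using l C[of T] T by (intro add_mono mult_right_mono mult_left_mono) auto
  also have "l * C \<le> e"
  proof -
    have "t * C \<le> T * e" using T(3) e by (simp add: field_simps)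
    then show ?thesis unfolding l_def using T(1) by (simp add: field_simps)
  qed
  finally show "dist (q t) (q' t) \<le> dist (q 0) (q' 0) + e" by simp
qed

lemma asymptotic_unique:
  assumes "ray UNIV dist q" "ray UNIV dist q'" "asymptotic q q'" "q 0 = q' 0" "0 \<le> t"
  shows "q t = (q' t :: 'a)"
proof -
  obtain C where C: "\<And>t. 0 \<le> t \<Longrightarrow> dist (q t) (q' t) \<le> C" using assms(3) unfolding asymptotic_def by blast
  show ?thesis using asymptotic_dist_le[OF assms(1,2) C assms(5)] assms(4) by simp
qed

lemma dist_to_ray: "ray UNIV dist q \<Longrightarrow> 0 \<le> r \<Longrightarrow> \<bar>dist (y :: 'a) (q r) - r\<bar> \<le> dist (q 0) y"
  using ray_unit_speed[of q 0 r] dist_triangle[of y "q r" "q 0"] dist_triangle[of "q 0" "q r" y] by (simp add: dist_commute)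

text \<open>By \<open>fan\<close> the distance is governed by the defect
  \<open>(m - r)^2 - (D - D')^2\<close> of the triangle with vertices \<open>y\<close>,
  \<open>w r\<close>, \<open>w m\<close>, a product of a factor at most \<open>2 * a\<close> and one
  at most \<open>2 * m\<close>. The bound is independent of \<open>m\<close>, so the segments are a
  Cauchy family with a rate.\<close>

lemma seg_to_ray_close:
  assumes w: "ray UNIV dist w" and r: "2 * dist (w 0) y < r" "r \<le> m" and T: "0 \<le> T" "T \<le> r - dist (w 0) y"
  shows "(dist (seg y (w r) T) (seg y (w m) T :: 'a))^2 * (r - dist (w 0) y) \<le> 8 * dist (w 0) y * T^2"
proof -
  define a where "a = dist (w 0) y"
  define D D' q where "D = dist y (w r)" and "D' = dist y (w m)" and "q = (dist (seg y (w r) T) (seg y (w m) T))^2"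
  have a0: "0 \<le> a" "2 * a < r" "r \<le> m" "T \<le> r - a" unfolding a_def using r T by auto
  have D: "r - a \<le> D" "D \<le> r + a" "m - a \<le> D'" "D' \<le> m + a"
    using dist_to_ray[OF w, of r y] dist_to_ray[OF w, of m y] a0 unfolding D_def D'_def a_def by (auto simp: abs_le_iff)
  have N: "dist (w r) (w m) = m - r" using ray_unit_speed[OF w, of r m] a0 by simp
  have \<Delta>: "\<bar>D' - D\<bar> \<le> m - r" unfolding D_def D'_def N[symmetric]
    using dist_triangle[of y "w m" "w r"] dist_triangle[of y "w r" "w m"] by (simp add: dist_commute abs_le_iff)
  have "q * (D * D') \<le> T^2 * ((m - r)^2 - (D - D')^2)" unfolding D_def D'_def q_def N[symmetric]
    by (rule fan) (use seg_dist[of T y "w r"] seg_dist[of T y "w m"] D a0 T(1) in \<open>auto simp: D_def D'_def\<close>)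
  also have "(m - r)^2 - (D - D')^2 = ((m - r) - (D' - D)) * ((m - r) + (D' - D))" by (simp add: power2_eq_square algebra_simps)
  also have "\<dots> \<le> (2 * a) * (2 * m)" using D a0 \<Delta> by (intro mult_mono) (auto simp: abs_le_iff)
  also have "\<dots> \<le> (2 * a) * (4 * (m - a))" using a0 by (intro mult_left_mono) auto
  finally have 1: "q * (D * D') \<le> T^2 * ((2 * a) * (4 * (m - a)))" by (simp add: mult_left_mono)
  have "q * ((r - a) * (m - a)) \<le> q * (D * D')" using D a0 unfolding q_def by (intro mult_left_mono mult_mono) auto
  with 1 have "(q * (r - a)) * (m - a) \<le> (8 * a * T^2) * (m - a)" by (simp add: algebra_simps)
  then show ?thesis unfolding q_def a_def[symmetric] using a0 by simp
qed

text \<open>The ray from \<open>y\<close> is the limit of the segments to distant points of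
  \<open>q\<close>. The rate of \<open>seg_to_ray_close\<close> survives in the limit and is kept in
  the conclusion, for changes of base point depend on it.\<close>

lemma seg_tendsto_ray:
  assumes q: "ray UNIV dist q"
  obtains c where "ray UNIV dist c" "c 0 = (y :: 'a)" "\<And>t. 0 \<le> t \<Longrightarrow> dist (q t) (c t) \<le> 2 * dist (q 0) y"
    "\<And>T r. 0 \<le> T \<Longrightarrow> 2 * dist (q 0) y < r \<Longrightarrow> T \<le> r - dist (q 0) y \<Longrightarrow>
      (dist (seg y (q r) T) (c T))^2 * (r - dist (q 0) y) \<le> 8 * dist (q 0) y * T^2"
proof -
  define a where "a = dist (q 0) y"
  have a0: "0 \<le> a" unfolding a_def by simp
  note close = seg_to_ray_close[OF q, of y, folded a_def]
  have "\<exists>z. (\<lambda>n. seg y (q (real n)) T) \<longlonglongrightarrow> z" if T: "0 \<le> T" for T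
  proof -
    obtain k where k: "2 * a + T < real k" using reals_Archimedean2 by blast
    define f where "f n = seg y (q (real (n + k))) T" for n
    have Dn: "T \<le> dist y (q (real (n + k)))" for n
      using dist_to_ray[OF q, of "real (n + k)" y] k a0 unfolding a_def[symmetric] by (simp add: abs_le_iff)
    have fb: "f n \<in> cball y T" for n unfolding f_def using seg_dist(1)[OF T Dn] by simp
    have "Cauchy f"
    proof (rule metric_CauchyI)
      fix e :: real assume e: "0 < e"
      obtain M where M: "8 * a * T^2 / e^2 + a < real M" using reals_Archimedean2 by blast
      have le: "dist (f m) (f n) < e" if "M \<le> m" "m \<le> n" for m n
      proof -
        have "(dist (f m) (f n))^2 * (real (m + k) - a) \<le> 8 * a * T^2"
          unfolding f_def by (rule close) (use that k T a0 in auto)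
        also have "\<dots> = e^2 * (8 * a * T^2 / e^2)" using e by simp
        also have "\<dots> < e^2 * (real (m + k) - a)" using M that e k by (intro mult_strict_left_mono) auto
        finally have "(dist (f m) (f n))^2 < e^2" using k a0 T by (simp add: mult_less_cancel_right)
        then show ?thesis using e by (simp add: power_less_imp_less_base)
      qed
      show "\<exists>M. \<forall>m\<ge>M. \<forall>n\<ge>M. dist (f m) (f n) < e" using le by (metis dist_commute nat_le_linear)
    qed
    then obtain z where "f \<longlonglongrightarrow> z" using compact_imp_complete[OF proper[of y T]] fb unfolding complete_def by blast
    then have "(\<lambda>n. seg y (q (real n)) T) \<longlonglongrightarrow> z" unfolding f_def by (rule LIMSEQ_offset)
    then show ?thesis ..
  qed
  then obtain c where c: "\<And>T. 0 \<le> T \<Longrightarrow> (\<lambda>n. seg y (q (real n)) T) \<longlonglongrightarrow> c T" by metis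
  have ev: "\<forall>\<^sub>F n in sequentially. R \<le> real n" for R using filterlim_real_sequentially unfolding filterlim_at_top by blast
  have big: "\<forall>\<^sub>F n in sequentially. R \<le> dist y (q (real n))" for R using ev[of "R + a"]
  proof eventually_elim
    case (elim n)
    then show ?case using dist_to_ray[OF q, of "real n" y] unfolding a_def[symmetric] by (simp add: abs_le_iff)
  qed
  have iso: "dist (c s) (c t) = \<bar>s - t\<bar>" if "0 \<le> s" "0 \<le> t" for s t
  proof (rule LIMSEQ_unique[OF tendsto_dist[OF c[OF that(1)] c[OF that(2)]]])
    show "(\<lambda>n. dist (seg y (q (real n)) s) (seg y (q (real n)) t)) \<longlonglongrightarrow> \<bar>s - t\<bar>"
      by (rule tendsto_eventually, use big[of s] big[of t] in eventually_elim) (use seg(3) that in auto)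
  qed
  have c0: "c 0 = y" using LIMSEQ_unique[OF c[of 0], of y] seg(1) by simp
  have near: "dist (q t) (c t) \<le> 2 * a" if t: "0 \<le> t" for t
  proof (rule tendsto_upperbound[OF tendsto_dist[OF tendsto_const c[OF t]]])
    show "\<forall>\<^sub>F n in sequentially. dist (q t) (seg y (q (real n)) t) \<le> 2 * a" using ev[of "t + 1"] big[of t]
    proof eventually_elim
      case (elim n)
      \<comment> \<open>Convexity compares points at proportional parameters, \<open>t\<close> on
        \<open>q\<close> and \<open>l * D\<close> on the segment; the shift from
        \<open>l * D\<close> to \<open>t\<close> costs another \<open>a\<close>.\<close>
      define D l where "D = dist y (q (real n))" and "l = t / real n"
      have l: "0 \<le> l" "l \<le> 1" "t = l * real n" unfolding l_def using elim t by auto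
      have D: "\<bar>D - real n\<bar> \<le> a" "0 \<le> D" using dist_to_ray[OF q, of "real n" y] unfolding D_def a_def by auto
      have lD: "0 \<le> l * D" "l * D \<le> D" using l D by (auto simp: mult_left_le_one_le)
      have "dist (q t) (seg y (q (real n)) (l * D)) \<le> (1 - l) * dist (q 0) y + l * dist (q (real n)) (q (real n))"
      proof (rule cn_on_convex_dist[OF geodesic cn _ _ _ _ _ _ l(1,2)])
        show "dist (q 0) (q t) = l * dist (q 0) (q (real n))" "dist (q t) (q (real n)) = (1 - l) * dist (q 0) (q (real n))"
          using ray_unit_speed[OF q] t elim l(3) by (auto simp: algebra_simps)
        show "dist y (seg y (q (real n)) (l * D)) = l * dist y (q (real n))"
          "dist (seg y (q (real n)) (l * D)) (q (real n)) = (1 - l) * dist y (q (real n))"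
          using seg_dist[of "l * D" y "q (real n)"] lD unfolding D_def by (auto simp: algebra_simps)
      qed auto
      also have "\<dots> \<le> a" using l unfolding a_def by (simp add: mult_left_le_one_le)
      finally have 1: "dist (q t) (seg y (q (real n)) (l * D)) \<le> a" .
      have "dist (seg y (q (real n)) (l * D)) (seg y (q (real n)) t) = \<bar>l * D - t\<bar>"
        by (rule seg(3)) (use lD elim t in \<open>auto simp: D_def\<close>)
      also have "\<dots> = l * \<bar>D - real n\<bar>" using l by (simp add: abs_mult right_diff_distrib[symmetric])
      also have "\<dots> \<le> 1 * a" using l D by (intro mult_mono) auto
      finally show ?case using 1 dist_triangle[of "q t" "seg y (q (real n)) t" "seg y (q (real n)) (l * D)"] by simp
    qed
  qed auto
  have lim: "(dist (seg y (q r) T) (c T))^2 * (r - a) \<le> 8 * a * T^2" if "0 \<le> T" "2 * a < r" "T \<le> r - a" for T r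
  proof (rule tendsto_upperbound[of "\<lambda>n. (dist (seg y (q r) T) (seg y (q (real n)) T))^2 * (r - a)"])
    show "(\<lambda>n. (dist (seg y (q r) T) (seg y (q (real n)) T))^2 * (r - a)) \<longlonglongrightarrow> (dist (seg y (q r) T) (c T))^2 * (r - a)"
      by (intro tendsto_intros c that)
    show "\<forall>\<^sub>F n in sequentially. (dist (seg y (q r) T) (seg y (q (real n)) T))^2 * (r - a) \<le> 8 * a * T^2"
      using ev[of r] by eventually_elim (rule close; use that in auto)
  qed auto
  have "ray UNIV dist c" unfolding dist_metric.ray_iff using iso by simp
  then show ?thesis by (rule that[OF _ c0 near[unfolded a_def] lim[unfolded a_def]])
qed

end

lemma tendsto_const_div_shift: "((\<lambda>r. k / (r - b)) \<longlongrightarrow> 0) at_top" for k b :: real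
proof -
  have "filterlim (\<lambda>r. - b + r) at_top at_top" by (rule filterlim_tendsto_add_at_top[OF tendsto_const filterlim_ident])
  from tendsto_divide_0[OF tendsto_const filterlim_at_top_imp_at_infinity[OF this]] show ?thesis by simp
qed

context cat0_space
begin

lemma seg_close_ray:
  assumes q: "ray UNIV dist q" and c: "ray UNIV dist c" "asymptotic q c"
    and r: "0 \<le> T" "2 * dist (q 0) (c 0) < r" "T \<le> r - dist (q 0) (c 0)"
  shows "(dist (seg (c 0) (q r) T) (c T :: 'a))^2 * (r - dist (q 0) (c 0)) \<le> 8 * dist (q 0) (c 0) * T^2"
proof -
  obtain c' where c': "ray UNIV dist c'" "c' 0 = c 0" "\<And>t. 0 \<le> t \<Longrightarrow> dist (q t) (c' t) \<le> 2 * dist (q 0) (c 0)"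
    "\<And>T r. 0 \<le> T \<Longrightarrow> 2 * dist (q 0) (c 0) < r \<Longrightarrow> T \<le> r - dist (q 0) (c 0) \<Longrightarrow>
      (dist (seg (c 0) (q r) T) (c' T))^2 * (r - dist (q 0) (c 0)) \<le> 8 * dist (q 0) (c 0) * T^2"
    using seg_tendsto_ray[OF q] by blast
  have "c' T = c T"
    by (rule asymptotic_unique[OF c'(1) c(1) asymptotic_trans[OF asymptotic_sym[OF asymptoticI[OF c'(3)]] c(2)] c'(2) r(1)])
  then show ?thesis using c'(4)[OF r] by simp
qed

lemma ray_to:
  assumes q: "ray UNIV dist q"
  shows "ray UNIV dist (ray_to y (point_at_infinity q))" "ray_to y (point_at_infinity q) 0 = (y :: 'a)"
    "asymptotic q (ray_to y (point_at_infinity q))"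
proof -
  obtain c where c: "ray UNIV dist c" "c 0 = y" "\<And>t. 0 \<le> t \<Longrightarrow> dist (q t) (c t) \<le> 2 * dist (q 0) y"
    using seg_tendsto_ray[OF q] by metis
  let ?P = "\<lambda>e. e \<in> point_at_infinity q \<and> e 0 = y \<and> e \<in> extensional {0..}"
  have "ray UNIV dist (restrict c {0..})" unfolding dist_metric.ray_iff using ray_unit_speed[OF c(1)] by simp
  moreover have "asymptotic q (restrict c {0..})" by (rule asymptoticI[of _ _ "2 * dist (q 0) y"]) (use c(3) in simp)
  ultimately have "restrict c {0..} \<in> point_at_infinity q" unfolding mem_point_at_infinity by blast
  then have ex: "?P (restrict c {0..})" using c(2) by simp
  have un: "e = e'" if e: "?P e" "?P e'" for e e'
  proof (rule extensionalityI)
    show "e \<in> extensional {0..}" "e' \<in> extensional {0..}" using e by auto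
    have r: "ray UNIV dist e" "ray UNIV dist e'" "asymptotic q e" "asymptotic q e'"
      using e unfolding mem_point_at_infinity by blast+
    show "e t = e' t" if "t \<in> {0..}" for t
      by (rule asymptotic_unique[OF r(1,2) asymptotic_trans[OF asymptotic_sym[OF r(3)] r(4)]]) (use e that in auto)
  qed
  have "?P (ray_to y (point_at_infinity q))" unfolding ray_to_def by (rule theI[of ?P, OF ex]) (rule un[OF _ ex])
  then show "ray UNIV dist (ray_to y (point_at_infinity q))" "ray_to y (point_at_infinity q) 0 = y"
    "asymptotic q (ray_to y (point_at_infinity q))" unfolding mem_point_at_infinity by blast+
qed

lemma ray_to_eq:
  assumes "ray UNIV dist c" "0 \<le> t"
  shows "ray_to (c 0 :: 'a) (point_at_infinity c) t = c t"
  using asymptotic_unique[OF assms(1) ray_to(1)[OF assms(1)] ray_to(3)[OF assms(1)] _ assms(2)] ray_to(2)[OF assms(1)] by simp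

section \<open>Busemann functions of asymptotic rays\<close>

text \<open>Segments from \<open>y\<close> to \<open>q t\<close> converge to \<open>c\<close>, and
  \<open>excess_bound\<close> is uniform in the target, so \<open>horo q x - horo q y\<close>
  differs from \<open>dist x (c R) - R\<close> by at most \<open>a^2 / R\<close>. As
  \<open>R\<close> grows, the latter becomes \<open>horo c x\<close>.\<close>

lemma horo_asymptotic:
  assumes q: "ray UNIV dist q" and c: "ray UNIV dist c" and as: "asymptotic q c"
  shows "dist_metric.horo q (x :: 'a) - dist_metric.horo q (c 0) = dist_metric.horo c x"
proof -
  define y a where "y = c 0" and "a = dist x y"
  define b where "b = dist (q 0) y"
  have b0: "0 \<le> b" unfolding b_def by simp
  define k where "k = dist_metric.horo q x - dist_metric.horo q y"
  have conv: "((\<lambda>r. seg y (q r) R) \<longlongrightarrow> c R) at_top" if R: "0 \<le> R" for R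
  proof (subst tendsto_dist_iff, rule tendsto_sandwich[of "\<lambda>_. 0" _ _ "\<lambda>r. sqrt (8 * b * R^2 / (r - b))"])
    show "\<forall>\<^sub>F r in at_top. dist (seg y (q r) R) (c R) \<le> sqrt (8 * b * R^2 / (r - b))"
    proof (rule eventually_at_top_linorderI)
      fix r assume r: "2 * b + R + 1 \<le> r"
      have "(dist (seg y (q r) R) (c R))^2 * (r - b) \<le> 8 * b * R^2"
        using seg_close_ray[OF q c as R, of r] r R b0 unfolding y_def b_def by simp
      then have "(dist (seg y (q r) R) (c R))^2 \<le> 8 * b * R^2 / (r - b)" using r b0 R by (simp add: pos_le_divide_eq)
      then show "dist (seg y (q r) R) (c R) \<le> sqrt (8 * b * R^2 / (r - b))" by (rule real_le_rsqrt)
    qed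
    show "((\<lambda>r. sqrt (8 * b * R^2 / (r - b))) \<longlongrightarrow> 0) at_top"
      using tendsto_real_sqrt[OF tendsto_const_div_shift[of "8 * b * R^2" b]] by simp
  qed auto
  have est: "\<bar>k - (dist x (c R) - R)\<bar> \<le> a^2 / R" if R: "0 < R" "2 * a \<le> R" for R
  proof (rule tendsto_upperbound[of "\<lambda>t. \<bar>(dist x (q t) - t) - (dist y (q t) - t) - (dist x (seg y (q t) R) - R)\<bar>"])
    show "((\<lambda>t. \<bar>(dist x (q t) - t) - (dist y (q t) - t) - (dist x (seg y (q t) R) - R)\<bar>) \<longlongrightarrow> \<bar>k - (dist x (c R) - R)\<bar>) at_top"
      unfolding k_def using R by (intro tendsto_intros dist_metric.horo_tendsto[OF q] conv) auto
    show "\<forall>\<^sub>F t in at_top. \<bar>(dist x (q t) - t) - (dist y (q t) - t) - (dist x (seg y (q t) R) - R)\<bar> \<le> a^2 / R"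
    proof (rule eventually_at_top_linorderI)
      fix t assume t: "R + b \<le> t"
      have D: "R \<le> dist y (q t)" using dist_to_ray[OF q, of t y] t R b0 unfolding b_def[symmetric] by (simp add: abs_le_iff)
      have p: "dist y (seg y (q t) R) = R" "dist (seg y (q t) R) (q t) = dist y (q t) - R" using seg_dist[of R y "q t"] R D by auto
      show "\<bar>(dist x (q t) - t) - (dist y (q t) - t) - (dist x (seg y (q t) R) - R)\<bar> \<le> a^2 / R"
        using excess_bound[OF p _ R(2,1) D, of x] dist_triangle[of x "q t" "seg y (q t) R"] p
          zero_le_divide_iff[of "a^2" R] R unfolding a_def by (simp add: abs_le_iff)
    qed
  qed auto
  have "((\<lambda>R. k - (dist x (c R) - R)) \<longlongrightarrow> 0) at_top"
  proof (rule tendsto_rabs_zero_cancel, rule tendsto_sandwich[of "\<lambda>_. 0" _ _ "\<lambda>R. a^2 / R"])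
    show "\<forall>\<^sub>F R in at_top. \<bar>k - (dist x (c R) - R)\<bar> \<le> a^2 / R"
      by (rule eventually_at_top_linorderI[of "2 * a + 1"], rule est) (use zero_le_dist[of x y, folded a_def] in linarith)+
    show "((\<lambda>R. a^2 / R) \<longlongrightarrow> 0) at_top" using tendsto_const_div_shift[of "a^2" 0] by simp
  qed auto
  moreover have "((\<lambda>R. k - (dist x (c R) - R)) \<longlongrightarrow> k - dist_metric.horo c x) at_top"
    by (intro tendsto_intros dist_metric.horo_tendsto[OF c]) auto
  ultimately have "k - dist_metric.horo c x = 0" using tendsto_unique trivial_limit_at_top_linorder by blast
  then show ?thesis unfolding k_def y_def by simp
qed

lemma horo_along:
  assumes "ray UNIV dist (q :: real \<Rightarrow> 'a)" "ray UNIV dist c" "asymptotic q c" "0 \<le> t"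
  shows "dist_metric.horo q (c t) = dist_metric.horo q (c 0) - t"
  using horo_asymptotic[OF assms(1-3), of "c t"] dist_metric.horo_ray[OF assms(2,4)] by simp

subsection \<open>The cone topology\<close>

text \<open>Convergence of rays is independent of the base point: both rays are approximated by segments to a distant
  point of the rays from the other base point.\<close>

lemma ray_convergence_base_change:
  assumes c: "\<And>n :: nat. ray UNIV dist (c n)" "ray UNIV dist c'" "\<And>n. c n 0 = c' 0"
    and conv: "\<And>T. 0 \<le> T \<Longrightarrow> (\<lambda>n. c n T) \<longlonglongrightarrow> (c' T :: 'a)" and e: "\<And>n. ray UNIV dist (e n)" "ray UNIV dist e'" "\<And>n. e n 0 = e' 0"
    and as: "\<And>n. asymptotic (c n) (e n)" "asymptotic c' e'" and T: "0 \<le> T"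
  shows "(\<lambda>n. e n T) \<longlonglongrightarrow> e' T"
proof (cases "T = 0")
  case True
  then show ?thesis using e(3) by simp
next
  case False
  then have T: "0 < T" using T by simp
  define x a where "x = e' 0" and "a = dist (c' 0) (e' 0)"
  have a0: "0 \<le> a" unfolding a_def by simp
  show ?thesis
  proof (rule metric_LIMSEQ_I)
    fix \<eta> :: real assume \<eta>: "0 < \<eta>"
    \<comment> \<open>Large enough that the segments from \<open>x\<close> to points at time
      \<open>r\<close> approximate their rays at time \<open>T\<close> up to
      \<open>\<eta> / 3\<close>.\<close>
    define r where "r = 2 * a + T + 1 + 8 * a * T^2 / (\<eta> / 3)^2"
    have "0 \<le> 8 * a * T^2 / (\<eta> / 3)^2" using a0 by simp
    then have r: "2 * a < r" "T \<le> r - a" "8 * a * T^2 / (\<eta> / 3)^2 < r - a" unfolding r_def using a0 T by linarith+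
    have small: "dist (seg x (f r) T) (h T) < \<eta> / 3"
      if "ray UNIV dist f" "ray UNIV dist h" "f 0 = c' 0" "h 0 = x" "asymptotic f h" for f h
    proof -
      have fh: "dist (f 0) (h 0) = a" unfolding a_def that(3,4) x_def ..
      have "(dist (seg x (f r) T) (h T))^2 * (r - a) \<le> 8 * a * T^2"
        using seg_close_ray[OF that(1,2,5), of T r] r T unfolding fh unfolding that(4) by simp
      also have "\<dots> = (\<eta> / 3)^2 * (8 * a * T^2 / (\<eta> / 3)^2)" using \<eta> by simp
      also have "\<dots> < (\<eta> / 3)^2 * (r - a)" using \<eta> r by (intro mult_strict_left_mono) auto
      finally have "(dist (seg x (f r) T) (h T))^2 < (\<eta> / 3)^2" using r T by (simp add: mult_less_cancel_right)
      then show ?thesis by (rule power2_less_imp_less) (use \<eta> in simp)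
    qed
    have Tle: "T \<le> dist x (f r)" if "ray UNIV dist f" "f 0 = c' 0" for f
      using dist_to_ray[OF that(1), of r x] that(2) r T a0 unfolding a_def x_def by (simp add: abs_le_iff)
    have mid: "dist (seg x (c n r) T) (seg x (c' r) T) \<le> dist (c n r) (c' r)" for n
    proof -
      let ?D = "dist x (c n r)" and ?D' = "dist x (c' r)"
      have D: "T \<le> ?D" "T \<le> ?D'" using Tle[OF c(1,3)] Tle[OF c(2)] by auto
      have "(dist (seg x (c n r) T) (seg x (c' r) T))^2 * (?D * ?D') \<le> T^2 * ((dist (c n r) (c' r))^2 - (?D - ?D')^2)"
        by (rule fan) (use seg_dist[of T x "c n r"] seg_dist[of T x "c' r"] D T in auto)
      also have "\<dots> \<le> T^2 * (dist (c n r) (c' r))^2" by (intro mult_left_mono) auto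
      also have "\<dots> \<le> (?D * ?D') * (dist (c n r) (c' r))^2"
        unfolding power2_eq_square[of T] using D T by (intro mult_right_mono mult_mono) auto
      finally have "(dist (seg x (c n r) T) (seg x (c' r) T))^2 * (?D * ?D') \<le> (dist (c n r) (c' r))^2 * (?D * ?D')"
        by (simp add: mult.commute)
      moreover have "0 < ?D * ?D'" using D T by (intro mult_pos_pos) auto
      ultimately have "(dist (seg x (c n r) T) (seg x (c' r) T))^2 \<le> (dist (c n r) (c' r))^2" by (rule mult_right_le_imp_le)
      then show ?thesis by (rule power2_le_imp_le) simp
    qed
    obtain N where N: "\<And>n. N \<le> n \<Longrightarrow> dist (c n r) (c' r) < \<eta> / 3"
      using metric_LIMSEQ_D[OF conv[of r], of "\<eta> / 3"] r a0 \<eta> T by auto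
    have "dist (e n T) (e' T) < \<eta>" if "N \<le> n" for n
    proof -
      have 1: "dist (seg x (c n r) T) (e n T) < \<eta> / 3" by (rule small) (use c e as in \<open>auto simp: x_def\<close>)
      have 2: "dist (seg x (c' r) T) (e' T) < \<eta> / 3" by (rule small) (use c e as in \<open>auto simp: x_def\<close>)
      show ?thesis using 1 2 mid[of n] N[OF that] dist_triangle[of "e n T" "e' T" "seg x (c' r) T"]
        dist_triangle[of "e n T" "seg x (c' r) T" "seg x (c n r) T"] by (simp add: dist_commute)
    qed
    then show "\<exists>N. \<forall>n\<ge>N. dist (e n T) (e' T) < \<eta>" by blast
  qed
qed

lemma boundaryI: "ray UNIV dist q \<Longrightarrow> point_at_infinity q \<in> boundary_at_infinity" unfolding boundary_at_infinity_def by blast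

text \<open>The subbasic sets use arbitrary base points, while convergence is given from one of
  them; \<open>ray_convergence_base_change\<close> reconciles the two. Intersections and unions are
  handled by induction over the generated topology.\<close>

lemma limitin_cone_topologyI:
  assumes c: "\<And>n. ray UNIV dist (c n)" "ray UNIV dist c'" "\<And>n. c n 0 = c' 0"
    and conv: "\<And>T. 0 \<le> T \<Longrightarrow> (\<lambda>n. c n T) \<longlonglongrightarrow> (c' T :: 'a)"
  shows "limitin cone_topology (\<lambda>n. point_at_infinity (c n)) (point_at_infinity c') sequentially"
proof -
  let ?S = "{{h \<in> boundary_at_infinity. dist (ray_to x h T) (ray_to x z T) < e} |(x :: 'a) z T e.
        z \<in> boundary_at_infinity \<and> 0 \<le> T \<and> 0 < e}"
  have "point_at_infinity c' \<in> {h \<in> boundary_at_infinity. dist (ray_to (c' 0) h 0) (ray_to (c' 0) (point_at_infinity c') 0) < 1}"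
    using boundaryI[OF c(2)] by simp
  moreover have "{h \<in> boundary_at_infinity. dist (ray_to (c' 0) h 0) (ray_to (c' 0) (point_at_infinity c') 0) < 1} \<in> ?S"
    using boundaryI[OF c(2)] by (intro CollectI exI[of _ "c' 0"] exI[of _ "point_at_infinity c'"] exI[of _ 0] exI[of _ 1]) auto
  ultimately have "point_at_infinity c' \<in> topspace cone_topology" unfolding cone_topology_def topology_generated_by_topspace by blast
  moreover have "\<forall>\<^sub>F n in sequentially. point_at_infinity (c n) \<in> U" if "openin cone_topology U" "point_at_infinity c' \<in> U" for U
  proof -
    have "generate_topology_on ?S U" using that(1) unfolding cone_topology_def openin_topology_generated_by_iff .
    then show ?thesis using that(2)
    proof (induction U)
      case (Int U V)
      then show ?case using eventually_conj by fastforce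
    next
      case (UN K)
      then obtain U where "U \<in> K" "point_at_infinity c' \<in> U" by blast
      then show ?case using eventually_mono[OF UN.IH[of U], of "\<lambda>n. point_at_infinity (c n) \<in> \<Union>K"] by blast
    next
      case (Basis U)
      then obtain x :: 'a and z T e where U: "U = {h \<in> boundary_at_infinity. dist (ray_to x h T) (ray_to x z T) < e}"
        "0 \<le> T" "0 < e" by blast
      have "(\<lambda>n. ray_to x (point_at_infinity (c n)) T) \<longlonglongrightarrow> ray_to x (point_at_infinity c') T"
        by (rule ray_convergence_base_change[OF c conv]) (use ray_to c U in auto)
      then have "(\<lambda>n. dist (ray_to x (point_at_infinity (c n)) T) (ray_to x z T)) \<longlonglongrightarrow> dist (ray_to x (point_at_infinity c') T) (ray_to x z T)"
        by (intro tendsto_intros)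
      then have "\<forall>\<^sub>F n in sequentially. dist (ray_to x (point_at_infinity (c n)) T) (ray_to x z T) < e"
        by (rule order_tendstoD(2)) (use Basis U in auto)
      then show ?case unfolding U(1) using boundaryI[OF c(1)] by simp
    qed simp
  qed
  ultimately show ?thesis unfolding limitin_def by blast
qed

lemma limitin_cone_topologyD:
  assumes lim: "limitin cone_topology z h sequentially" and h: "h \<in> boundary_at_infinity" and T: "0 \<le> T"
  shows "(\<lambda>n. ray_to x (z n) T) \<longlonglongrightarrow> ray_to (x :: 'a) h T"
proof (rule metric_LIMSEQ_I)
  fix e :: real assume e: "0 < e"
  define U where "U = {Z \<in> boundary_at_infinity. dist (ray_to x Z T) (ray_to x h T) < e}"
  have "openin cone_topology U" unfolding cone_topology_def U_def by (rule topology_generated_by_Basis) (use h T e in blast)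
  moreover have "h \<in> U" unfolding U_def using h e by simp
  ultimately have "\<forall>\<^sub>F n in sequentially. z n \<in> U" using lim unfolding limitin_def by blast
  then show "\<exists>N. \<forall>n\<ge>N. dist (ray_to x (z n) T) (ray_to x h T) < e" unfolding U_def eventually_sequentially by blast
qed

end

section \<open>Ordinary differential equations on short intervals\<close>

text \<open>Takes the place of Gronwall's inequality on intervals so short that the growth term
  contributes at most half the maximum: the hypothesis is applied with \<open>B\<close> the maximum
  itself.\<close>

lemma norm_le_of_half_bound:
  fixes u :: "real \<Rightarrow> 'z::real_normed_vector"
  assumes "continuous_on {0..T} u"
    and half: "\<And>B t. 0 \<le> B \<Longrightarrow> (\<And>s. s \<in> {0..T} \<Longrightarrow> norm (u s) \<le> B) \<Longrightarrow> t \<in> {0..T} \<Longrightarrow> norm (u t) \<le> c + B / 2" and t: "t \<in> {0..T}"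
  shows "norm (u t) \<le> 2 * c"
proof -
  have "continuous_on {0..T} (\<lambda>t. norm (u t))" using assms(1) by (intro continuous_intros)
  then obtain m where m: "m \<in> {0..T}" "\<And>s. s \<in> {0..T} \<Longrightarrow> norm (u s) \<le> norm (u m)"
    using continuous_attains_sup[OF compact_Icc] t by (metis empty_iff)
  have "norm (u m) \<le> c + norm (u m) / 2" using half[OF norm_ge_zero m(2) m(1)] .
  then show ?thesis using m(2)[OF t] by simp
qed

lemma continuous_on_compose_time:
  assumes "continuous_on ({0..T} \<times> S) (\<lambda>(s, x). G s x)" "continuous_on {0..T} f"
    "\<And>s. s \<in> {0..T} \<Longrightarrow> f s \<in> S"
  shows "continuous_on {0..T} (\<lambda>s. G s (f s))"
proof -
  have "continuous_on {0..T} (\<lambda>s. (\<lambda>(s, x). G s x) (s, f s))"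
    by (rule continuous_on_compose2[OF assms(1)]) (use assms in \<open>auto intro!: continuous_intros\<close>)
  then show ?thesis by simp
qed

lemma norm_integral_le_time:
  fixes f :: "real \<Rightarrow> 'z::euclidean_space"
  assumes "continuous_on {0..T} f" "\<And>s. s \<in> {0..T} \<Longrightarrow> norm (f s) \<le> B" "t \<in> {0..T}"
  shows "norm (integral {0..t} f) \<le> T * B"
proof -
  have B: "0 \<le> B" using assms(2)[OF assms(3)] norm_ge_zero order_trans by blast
  have "norm (integral {0..t} f) \<le> B * (t - 0)" by (rule integral_bound) (use assms in \<open>auto intro: continuous_on_subset\<close>)
  also have "\<dots> \<le> B * T" using B assms(3) by (intro mult_left_mono) auto
  finally show ?thesis by (simp add: mult.commute)
qed

lemma compact_continuous_norm_bound:
  fixes f :: "'b::topological_space \<Rightarrow> 'c::real_normed_vector"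
  assumes "compact S" "continuous_on S f" obtains B where "\<And>x. x \<in> S \<Longrightarrow> norm (f x) \<le> B"
  using compact_imp_bounded[OF compact_continuous_image[OF assms(2,1)]] unfolding bounded_iff by auto

text \<open>Picard iteration on an interval where it contracts by 1/2. The invariant set
  \<open>S\<close> lets one statement serve the nonlinear flow, with \<open>S\<close> a ball, and
  the linearized equation, with \<open>S\<close> the whole space. Times are clamped to
  \<open>[0, T]\<close> in order to work with bounded continuous functions on the line.\<close>

lemma volterra_solution:
  fixes G :: "real \<Rightarrow> 'z::euclidean_space \<Rightarrow> 'z"
  assumes T: "0 < T" and S: "closed S" "S \<noteq> {}" and G: "continuous_on ({0..T} \<times> S) (\<lambda>(s, x). G s x)"
    and L: "0 \<le> L" "T * L \<le> 1 / 2" and lip: "\<And>s x y. s \<in> {0..T} \<Longrightarrow> x \<in> S \<Longrightarrow> y \<in> S \<Longrightarrow> norm (G s x - G s y) \<le> L * norm (x - y)"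
    and inv: "\<And>f t. continuous_on {0..T} f \<Longrightarrow> (\<And>s. s \<in> {0..T} \<Longrightarrow> f s \<in> S) \<Longrightarrow> t \<in> {0..T} \<Longrightarrow>
        a + integral {0..t} (\<lambda>s. G s (f s)) \<in> S" obtains f where "continuous_on {0..T} f" "\<And>s. s \<in> {0..T} \<Longrightarrow> f s \<in> S"
    "\<And>t. t \<in> {0..T} \<Longrightarrow> f t = a + integral {0..t} (\<lambda>s. G s (f s))"
proof -
  define cl :: "real \<Rightarrow> real" where "cl t = max 0 (min T t)" for t
  have cl: "cl t \<in> {0..T}" "t \<in> {0..T} \<Longrightarrow> cl t = t" for t using T unfolding cl_def by auto
  have ccl: "continuous_on UNIV cl" unfolding cl_def by (intro continuous_intros)
  define X where "X = PiC (UNIV :: real set) (\<lambda>_. S)"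
  define P where "P f t = a + integral {0..cl t} (\<lambda>s. G s (apply_bcontfun f s))" for f t
  have XS: "apply_bcontfun f s \<in> S" if "f \<in> X" for f s using that unfolding X_def mem_PiC_iff by auto
  have cG: "continuous_on {0..T} (\<lambda>s. G s (apply_bcontfun f s))" if "f \<in> X" for f
    by (rule continuous_on_compose_time[OF G]) (use XS[OF that] in auto)
  have Pb: "P f \<in> bcontfun" and PX: "P f t \<in> S" if f: "f \<in> X" for f t
  proof -
    show "P f t \<in> S" unfolding P_def using inv[OF _ _ cl(1)] XS[OF f] by simp
    have "continuous_on {0..T} (\<lambda>t. a + integral {0..t} (\<lambda>s. G s (apply_bcontfun f s)))"
      by (intro continuous_intros indefinite_integral_continuous_1 integrable_continuous_real cG[OF f])
    then have "continuous_on UNIV (\<lambda>t. a + integral {0..cl t} (\<lambda>s. G s (apply_bcontfun f s)))"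
      by (rule continuous_on_compose2[OF _ ccl]) (use cl in auto)
    moreover obtain B where B: "\<And>s. s \<in> {0..T} \<Longrightarrow> norm (G s (apply_bcontfun f s)) \<le> B"
      using compact_continuous_norm_bound[OF compact_Icc cG[OF f]] by blast
    have "norm (P f t) \<le> norm a + T * B" for t unfolding P_def
      using norm_integral_le_time[OF cG[OF f] B cl(1)] norm_triangle_ineq[of a] by (meson add_left_mono order_trans)
    ultimately show "P f \<in> bcontfun" by (intro bcontfun_normI) (auto simp: P_def)
  qed
  define Q where "Q f = Bcontfun (P f)" for f
  have Q: "apply_bcontfun (Q f) t = P f t" if "f \<in> X" for f t unfolding Q_def using Bcontfun_inverse[OF Pb[OF that]] by simp
  have "\<exists>!f\<in>X. Q f = f"
  proof (rule Banach_fix)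
    have "closed X" unfolding X_def by (rule closed_PiC) (use S in auto)
    then show "complete X" using complete_eq_closed by blast
    obtain x where x: "x \<in> S" using S by auto
    then have "const_bcontfun x \<in> X" unfolding X_def mem_PiC_iff by (simp add: const_bcontfun.rep_eq)
    then show "X \<noteq> {}" by auto
    show "Q ` X \<subseteq> X" using Q PX unfolding X_def by (auto simp: mem_PiC_iff)
    show "dist (Q f) (Q g) \<le> (1 / 2) * dist f g" if f: "f \<in> X" and g: "g \<in> X" for f g
    proof (rule dist_bound)
      fix t
      have "P f t - P g t = integral {0..cl t} (\<lambda>s. G s (apply_bcontfun f s) - G s (apply_bcontfun g s))"
        unfolding P_def using cl(1)[of t]
        by (subst integral_diff) (auto intro!: integrable_continuous_real continuous_on_subset[OF cG] f g)
      moreover have "norm \<dots> \<le> T * (L * dist f g)"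
      proof (rule norm_integral_le_time[OF _ _ cl(1)])
        show "continuous_on {0..T} (\<lambda>s. G s (apply_bcontfun f s) - G s (apply_bcontfun g s))"
          by (intro continuous_intros cG f g)
        fix s assume "s \<in> {0..T}"
        then have "norm (G s (apply_bcontfun f s) - G s (apply_bcontfun g s))
            \<le> L * norm (apply_bcontfun f s - apply_bcontfun g s)" using lip XS f g by blast
        also have "\<dots> \<le> L * dist f g" using dist_bounded[of f s g] L by (intro mult_left_mono) (auto simp: dist_norm)
        finally show "norm (G s (apply_bcontfun f s) - G s (apply_bcontfun g s)) \<le> L * dist f g" .
      qed
      moreover have "T * (L * dist f g) \<le> (1 / 2) * dist f g"
        using mult_right_mono[OF L(2), of "dist f g"] by (simp add: mult.assoc)
      ultimately show "dist (apply_bcontfun (Q f) t) (apply_bcontfun (Q g) t) \<le> (1 / 2) * dist f g"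
        using Q f g by (simp add: dist_norm)
    qed
  qed auto
  then obtain f where f: "f \<in> X" "Q f = f" by blast
  show ?thesis
  proof (rule that)
    show "continuous_on {0..T} (apply_bcontfun f)" by simp
    show "apply_bcontfun f s \<in> S" for s using XS f by simp
    show "apply_bcontfun f t = a + integral {0..t} (\<lambda>s. G s (apply_bcontfun f s))" if "t \<in> {0..T}" for t
      using Q[OF f(1), of t] cl(2)[OF that] f(2) by (simp add: P_def)
  qed
qed

text \<open>\<open>K a h\<close> is the derivative of the flow \<open>Z\<close> in the direction \<open>h\<close>, i.e. the solution of the linearized equation.\<close>

lemma local_flow:
  fixes F :: "'z::euclidean_space \<Rightarrow> 'z" and F' :: "'z \<Rightarrow> 'z \<Rightarrow>\<^sub>L 'z"
  assumes W: "open W" "z0 \<in> W" and F: "\<And>z. z \<in> W \<Longrightarrow> (F has_derivative F' z) (at z)" and F': "continuous_on W F'"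
  obtains l \<delta> :: real and Z K where "0 < l" "0 < \<delta>"
    "\<And>a. a \<in> cball z0 \<delta> \<Longrightarrow> Z a 0 = a"
    "\<And>a t. a \<in> cball z0 \<delta> \<Longrightarrow> t \<in> {0..l} \<Longrightarrow> Z a t \<in> W"
    "\<And>a t. a \<in> cball z0 \<delta> \<Longrightarrow> t \<in> {0..l} \<Longrightarrow> (Z a has_vector_derivative F (Z a t)) (at t within {0..l})"
    "\<And>a h. a \<in> cball z0 \<delta> \<Longrightarrow> K a h 0 = h"
    "\<And>a h t. a \<in> cball z0 \<delta> \<Longrightarrow> t \<in> {0..l} \<Longrightarrow>
       (K a h has_vector_derivative F' (Z a t) (K a h t)) (at t within {0..l})"
    "\<And>a t. a \<in> ball z0 \<delta> \<Longrightarrow> t \<in> {0..l} \<Longrightarrow> ((\<lambda>a. Z a t) has_derivative (\<lambda>h. K a h t)) (at a)"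
    "\<And>h t. t \<in> {0..l} \<Longrightarrow> continuous_on (cball z0 \<delta>) (\<lambda>a. K a h t)"
proof -
  obtain \<rho> where \<rho>: "0 < \<rho>" "cball z0 \<rho> \<subseteq> W" using W open_contains_cball by blast
  define S where "S = cball z0 \<rho>"
  have S: "compact S" "convex S" "closed S" "S \<noteq> {}" "S \<subseteq> W" unfolding S_def using \<rho> by auto
  have cF: "continuous_on S F" using F S(5) by (meson continuous_at_imp_continuous_on has_derivative_continuous subsetD)
  have cF': "continuous_on S F'" using F' S(5) continuous_on_subset by blast
  obtain M0 where M0: "\<And>x. x \<in> S \<Longrightarrow> norm (F x) \<le> M0" using compact_continuous_norm_bound[OF S(1) cF] by blast
  obtain L0 where L0: "\<And>x. x \<in> S \<Longrightarrow> norm (F' x) \<le> L0" using compact_continuous_norm_bound[OF S(1) cF'] by blast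
  define M where "M = max 1 M0"
  define L where "L = max 1 L0"
  have M: "0 < M" "\<And>x. x \<in> S \<Longrightarrow> norm (F x) \<le> M" using M0 unfolding M_def by force+
  have L: "0 < L" "\<And>x. x \<in> S \<Longrightarrow> norm (F' x) \<le> L" using L0 unfolding L_def by force+
  \<comment> \<open>Solutions that start within \<open>\<rho> / 2\<close> of \<open>z0\<close>
    travel at most \<open>\<rho> / 2\<close> in this time, and both Picard iterations contract by
    1/2.\<close>
  define l where "l = min (\<rho> / (2 * M)) (1 / (2 * L))"
  have l: "0 < l" unfolding l_def using \<rho> M L by simp
  have lM: "l * M \<le> \<rho> / 2"
  proof -
    have "l * M \<le> (\<rho> / (2 * M)) * M" unfolding l_def using M by (intro mult_right_mono) auto
    then show ?thesis using M by simp
  qed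
  have lL: "l * L \<le> 1 / 2"
  proof -
    have "l * L \<le> (1 / (2 * L)) * L" unfolding l_def using L by (intro mult_right_mono) auto
    then show ?thesis using L by simp
  qed
  have Fder: "(F has_derivative F' z) (at z within S)" if "z \<in> S" for z using F S(5) that has_derivative_at_withinI by blast
  have Flip: "norm (F x - F y) \<le> L * norm (x - y)" if "x \<in> S" "y \<in> S" for x y
    by (rule differentiable_bound[OF S(2) Fder _ that]) (use L in \<open>auto simp: norm_blinfun.rep_eq\<close>)
  \<comment> \<open>One inequality, in integrated form, for solutions of \<open>u' = q\<close> with
    \<open>norm q \<le> L * norm u + C\<close>; it yields Lipschitz dependence on the initial value,
    bound, linearity and continuity of \<open>K\<close>, and differentiability of the flow.\<close>
  have estimate: "norm (u t) \<le> 2 * (norm v + l * C)"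
    if u: "continuous_on {0..l} u" and q: "continuous_on {0..l} q" and eq: "\<And>t. t \<in> {0..l} \<Longrightarrow> u t = v + integral {0..t} q"
      and le: "\<And>s. s \<in> {0..l} \<Longrightarrow> norm (q s) \<le> L * norm (u s) + C" and t: "t \<in> {0..l}"
    for u q :: "real \<Rightarrow> 'z" and v t C
  proof (rule norm_le_of_half_bound[OF u _ t])
    fix B t assume B: "0 \<le> B" "\<And>s. s \<in> {0..l} \<Longrightarrow> norm (u s) \<le> B" and t: "t \<in> {0..l}"
    have "norm (q s) \<le> L * B + C" if "s \<in> {0..l}" for s
      using le[OF that] mult_left_mono[OF B(2)[OF that] less_imp_le[OF L(1)]] by linarith
    then have "norm (integral {0..t} q) \<le> l * (L * B + C)" by (rule norm_integral_le_time[OF q _ t])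
    also have "\<dots> \<le> B / 2 + l * C" using mult_right_mono[OF lL B(1)] by (simp add: algebra_simps)
    finally show "norm (u t) \<le> norm v + l * C + B / 2" unfolding eq[OF t] using norm_triangle_ineq[of v "integral {0..t} q"] by simp
  qed
  define D where "D = cball z0 (\<rho> / 2)"
  have ex: "\<exists>f. continuous_on {0..l} f \<and> (\<forall>s\<in>{0..l}. f s \<in> S) \<and>
      (\<forall>t\<in>{0..l}. f t = a + integral {0..t} (\<lambda>s. F (f s)))" if a: "a \<in> D" for a
  proof (rule volterra_solution[of l S "\<lambda>_. F" L a])
    show "continuous_on ({0..l} \<times> S) (\<lambda>(s, x). F x)" unfolding case_prod_beta
      by (rule continuous_on_compose2[OF cF continuous_on_snd]) (auto intro: continuous_intros)
    fix f t assume f: "continuous_on {0..l} f" "\<And>s. s \<in> {0..l} \<Longrightarrow> f s \<in> S" and t: "t \<in> {0..l}"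
    have "norm (integral {0..t} (\<lambda>s. F (f s))) \<le> l * M"
    proof (rule norm_integral_le_time[OF _ _ t])
      show "continuous_on {0..l} (\<lambda>s. F (f s))" by (rule continuous_on_compose2[OF cF f(1)]) (use f in auto)
      show "\<And>s. s \<in> {0..l} \<Longrightarrow> norm (F (f s)) \<le> M" using M f by simp
    qed
    then have "dist z0 (a + integral {0..t} (\<lambda>s. F (f s))) \<le> \<rho>"
      using a lM dist_triangle[of z0 "a + integral {0..t} (\<lambda>s. F (f s))" a] unfolding D_def by (simp add: dist_norm)
    then show "a + integral {0..t} (\<lambda>s. F (f s)) \<in> S" unfolding S_def by simp
  qed (use l lL L S Flip in auto)
  define Z where "Z a = (SOME f. continuous_on {0..l} f \<and> (\<forall>s\<in>{0..l}. f s \<in> S) \<and>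
      (\<forall>t\<in>{0..l}. f t = a + integral {0..t} (\<lambda>s. F (f s))))" for a
  have Z: "continuous_on {0..l} (Z a)" "\<And>s. s \<in> {0..l} \<Longrightarrow> Z a s \<in> S"
     "\<And>t. t \<in> {0..l} \<Longrightarrow> Z a t = a + integral {0..t} (\<lambda>s. F (Z a s))" if "a \<in> D" for a
    using someI_ex[OF ex[OF that]] unfolding Z_def by auto
  have cFZ: "continuous_on {0..l} (\<lambda>s. F (Z a s))" "continuous_on {0..l} (\<lambda>s. F' (Z a s))" if "a \<in> D" for a
    by (rule continuous_on_compose2[OF cF Z(1)] continuous_on_compose2[OF cF' Z(1)]; use Z(2) that in auto)+
  have exK: "\<exists>f. continuous_on {0..l} f \<and>
      (\<forall>t\<in>{0..l}. f t = h + integral {0..t} (\<lambda>s. F' (Z a s) (f s)))" if a: "a \<in> D" for a h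
  proof (rule volterra_solution[of l UNIV "\<lambda>s x. F' (Z a s) x" L h])
    show "continuous_on ({0..l} \<times> UNIV) (\<lambda>(s, x). F' (Z a s) x)" unfolding case_prod_beta
      by (intro continuous_intros continuous_on_compose2[OF cFZ(2)[OF a], of _ fst]) auto
    show "norm (F' (Z a s) x - F' (Z a s) y) \<le> L * norm (x - y)" if "s \<in> {0..l}" for s x y
    proof -
      have "norm (F' (Z a s) (x - y)) \<le> norm (F' (Z a s)) * norm (x - y)" by (rule norm_blinfun)
      also have "\<dots> \<le> L * norm (x - y)" using L Z(2)[OF a that] by (intro mult_right_mono) auto
      finally show ?thesis by (simp add: blinfun.diff_right)
    qed
  qed (use l lL L in auto)
  define K where "K a h = (SOME f. continuous_on {0..l} f \<and>
      (\<forall>t\<in>{0..l}. f t = h + integral {0..t} (\<lambda>s. F' (Z a s) (f s))))" for a h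
  have K: "continuous_on {0..l} (K a h)"
     "\<And>t. t \<in> {0..l} \<Longrightarrow> K a h t = h + integral {0..t} (\<lambda>s. F' (Z a s) (K a h s))" if "a \<in> D" for a h
    using someI_ex[OF exK[OF that]] unfolding K_def by auto
  have cF'K: "continuous_on {0..l} (\<lambda>s. F' (Z a s) (K b h s))" if "a \<in> D" "b \<in> D" for a b h
    by (intro continuous_intros cFZ K that)
  have F'L: "norm (F' (Z a s) x) \<le> L * norm x" if "a \<in> D" "s \<in> {0..l}" for a s x
  proof -
    have "norm (F' (Z a s) x) \<le> norm (F' (Z a s)) * norm x" by (rule norm_blinfun)
    also have "\<dots> \<le> L * norm x" using L Z(2)[OF that] by (intro mult_right_mono) auto
    finally show ?thesis .
  qed
  have int: "f integrable_on {0..t}" if "continuous_on {0..l} f" "t \<in> {0..l}" for f :: "real \<Rightarrow> 'z" and t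
    using that by (auto intro!: integrable_continuous_real intro: continuous_on_subset)
  have Zlip: "norm (Z a t - Z b t) \<le> 2 * norm (a - b)" if a: "a \<in> D" and b: "b \<in> D" and t: "t \<in> {0..l}" for a b t
    using estimate[of "\<lambda>t. Z a t - Z b t" "\<lambda>s. F (Z a s) - F (Z b s)" "a - b" 0 t] Z cFZ(1) Flip int a b t
    by (simp add: integral_diff continuous_on_diff)
  have Kbound: "norm (K a h t) \<le> 2 * norm h" if a: "a \<in> D" and t: "t \<in> {0..l}" for a h t
    using estimate[OF K(1)[OF a] cF'K[OF a a] K(2)[OF a], of h 0] F'L[OF a] t by simp
  have Klin: "K a (r *\<^sub>R h + k) t = r *\<^sub>R K a h t + K a k t" if a: "a \<in> D" and t: "t \<in> {0..l}" for a r h k t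
  proof -
    define u where "u t = K a (r *\<^sub>R h + k) t - (r *\<^sub>R K a h t + K a k t)" for t
    have cu: "continuous_on {0..l} u" unfolding u_def by (intro continuous_intros K a)
    have "norm (u t) \<le> 2 * (norm (0 :: 'z) + l * 0)"
    proof (rule estimate[OF cu _ _ _ t])
      show "continuous_on {0..l} (\<lambda>s. F' (Z a s) (u s))" by (intro continuous_intros cFZ a cu)
      fix t assume t: "t \<in> {0..l}"
      show "norm (F' (Z a t) (u t)) \<le> L * norm (u t) + 0" using F'L[OF a t] by simp
      have "u t = integral {0..t} (\<lambda>s. F' (Z a s) (K a (r *\<^sub>R h + k) s)) -
          (r *\<^sub>R integral {0..t} (\<lambda>s. F' (Z a s) (K a h s)) + integral {0..t} (\<lambda>s. F' (Z a s) (K a k s)))"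
        unfolding u_def K(2)[OF a t, of "r *\<^sub>R h + k"] K(2)[OF a t, of h] K(2)[OF a t, of k] by (simp add: scaleR_add_right)
      also have "\<dots> = integral {0..t} (\<lambda>s. F' (Z a s) (u s))" unfolding u_def using int[OF cF'K[OF a a] t]
        by (simp add: integral_diff integral_add integrable_add integrable_cmul blinfun.diff_right blinfun.add_right blinfun.scaleR_right)
      finally show "u t = 0 + integral {0..t} (\<lambda>s. F' (Z a s) (u s))" by simp
    qed
    then show ?thesis unfolding u_def by simp
  qed
  have F'unif: "\<exists>d>0. \<forall>x\<in>S. \<forall>y\<in>S. norm (x - y) < d \<longrightarrow> norm (F' x - F' y) \<le> e" if "0 < e" for e
    using compact_uniformly_continuous[OF cF' S(1)] that
    unfolding uniformly_continuous_on_def dist_norm by (metis less_imp_le norm_minus_commute)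
  have Kcont: "continuous_on D (\<lambda>a. K a h t)" if t: "t \<in> {0..l}" for h t unfolding continuous_on_iff
  proof (intro ballI allI impI)
    fix a and e :: real assume a: "a \<in> D" and e: "0 < e"
    define k where "k = norm h + 1"
    have k: "0 < k" unfolding k_def by (simp add: add_nonneg_pos)
    define e' where "e' = e / (8 * l * k)"
    have e': "0 < e'" unfolding e'_def using e l k by simp
    obtain d where d: "d > 0" "\<And>x y. x \<in> S \<Longrightarrow> y \<in> S \<Longrightarrow> norm (x - y) < d \<Longrightarrow> norm (F' x - F' y) \<le> e'" using F'unif[OF e'] by blast
    show "\<exists>d>0. \<forall>b\<in>D. dist b a < d \<longrightarrow> dist (K b h t) (K a h t) < e"
    proof (intro exI[of _ "d / 2"] conjI ballI impI)
      show "0 < d / 2" using d by simp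
      fix b assume b: "b \<in> D" and ba: "dist b a < d / 2"
      have "norm (K b h t - K a h t) \<le> 2 * (norm (0 :: 'z) + l * (e' * (2 * norm h)))"
      proof (rule estimate[of "\<lambda>t. K b h t - K a h t" "\<lambda>s. F' (Z b s) (K b h s) - F' (Z a s) (K a h s)", OF _ _ _ _ t])
        fix s assume s: "s \<in> {0..l}"
        show "K b h s - K a h s = 0 + integral {0..s} (\<lambda>s. F' (Z b s) (K b h s) - F' (Z a s) (K a h s))"
          using K(2)[OF a s, of h] K(2)[OF b s, of h] int[OF cF'K s] a b by (simp add: integral_diff)
        have "norm (Z b s - Z a s) < d" using Zlip[OF b a s] ba by (simp add: dist_norm)
        then have "norm (F' (Z b s) - F' (Z a s)) \<le> e'" using d(2) Z(2) a b s by blast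
        then have "norm ((F' (Z b s) - F' (Z a s)) (K a h s)) \<le> e' * (2 * norm h)"
          using norm_blinfun[of "F' (Z b s) - F' (Z a s)" "K a h s"] Kbound[OF a s, of h] e'
          by (smt (verit) mult_mono norm_ge_zero)
        moreover have "F' (Z b s) (K b h s) - F' (Z a s) (K a h s)
            = F' (Z b s) (K b h s - K a h s) + (F' (Z b s) - F' (Z a s)) (K a h s)"
          by (simp add: blinfun.diff_right blinfun.diff_left)
        ultimately show "norm (F' (Z b s) (K b h s) - F' (Z a s) (K a h s)) \<le> L * norm (K b h s - K a h s) + e' * (2 * norm h)"
          using F'L[OF b s, of "K b h s - K a h s"] norm_triangle_mono by metis
      qed (intro continuous_intros K cF'K a b)+
      also have "\<dots> \<le> 4 * l * e' * k" unfolding k_def using l e' by (simp add: algebra_simps)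
      also have "\<dots> = e / 2" unfolding e'_def using l k by simp
      also have "\<dots> < e" using e by simp
      finally show "dist (K b h t) (K a h t) < e" by (simp add: dist_norm)
    qed
  qed
  have Kblin: "bounded_linear (\<lambda>h. K a h t)" if a: "a \<in> D" and t: "t \<in> {0..l}" for a t
    by (rule bounded_linear_intro[where K = 2])
      (use Klin[OF a t, of 1] Klin[OF a t, of _ _ 0] Klin[OF a t, of 1 0 0] Kbound[OF a t] in \<open>auto simp: mult.commute\<close>)
  have deriv: "((\<lambda>a. Z a t) has_derivative (\<lambda>h. K a h t)) (at a)" if a': "a \<in> ball z0 (\<rho> / 2)" and t: "t \<in> {0..l}" for a t
    unfolding has_derivative_at_within[of _ _ a UNIV] has_derivative_within_alt
  proof (intro conjI allI impI)
    have a: "a \<in> D" using a' unfolding D_def by auto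
    show "bounded_linear (\<lambda>h. K a h t)" by (rule Kblin[OF a t])
    fix e :: real assume e: "0 < e"
    \<comment> \<open>The remainder satisfies the linearized inequality with forcing term at most
      \<open>2 * norm h * e'\<close>; the estimate multiplies this by \<open>2 * l\<close>.\<close>
    define e' where "e' = e / (4 * l)"
    have e': "0 < e'" unfolding e'_def using e l by simp
    obtain d where d: "d > 0" "\<And>x y. x \<in> S \<Longrightarrow> y \<in> S \<Longrightarrow> norm (x - y) < d \<Longrightarrow> norm (F' x - F' y) \<le> e'" using F'unif[OF e'] by blast
    obtain r where r: "r > 0" "ball a r \<subseteq> D"
      using a' open_contains_ball[of "ball z0 (\<rho> / 2)"] unfolding D_def by (metis ball_subset_cball open_ball order_trans)
    show "\<exists>d>0. \<forall>b\<in>UNIV. norm (b - a) < d \<longrightarrow> norm (Z b t - Z a t - K a (b - a) t) \<le> e * norm (b - a)"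
    proof (intro exI[of _ "min r (d / 2)"] conjI ballI impI)
      show "0 < min r (d / 2)" using d r by simp
      fix b assume ba: "norm (b - a) < min r (d / 2)"
      then have b: "b \<in> D" using r(2) by (auto simp: dist_norm norm_minus_commute)
      define h where "h = b - a"
      have lin: "norm (F y - F x - F' x (y - x)) \<le> norm (y - x) * e'"
        if x: "x \<in> S" and y: "y \<in> S" and xy: "norm (y - x) < d" for x y
      proof -
        define T where "T = S \<inter> ball x d"
        have T: "convex T" "x \<in> T" "y \<in> T" unfolding T_def using S x y xy d
          by (auto intro: convex_Int simp: dist_norm norm_minus_commute)
        show ?thesis
        proof (rule differentiable_bound_linearization[of x y T F F' x e'])
          show "x + t *\<^sub>R (y - x) \<in> T" if "t \<in> {0..1}" for t
            using convexD_alt[OF T(1,2,3), of t] that by (simp add: algebra_simps)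
          show "(F has_derivative F' z) (at z within T)" if "z \<in> T" for z
            using Fder[of z] that has_derivative_subset unfolding T_def by blast
          show "onorm (blinfun_apply (F' z) - blinfun_apply (F' x)) \<le> e'" if "z \<in> T" for z
            using d(2)[of z x] that x unfolding T_def
            by (auto simp: norm_blinfun.rep_eq minus_blinfun.rep_eq dist_norm norm_minus_commute fun_diff_def)
        qed (use T in auto)
      qed
      have "norm (Z b t - Z a t - K a h t) \<le> 2 * (norm (0 :: 'z) + l * (2 * norm h * e'))"
      proof (rule estimate[of "\<lambda>t. Z b t - Z a t - K a h t" "\<lambda>s. F (Z b s) - F (Z a s) - F' (Z a s) (K a h s)", OF _ _ _ _ t])
        fix s assume s: "s \<in> {0..l}"
        show "Z b s - Z a s - K a h s = 0 + integral {0..s} (\<lambda>s. F (Z b s) - F (Z a s) - F' (Z a s) (K a h s))"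
          using K(2)[OF a s, of h] Z(3)[OF a s] Z(3)[OF b s] int[OF cFZ(1)[OF a] s] int[OF cFZ(1)[OF b] s] int[OF cF'K[OF a a] s]
          by (simp add: integral_diff integrable_diff h_def)
        have le: "norm (Z b s - Z a s) \<le> 2 * norm h" using Zlip[OF b a s] by (simp add: h_def)
        then have "norm (Z b s - Z a s) < d" using ba by (simp add: h_def)
        from lin[OF Z(2)[OF a s] Z(2)[OF b s] this]
        have "norm (F (Z b s) - F (Z a s) - F' (Z a s) (Z b s - Z a s)) \<le> 2 * norm h * e'"
          using le e' by (meson mult_right_mono less_imp_le order_trans)
        moreover have "F (Z b s) - F (Z a s) - F' (Z a s) (K a h s)
            = F' (Z a s) (Z b s - Z a s - K a h s) + (F (Z b s) - F (Z a s) - F' (Z a s) (Z b s - Z a s))"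
          by (simp add: blinfun.diff_right)
        ultimately show "norm (F (Z b s) - F (Z a s) - F' (Z a s) (K a h s)) \<le> L * norm (Z b s - Z a s - K a h s) + 2 * norm h * e'"
          using F'L[OF a s, of "Z b s - Z a s - K a h s"] norm_triangle_mono by metis
      qed (intro continuous_intros Z K cFZ cF'K a b)+
      also have "\<dots> = e * norm h" unfolding e'_def using l by simp
      finally show "norm (Z b t - Z a t - K a (b - a) t) \<le> e * norm (b - a)" by (simp add: h_def)
    qed
  qed
  show ?thesis
  proof (rule that[of l "\<rho> / 2" Z K], goal_cases)
    case (3 a) then show ?case using Z(3)[of a 0] l unfolding D_def by simp
  next
    case (4 a t) then show ?case using Z(2)[of a t] S(5) unfolding D_def by auto
  next
    case (5 a t)
    then have a: "a \<in> D" unfolding D_def by simp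
    have "((\<lambda>t. a + integral {0..t} (\<lambda>s. F (Z a s))) has_vector_derivative 0 + F (Z a t)) (at t within {0..l})"
      by (intro has_vector_derivative_add has_vector_derivative_const integral_has_vector_derivative cFZ a 5)
    then show ?case
      by (rule has_vector_derivative_transform[rotated 2, THEN has_vector_derivative_eq_rhs]) (use Z(3)[OF a] 5 in auto)
  next
    case (6 a h) then show ?case using K(2)[of a 0 h] l unfolding D_def by simp
  next
    case (7 a h t)
    then have a: "a \<in> D" unfolding D_def by simp
    have "((\<lambda>t. h + integral {0..t} (\<lambda>s. F' (Z a s) (K a h s))) has_vector_derivative 0 + F' (Z a t) (K a h t)) (at t within {0..l})"
      by (intro has_vector_derivative_add has_vector_derivative_const integral_has_vector_derivative cF'K a 7)
    then show ?case
      by (rule has_vector_derivative_transform[rotated 2, THEN has_vector_derivative_eq_rhs]) (use K(2)[OF a] 7 in auto)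
  next
    case (8 a t) then show ?case by (rule deriv)
  next
    case (9 h t) then show ?case using Kcont unfolding D_def by simp
  qed (use l \<rho> in auto)
qed

section \<open>Bilinear forms depending on a point\<close>

text \<open>Reduces families of bilinear maps to finitely many coefficient functions, so that
  continuity and differentiability are needed only for fixed vectors, the form in which smoothness
  of the metric is given.\<close>

lemma bilinear_expand:
  fixes B :: "'e::euclidean_space \<Rightarrow> 'e \<Rightarrow> 'f::real_vector"
  assumes "bilinear B"
  shows "B u v = (\<Sum>i\<in>Basis. \<Sum>j\<in>Basis. (u \<bullet> i) *\<^sub>R (v \<bullet> j) *\<^sub>R B i j)"
proof -
  have "B u v = B (\<Sum>i\<in>Basis. (u \<bullet> i) *\<^sub>R i) (\<Sum>j\<in>Basis. (v \<bullet> j) *\<^sub>R j)" by (simp add: euclidean_representation)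
  also have "\<dots> = (\<Sum>(i, j)\<in>Basis \<times> Basis. B ((u \<bullet> i) *\<^sub>R i) ((v \<bullet> j) *\<^sub>R j))" by (rule bilinear_sum[OF assms])
  also have "\<dots> = (\<Sum>i\<in>Basis. \<Sum>j\<in>Basis. (u \<bullet> i) *\<^sub>R (v \<bullet> j) *\<^sub>R B i j)"
    using assms by (simp add: sum.cartesian_product bilinear_lmul bilinear_rmul)
  finally show ?thesis .
qed

lemma bilinear_family_derivative_expand:
  fixes B :: "'p::real_normed_vector \<Rightarrow> 'e::euclidean_space \<Rightarrow> 'e \<Rightarrow> 'f::real_normed_vector"
  assumes W: "open W" "p \<in> W" and bil: "\<And>q. q \<in> W \<Longrightarrow> bilinear (B q)"
    and der: "\<And>u v. ((\<lambda>q. B q u v) has_derivative (\<lambda>h. B' h u v)) (at p)"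
  shows "B' h u v = (\<Sum>i\<in>Basis. \<Sum>j\<in>Basis. (u \<bullet> i) *\<^sub>R (v \<bullet> j) *\<^sub>R B' h i j)"
proof -
  have "((\<lambda>q. \<Sum>i\<in>Basis. \<Sum>j\<in>Basis. (u \<bullet> i) *\<^sub>R (v \<bullet> j) *\<^sub>R B q i j) has_derivative
      (\<lambda>h. \<Sum>i\<in>Basis. \<Sum>j\<in>Basis. (u \<bullet> i) *\<^sub>R (v \<bullet> j) *\<^sub>R B' h i j)) (at p)"
    by (intro has_derivative_sum has_derivative_scaleR_right der)
  then have "((\<lambda>q. B q u v) has_derivative
      (\<lambda>h. \<Sum>i\<in>Basis. \<Sum>j\<in>Basis. (u \<bullet> i) *\<^sub>R (v \<bullet> j) *\<^sub>R B' h i j)) (at p)"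
    by (rule has_derivative_transform_within_open[OF _ W]) (rule bilinear_expand[OF bil, symmetric])
  from has_derivative_unique[OF der[of u v] this] show ?thesis by metis
qed

lemma has_derivative_bilinear_family:
  fixes B :: "'p::real_normed_vector \<Rightarrow> 'e::euclidean_space \<Rightarrow> 'e \<Rightarrow> 'f::real_normed_vector"
    and y :: "'x::real_normed_vector \<Rightarrow> 'p"
  assumes W: "open W" "y x \<in> W" and bil: "\<And>q. q \<in> W \<Longrightarrow> bilinear (B q)"
    and der: "\<And>u v. ((\<lambda>q. B q u v) has_derivative (\<lambda>h. B' h u v)) (at (y x))" and y: "(y has_derivative y') (at x within S)"
    and U: "(U has_derivative U') (at x within S)" and V: "(V has_derivative V') (at x within S)" and x: "x \<in> S"
  shows "((\<lambda>s. B (y s) (U s) (V s)) has_derivative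
     (\<lambda>h. B' (y' h) (U x) (V x) + B (y x) (U' h) (V x) + B (y x) (U x) (V' h))) (at x within S)"
proof -
  have "((\<lambda>s. B (y s) i j) has_derivative (\<lambda>h. B' (y' h) i j)) (at x within S)" for i j
    using has_derivative_compose[OF y der[of i j]] .
  then have "((\<lambda>s. \<Sum>i\<in>Basis. \<Sum>j\<in>Basis. (U s \<bullet> i) *\<^sub>R (V s \<bullet> j) *\<^sub>R B (y s) i j) has_derivative
     (\<lambda>h. \<Sum>i\<in>Basis. \<Sum>j\<in>Basis. (U x \<bullet> i) *\<^sub>R ((V x \<bullet> j) *\<^sub>R B' (y' h) i j + (V' h \<bullet> j) *\<^sub>R B (y x) i j)
        + (U' h \<bullet> i) *\<^sub>R (V x \<bullet> j) *\<^sub>R B (y x) i j)) (at x within S)"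
    by (intro has_derivative_sum has_derivative_scaleR has_derivative_inner_left U V)
  also have "(\<lambda>h. \<Sum>i\<in>Basis. \<Sum>j\<in>Basis. (U x \<bullet> i) *\<^sub>R ((V x \<bullet> j) *\<^sub>R B' (y' h) i j + (V' h \<bullet> j) *\<^sub>R B (y x) i j)
        + (U' h \<bullet> i) *\<^sub>R (V x \<bullet> j) *\<^sub>R B (y x) i j) =
     (\<lambda>h. B' (y' h) (U x) (V x) + B (y x) (U' h) (V x) + B (y x) (U x) (V' h))" (is "?L = ?R")
  proof
    fix h
    show "?L h = ?R h" unfolding bilinear_family_derivative_expand[OF W bil der, of "y' h" "U x" "V x", simplified]
        bilinear_expand[OF bil[OF W(2)], of "U' h" "V x"] bilinear_expand[OF bil[OF W(2)], of "U x" "V' h"]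
      by (simp add: sum.distrib scaleR_add_right algebra_simps)
  qed
  finally have *: "((\<lambda>s. \<Sum>i\<in>Basis. \<Sum>j\<in>Basis. (U s \<bullet> i) *\<^sub>R (V s \<bullet> j) *\<^sub>R B (y s) i j) has_derivative ?R) (at x within S)" .
  have "(y \<longlongrightarrow> y x) (at x within S)" using has_derivative_continuous[OF y] by (simp add: continuous_within)
  then have "\<forall>\<^sub>F s in at x within S. y s \<in> W" using W by (rule topological_tendstoD)
  then have "\<forall>\<^sub>F s in at x within S. (\<Sum>i\<in>Basis. \<Sum>j\<in>Basis. (U s \<bullet> i) *\<^sub>R (V s \<bullet> j) *\<^sub>R B (y s) i j) = B (y s) (U s) (V s)"
    by eventually_elim (rule bilinear_expand[OF bil, symmetric])
  from has_derivative_transform_eventually[OF * this bilinear_expand[OF bil[OF W(2)], symmetric] x]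
  show ?thesis .
qed

lemma continuous_on_bilinear_family:
  fixes B :: "'p::topological_space \<Rightarrow> 'e::euclidean_space \<Rightarrow> 'e \<Rightarrow> 'f::real_normed_vector"
  assumes bil: "\<And>q. q \<in> W \<Longrightarrow> bilinear (B q)" and cont: "\<And>u v. continuous_on W (\<lambda>q. B q u v)"
    and y: "continuous_on S y" "y ` S \<subseteq> W" and U: "continuous_on S U" and V: "continuous_on S V"
  shows "continuous_on S (\<lambda>s. B (y s) (U s) (V s))"
proof -
  have "continuous_on S (\<lambda>s. \<Sum>i\<in>Basis. \<Sum>j\<in>Basis. (U s \<bullet> i) *\<^sub>R (V s \<bullet> j) *\<^sub>R B (y s) i j)"
    by (intro continuous_intros U V continuous_on_compose2[OF cont y])
  then show ?thesis by (rule continuous_on_eq) (rule bilinear_expand[OF bil, symmetric], use y(2) in auto)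
qed

lemma has_derivative_linear_family:
  fixes B :: "'p::real_normed_vector \<Rightarrow> 'e::euclidean_space \<Rightarrow> 'f::real_normed_vector"
  assumes W: "open W" "p \<in> W" and lin: "\<And>q. q \<in> W \<Longrightarrow> linear (B q)"
    and der: "\<And>u. ((\<lambda>q. B q u) has_derivative (\<lambda>h. B' h u)) (at p)"
  shows "linear (B' h)"
proof
  fix u v :: 'e and r :: real
  have "((\<lambda>q. B q u + B q v) has_derivative (\<lambda>h. B' h u + B' h v)) (at p)" by (intro has_derivative_add der)
  then have "((\<lambda>q. B q (u + v)) has_derivative (\<lambda>h. B' h u + B' h v)) (at p)"
    by (rule has_derivative_transform_within_open[OF _ W]) (simp add: linear_add[OF lin])
  from has_derivative_unique[OF der this] show "B' h (u + v) = B' h u + B' h v" by metis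
  have "((\<lambda>q. r *\<^sub>R B q u) has_derivative (\<lambda>h. r *\<^sub>R B' h u)) (at p)" by (intro has_derivative_scaleR_right der)
  then have "((\<lambda>q. B q (r *\<^sub>R u)) has_derivative (\<lambda>h. r *\<^sub>R B' h u)) (at p)"
    by (rule has_derivative_transform_within_open[OF _ W]) (simp add: linear_cmul[OF lin])
  from has_derivative_unique[OF der this] show "B' h (r *\<^sub>R u) = r *\<^sub>R B' h u" by metis
qed

lemma bilinear_derivative_family:
  fixes B :: "'p::real_normed_vector \<Rightarrow> 'e::euclidean_space \<Rightarrow> 'e \<Rightarrow> 'f::real_normed_vector"
  assumes W: "open W" "p \<in> W" and bil: "\<And>q. q \<in> W \<Longrightarrow> bilinear (B q)"
    and der: "\<And>u v. ((\<lambda>q. B q u v) has_derivative (\<lambda>h. B' h u v)) (at p)"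
  shows "bilinear (B' h)" unfolding bilinear_def
proof (intro conjI allI)
  show "linear (\<lambda>v. B' h u v)" for u
    by (rule has_derivative_linear_family[OF W, of "\<lambda>q. B q u"]) (use bil der in \<open>auto simp: bilinear_def\<close>)
  show "linear (\<lambda>u. B' h u v)" for v
    by (rule has_derivative_linear_family[OF W, of "\<lambda>q u. B q u v" "\<lambda>h u. B' h u v"]) (use bil der in \<open>auto simp: bilinear_def\<close>)
qed

section \<open>Inner products varying with a point\<close>

locale inner_product_family =
  fixes W :: "'e::euclidean_space set" and g :: "'e \<Rightarrow> 'e \<Rightarrow> 'e \<Rightarrow> real"
  assumes open_W: "open W" and bil: "p \<in> W \<Longrightarrow> bilinear (g p)" and sym: "p \<in> W \<Longrightarrow> g p u v = g p v u"
    and pos: "p \<in> W \<Longrightarrow> u \<noteq> 0 \<Longrightarrow> 0 < g p u u" and cont: "continuous_on W (\<lambda>p. g p u v)"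
begin

lemma lin: "p \<in> W \<Longrightarrow> linear (g p u)" "p \<in> W \<Longrightarrow> linear (\<lambda>u. g p u v)" using bil unfolding bilinear_def by auto

lemmas algebra = bilinear_ladd[OF bil] bilinear_radd[OF bil] bilinear_lmul[OF bil] bilinear_rmul[OF bil]
  bilinear_lneg[OF bil] bilinear_rneg[OF bil] bilinear_lzero[OF bil] bilinear_rzero[OF bil]
  bilinear_lsub[OF bil] bilinear_rsub[OF bil]

lemma nonneg: "p \<in> W \<Longrightarrow> 0 \<le> g p u u" using pos[of p u] algebra(7)[of p 0] by (cases "u = 0") (auto simp: less_imp_le)

lemma eq_0_iff: "p \<in> W \<Longrightarrow> g p u u = 0 \<longleftrightarrow> u = 0" using pos[of p u] algebra(7)[of p 0] by (cases "u = 0") auto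

lemma eqI: "p \<in> W \<Longrightarrow> (\<And>w. g p u w = g p v w) \<Longrightarrow> u = v" using eq_0_iff[of p "u - v"] by (simp add: algebra)

lemma cauchy_schwarz: assumes p: "p \<in> W" shows "(g p u v)^2 \<le> g p u u * g p v v"
proof (cases "v = 0")
  case True
  then show ?thesis using p by (simp add: algebra)
next
  case False
  then have v: "0 < g p v v" using pos p by blast
  define r where "r = g p u v / g p v v"
  have "0 \<le> g p (u - r *\<^sub>R v) (u - r *\<^sub>R v)" by (rule nonneg[OF p])
  also have "\<dots> = g p u u - 2 * r * g p u v + r * r * g p v v" using p sym[OF p, of v u] by (simp add: algebra algebra_simps)
  also have "\<dots> = g p u u - (g p u v)^2 / g p v v" unfolding r_def using v by (simp add: power2_eq_square)
  finally show ?thesis using v by (simp add: field_simps)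
qed

lemma local_bounds:
  assumes p: "p \<in> W" obtains r c where "0 < r" "0 < c" "cball p r \<subseteq> W"
    "\<And>q u. q \<in> cball p r \<Longrightarrow> c * (norm u)^2 \<le> g q u u"
proof -
  obtain r where r: "0 < r" "cball p r \<subseteq> W" using open_W p open_contains_cball by blast
  have "compact (cball p r \<times> sphere (0::'e) 1)" by (intro compact_Times) auto
  moreover have "continuous_on (cball p r \<times> sphere (0::'e) 1) (\<lambda>x. g (fst x) (snd x) (snd x))"
    by (rule continuous_on_bilinear_family[OF bil cont]) (use r in \<open>auto intro!: continuous_intros\<close>)
  moreover have "cball p r \<times> sphere (0::'e) 1 \<noteq> {}" using r by (simp add: sphere_eq_empty)
  ultimately obtain x where x: "x \<in> cball p r \<times> sphere (0::'e) 1"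
    "\<And>z. z \<in> cball p r \<times> sphere (0::'e) 1 \<Longrightarrow> g (fst x) (snd x) (snd x) \<le> g (fst z) (snd z) (snd z)"
    using continuous_attains_inf[of "cball p r \<times> sphere (0::'e) 1" "\<lambda>x. g (fst x) (snd x) (snd x)"] by auto
  have c: "0 < g (fst x) (snd x) (snd x)" using x(1) r by (intro pos) auto
  have "g (fst x) (snd x) (snd x) * (norm u)^2 \<le> g q u u" if q: "q \<in> cball p r" for q u
  proof (cases "u = 0")
    case True
    then show ?thesis using q r by (simp add: algebra subsetD)
  next
    case False
    have q': "q \<in> W" using q r by blast
    have "g (fst x) (snd x) (snd x) \<le> g q (u /\<^sub>R norm u) (u /\<^sub>R norm u)" using x(2)[of "(q, u /\<^sub>R norm u)"] q False by simp
    also have "\<dots> = g q u u / (norm u)^2" using q' by (simp add: algebra power2_eq_square divide_inverse)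
    finally show ?thesis using False by (simp add: field_simps)
  qed
  then show ?thesis using that r c by blast
qed

text \<open>The map \<open>T\<close> that expresses \<open>g p\<close> through the standard inner
  product is injective by definiteness, hence onto in finite dimension.\<close>

lemma represent:
  assumes p: "p \<in> W" and k: "linear k"
  shows "\<exists>!z. \<forall>w. g p z w = k w"
proof -
  define T where "T x = (\<Sum>b\<in>Basis. g p x b *\<^sub>R b)" for x
  have T: "T x \<bullet> w = g p x w" for x w
  proof -
    have "T x \<bullet> w = (\<Sum>b\<in>Basis. (w \<bullet> b) * g p x b)"
      unfolding T_def inner_sum_left by (intro sum.cong) (simp_all add: inner_commute)
    also have "\<dots> = g p x (\<Sum>b\<in>Basis. (w \<bullet> b) *\<^sub>R b)" by (simp add: linear_sum[OF lin(1)[OF p]] linear_cmul[OF lin(1)[OF p]])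
    finally show ?thesis by (simp add: euclidean_representation)
  qed
  have linT: "linear T"
    unfolding T_def by (rule linearI) (use p in \<open>simp_all add: algebra sum.distrib scaleR_sum_right scaleR_add_left\<close>)
  have "inj T" by (rule linear_injective_0[OF linT, THEN iffD2]) (use T eq_0_iff[OF p] in \<open>metis inner_zero_left\<close>)
  then have "surj T" using linear_injective_imp_surjective[OF linT] by blast
  then obtain z where z: "T z = (\<Sum>b\<in>Basis. k b *\<^sub>R b)" by (metis surjD)
  have "g p z w = k w" for w
  proof -
    have "g p z w = (\<Sum>b\<in>Basis. (w \<bullet> b) * k b)"
      unfolding T[of z w, symmetric] z inner_sum_left by (intro sum.cong) (simp_all add: inner_commute)
    also have "\<dots> = k (\<Sum>b\<in>Basis. (w \<bullet> b) *\<^sub>R b)" by (simp add: linear_sum[OF k] linear_cmul[OF k])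
    finally show ?thesis by (simp add: euclidean_representation)
  qed
  then show ?thesis using eqI[OF p] by metis
qed

lemma norm_represent_le:
  assumes q: "q \<in> W" and c: "0 < c" "\<And>u. c * (norm u)^2 \<le> g q u u" and k: "\<And>w. norm w \<le> 1 \<Longrightarrow> \<bar>g q z w\<bar> \<le> e"
  shows "c * norm z \<le> e"
proof (cases "z = 0")
  case True
  then show ?thesis using k[of 0] q by (simp add: algebra)
next
  case False
  have "c * norm z * norm z \<le> g q z z" using c(2)[of z] by (simp add: power2_eq_square algebra_simps)
  also have "\<dots> = norm z * g q z (z /\<^sub>R norm z)" using False q by (simp add: algebra)
  also have "\<dots> \<le> norm z * e" using k[of "z /\<^sub>R norm z"] False by (intro mult_left_mono) auto
  finally show ?thesis using False by simp
qed

lemma linear_le_sum_Basis: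
  fixes k :: "'e \<Rightarrow> real"
  assumes "linear k" "norm w \<le> 1"
  shows "\<bar>k w\<bar> \<le> (\<Sum>b\<in>Basis. \<bar>k b\<bar>)"
proof -
  have "k w = (\<Sum>b\<in>Basis. (w \<bullet> b) * k b)" using linear_sum[OF assms(1), of "\<lambda>b. (w \<bullet> b) *\<^sub>R b" Basis] linear_cmul[OF assms(1)]
    by (simp add: euclidean_representation)
  also have "\<bar>\<dots>\<bar> \<le> (\<Sum>b\<in>Basis. \<bar>(w \<bullet> b) * k b\<bar>)" by (rule sum_abs)
  also have "\<dots> \<le> (\<Sum>b\<in>Basis. \<bar>k b\<bar>)"
  proof (rule sum_mono)
    fix b :: 'e assume "b \<in> Basis"
    then have "\<bar>w \<bullet> b\<bar> \<le> 1" using Basis_le_norm[of b w] assms(2) by linarith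
    then show "\<bar>(w \<bullet> b) * k b\<bar> \<le> \<bar>k b\<bar>" unfolding abs_mult by (intro mult_left_le_one_le) auto
  qed
  finally show ?thesis .
qed

lemma continuous_represent:
  assumes z: "\<And>q w. q \<in> W \<Longrightarrow> g q (z q) w = k q w" and k: "\<And>w. continuous_on W (\<lambda>q. k q w)"
  shows "continuous_on W z" unfolding continuous_on_eq_continuous_at[OF open_W]
proof
  fix p assume p: "p \<in> W"
  obtain r c where rc: "0 < r" "0 < c" "cball p r \<subseteq> W" "\<And>q u. q \<in> cball p r \<Longrightarrow> c * (norm u)^2 \<le> g q u u"
    using local_bounds[OF p] by blast
  define f where "f q = (\<Sum>b\<in>Basis. \<bar>k q b - g q (z p) b\<bar>)" for q
  have "isCont f p"
    unfolding f_def using k cont p open_W by (intro continuous_intros) (auto simp: continuous_on_eq_continuous_at)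
  then have "(f \<longlongrightarrow> f p) (at p)" by (simp add: isCont_def)
  moreover have "f p = 0" unfolding f_def using z[OF p] by simp
  ultimately have f: "((\<lambda>q. f q / c) \<longlongrightarrow> 0) (at p)" using tendsto_divide[of f "f p" "at p" "\<lambda>_. c" c] rc by simp
  have near: "\<forall>\<^sub>F q in at p. q \<in> ball p r" using rc(1) by (intro eventually_at_in_open') auto
  have "\<forall>\<^sub>F q in at p. norm (z q - z p) \<le> f q / c" using near
  proof eventually_elim
    case (elim q)
    then have q: "q \<in> W" "q \<in> cball p r" using rc by auto
    have "c * norm (z q - z p) \<le> f q"
    proof (rule norm_represent_le[OF q(1) rc(2) rc(4)[OF q(2)]])
      fix w :: 'e assume "norm w \<le> 1"
      then show "\<bar>g q (z q - z p) w\<bar> \<le> f q"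
        unfolding f_def using linear_le_sum_Basis[OF lin(1)[OF q(1)], of w "z q - z p"] z[OF q(1)] q(1)
        by (simp add: algebra)
    qed
    then show ?case using rc(2) by (simp add: field_simps)
  qed
  then have "((\<lambda>q. z q - z p) \<longlongrightarrow> 0) (at p)" by (rule Lim_null_comparison[OF _ f])
  then show "isCont z p" unfolding isCont_def by (simp add: LIM_zero_iff)
qed

text \<open>Differentiates \<open>g q (z q) w = k q w\<close> without assuming that \<open>z\<close>
  is differentiable. The candidate \<open>z'\<close> comes from the product rule; the remainder,
  tested on basis vectors, is of lower order than \<open>q - p\<close>, and
  \<open>norm_represent_le\<close> turns this into a bound of its norm. The Christoffel symbols,
  given by a definite description, are differentiated in this way.\<close>

lemma has_derivative_represent:
  assumes z: "\<And>q w. q \<in> W \<Longrightarrow> g q (z q) w = k q w" and p: "p \<in> W" and k: "\<And>w. ((\<lambda>q. k q w) has_derivative (\<lambda>h. k' h w)) (at p)"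
    and g: "\<And>u v. ((\<lambda>q. g q u v) has_derivative (\<lambda>h. g' h u v)) (at p)" and z': "\<And>h w. g p (z' h) w = k' h w - g' h (z p) w"
  shows "(z has_derivative z') (at p)"
proof -
  obtain r c where rc: "0 < r" "0 < c" "cball p r \<subseteq> W" "\<And>q u. q \<in> cball p r \<Longrightarrow> c * (norm u)^2 \<le> g q u u"
    using local_bounds[OF p] by blast
  have z'lin: "linear z'"
  proof
    have klin: "linear (\<lambda>h. k' h w)" "linear (\<lambda>h. g' h u w)" for u w
      using has_derivative_linear[OF k] has_derivative_linear[OF g] by auto
    fix h h' :: 'e and s :: real
    show "z' (h + h') = z' h + z' h'"
      by (rule eqI[OF p]) (use z' linear_add[OF klin(1)] linear_add[OF klin(2)] p in \<open>simp add: algebra\<close>)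
    show "z' (s *\<^sub>R h) = s *\<^sub>R z' h"
      by (rule eqI[OF p]) (use z' linear_cmul[OF klin(1)] linear_cmul[OF klin(2)] p in \<open>simp add: algebra right_diff_distrib\<close>)
  qed
  define \<mu> where "\<mu> q w = k q w - g q (z p) w" for q w
  have \<mu>p: "\<mu> p w = 0" for w unfolding \<mu>_def using z[OF p] by simp
  define m where "m h w = k' h w - g' h (z p) w" for h w
  have \<mu>: "((\<lambda>q. \<mu> q w) has_derivative (\<lambda>h. m h w)) (at p)" for w unfolding \<mu>_def m_def by (intro has_derivative_diff k g)
  define R where "R q b = \<bar>\<mu> q b - m (q - p) b\<bar> / norm (q - p) + (\<Sum>i\<in>Basis. \<bar>g q (z' i) b - g p (z' i) b\<bar>)" for q b
  have Rlim: "((\<lambda>q. (\<Sum>b\<in>Basis. R q b) / c) \<longlongrightarrow> 0) (at p)"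
  proof -
    have 1: "((\<lambda>q. \<bar>\<mu> q b - m (q - p) b\<bar> / norm (q - p)) \<longlongrightarrow> 0) (at p)" for b
      using \<mu>[of b, unfolded has_derivative_iff_norm] \<mu>p by simp
    have 2: "((\<lambda>q. \<bar>g q (z' i) b - g p (z' i) b\<bar>) \<longlongrightarrow> 0) (at p)" for i b
    proof -
      have "((\<lambda>q. g q (z' i) b) \<longlongrightarrow> g p (z' i) b) (at p)"
        using cont p open_W by (auto simp: continuous_on_eq_continuous_at isCont_def)
      then show ?thesis using tendsto_rabs_zero LIM_zero by blast
    qed
    have "((\<lambda>q. R q b) \<longlongrightarrow> 0 + 0) (at p)" for b unfolding R_def by (intro tendsto_add 1 tendsto_null_sum 2)
    then have "((\<lambda>q. \<Sum>b\<in>Basis. R q b) \<longlongrightarrow> 0) (at p)" by (intro tendsto_null_sum) simp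
    then show ?thesis by (rule tendsto_divide_zero)
  qed
  have near: "\<forall>\<^sub>F q in at p. q \<in> ball p r" using rc(1) by (intro eventually_at_in_open') auto
  have ne: "\<forall>\<^sub>F q in at p. q \<noteq> p" by (simp add: eventually_neq_at_within)
  have "\<forall>\<^sub>F q in at p. norm (norm (z q - z p - z' (q - p)) / norm (q - p)) \<le> (\<Sum>b\<in>Basis. R q b) / c" using near ne
  proof eventually_elim
    case (elim q)
    then have q: "q \<in> W" "q \<in> cball p r" "0 < norm (q - p)" using rc by auto
    define x where "x = z q - z p - z' (q - p)"
    have gx: "g q x w = (\<mu> q w - m (q - p) w) - (g q (z' (q - p)) w - g p (z' (q - p)) w)" for w
      unfolding x_def \<mu>_def m_def using z[OF q(1)] z' q(1) by (simp add: algebra)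
    have "\<bar>g q x b\<bar> \<le> norm (q - p) * R q b" for b
    proof -
      have e: "z' (q - p) = (\<Sum>i\<in>Basis. ((q - p) \<bullet> i) *\<^sub>R z' i)"
        using linear_sum[OF z'lin, of "\<lambda>i. ((q - p) \<bullet> i) *\<^sub>R i" Basis] linear_cmul[OF z'lin]
        by (simp add: euclidean_representation)
      have "g s (z' (q - p)) b = (\<Sum>i\<in>Basis. ((q - p) \<bullet> i) * g s (z' i) b)" if "s \<in> W" for s
        unfolding e by (simp add: linear_sum[OF lin(2)[OF that]] linear_cmul[OF lin(2)[OF that]])
      then have "\<bar>g q (z' (q - p)) b - g p (z' (q - p)) b\<bar> = \<bar>\<Sum>i\<in>Basis. ((q - p) \<bullet> i) * (g q (z' i) b - g p (z' i) b)\<bar>"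
        using p q by (simp add: sum_subtractf right_diff_distrib)
      also have "\<dots> \<le> (\<Sum>i\<in>Basis. \<bar>((q - p) \<bullet> i) * (g q (z' i) b - g p (z' i) b)\<bar>)" by (rule sum_abs)
      also have "\<dots> \<le> (\<Sum>i\<in>Basis. norm (q - p) * \<bar>g q (z' i) b - g p (z' i) b\<bar>)"
        unfolding abs_mult by (intro sum_mono mult_right_mono Basis_le_norm) auto
      finally have "\<bar>g q (z' (q - p)) b - g p (z' (q - p)) b\<bar> \<le> norm (q - p) * (\<Sum>i\<in>Basis. \<bar>g q (z' i) b - g p (z' i) b\<bar>)"
        by (simp add: sum_distrib_left)
      then have "\<bar>g q x b\<bar> \<le> \<bar>\<mu> q b - m (q - p) b\<bar> + norm (q - p) * (\<Sum>i\<in>Basis. \<bar>g q (z' i) b - g p (z' i) b\<bar>)"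
        unfolding gx by linarith
      then show ?thesis unfolding R_def using q(3) by (simp add: distrib_left)
    qed
    then have "(\<Sum>b\<in>Basis. \<bar>g q x b\<bar>) \<le> norm (q - p) * (\<Sum>b\<in>Basis. R q b)" unfolding sum_distrib_left by (intro sum_mono)
    then have "c * norm x \<le> norm (q - p) * (\<Sum>b\<in>Basis. R q b)"
      using norm_represent_le[OF q(1) rc(2) rc(4)[OF q(2)], of x "norm (q - p) * (\<Sum>b\<in>Basis. R q b)"]
        linear_le_sum_Basis[OF lin(1)[OF q(1)], of _ x] by (meson order_trans)
    then show ?case unfolding x_def[symmetric] using rc(2) q(3) by (simp add: field_simps)
  qed
  then have "((\<lambda>q. norm (z q - z p - z' (q - p)) / norm (q - p)) \<longlongrightarrow> 0) (at p)" by (rule Lim_null_comparison[OF _ Rlim])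
  then show ?thesis unfolding has_derivative_iff_norm using z'lin linear_conv_bounded_linear by blast
qed

end

lemma has_vector_derivative_bilinear_family:
  fixes B :: "'p::real_normed_vector \<Rightarrow> 'e::euclidean_space \<Rightarrow> 'e \<Rightarrow> 'f::real_normed_vector"
  assumes W: "open W" "y t \<in> W" and bil: "\<And>q. q \<in> W \<Longrightarrow> bilinear (B q)"
    and der: "\<And>u v. ((\<lambda>q. B q u v) has_derivative (\<lambda>h. B' h u v)) (at (y t))"
    and y: "(y has_vector_derivative w) (at t within S)" and U: "(U has_vector_derivative U') (at t within S)"
    and V: "(V has_vector_derivative V') (at t within S)" and t: "t \<in> S"
  shows "((\<lambda>s. B (y s) (U s) (V s)) has_vector_derivative
     (B' w (U t) (V t) + B (y t) U' (V t) + B (y t) (U t) V')) (at t within S)"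
proof -
  have *: "((\<lambda>s. B (y s) (U s) (V s)) has_derivative
     (\<lambda>h. B' (h *\<^sub>R w) (U t) (V t) + B (y t) (h *\<^sub>R U') (V t) + B (y t) (U t) (h *\<^sub>R V'))) (at t within S)"
    by (rule has_derivative_bilinear_family[where y = y and x = t and B = B and B' = B' and U = U and V = V, OF W bil der _ _ _ t])
      (use y U V in \<open>auto simp: has_vector_derivative_def\<close>)
  have "B' (h *\<^sub>R w) (U t) (V t) = h *\<^sub>R B' w (U t) (V t)" for h using linear_cmul[OF has_derivative_linear[OF der]] .
  then have "(\<lambda>h. B' (h *\<^sub>R w) (U t) (V t) + B (y t) (h *\<^sub>R U') (V t) + B (y t) (U t) (h *\<^sub>R V'))
    = (\<lambda>h. h *\<^sub>R (B' w (U t) (V t) + B (y t) U' (V t) + B (y t) (U t) V'))"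
    by (simp add: bilinear_lmul[OF bil[OF W(2)]] bilinear_rmul[OF bil[OF W(2)]] scaleR_add_right)
  then show ?thesis using * unfolding has_vector_derivative_def by simp
qed

lemma tendsto_bilinear_family:
  fixes B :: "'p::t2_space \<Rightarrow> 'e::euclidean_space \<Rightarrow> 'e \<Rightarrow> 'f::real_normed_vector"
  assumes W: "open W" "y0 \<in> W" and bil: "\<And>q. q \<in> W \<Longrightarrow> bilinear (B q)" and cont: "\<And>u v. continuous_on W (\<lambda>q. B q u v)"
    and y: "(y \<longlongrightarrow> y0) F" and U: "(U \<longlongrightarrow> U0) F" and V: "(V \<longlongrightarrow> V0) F"
  shows "((\<lambda>s. B (y s) (U s) (V s)) \<longlongrightarrow> B y0 U0 V0) F"
proof -
  have "isCont (\<lambda>q. B q i j) y0" for i j using cont W continuous_on_eq_continuous_at by blast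
  then have "((\<lambda>s. B (y s) i j) \<longlongrightarrow> B y0 i j) F" for i j using isCont_tendsto_compose y by blast
  then have "((\<lambda>s. \<Sum>i\<in>Basis. \<Sum>j\<in>Basis. (U s \<bullet> i) *\<^sub>R (V s \<bullet> j) *\<^sub>R B (y s) i j) \<longlongrightarrow>
      (\<Sum>i\<in>Basis. \<Sum>j\<in>Basis. (U0 \<bullet> i) *\<^sub>R (V0 \<bullet> j) *\<^sub>R B y0 i j)) F" by (intro tendsto_intros U V)
  moreover have "\<forall>\<^sub>F s in F. y s \<in> W" using y W by (rule topological_tendstoD)
  then have *: "\<forall>\<^sub>F s in F. (\<Sum>i\<in>Basis. \<Sum>j\<in>Basis. (U s \<bullet> i) *\<^sub>R (V s \<bullet> j) *\<^sub>R B (y s) i j) = B (y s) (U s) (V s)"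
    by eventually_elim (rule bilinear_expand[OF bil, symmetric])
  ultimately show ?thesis using tendsto_cong[OF *] bilinear_expand[OF bil[OF W(2)], of U0 V0] by simp
qed

lemma second_derivative_nonneg_le_chord:
  fixes f :: "real \<Rightarrow> real"
  assumes ab: "a < t" "t < b" and cont: "continuous_on {a..b} f"
    and f': "\<And>x. a < x \<Longrightarrow> x < b \<Longrightarrow> (f has_real_derivative f' x) (at x)"
    and f'': "\<And>x. a < x \<Longrightarrow> x < b \<Longrightarrow> (f' has_real_derivative f'' x) (at x)" and nonneg: "\<And>x. a < x \<Longrightarrow> x < b \<Longrightarrow> 0 \<le> f'' x"
  shows "(b - a) * f t \<le> (b - t) * f a + (t - a) * f b"
proof -
  have d: "f differentiable (at x)" if "a < x" "x < b" for x unfolding real_differentiable_def using f'[OF that] by blast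
  have "\<exists>l z. z > a \<and> z < t \<and> DERIV f z :> l \<and> f t - f a = (t - a) * l"
    by (rule MVT[OF ab(1)]) (use ab d in \<open>auto intro: continuous_on_subset[OF cont]\<close>)
  then obtain l z where z: "a < z" "z < t" "DERIV f z :> l" "f t - f a = (t - a) * l" by blast
  have "\<exists>l z. z > t \<and> z < b \<and> DERIV f z :> l \<and> f b - f t = (b - t) * l"
    by (rule MVT[OF ab(2)]) (use ab d in \<open>auto intro: continuous_on_subset[OF cont]\<close>)
  then obtain l' z' where z': "t < z'" "z' < b" "DERIV f z' :> l'" "f b - f t = (b - t) * l'" by blast
  have l: "l = f' z" "l' = f' z'" using z z' ab f'[of z] f'[of z'] by (auto intro: DERIV_unique)
  have "f' z \<le> f' z'"
  proof (rule DERIV_nonneg_imp_nondecreasing[of z z' f'])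
    show "z \<le> z'" using z z' by simp
    show "\<exists>y. DERIV f' x :> y \<and> 0 \<le> y" if "z \<le> x" "x \<le> z'" for x using f''[of x] nonneg[of x] z z' that by auto
  qed
  then have "(b - t) * ((t - a) * f' z) \<le> (t - a) * ((b - t) * f' z')"
    using ab by (simp add: mult.left_commute mult_left_mono)
  then show ?thesis unfolding l[symmetric] z(4)[symmetric] z'(4)[symmetric] by (simp add: algebra_simps)
qed

section \<open>The geometry of a metric of nonpositive curvature in coordinates\<close>

lemma smooth_on_differentiable: "smooth_on S f \<Longrightarrow> x \<in> S \<Longrightarrow> f differentiable (at x)"
  unfolding smooth_on_def using Ck_on.simps(2)[of 0 S f] by blast

lemma smooth_on_frechet: "smooth_on S f \<Longrightarrow> smooth_on S (\<lambda>x. frechet_derivative f (at x) v)"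
  unfolding smooth_on_def using Ck_on.simps(2)[of _ S f] by blast

lemma smooth_on_continuous: "smooth_on S f \<Longrightarrow> continuous_on S f" unfolding smooth_on_def using Ck_on.simps(1)[of S f] by blast

locale coordinate_metric =
  fixes c :: "('a, 'e::euclidean_space) chart" and g :: "('a, 'e) metric_tensor" and W :: "'e set"
  assumes open_domain: "open W" and bilinear_metric: "p \<in> W \<Longrightarrow> bilinear (g c p)"
    and sym_metric: "p \<in> W \<Longrightarrow> g c p u v = g c p v u" and pos_metric: "p \<in> W \<Longrightarrow> u \<noteq> 0 \<Longrightarrow> 0 < g c p u u"
    and smooth_metric: "smooth_on W (\<lambda>p. g c p u v)"
    and sectional_nonpos: "p \<in> W \<Longrightarrow> u \<noteq> v \<Longrightarrow> independent {u, v} \<Longrightarrow> sectional_curvature g c p u v \<le> 0"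
begin

sublocale inner_product_family W "g c"
  by standard (use open_domain bilinear_metric sym_metric pos_metric smooth_on_continuous[OF smooth_metric] in auto)

definition dg :: "'e \<Rightarrow> 'e \<Rightarrow> 'e \<Rightarrow> 'e \<Rightarrow> real" where
  "dg p h u v = frechet_derivative (\<lambda>q. g c q u v) (at p) h"

definition ddg :: "'e \<Rightarrow> 'e \<Rightarrow> 'e \<Rightarrow> 'e \<Rightarrow> 'e \<Rightarrow> real" where
  "ddg p h k u v = frechet_derivative (\<lambda>q. dg q k u v) (at p) h"

abbreviation \<Gamma> :: "'e \<Rightarrow> 'e \<Rightarrow> 'e \<Rightarrow> 'e" where "\<Gamma> \<equiv> christoffel g c"

definition d\<Gamma> :: "'e \<Rightarrow> 'e \<Rightarrow> 'e \<Rightarrow> 'e \<Rightarrow> 'e" where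
  "d\<Gamma> p h u v = frechet_derivative (\<lambda>q. \<Gamma> q u v) (at p) h"

lemma dg: "p \<in> W \<Longrightarrow> ((\<lambda>q. g c q u v) has_derivative (\<lambda>h. dg p h u v)) (at p)"
  unfolding dg_def using smooth_on_differentiable[OF smooth_metric] frechet_derivative_works by blast

lemma smooth_dg: "smooth_on W (\<lambda>p. dg p h u v)" unfolding dg_def by (rule smooth_on_frechet[OF smooth_metric])

lemma ddg: "p \<in> W \<Longrightarrow> ((\<lambda>q. dg q k u v) has_derivative (\<lambda>h. ddg p h k u v)) (at p)"
  unfolding ddg_def using smooth_on_differentiable[OF smooth_dg] frechet_derivative_works by blast

lemma cont_ddg: "continuous_on W (\<lambda>p. ddg p h k u v)"
  unfolding ddg_def by (intro smooth_on_continuous smooth_on_frechet smooth_dg)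

lemma cont_dg: "continuous_on W (\<lambda>p. dg p h u v)" by (rule smooth_on_continuous[OF smooth_dg])

lemma bilinear_dg: "p \<in> W \<Longrightarrow> bilinear (dg p h)" using bilinear_derivative_family[OF open_W _ bil dg] .

lemma linear_dg: "p \<in> W \<Longrightarrow> linear (\<lambda>h. dg p h u v)" using has_derivative_linear[OF dg] .

lemma bilinear_ddg: "p \<in> W \<Longrightarrow> bilinear (ddg p h k)" by (rule bilinear_derivative_family[OF open_W _ bilinear_dg ddg])

lemma linear_ddg: "p \<in> W \<Longrightarrow> linear (\<lambda>k. ddg p h k u v)" by (rule has_derivative_linear_family[OF open_W _ linear_dg ddg])

lemma sym_dg: assumes p: "p \<in> W" shows "dg p h u v = dg p h v u"
proof -
  have "((\<lambda>q. g c q u v) has_derivative (\<lambda>h. dg p h v u)) (at p)"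
    by (rule has_derivative_transform_within_open[OF dg[OF p, of v u] open_W p]) (rule sym)
  from has_derivative_unique[OF dg[OF p, of u v] this] show ?thesis by metis
qed

lemmas dg_algebra = linear_add[OF linear_dg] linear_cmul[OF linear_dg] bilinear_ladd[OF bilinear_dg]
  bilinear_radd[OF bilinear_dg] bilinear_lmul[OF bilinear_dg] bilinear_rmul[OF bilinear_dg]

lemmas ddg_algebra = linear_add[OF linear_ddg] linear_cmul[OF linear_ddg] bilinear_ladd[OF bilinear_ddg]
  bilinear_radd[OF bilinear_ddg] bilinear_lmul[OF bilinear_ddg] bilinear_rmul[OF bilinear_ddg]

lemma christoffel:
  assumes p: "p \<in> W"
  shows "g c p (\<Gamma> p u v) w = (dg p u v w + dg p v u w - dg p w u v) / 2"
proof -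
  have "linear (\<lambda>w. (dg p u v w + dg p v u w - dg p w u v) / 2)"
    by (rule linearI) (simp_all add: dg_algebra[OF p] field_simps)
  from theI'[OF represent[OF p this]] show ?thesis unfolding christoffel_def Let_def dg_def by blast
qed

lemma bilinear_christoffel: assumes p: "p \<in> W" shows "bilinear (\<Gamma> p)" unfolding bilinear_def
  by (intro conjI allI linearI; rule eqI[OF p])
    (simp_all add: algebra[OF p] christoffel[OF p] dg_algebra[OF p] field_simps)

lemma sym_christoffel: assumes p: "p \<in> W" shows "\<Gamma> p u v = \<Gamma> p v u"
  by (rule eqI[OF p]) (simp add: christoffel[OF p] sym_dg[OF p, of _ u v])

lemma metric_compatible:
  assumes p: "p \<in> W"
  shows "dg p h u v = g c p (\<Gamma> p h u) v + g c p u (\<Gamma> p h v)" unfolding sym[OF p, of u] christoffel[OF p]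
  by (simp add: sym_dg[OF p, of u h v] sym_dg[OF p, of v h u] sym_dg[OF p, of h v u] field_simps)

lemma christoffel_derivative:
  assumes p: "p \<in> W"
  shows "((\<lambda>q. \<Gamma> q u v) has_derivative (\<lambda>h. d\<Gamma> p h u v)) (at p)"
    and "g c p (d\<Gamma> p h u v) w = (ddg p h u v w + ddg p h v u w - ddg p h w u v) / 2 - dg p h (\<Gamma> p u v) w"
proof -
  define k where "k h w = (ddg p h u v w + ddg p h v u w - ddg p h w u v) / 2" for h w
  have "\<exists>!z. \<forall>w. g c p z w = k h w - dg p h (\<Gamma> p u v) w" for h unfolding k_def
    by (rule represent[OF p], rule linearI) (simp_all add: dg_algebra[OF p] ddg_algebra[OF p] field_simps)
  then obtain z' where z': "\<And>h w. g c p (z' h) w = k h w - dg p h (\<Gamma> p u v) w" by metis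
  have "((\<lambda>q. (dg q u v w + dg q v u w - dg q w u v) / 2) has_derivative (\<lambda>h. k h w)) (at p)" for w
    unfolding k_def by (auto intro!: derivative_eq_intros ddg[OF p])
  then have *: "((\<lambda>q. \<Gamma> q u v) has_derivative z') (at p)" using has_derivative_represent[where z = "\<lambda>q. \<Gamma> q u v" and z' = z'
        and k = "\<lambda>q w. (dg q u v w + dg q v u w - dg q w u v) / 2" and k' = k and g' = "dg p"]
      christoffel p dg[OF p] z' by blast
  then have "z' = (\<lambda>h. d\<Gamma> p h u v)" unfolding d\<Gamma>_def using frechet_derivative_at by metis
  then show "((\<lambda>q. \<Gamma> q u v) has_derivative (\<lambda>h. d\<Gamma> p h u v)) (at p)"
    "g c p (d\<Gamma> p h u v) w = (ddg p h u v w + ddg p h v u w - ddg p h w u v) / 2 - dg p h (\<Gamma> p u v) w"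
    using * z'[of h w] unfolding k_def by auto
qed

lemma cont_christoffel: "continuous_on W (\<lambda>p. \<Gamma> p u v)"
  by (intro continuous_at_imp_continuous_on ballI has_derivative_continuous[OF christoffel_derivative(1)])

lemma cont_d\<Gamma>: "continuous_on W (\<lambda>p. d\<Gamma> p h u v)"
proof (rule continuous_represent[OF christoffel_derivative(2)])
  have "continuous_on W (\<lambda>p. dg p h (\<Gamma> p u v) w)" for w
    by (rule continuous_on_bilinear_family[where y = "\<lambda>p. p", OF bilinear_dg cont_dg])
      (auto intro: cont_christoffel continuous_intros)
  then show "continuous_on W
     (\<lambda>p. (ddg p h u v w + ddg p h v u w - ddg p h w u v) / 2 - dg p h (\<Gamma> p u v) w)" for w
    by (intro continuous_intros cont_ddg) auto
qed

lemma bilinear_d\<Gamma>: "p \<in> W \<Longrightarrow> bilinear (d\<Gamma> p h)"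
  by (rule bilinear_derivative_family[OF open_W _ bilinear_christoffel christoffel_derivative(1)])

lemma linear_d\<Gamma>: "p \<in> W \<Longrightarrow> linear (\<lambda>h. d\<Gamma> p h u v)" using has_derivative_linear[OF christoffel_derivative(1)] .

lemmas \<Gamma>_algebra = bilinear_ladd[OF bilinear_christoffel] bilinear_radd[OF bilinear_christoffel]
  bilinear_lmul[OF bilinear_christoffel] bilinear_rmul[OF bilinear_christoffel]
  bilinear_lneg[OF bilinear_christoffel] bilinear_rneg[OF bilinear_christoffel]
  bilinear_lzero[OF bilinear_christoffel] bilinear_rzero[OF bilinear_christoffel]
  bilinear_lsub[OF bilinear_christoffel] bilinear_rsub[OF bilinear_christoffel]

lemma riemann_curvature_eq:
  "riemann_curvature g c p u v w =
     d\<Gamma> p u v w - d\<Gamma> p v u w + \<Gamma> p u (\<Gamma> p v w) - \<Gamma> p v (\<Gamma> p u w)" unfolding riemann_curvature_def Let_def d\<Gamma>_def ..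

lemma strict_cauchy_schwarz:
  assumes p: "p \<in> W" and v: "v \<noteq> 0" and "\<And>r. u \<noteq> r *\<^sub>R v"
  shows "0 < g c p u u * g c p v v - (g c p u v)^2"
proof -
  have vv: "0 < g c p v v" using pos p v by blast
  define r where "r = g c p u v / g c p v v"
  have "0 < g c p (u - r *\<^sub>R v) (u - r *\<^sub>R v)" using assms(3) by (intro pos[OF p]) auto
  also have "\<dots> = g c p u u - 2 * r * g c p u v + r * r * g c p v v"
    using p sym[OF p, of v u] by (simp add: algebra algebra_simps)
  also have "\<dots> = g c p u u - (g c p u v)^2 / g c p v v" unfolding r_def using vv by (simp add: power2_eq_square)
  finally show ?thesis using vv by (simp add: field_simps)
qed

text \<open>For independent vectors this is minus the sectional curvature times the positive Gram
  determinant, the sign coming from antisymmetry in the first two arguments. For dependent vectors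
  the curvature term vanishes.\<close>

lemma curvature_term_nonneg:
  assumes p: "p \<in> W"
  shows "0 \<le> g c p (riemann_curvature g c p w u w) u"
proof (cases "w = 0 \<or> (\<exists>r. u = r *\<^sub>R w)")
  case True
  then have "riemann_curvature g c p w u w = 0"
  proof
    assume "w = 0"
    then show ?thesis unfolding riemann_curvature_eq using linear_0[OF linear_d\<Gamma>[OF p]]
      by (simp add: \<Gamma>_algebra[OF p] bilinear_rzero[OF bilinear_d\<Gamma>[OF p]])
  next
    assume "\<exists>r. u = r *\<^sub>R w"
    then show ?thesis unfolding riemann_curvature_eq using linear_cmul[OF linear_d\<Gamma>[OF p]]
      by (auto simp: \<Gamma>_algebra[OF p] bilinear_lmul[OF bilinear_d\<Gamma>[OF p]])
  qed
  then show ?thesis by (simp add: algebra p)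
next
  case False
  then have w: "w \<noteq> 0" and r: "\<And>r. u \<noteq> r *\<^sub>R w" by auto
  have "u \<noteq> w" using r[of 1] by auto
  moreover have "independent {u, w}" using w r by (simp add: independent_insert span_singleton image_iff)
  ultimately have "sectional_curvature g c p u w \<le> 0" using sectional_nonpos p by blast
  then have "g c p (riemann_curvature g c p u w w) u \<le> 0"
    using strict_cauchy_schwarz[OF p w r] unfolding sectional_curvature_def by (simp add: divide_le_0_iff)
  moreover have "riemann_curvature g c p w u w = - riemann_curvature g c p u w w" unfolding riemann_curvature_eq by simp
  ultimately show ?thesis by (simp add: algebra p)
qed

section \<open>Geodesics and Jacobi fields in coordinates\<close>

text \<open>The product rule for a metric connection: \<open>U' + \<Gamma> (y t) w (U t)\<close> is
  the covariant derivative of \<open>U\<close> along \<open>y\<close>.\<close>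

lemma geodesic_derivative_metric:
  assumes y: "y t \<in> W" "(y has_vector_derivative w) (at t within S)"
    and U: "(U has_vector_derivative U') (at t within S)" and V: "(V has_vector_derivative V') (at t within S)"
    and t: "t \<in> S"
  shows "((\<lambda>s. g c (y s) (U s) (V s)) has_vector_derivative
    g c (y t) (U' + \<Gamma> (y t) w (U t)) (V t) + g c (y t) (U t) (V' + \<Gamma> (y t) w (V t))) (at t within S)"
  using has_vector_derivative_bilinear_family[OF open_W y(1) bil dg[OF y(1)] y(2) U V t] unfolding metric_compatible[OF y(1)]
  by (rule has_vector_derivative_eq_rhs) (simp_all add: algebra[OF y(1)])

lemma geodesic_speed_constant:
  assumes y: "\<And>t. t \<in> {0..T} \<Longrightarrow> y t \<in> W"
    "\<And>t. t \<in> {0..T} \<Longrightarrow> (y has_vector_derivative w t) (at t within {0..T})"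
    "\<And>t. t \<in> {0..T} \<Longrightarrow> (w has_vector_derivative - \<Gamma> (y t) (w t) (w t)) (at t within {0..T})" and t: "t \<in> {0..T}"
  shows "g c (y t) (w t) (w t) = g c (y 0) (w 0) (w 0)"
proof -
  have "((\<lambda>s. g c (y s) (w s) (w s)) has_vector_derivative 0) (at t within {0..T})" if t: "t \<in> {0..T}" for t
    using geodesic_derivative_metric[where y = y, OF y(1)[OF t] y(2)[OF t] y(3)[OF t] y(3)[OF t] t]
    by (rule has_vector_derivative_eq_rhs) (simp add: algebra[OF y(1)[OF t]])
  then obtain k where "\<And>t. t \<in> {0..T} \<Longrightarrow> g c (y t) (w t) (w t) = k"
    using has_vector_derivative_zero_constant[of "{0..T}" "\<lambda>s. g c (y s) (w s) (w s)"] by auto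
  then show ?thesis using t by simp
qed

text \<open>The norm of a Jacobi field along a geodesic is convex; where the field vanishes the norm is not
  differentiable, so it is approximated by \<open>t \<mapsto> sqrt (g(J, J) + \<epsilon>)\<close>.\<close>

lemma jacobi_field_expands:
  assumes T: "0 < T" and y: "\<And>t. t \<in> {0..T} \<Longrightarrow> y t \<in> W"
    "\<And>t. t \<in> {0..T} \<Longrightarrow> (y has_vector_derivative w t) (at t within {0..T})"
    "\<And>t. t \<in> {0..T} \<Longrightarrow> (w has_vector_derivative - \<Gamma> (y t) (w t) (w t)) (at t within {0..T})"
    and J: "\<And>t. t \<in> {0..T} \<Longrightarrow> (J has_vector_derivative J' t) (at t within {0..T})"
    "\<And>t. t \<in> {0..T} \<Longrightarrow> (J' has_vector_derivative
        - (d\<Gamma> (y t) (J t) (w t) (w t) + \<Gamma> (y t) (J' t) (w t) + \<Gamma> (y t) (w t) (J' t))) (at t within {0..T})" and J0: "J 0 = 0"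
  shows "T^2 * g c (y 0) (J' 0) (J' 0) \<le> g c (y T) (J T) (J T)"
proof -
  \<comment> \<open>The covariant derivative of \<open>J\<close>. In terms of it the linearized
    geodesic equation becomes the Jacobi equation: the derivatives of the Christoffel symbols
    combine into the curvature term \<open>R\<close>.\<close>
  define X where "X t = J' t + \<Gamma> (y t) (w t) (J t)" for t
  define R where "R t = riemann_curvature g c (y t) (w t) (J t) (w t)" for t
  have X: "(X has_vector_derivative R t - \<Gamma> (y t) (w t) (X t)) (at t within {0..T})" if t: "t \<in> {0..T}" for t
  proof -
    note yt = y(1)[OF t]
    have "((\<lambda>s. J' s + \<Gamma> (y s) (w s) (J s)) has_vector_derivative
      - (d\<Gamma> (y t) (J t) (w t) (w t) + \<Gamma> (y t) (J' t) (w t) + \<Gamma> (y t) (w t) (J' t))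
      + (d\<Gamma> (y t) (w t) (w t) (J t) + \<Gamma> (y t) (- \<Gamma> (y t) (w t) (w t)) (J t) + \<Gamma> (y t) (w t) (J' t)))
      (at t within {0..T})" by (intro has_vector_derivative_add J(2)[OF t]
        has_vector_derivative_bilinear_family[OF open_W yt bilinear_christoffel christoffel_derivative(1)[OF yt]
          y(2)[OF t] y(3)[OF t] J(1)[OF t] t])
    moreover have "d\<Gamma> (y t) (w t) (w t) (J t) = d\<Gamma> (y t) (w t) (J t) (w t)"
    proof -
      have "((\<lambda>q. \<Gamma> q (w t) (J t)) has_derivative (\<lambda>h. d\<Gamma> (y t) h (J t) (w t))) (at (y t))"
        by (rule has_derivative_transform_within_open[OF christoffel_derivative(1)[OF yt, of "J t" "w t"] open_W yt])
          (rule sym_christoffel)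
      from has_derivative_unique[OF christoffel_derivative(1)[OF yt, of "w t" "J t"] this] show ?thesis by metis
    qed
    ultimately show ?thesis unfolding X_def R_def riemann_curvature_eq
      by (simp add: \<Gamma>_algebra[OF yt] sym_christoffel[OF yt, of "J' t"] sym_christoffel[OF yt, of "\<Gamma> (y t) (w t) (w t)"]
          sym_christoffel[OF yt, of "J t" "w t"] algebra_simps)
  qed
  define q where "q t = g c (y t) (J t) (J t)" for t
  define P where "P t = g c (y t) (X t) (J t)" for t
  define Q where "Q t = g c (y t) (R t) (J t) + g c (y t) (X t) (X t)" for t
  have q': "(q has_vector_derivative 2 * P t) (at t within {0..T})" if t: "t \<in> {0..T}" for t
    using geodesic_derivative_metric[where y = y, OF y(1)[OF t] y(2)[OF t] J(1)[OF t] J(1)[OF t] t]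
    unfolding q_def P_def X_def by (rule has_vector_derivative_eq_rhs) (simp add: sym[OF y(1)[OF t], of "J t"])
  have P': "(P has_vector_derivative Q t) (at t within {0..T})" if t: "t \<in> {0..T}" for t
    using geodesic_derivative_metric[where y = y, OF y(1)[OF t] y(2)[OF t] X[OF t] J(1)[OF t] t]
    unfolding P_def Q_def by (rule has_vector_derivative_eq_rhs) (simp add: X_def)
  have interior: "(f has_real_derivative f') (at t)"
    if "(f has_vector_derivative f') (at t within {0..T})" "0 < t" "t < T" for f f' t
  proof -
    have "at t within {0..T} = at t" using that(2,3) by (intro at_within_interior) (simp add: interior_atLeastAtMost_real)
    then show ?thesis using that(1) by (simp add: has_real_derivative_iff_has_vector_derivative)
  qed
  have q0: "0 \<le> q t" if "t \<in> {0..T}" for t unfolding q_def using nonneg y(1) that by blast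
  \<comment> \<open>With \<open>q = g(J, J)\<close>, \<open>P = q' / 2\<close> and
    \<open>Q = P'\<close>, the difference of the two sides is the numerator of the second derivative
    of \<open>sqrt q\<close>. The curvature term in \<open>Q\<close> has the favourable sign, and
    the rest is the Cauchy-Schwarz inequality.\<close>
  have PQ: "(P t)^2 \<le> q t * Q t" if t: "t \<in> {0..T}" for t
  proof -
    have "(P t)^2 \<le> g c (y t) (X t) (X t) * q t" unfolding P_def q_def by (rule cauchy_schwarz[OF y(1)[OF t]])
    also have "\<dots> \<le> Q t * q t"
      unfolding Q_def R_def using curvature_term_nonneg[OF y(1)[OF t]] q0[OF t] by (intro mult_right_mono) auto
    finally show ?thesis by (simp add: mult.commute)
  qed
  have Q0: "0 \<le> Q t" if t: "t \<in> {0..T}" for t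
    unfolding Q_def R_def using curvature_term_nonneg[OF y(1)[OF t]] nonneg[OF y(1)[OF t]] by simp
  have qc: "continuous_on {0..T} q" by (rule continuous_on_vector_derivative[OF q'])
  have approx: "T * sqrt (q s + \<eta>) \<le> (T - s) * sqrt (q 0 + \<eta>) + s * sqrt (q T + \<eta>)"
    if s: "0 < s" "s < T" and \<eta>: "0 < \<eta>" for s \<eta>
  proof -
    define f where "f = (\<lambda>t. sqrt (q t + \<eta>))"
    have "(T - 0) * f s \<le> (T - s) * f 0 + (s - 0) * f T"
    proof (rule second_derivative_nonneg_le_chord[OF s])
      show "continuous_on {0..T} f" unfolding f_def by (intro continuous_intros qc)
      fix t assume t: "0 < t" "t < T"
      then have t': "t \<in> {0..T}" by simp
      have qe: "0 < q t + \<eta>" using q0[OF t'] \<eta> by simp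
      have ft: "0 < f t" "f t * f t = q t + \<eta>" unfolding f_def using qe by auto
      show f': "(f has_real_derivative P t / f t) (at t)" unfolding f_def
      proof -
        have "((\<lambda>t. q t + \<eta>) has_real_derivative 2 * P t + 0) (at t)"
          by (intro DERIV_add interior[OF q'[OF t'] t] DERIV_const)
        from DERIV_chain2[where f = sqrt and g = "\<lambda>t. q t + \<eta>", OF DERIV_real_sqrt[OF qe] this]
        have "((\<lambda>t. sqrt (q t + \<eta>)) has_real_derivative inverse (sqrt (q t + \<eta>)) / 2 * (2 * P t + 0)) (at t)" .
        moreover have "inverse a / 2 * (2 * b + 0) = b / a" for a b :: real by (simp add: field_simps)
        ultimately show "((\<lambda>t. sqrt (q t + \<eta>)) has_real_derivative P t / sqrt (q t + \<eta>)) (at t)" by metis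
      qed
      show "((\<lambda>t. P t / f t) has_real_derivative (Q t * (q t + \<eta>) - (P t)^2) / (f t)^3) (at t)"
      proof -
        have "(x * a - z * (z / a)) / (a * a) = (x * (a * a) - z^2) / a^3" if "0 < a" for a x z :: real
        proof -
          have "x * a - z * (z / a) = (x * (a * a) - z^2) / a" using that by (simp add: diff_divide_distrib power2_eq_square)
          then show ?thesis by (simp add: power3_eq_cube)
        qed
        from this[OF ft(1), of "Q t" "P t"]
        have eq: "(Q t * f t - P t * (P t / f t)) / (f t * f t) = (Q t * (q t + \<eta>) - (P t)^2) / (f t)^3" unfolding ft(2) .
        have "((\<lambda>t. P t / f t) has_real_derivative (Q t * f t - P t * (P t / f t)) / (f t * f t)) (at t)"
          using DERIV_divide[OF interior[OF P'[OF t'] t] f'] ft(1) by simp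
        then show ?thesis unfolding eq .
      qed
      have "(P t)^2 \<le> Q t * (q t + \<eta>)"
        using PQ[OF t'] mult_nonneg_nonneg[OF Q0[OF t'] less_imp_le[OF \<eta>]] by (simp add: algebra_simps)
      then show "0 \<le> (Q t * (q t + \<eta>) - (P t)^2) / (f t)^3" using ft by simp
    qed
    then show ?thesis unfolding f_def by simp
  qed
  have q00: "q 0 = 0" unfolding q_def J0 using y(1)[of 0] T by (simp add: algebra)
  have conv: "T * sqrt (q s) \<le> s * sqrt (q T)" if s: "0 < s" "s < T" for s
  proof (rule field_le_epsilon)
    fix e :: real assume e: "0 < e"
    define d where "d = e / T"
    have d: "0 < d" unfolding d_def using e T by simp
    have "T * sqrt (q s) \<le> T * sqrt (q s + d^2)" using T by (intro mult_left_mono) auto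
    also have "\<dots> \<le> (T - s) * d + s * sqrt (q T + d^2)" using approx[OF s, of "d^2"] d q00 by simp
    also have "\<dots> \<le> (T - s) * d + s * (sqrt (q T) + d)"
      using sqrt_add_le_add_sqrt[of "q T" "d^2"] q0[of T] T d s by (intro add_left_mono mult_left_mono) auto
    also have "\<dots> = s * sqrt (q T) + e" unfolding d_def using T by (simp add: field_simps)
    finally show "T * sqrt (q s) \<le> s * sqrt (q T) + e" .
  qed
  have bound: "g c (y s) (J s /\<^sub>R s) (J s /\<^sub>R s) \<le> q T / T^2" if s: "0 < s" "s < T" for s
  proof -
    have s': "s \<in> {0..T}" using s by simp
    have "(T * sqrt (q s))^2 \<le> (s * sqrt (q T))^2" by (rule power_mono[OF conv[OF s]]) (use T in \<open>simp add: q0[OF s']\<close>)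
    then have "T^2 * q s \<le> s^2 * q T" using q0[OF s'] q0[of T] T by (simp add: power_mult_distrib)
    then have "q s / s^2 \<le> q T / T^2" using s T by (simp add: field_simps)
    moreover have "g c (y s) (J s /\<^sub>R s) (J s /\<^sub>R s) = q s / s^2"
      unfolding q_def using y(1)[OF s'] by (simp add: algebra power2_eq_square divide_inverse)
    ultimately show ?thesis by simp
  qed
  \<comment> \<open>As \<open>s\<close> tends to 0, \<open>J s\<close> divided by \<open>s\<close>
    tends to \<open>J' 0\<close>, so the convexity bound passes to the initial derivative.\<close>
  have "((\<lambda>s. g c (y s) (J s /\<^sub>R s) (J s /\<^sub>R s)) \<longlongrightarrow> g c (y 0) (J' 0) (J' 0)) (at 0 within {0..T})"
  proof (rule tendsto_bilinear_family[OF open_W _ bil cont])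
    show "y 0 \<in> W" using y(1) T by simp
    show "(y \<longlongrightarrow> y 0) (at 0 within {0..T})"
      using has_vector_derivative_continuous[OF y(2)[of 0]] T by (simp add: continuous_within)
    have "((\<lambda>s. (1 / norm (s - 0)) *\<^sub>R (J s - (J 0 + (s - 0) *\<^sub>R J' 0))) \<longlongrightarrow> 0) (at 0 within {0..T})"
      using J(1)[of 0] T unfolding has_vector_derivative_def has_derivative_within by auto
    moreover have "\<forall>\<^sub>F s in at 0 within {0..T}. (1 / norm (s - 0)) *\<^sub>R (J s - (J 0 + (s - 0) *\<^sub>R J' 0)) = J s /\<^sub>R s - J' 0"
      unfolding eventually_at by (intro exI[of _ 1]) (auto simp: J0 scaleR_diff_right divide_inverse)
    ultimately have "((\<lambda>s. J s /\<^sub>R s - J' 0) \<longlongrightarrow> 0) (at 0 within {0..T})" by (simp add: tendsto_cong)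
    then show "((\<lambda>s. J s /\<^sub>R s) \<longlongrightarrow> J' 0) (at 0 within {0..T})" "((\<lambda>s. J s /\<^sub>R s) \<longlongrightarrow> J' 0) (at 0 within {0..T})"
      by (simp_all add: LIM_zero_iff)
  qed
  moreover have "\<forall>\<^sub>F s in at 0 within {0..T}. g c (y s) (J s /\<^sub>R s) (J s /\<^sub>R s) \<le> q T / T^2"
    unfolding eventually_at using T bound by (intro exI[of _ T]) (auto simp: dist_real_def)
  moreover have "at 0 within {0..T} \<noteq> bot" using T by (simp add: at_within_Icc_at_right)
  ultimately have "g c (y 0) (J' 0) (J' 0) \<le> q T / T^2" by (rule tendsto_upperbound)
  then show ?thesis unfolding q_def using T by (simp add: field_simps)
qed

end

section \<open>The geodesic flow and the exponential map\<close>

context coordinate_metric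
begin

definition geodesic_field :: "'e \<times> 'e \<Rightarrow> 'e \<times> 'e" where
  "geodesic_field z = (snd z, - \<Gamma> (fst z) (snd z) (snd z))"

definition jacobi_field :: "'e \<times> 'e \<Rightarrow> 'e \<times> 'e \<Rightarrow> 'e \<times> 'e" where
  "jacobi_field z h = (snd h, - (d\<Gamma> (fst z) (fst h) (snd z) (snd z) + \<Gamma> (fst z) (snd h) (snd z) + \<Gamma> (fst z) (snd z) (snd h)))"

lemma geodesic_field_derivative:
  assumes "z \<in> W \<times> UNIV"
  shows "(geodesic_field has_derivative jacobi_field z) (at z)"
proof -
  have z: "fst z \<in> W" using assms by auto
  have "((\<lambda>z. \<Gamma> (fst z) (snd z) (snd z)) has_derivative
      (\<lambda>h. d\<Gamma> (fst z) (fst h) (snd z) (snd z) + \<Gamma> (fst z) (snd h) (snd z) + \<Gamma> (fst z) (snd z) (snd h))) (at z)"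
    by (rule has_derivative_bilinear_family[where y = fst and B = \<Gamma> and U = snd and V = snd and B' = "d\<Gamma> (fst z)",
          OF open_W z bilinear_christoffel christoffel_derivative(1)[OF z]])
      (auto intro: bounded_linear_imp_has_derivative bounded_linear_fst bounded_linear_snd)
  then show ?thesis unfolding geodesic_field_def[abs_def] jacobi_field_def[abs_def]
    by (intro has_derivative_Pair has_derivative_minus bounded_linear_imp_has_derivative bounded_linear_snd)
qed

definition jacobi_blinfun :: "'e \<times> 'e \<Rightarrow> ('e \<times> 'e) \<Rightarrow>\<^sub>L ('e \<times> 'e)" where
  "jacobi_blinfun z = Blinfun (jacobi_field z)"

lemma jacobi_blinfun_apply: "z \<in> W \<times> UNIV \<Longrightarrow> blinfun_apply (jacobi_blinfun z) = jacobi_field z" unfolding jacobi_blinfun_def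
  by (intro bounded_linear_Blinfun_apply has_derivative_bounded_linear[OF geodesic_field_derivative])

lemma cont_jacobi_blinfun: "continuous_on (W \<times> UNIV) jacobi_blinfun"
proof (rule continuous_on_blinfun_componentwise)
  fix h :: "'e \<times> 'e"
  have "continuous_on (W \<times> UNIV) (\<lambda>z. jacobi_field z h)" unfolding jacobi_field_def by (intro continuous_intros
        continuous_on_bilinear_family[where y = fst and B = "\<lambda>q. d\<Gamma> q (fst h)", OF bilinear_d\<Gamma> cont_d\<Gamma>]
        continuous_on_bilinear_family[where y = fst and B = \<Gamma>, OF bilinear_christoffel cont_christoffel]) auto
  then show "continuous_on (W \<times> UNIV) (\<lambda>z. blinfun_apply (jacobi_blinfun z) h)"
    by (rule continuous_on_eq) (simp add: jacobi_blinfun_apply)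
qed

lemma geodesic_const:
  assumes T: "0 < T" and y: "\<And>t. t \<in> {0..T} \<Longrightarrow> y t \<in> W"
    "\<And>t. t \<in> {0..T} \<Longrightarrow> (y has_vector_derivative w t) (at t within {0..T})"
    "\<And>t. t \<in> {0..T} \<Longrightarrow> (w has_vector_derivative - \<Gamma> (y t) (w t) (w t)) (at t within {0..T})" and w0: "w 0 = 0"
  shows "\<And>t. t \<in> {0..T} \<Longrightarrow> w t = 0" "\<And>t. t \<in> {0..T} \<Longrightarrow> y t = y 0"
proof -
  show w: "w t = 0" if t: "t \<in> {0..T}" for t
    using geodesic_speed_constant[OF y t] w0 eq_0_iff[OF y(1)[OF t]] algebra(7)[of "y 0" 0] y(1)[of 0] T by simp
  have "(y has_vector_derivative 0) (at t within {0..T})" if "t \<in> {0..T}" for t using y(2)[OF that] w[OF that] by simp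
  then obtain k where "\<And>t. t \<in> {0..T} \<Longrightarrow> y t = k" using has_vector_derivative_zero_constant[of "{0..T}" y] by auto
  then show "y t = y 0" if "t \<in> {0..T}" for t using that T by simp
qed

text \<open>The geodesic flow is run up to a fixed time \<open>T\<close>, so \<open>E p v\<close> is the exponential map at \<open>p\<close> when the initial
  velocity is \<open>v /\<^sub>R T\<close>.\<close>

lemma exponential_map:
  assumes p0: "p0 \<in> W" obtains r E E' where "0 < r"
    "\<And>p v. p \<in> ball p0 r \<Longrightarrow> v \<in> ball 0 r \<Longrightarrow> E p v \<in> W"
    "\<And>p v. p \<in> ball p0 r \<Longrightarrow> v \<in> ball 0 r \<Longrightarrow> (E p has_derivative E' p v) (at v)"
    "\<And>p w. p \<in> ball p0 r \<Longrightarrow> continuous_on (ball 0 r) (\<lambda>v. E' p v w)"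
    "\<And>p v w. p \<in> ball p0 r \<Longrightarrow> v \<in> ball 0 r \<Longrightarrow> norm (E' p v w - w) \<le> norm w / 2"
    "\<And>p. p \<in> ball p0 r \<Longrightarrow> E p 0 = p"
    "\<And>p w. p \<in> ball p0 r \<Longrightarrow> E' p 0 w = w"
    "\<And>p v w. p \<in> ball p0 r \<Longrightarrow> v \<in> ball 0 r \<Longrightarrow> g c p w w \<le> g c (E p v) (E' p v w) (E' p v w)"
    "\<And>p v. p \<in> ball p0 r \<Longrightarrow> v \<in> ball 0 r \<Longrightarrow> \<exists>T y y'. 0 < T \<and> y 0 = p \<and> y T = E p v \<and> continuous_on {0..T} y' \<and>
       (\<forall>t\<in>{0..T}. y t \<in> W \<and> (y has_vector_derivative y' t) (at t within {0..T}) \<and>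
         g c (y t) (y' t) (y' t) = g c p v v / T^2)"
proof -
  define a0 :: "'e \<times> 'e" where "a0 = (p0, 0)"
  have W: "open (W \<times> (UNIV :: 'e set))" "a0 \<in> W \<times> UNIV" unfolding a0_def using open_W p0 by (auto intro: open_Times)
  have der: "(geodesic_field has_derivative blinfun_apply (jacobi_blinfun z)) (at z)" if "z \<in> W \<times> UNIV" for z
    using geodesic_field_derivative[OF that] jacobi_blinfun_apply[OF that] by simp
  show ?thesis
  proof (rule local_flow[OF W _ cont_jacobi_blinfun])
  show "(geodesic_field has_derivative blinfun_apply (jacobi_blinfun z)) (at z)" if "z \<in> W \<times> UNIV" for z
    by (rule der[OF that])
  fix T \<delta> :: real and Z K
  assume T: "0 < T" and \<delta>: "0 < \<delta>" and Z: "\<And>a. a \<in> cball a0 \<delta> \<Longrightarrow> Z a 0 = a"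
      "\<And>a t. a \<in> cball a0 \<delta> \<Longrightarrow> t \<in> {0..T} \<Longrightarrow> Z a t \<in> W \<times> UNIV"
      "\<And>a t. a \<in> cball a0 \<delta> \<Longrightarrow> t \<in> {0..T} \<Longrightarrow> (Z a has_vector_derivative geodesic_field (Z a t)) (at t within {0..T})"
    and K: "\<And>a h. a \<in> cball a0 \<delta> \<Longrightarrow> K a h 0 = h"
      "\<And>a h t. a \<in> cball a0 \<delta> \<Longrightarrow> t \<in> {0..T} \<Longrightarrow>
         (K a h has_vector_derivative blinfun_apply (jacobi_blinfun (Z a t)) (K a h t)) (at t within {0..T})"
      "\<And>a t. a \<in> ball a0 \<delta> \<Longrightarrow> t \<in> {0..T} \<Longrightarrow> ((\<lambda>a. Z a t) has_derivative (\<lambda>h. K a h t)) (at a)"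
      "\<And>h t. t \<in> {0..T} \<Longrightarrow> continuous_on (cball a0 \<delta>) (\<lambda>a. K a h t)"
  have y: "fst (Z a t) \<in> W"
    "((\<lambda>t. fst (Z a t)) has_vector_derivative snd (Z a t)) (at t within {0..T})"
    "((\<lambda>t. snd (Z a t)) has_vector_derivative - \<Gamma> (fst (Z a t)) (snd (Z a t)) (snd (Z a t))) (at t within {0..T})"
    if "a \<in> cball a0 \<delta>" "t \<in> {0..T}" for a t
    using Z(2)[OF that] bounded_linear.has_vector_derivative[OF bounded_linear_fst Z(3)[OF that]]
      bounded_linear.has_vector_derivative[OF bounded_linear_snd Z(3)[OF that]] by (auto simp: geodesic_field_def)
  have J: "((\<lambda>t. fst (K a h t)) has_vector_derivative snd (K a h t)) (at t within {0..T})"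
    "((\<lambda>t. snd (K a h t)) has_vector_derivative - (d\<Gamma> (fst (Z a t)) (fst (K a h t)) (snd (Z a t)) (snd (Z a t))
        + \<Gamma> (fst (Z a t)) (snd (K a h t)) (snd (Z a t)) + \<Gamma> (fst (Z a t)) (snd (Z a t)) (snd (K a h t)))) (at t within {0..T})"
    if "a \<in> cball a0 \<delta>" "t \<in> {0..T}" for a h t using jacobi_blinfun_apply[OF Z(2)[OF that]]
      bounded_linear.has_vector_derivative[OF bounded_linear_fst K(2)[OF that, of h]]
      bounded_linear.has_vector_derivative[OF bounded_linear_snd K(2)[OF that, of h]] by (auto simp: jacobi_field_def)
  have Tin: "T \<in> {0..T}" "0 \<in> {0..T}" using T by auto
  \<comment> \<open>Zero initial velocity gives the constant geodesic, along which the linearized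
    equation reduces to that of straight lines; therefore the derivative of the exponential map at 0
    is the identity.\<close>
  have at0: "fst (Z (p, 0) t) = p" "fst (K (p, 0) (0, b) T) = T *\<^sub>R b"
    if p: "(p, 0) \<in> cball a0 \<delta>" and t: "t \<in> {0..T}" for p b t
  proof -
    have c: "snd (Z (p, 0) t) = 0" "fst (Z (p, 0) t) = fst (Z (p, 0) 0)" if t: "t \<in> {0..T}" for t
      using geodesic_const[OF T y(1)[OF p] y(2)[OF p] y(3)[OF p] _ t] Z(1)[OF p] by auto
    then show "fst (Z (p, 0) t) = p" using Z(1)[OF p] t by simp
    have "((\<lambda>t. snd (K (p, 0) (0, b) t)) has_vector_derivative 0) (at t within {0..T})" if t: "t \<in> {0..T}" for t
      using J(2)[OF p t, of "(0, b)"] c(1)[OF t] y(1)[OF p t] by (simp add: \<Gamma>_algebra bilinear_rzero[OF bilinear_d\<Gamma>])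
    then obtain k where k: "\<And>t. t \<in> {0..T} \<Longrightarrow> snd (K (p, 0) (0, b) t) = k"
      using has_vector_derivative_zero_constant[of "{0..T}" "\<lambda>t. snd (K (p, 0) (0, b) t)"] by auto
    have kb: "k = b" using k[of 0] K(1)[OF p, of "(0, b)"] T by simp
    have "((\<lambda>t. fst (K (p, 0) (0, b) t) - t *\<^sub>R b) has_vector_derivative 0) (at t within {0..T})" if t: "t \<in> {0..T}" for t
    proof -
      have "((\<lambda>t. fst (K (p, 0) (0, b) t) - t *\<^sub>R b) has_vector_derivative b - 1 *\<^sub>R b) (at t within {0..T})"
        using J(1)[OF p t, of "(0, b)"] k[OF t] kb
        by (intro has_vector_derivative_diff) (auto intro!: derivative_eq_intros simp: has_vector_derivative_def)
      then show ?thesis by simp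
    qed
    then obtain k' where k': "\<And>t. t \<in> {0..T} \<Longrightarrow> fst (K (p, 0) (0, b) t) - t *\<^sub>R b = k'"
      using has_vector_derivative_zero_constant[of "{0..T}" "\<lambda>t. fst (K (p, 0) (0, b) t) - t *\<^sub>R b"] by auto
    show "fst (K (p, 0) (0, b) T) = T *\<^sub>R b" using k'[OF Tin(1)] k'[OF Tin(2)] K(1)[OF p, of "(0, b)"] by simp
  qed
  define E where "E p v = fst (Z (p, v /\<^sub>R T) T)" for p v
  define E' where "E' p v w = fst (K (p, v /\<^sub>R T) (0, w /\<^sub>R T) T)" for p v w
  \<comment> \<open>Each basis vector is to be moved by at most \<open>1 / (2 * n)\<close>; summed
    over the \<open>n\<close> basis vectors, this bounds the relative deviation from the identity by
    1/2.\<close>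
  define n where "n = real DIM('e)"
  have n: "0 < n" unfolding n_def by simp
  have "\<exists>d>0. \<forall>a\<in>cball a0 \<delta>. dist a a0 < d \<longrightarrow> dist (fst (K a (0, b /\<^sub>R T) T)) b < 1 / (2 * n)" for b
  proof -
    have "continuous_on (cball a0 \<delta>) (\<lambda>a. fst (K a (0, b /\<^sub>R T) T))" by (intro continuous_intros K(4) Tin)
    moreover have "fst (K a0 (0, b /\<^sub>R T) T) = b" unfolding a0_def using at0(2)[of p0 0 "b /\<^sub>R T"] \<delta> T by (simp add: a0_def)
    ultimately show ?thesis
      using n \<delta> unfolding continuous_on_iff by (metis centre_in_cball less_imp_le mult_pos_pos zero_less_divide_1_iff zero_less_numeral)
  qed
  then obtain d where d: "\<And>b. 0 < d b" "\<And>b a. a \<in> cball a0 \<delta> \<Longrightarrow> dist a a0 < d b \<Longrightarrow>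
      dist (fst (K a (0, b /\<^sub>R T) T)) b < 1 / (2 * n)" by metis
  define m where "m = min \<delta> (Min (d ` Basis))"
  have m: "0 < m" "m \<le> \<delta>" "\<And>b. b \<in> Basis \<Longrightarrow> m \<le> d b" unfolding m_def using \<delta> d(1) by (auto intro: min.coboundedI2)
  define r where "r = min (m / 2) (m * T / 2)"
  have r: "0 < r" unfolding r_def using m T by simp
  have near: "dist (p, v /\<^sub>R T) a0 < m" if p: "p \<in> ball p0 r" and v: "v \<in> ball 0 r" for p v
  proof -
    have "norm v < m * T / 2" using v unfolding r_def by simp
    then have "norm v / T < m / 2" using T by (simp add: field_simps)
    moreover have "norm (p - p0) < m / 2" using p unfolding r_def by (simp add: dist_norm norm_minus_commute)
    moreover have "dist (p, v /\<^sub>R T) a0 \<le> norm (p - p0) + norm (v /\<^sub>R T)"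
      unfolding dist_norm a0_def using norm_Pair_le[of "p - p0" "v /\<^sub>R T"] by simp
    moreover have "norm (v /\<^sub>R T) = norm v / T" using T by (simp add: field_simps)
    ultimately show ?thesis by linarith
  qed
  have in_ball: "(p, v /\<^sub>R T) \<in> ball a0 \<delta>" "(p, v /\<^sub>R T) \<in> cball a0 \<delta>"
    if "p \<in> ball p0 r" "v \<in> ball 0 r" for p v using near[OF that] m(2) by (auto simp: dist_commute)
  have Klin: "linear (\<lambda>h. K a h T)" if "a \<in> ball a0 \<delta>" for a using has_derivative_linear[OF K(3)[OF that Tin(1)]] .
  show ?thesis
  proof (rule that[of r E E'], goal_cases)
    case 1 then show ?case by (rule r)
  next
    case (2 p v) then show ?case unfolding E_def using y(1)[OF in_ball(2) Tin(1)] by blast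
  next
    case (3 p v)
    have "((\<lambda>v. (p, v /\<^sub>R T)) has_derivative (\<lambda>h. (0, h /\<^sub>R T))) (at v)" by (auto intro!: derivative_eq_intros)
    from has_derivative_compose[OF this K(3)[OF in_ball(1)[OF 3] Tin(1)]]
    show ?case unfolding E_def[abs_def] E'_def[abs_def] by (rule has_derivative_fst)
  next
    case (4 p w)
    show ?case unfolding E'_def by (intro continuous_on_fst continuous_on_compose2[OF K(4)[OF Tin(1)]])
        (use in_ball(2)[OF 4] in \<open>auto intro!: continuous_intros\<close>)
  next
    case (5 p v w)
    define L where "L w = E' p v w - w" for w
    have linL: "linear L"
    proof
      note K = linear_add[OF Klin[OF in_ball(1)[OF 5]]] linear_cmul[OF Klin[OF in_ball(1)[OF 5]]]
      show "L (a + b) = L a + L b" for a b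
        using K(1)[of "(0, a /\<^sub>R T)" "(0, b /\<^sub>R T)"] unfolding L_def E'_def by (simp add: scaleR_add_right)
      show "L (s *\<^sub>R b) = s *\<^sub>R L b" for s b
        using K(2)[of s "(0, b /\<^sub>R T)"] unfolding L_def E'_def by (simp add: scaleR_diff_right mult.commute)
    qed
    have "L w = (\<Sum>b\<in>Basis. (w \<bullet> b) *\<^sub>R L b)"
      using linear_sum[OF linL, of "\<lambda>b. (w \<bullet> b) *\<^sub>R b" Basis] linear_cmul[OF linL] by (simp add: euclidean_representation)
    also have "norm \<dots> \<le> (\<Sum>b\<in>Basis. norm ((w \<bullet> b) *\<^sub>R L b))" by (rule norm_sum)
    also have "\<dots> \<le> (\<Sum>b\<in>(Basis::'e set). norm w * (1 / (2 * n)))"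
    proof (rule sum_mono)
      fix b :: 'e assume b: "b \<in> Basis"
      have "norm (L b) \<le> 1 / (2 * n)"
        using d(2)[OF in_ball(2)[OF 5], of b] near[OF 5] m(3)[OF b] unfolding L_def E'_def by (simp add: dist_norm)
      then show "norm ((w \<bullet> b) *\<^sub>R L b) \<le> norm w * (1 / (2 * n))"
        using Basis_le_norm[OF b, of w] by (simp only: norm_scaleR) (intro mult_mono, auto)
    qed
    also have "\<dots> = norm w / 2" using n unfolding n_def by simp
    finally show ?case unfolding L_def .
  next
    case (6 p)
    then show ?case unfolding E_def using at0(1)[OF _ Tin(1), of p] in_ball(2)[OF 6, of 0] r by (simp add: scaleR_zero_right)
  next
    case (7 p w)
    then show ?case unfolding E'_def using at0(2)[of p 0 "w /\<^sub>R T"] in_ball(2)[OF 7, of 0] r T by simp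
  next
    case (8 p v w)
    note a = in_ball(2)[OF 8]
    have "T^2 * g c (fst (Z (p, v /\<^sub>R T) 0)) (snd (K (p, v /\<^sub>R T) (0, w /\<^sub>R T) 0)) (snd (K (p, v /\<^sub>R T) (0, w /\<^sub>R T) 0))
       \<le> g c (fst (Z (p, v /\<^sub>R T) T)) (fst (K (p, v /\<^sub>R T) (0, w /\<^sub>R T) T)) (fst (K (p, v /\<^sub>R T) (0, w /\<^sub>R T) T))"
      by (rule jacobi_field_expands[where y = "\<lambda>t. fst (Z (p, v /\<^sub>R T) t)" and w = "\<lambda>t. snd (Z (p, v /\<^sub>R T) t)"
            and J = "\<lambda>t. fst (K (p, v /\<^sub>R T) (0, w /\<^sub>R T) t)" and J' = "\<lambda>t. snd (K (p, v /\<^sub>R T) (0, w /\<^sub>R T) t)", OF T])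
        (use y[OF a] J[OF a] K(1)[OF a] in auto)
    then have "T^2 * g c p (w /\<^sub>R T) (w /\<^sub>R T) \<le> g c (E p v) (E' p v w) (E' p v w)"
      using Z(1)[OF a] K(1)[OF a] unfolding E_def E'_def by simp
    moreover have "p \<in> W" using y(1)[OF a Tin(2)] Z(1)[OF a] by simp
    then have "T^2 * g c p (w /\<^sub>R T) (w /\<^sub>R T) = g c p w w" using T by (simp add: algebra power2_eq_square field_simps)
    ultimately show ?case by simp
  next
    case (9 p v)
    note a = in_ball(2)[OF 9]
    let ?y = "\<lambda>t. fst (Z (p, v /\<^sub>R T) t)" and ?w = "\<lambda>t. snd (Z (p, v /\<^sub>R T) t)"
    have pO: "p \<in> W" using y(1)[OF a Tin(2)] Z(1)[OF a] by simp
    have "g c (?y t) (?w t) (?w t) = g c p v v / T^2" if "t \<in> {0..T}" for t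
    proof -
      have "g c (?y t) (?w t) (?w t) = g c (?y 0) (?w 0) (?w 0)"
        by (rule geodesic_speed_constant[OF y(1)[OF a] y(2)[OF a] y(3)[OF a] that])
      also have "\<dots> = g c p v v / T^2" using pO Z(1)[OF a] T by (simp add: algebra power2_eq_square field_simps)
      finally show ?thesis .
    qed
    moreover have "continuous_on {0..T} ?w" by (rule continuous_on_vector_derivative[OF y(3)[OF a]])
    ultimately show ?case by (intro exI[of _ T] exI[of _ ?y] exI[of _ ?w]) (use y[OF a] T Z(1)[OF a] in \<open>auto simp: E_def\<close>)
  qed
  qed
qed

end

section \<open>Lengths of curves in a Riemannian manifold\<close>

definition chart_inv :: "('a, 'e) chart \<Rightarrow> 'e \<Rightarrow> 'a" where
  "chart_inv c = inv_into (fst c) (snd c)"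

context hadamard_space
begin

lemma chart_openD:
  assumes "c \<in> A"
  shows "open (fst c)" "open (snd c ` fst c)" "homeomorphism (fst c) (snd c ` fst c) (snd c) (chart_inv c)"
  using smooth_atlas assms unfolding smooth_atlas_def chart_inv_def by (auto simp: split_beta)

lemma chart_cover: obtains c where "c \<in> A" "x \<in> fst c" using smooth_atlas unfolding smooth_atlas_def by blast

lemma chart_inv: assumes "c \<in> A"
  shows "x \<in> fst c \<Longrightarrow> chart_inv c (snd c x) = x" "p \<in> snd c ` fst c \<Longrightarrow> snd c (chart_inv c p) = p"
    "p \<in> snd c ` fst c \<Longrightarrow> chart_inv c p \<in> fst c"
    "continuous_on (fst c) (snd c)" "continuous_on (snd c ` fst c) (chart_inv c)"
  using chart_openD(3)[OF assms] unfolding homeomorphism_def by auto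

lemma coordinate_metric: assumes c: "c \<in> A" shows "coordinate_metric c g (snd c ` fst c)"
proof
  show "open (snd c ` fst c)" by (rule chart_openD[OF c])
  show "bilinear (g c p)" "g c p u v = g c p v u" "u \<noteq> 0 \<Longrightarrow> 0 < g c p u u" if "p \<in> snd c ` fst c" for p u v
    using riemannian_metric c that unfolding riemannian_metric_def by blast+
  show "smooth_on (snd c ` fst c) (\<lambda>p. g c p u v)" for u v using riemannian_metric c unfolding riemannian_metric_def by blast
  show "sectional_curvature g c p u v \<le> 0"
    if "p \<in> snd c ` fst c" "u \<noteq> v" "independent {u, v}" for p u v using nonpositive_curvature[OF c] that by blast
qed

definition trans_deriv :: "('a, 'e) chart \<Rightarrow> ('a, 'e) chart \<Rightarrow> 'a \<Rightarrow> 'e \<Rightarrow> 'e" where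
  "trans_deriv c c' x = frechet_derivative (transition c c') (at (snd c x))"

lemma transition_derivative:
  assumes "c \<in> A" "c' \<in> A" "x \<in> fst c" "x \<in> fst c'"
  shows "(transition c c' has_derivative trans_deriv c c' x) (at (snd c x))"
proof -
  have "smooth_on (snd c ` (fst c \<inter> fst c')) (transition c c')" using smooth_atlas assms unfolding smooth_atlas_def by blast
  then show ?thesis unfolding trans_deriv_def
    using smooth_on_differentiable[of _ _ "snd c x"] assms frechet_derivative_works by blast
qed

lemma continuous_on_trans_deriv:
  assumes "c \<in> A" "c' \<in> A"
  shows "continuous_on (fst c \<inter> fst c') (\<lambda>x. trans_deriv c c' x v)"
proof -
  have "smooth_on (snd c ` (fst c \<inter> fst c')) (transition c c')" using smooth_atlas assms unfolding smooth_atlas_def by blast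
  then have "continuous_on (snd c ` (fst c \<inter> fst c')) (\<lambda>p. frechet_derivative (transition c c') (at p) v)"
    by (intro smooth_on_continuous smooth_on_frechet)
  from continuous_on_compose2[OF this, of _ "snd c"] show ?thesis
    unfolding trans_deriv_def using continuous_on_subset[OF chart_inv(4)[OF assms(1)]] by fastforce
qed

lemma metric_invariant:
  assumes "c \<in> A" "c' \<in> A" "x \<in> fst c" "x \<in> fst c'"
  shows "g c (snd c x) u v = g c' (snd c' x) (trans_deriv c c' x u) (trans_deriv c c' x v)"
  using riemannian_metric assms unfolding riemannian_metric_def trans_deriv_def Let_def by blast

lemma transition_curve_derivative:
  assumes c: "c \<in> A" "c' \<in> A" and t: "q t \<in> fst c" "q t \<in> fst c'" "t \<in> S" and cont: "continuous (at t within S) q"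
    and D: "((\<lambda>s. snd c (q s)) has_vector_derivative D) (at t within S)"
  shows "((\<lambda>s. snd c' (q s)) has_vector_derivative trans_deriv c c' (q t) D) (at t within S)"
proof -
  note T = transition_derivative[OF c t(1,2)]
  have "((\<lambda>s. transition c c' (snd c (q s))) has_derivative (\<lambda>h. trans_deriv c c' (q t) (h *\<^sub>R D))) (at t within S)"
    using has_derivative_compose[OF D[unfolded has_vector_derivative_def] T] .
  moreover have "(\<lambda>h. trans_deriv c c' (q t) (h *\<^sub>R D)) = (\<lambda>h. h *\<^sub>R trans_deriv c c' (q t) D)"
    using linear_cmul[OF has_derivative_linear[OF T]] by auto
  ultimately have "((\<lambda>s. transition c c' (snd c (q s))) has_derivative (\<lambda>h. h *\<^sub>R trans_deriv c c' (q t) D)) (at t within S)"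
    by simp
  moreover have "(q \<longlongrightarrow> q t) (at t within S)" using cont by (simp add: continuous_within)
  then have "\<forall>\<^sub>F s in at t within S. q s \<in> fst c" by (rule topological_tendstoD) (use chart_openD(1) c t in auto)
  then have "\<forall>\<^sub>F s in at t within S. transition c c' (snd c (q s)) = snd c' (q s)"
    by eventually_elim (use chart_inv(1)[OF c(1)] in \<open>simp add: transition_def chart_inv_def\<close>)
  ultimately show ?thesis unfolding has_vector_derivative_def by (rule has_derivative_transform_eventually)
      (use chart_inv(1)[OF c(1) t(1)] t in \<open>simp_all add: transition_def chart_inv_def\<close>)
qed

text \<open>The two-sided derivative in \<open>speed\<close> carries no information at break points.
  The derivative within the arc makes the speed continuous up to both ends, and the two notions
  agree in the interior.\<close>

definition arc_speed :: "real set \<Rightarrow> (real \<Rightarrow> 'a) \<Rightarrow> real \<Rightarrow> real" where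
  "arc_speed S \<gamma> t =
     (let c = (SOME c. c \<in> A \<and> \<gamma> t \<in> fst c);
          v = vector_derivative (\<lambda>s. snd c (\<gamma> s)) (at t within S)
      in sqrt (g c (snd c (\<gamma> t)) v v))"

lemma speed_eq_arc_speed: "speed A g q t = arc_speed UNIV q t" unfolding speed_def arc_speed_def ..

lemma arc_speed_chart:
  assumes c: "c \<in> A" "q t \<in> fst c" and t: "t \<in> S" "at t within S \<noteq> bot" and cont: "continuous (at t within S) q"
    and D: "((\<lambda>s. snd c (q s)) has_vector_derivative D) (at t within S)"
  shows "arc_speed S q t = sqrt (g c (snd c (q t)) D D)"
proof -
  define c' where "c' = (SOME c. c \<in> A \<and> q t \<in> fst c)"
  have c': "c' \<in> A" "q t \<in> fst c'" unfolding c'_def using someI[of "\<lambda>c. c \<in> A \<and> q t \<in> fst c" c] c by auto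
  have "vector_derivative (\<lambda>s. snd c' (q s)) (at t within S) = trans_deriv c c' (q t) D"
    by (rule vector_derivative_within[OF t(2) transition_curve_derivative[OF c(1) c'(1) c(2) c'(2) t(1) cont D]])
  then show ?thesis
    unfolding arc_speed_def c'_def[symmetric] Let_def using metric_invariant[OF c(1) c'(1) c(2) c'(2)] by simp
qed

lemma arc_speed_nonneg: "0 \<le> arc_speed S q t"
proof -
  define c where "c = (SOME c. c \<in> A \<and> q t \<in> fst c)"
  obtain c0 where "c0 \<in> A" "q t \<in> fst c0" by (rule chart_cover)
  then have c: "c \<in> A" "q t \<in> fst c" unfolding c_def using someI[of "\<lambda>c. c \<in> A \<and> q t \<in> fst c" c0] by auto
  interpret coordinate_metric c g "snd c ` fst c" by (rule coordinate_metric[OF c(1)])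
  show ?thesis unfolding arc_speed_def c_def[symmetric] Let_def using nonneg c by simp
qed

lemma at_within_Icc_neq_bot: "a < b \<Longrightarrow> t \<in> {a..b} \<Longrightarrow> at t within {a..b::real} \<noteq> bot"
  using trivial_limit_within[of t "{a..b}"] islimpt_Icc[of a b t] by (auto simp: trivial_limit_def)

lemma speed_interior:
  assumes "a < t" "t < b"
  shows "speed A g q t = arc_speed {a..b} q t"
  unfolding speed_eq_arc_speed arc_speed_def using at_within_Icc_at[OF assms] by simp

lemma C1_arcD:
  assumes "C1_arc A q a b" "c \<in> A" obtains D where "continuous_on {t\<in>{a..b}. q t \<in> fst c} D"
    "\<And>t. t \<in> {a..b} \<Longrightarrow> q t \<in> fst c \<Longrightarrow> ((\<lambda>s. snd c (q s)) has_vector_derivative D t) (at t within {a..b})"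
  using assms unfolding C1_arc_def by (auto simp: split_beta)

lemma continuous_arc_speed:
  assumes arc: "C1_arc A q a b" and ab: "a < b"
  shows "continuous_on {a..b} (arc_speed {a..b} q)" unfolding continuous_on_eq_continuous_within
proof
  fix t assume t: "t \<in> {a..b}"
  obtain c where c: "c \<in> A" "q t \<in> fst c" by (rule chart_cover)
  interpret coordinate_metric c g "snd c ` fst c" by (rule coordinate_metric[OF c(1)])
  have contg: "continuous_on {a..b} q" using arc unfolding C1_arc_def by blast
  obtain D where D: "continuous_on {t\<in>{a..b}. q t \<in> fst c} D"
    "\<And>t. t \<in> {a..b} \<Longrightarrow> q t \<in> fst c \<Longrightarrow> ((\<lambda>s. snd c (q s)) has_vector_derivative D t) (at t within {a..b})"
    by (rule C1_arcD[OF arc c(1)]) blast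
  define S where "S = {t\<in>{a..b}. q t \<in> fst c}"
  have contS: "continuous_on S q" using contg unfolding S_def by (rule continuous_on_subset) auto
  have eq: "arc_speed {a..b} q s = sqrt (g c (snd c (q s)) (D s) (D s))" if "s \<in> S" for s
    by (rule arc_speed_chart[OF c(1) _ _ at_within_Icc_neq_bot[OF ab]])
      (use that D(2) contg in \<open>auto simp: S_def continuous_on_eq_continuous_within\<close>)
  have "continuous_on S (\<lambda>s. snd c (q s))"
    by (rule continuous_on_compose2[OF chart_inv(4)[OF c(1)] contS]) (auto simp: S_def)
  then have "continuous_on S (\<lambda>s. sqrt (g c (snd c (q s)) (D s) (D s)))"
    by (intro continuous_on_real_sqrt continuous_on_bilinear_family[where y = "\<lambda>s. snd c (q s)" and B = "g c", OF bil cont])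
      (use D(1) in \<open>auto simp: S_def\<close>)
  then have "continuous_on S (arc_speed {a..b} q)" by (rule continuous_on_eq) (simp add: eq)
  moreover obtain U where U: "open U" "S = {a..b} \<inter> U"
  proof -
    have "openin (top_of_set {a..b}) ({a..b} \<inter> q -` fst c)"
      by (rule continuous_openin_preimage_gen[OF contg chart_openD(1)[OF c(1)]])
    then show ?thesis using that unfolding openin_open S_def by (metis Collect_conj_eq Collect_mem_eq vimage_def)
  qed
  moreover have "t \<in> S" using t c unfolding S_def by simp
  ultimately have "continuous (at t within S) (arc_speed {a..b} q)" "at t within S = at t within {a..b}"
    by (auto simp: continuous_on_eq_continuous_within intro!: at_within_nhd[of t U])
  then show "continuous (at t within {a..b}) (arc_speed {a..b} q)" by simp
qed

end

section \<open>Piecewise C1 curves and their lengths\<close>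

context hadamard_space
begin

lemma C1_arcI:
  assumes "continuous_on {a..b} q" and "\<And>c. c \<in> A \<Longrightarrow> \<exists>D. continuous_on {t\<in>{a..b}. q t \<in> fst c} D \<and>
      (\<forall>t\<in>{a..b}. q t \<in> fst c \<longrightarrow> ((\<lambda>s. snd c (q s)) has_vector_derivative D t) (at t within {a..b}))"
  shows "C1_arc A q a b" using assms unfolding C1_arc_def by (auto simp: split_beta)

lemma C1_arc_subset:
  assumes arc: "C1_arc A q a b" and sub: "a \<le> a'" "b' \<le> b"
  shows "C1_arc A q a' b'"
proof (rule C1_arcI)
  show "continuous_on {a'..b'} q" using arc sub unfolding C1_arc_def by (auto elim: continuous_on_subset)
  fix c assume c: "c \<in> A"
  obtain D where D: "continuous_on {t\<in>{a..b}. q t \<in> fst c} D"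
    "\<And>t. t \<in> {a..b} \<Longrightarrow> q t \<in> fst c \<Longrightarrow> ((\<lambda>s. snd c (q s)) has_vector_derivative D t) (at t within {a..b})"
    using C1_arcD[OF arc c] by metis
  show "\<exists>D. continuous_on {t \<in> {a'..b'}. q t \<in> fst c} D \<and>
       (\<forall>t\<in>{a'..b'}. q t \<in> fst c \<longrightarrow> ((\<lambda>s. snd c (q s)) has_vector_derivative D t) (at t within {a'..b'}))"
  proof (intro exI[of _ D] conjI ballI impI)
    show "continuous_on {t \<in> {a'..b'}. q t \<in> fst c} D" using D(1) sub by (auto elim: continuous_on_subset)
    show "((\<lambda>s. snd c (q s)) has_vector_derivative D t) (at t within {a'..b'})" if "t \<in> {a'..b'}" "q t \<in> fst c" for t
      by (rule has_vector_derivative_within_subset[OF D(2)]) (use that sub in auto)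
  qed
qed

lemma C1_arc_affine:
  assumes arc: "C1_arc A q a b" and m: "0 < m" and a': "m * a' + k = a" "m * b' + k = b"
  shows "C1_arc A (\<lambda>s. q (m * s + k)) a' b'"
proof (rule C1_arcI)
  have im: "(\<lambda>s. m * s + k) ` {a'..b'} = {a..b}" using m a' by (auto simp: image_affinity_atLeastAtMost)
  have mem: "m * s + k \<in> {a..b}" if "s \<in> {a'..b'}" for s using im that by blast
  show "continuous_on {a'..b'} (\<lambda>s. q (m * s + k))"
  proof (rule continuous_on_compose2[where g = q and f = "\<lambda>s. m * s + k" and t = "{a..b}"])
    show "continuous_on {a..b} q" using arc unfolding C1_arc_def by blast
    show "continuous_on {a'..b'} (\<lambda>s. m * s + k)" by (intro continuous_intros)
    show "(\<lambda>s. m * s + k) ` {a'..b'} \<subseteq> {a..b}" using im by simp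
  qed
  fix c assume c: "c \<in> A"
  obtain D where D: "continuous_on {t\<in>{a..b}. q t \<in> fst c} D"
    "\<And>t. t \<in> {a..b} \<Longrightarrow> q t \<in> fst c \<Longrightarrow> ((\<lambda>s. snd c (q s)) has_vector_derivative D t) (at t within {a..b})"
    using C1_arcD[OF arc c] by metis
  show "\<exists>D. continuous_on {t \<in> {a'..b'}. q (m * t + k) \<in> fst c} D \<and>
       (\<forall>t\<in>{a'..b'}. q (m * t + k) \<in> fst c \<longrightarrow> ((\<lambda>s. snd c (q (m * s + k))) has_vector_derivative D t) (at t within {a'..b'}))"
  proof (intro exI[of _ "\<lambda>s. m *\<^sub>R D (m * s + k)"] conjI ballI impI)
    show "continuous_on {t \<in> {a'..b'}. q (m * t + k) \<in> fst c} (\<lambda>s. m *\<^sub>R D (m * s + k))"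
      by (intro continuous_on_scaleR continuous_on_const continuous_on_compose2[OF D(1)] continuous_intros) (use mem in auto)
    fix t assume t: "t \<in> {a'..b'}" "q (m * t + k) \<in> fst c"
    have "((\<lambda>s. m * s + k) has_vector_derivative m) (at t within {a'..b'})"
      by (auto intro!: derivative_eq_intros simp: has_real_derivative_iff_has_vector_derivative[symmetric])
    from vector_diff_chain_within[OF this, of "\<lambda>s. snd c (q s)" "D (m * t + k)"]
    show "((\<lambda>s. snd c (q (m * s + k))) has_vector_derivative m *\<^sub>R D (m * t + k)) (at t within {a'..b'})"
      using D(2)[OF mem[OF t(1)] t(2)] unfolding im by (simp add: o_def)
  qed
qed

text \<open>An inductive form of finite subdivision, so that statements about paths become
  inductions over arcs; \<open>piecewise_C1_path_iff\<close> identifies it with the given notion on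
  \<open>[0, 1]\<close>.\<close>

inductive piecewise_C1 :: "(real \<Rightarrow> 'a) \<Rightarrow> real \<Rightarrow> real \<Rightarrow> bool" for \<gamma> where
  arc: "a < b \<Longrightarrow> C1_arc A \<gamma> a b \<Longrightarrow> piecewise_C1 \<gamma> a b"
| snoc: "piecewise_C1 \<gamma> a b \<Longrightarrow> b < c \<Longrightarrow> C1_arc A \<gamma> b c \<Longrightarrow> piecewise_C1 \<gamma> a c"

lemma piecewise_C1_less: "piecewise_C1 q a b \<Longrightarrow> a < b" by (induction rule: piecewise_C1.induct) auto

lemma piecewise_C1_append:
  assumes "piecewise_C1 q b c" "piecewise_C1 q a b"
  shows "piecewise_C1 q a c" using assms by (induction rule: piecewise_C1.induct) (auto intro: piecewise_C1.snoc)

lemma piecewise_C1_continuous: "piecewise_C1 q a b \<Longrightarrow> continuous_on {a..b} q"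
proof (induction rule: piecewise_C1.induct)
  case (arc a b)
  then show ?case unfolding C1_arc_def by blast
next
  case (snoc a b c)
  then have "continuous_on {b..c} q" unfolding C1_arc_def by blast
  then have "continuous_on ({a..b} \<union> {b..c}) q" by (intro continuous_on_closed_Un snoc.IH) auto
  moreover have "{a..b} \<union> {b..c} = {a..c}" using snoc.hyps(2) piecewise_C1_less[OF snoc.hyps(1)] by auto
  ultimately show ?case by simp
qed

lemma piecewise_C1_subset:
  assumes "piecewise_C1 q a b" "a \<le> a'" "a' < b'" "b' \<le> b"
  shows "piecewise_C1 q a' b'" using assms
proof (induction arbitrary: a' b' rule: piecewise_C1.induct)
  case (arc a b)
  then show ?case using C1_arc_subset by (blast intro: piecewise_C1.arc)
next
  case (snoc a b c)
  show ?case
  proof (cases "b' \<le> b")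
    case True
    then show ?thesis using snoc by blast
  next
    case False
    show ?thesis
    proof (cases "b \<le> a'")
      case True
      then show ?thesis using snoc C1_arc_subset by (blast intro: piecewise_C1.arc)
    next
      case False
      with \<open>\<not> b' \<le> b\<close> show ?thesis using snoc C1_arc_subset[of q b c b b'] by (intro piecewise_C1.snoc[of q a' b b']) auto
    qed
  qed
qed

lemma piecewise_C1_affine:
  assumes "piecewise_C1 q a b" "0 < m" "m * a' + k = a" "m * b' + k = b"
  shows "piecewise_C1 (\<lambda>s. q (m * s + k)) a' b'" using assms
proof (induction arbitrary: b' rule: piecewise_C1.induct)
  case (arc a b)
  then have "m * a' < m * b'" by linarith
  then show ?case using arc C1_arc_affine by (intro piecewise_C1.arc) auto
next
  case (snoc a b c)
  define x where "x = (b - k) / m"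
  have x: "m * x + k = b" unfolding x_def using snoc by simp
  then have "m * x < m * b'" using snoc by linarith
  then show ?case using snoc x by (intro piecewise_C1.snoc[of _ a' x b'] C1_arc_affine) auto
qed

lemma piecewise_C1_path_of:
  assumes "piecewise_C1 q a b"
  shows "\<exists>T. finite T \<and> {a, b} \<subseteq> T \<and> T \<subseteq> {a..b} \<and> (\<forall>u\<in>T. \<forall>v\<in>T. u < v \<and> T \<inter> {u<..<v} = {} \<longrightarrow> C1_arc A q u v)" using assms
proof (induction rule: piecewise_C1.induct)
  case (arc a b)
  then show ?case by (intro exI[of _ "{a, b}"]) auto
next
  case (snoc a b c)
  obtain T where T: "finite T" "{a, b} \<subseteq> T" "T \<subseteq> {a..b}"
    "\<forall>u\<in>T. \<forall>v\<in>T. u < v \<and> T \<inter> {u<..<v} = {} \<longrightarrow> C1_arc A q u v" using snoc.IH by (elim exE conjE)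
  have "C1_arc A q u v" if uv: "u \<in> insert c T" "v \<in> insert c T" "u < v" "insert c T \<inter> {u<..<v} = {}" for u v
  proof (cases "v = c")
    case True
    then have "u \<in> T" using uv by auto
    then have "u \<le> b" using T(3) by auto
    moreover have "b \<notin> {u<..<v}" using uv(4) T(2) by auto
    ultimately have "u = b" using True snoc.hyps(2) by auto
    then show ?thesis using True snoc by simp
  next
    case False
    then have v: "v \<in> T" using uv by simp
    then have "u \<noteq> c" using uv(3) T(3) snoc.hyps(2) by auto
    then show ?thesis using T(4)[rule_format, of u v] uv v by auto
  qed
  moreover have "insert c T \<subseteq> {a..c}" using T(3) snoc.hyps(2) piecewise_C1_less[OF snoc.hyps(1)] by force
  ultimately show ?case using T(1,2) by (intro exI[of _ "insert c T"]) blast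
qed

lemma piecewise_C1_of_path:
  assumes "finite T" "{a, b} \<subseteq> T" "T \<subseteq> {a..b}" "a < b"
    "\<And>u v. u \<in> T \<Longrightarrow> v \<in> T \<Longrightarrow> u < v \<Longrightarrow> T \<inter> {u<..<v} = {} \<Longrightarrow> C1_arc A q u v"
  shows "piecewise_C1 q a b" using assms
proof (induction "card T" arbitrary: T b rule: less_induct)
  case less
  define u where "u = Max (T - {b})"
  have fin: "finite (T - {b})" "T - {b} \<noteq> {}" using less.prems by auto
  then have u: "u \<in> T" "u \<noteq> b" using Max_in[OF fin] unfolding u_def by auto
  then have ub: "a \<le> u" "u < b" using less.prems(3) by force+
  have umax: "t \<le> u" if "t \<in> T" "t \<noteq> b" for t using Max_ge[of "T - {b}" t] fin that unfolding u_def by auto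
  have arc: "C1_arc A q u b" using less.prems(2) umax by (intro less.prems(5) u ub) force+
  show ?case
  proof (cases "u = a")
    case True
    then show ?thesis using arc ub by (auto intro: piecewise_C1.arc)
  next
    case False
    have "piecewise_C1 q a u"
    proof (rule less.hyps[of "T - {b}"])
      show "card (T - {b}) < card T" using less.prems(1,2) by (intro psubset_card_mono) auto
      show "finite (T - {b})" using less.prems(1) by simp
      show "{a, u} \<subseteq> T - {b}" using less.prems(2,4) u by auto
      show "T - {b} \<subseteq> {a..u}" using subsetD[OF less.prems(3)] umax by fastforce
      show "a < u" using ub False by simp
      show "C1_arc A q x y" if xy: "x \<in> T - {b}" "y \<in> T - {b}" "x < y" "(T - {b}) \<inter> {x<..<y} = {}" for x y
      proof (rule less.prems(5))
        have "y < b" using umax[of y] xy ub by auto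
        then have "b \<notin> {x<..<y}" by simp
        then show "T \<inter> {x<..<y} = {}" using xy(4) by blast
      qed (use xy in simp_all)
    qed
    then show ?thesis using arc ub by (auto intro: piecewise_C1.snoc)
  qed
qed

lemma piecewise_C1_path_iff: "piecewise_C1_path A q \<longleftrightarrow> piecewise_C1 q 0 1"
proof
  assume "piecewise_C1_path A q"
  then obtain T where T: "finite T" "{0, 1} \<subseteq> T" "T \<subseteq> {0..1}"
    "\<forall>a\<in>T. \<forall>b\<in>T. a < b \<and> T \<inter> {a<..<b} = {} \<longrightarrow> C1_arc A q a b" unfolding piecewise_C1_path_def by blast
  then show "piecewise_C1 q 0 1" by (intro piecewise_C1_of_path[of T]) auto
next
  assume "piecewise_C1 q 0 1"
  from piecewise_C1_path_of[OF this] show "piecewise_C1_path A q" unfolding piecewise_C1_path_def .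
qed

lemma piecewise_C1_speed_integrable: "piecewise_C1 q a b \<Longrightarrow> speed A g q integrable_on {a..b}"
proof (induction rule: piecewise_C1.induct)
  case (arc a b)
  have "arc_speed {a..b} q integrable_on {a..b}" by (intro integrable_continuous_real continuous_arc_speed arc)
  then show ?case by (rule integrable_spike_finite[of "{a, b}", rotated 2]) (auto intro: speed_interior)
next
  case (snoc a b c)
  have "arc_speed {b..c} q integrable_on {b..c}" by (intro integrable_continuous_real continuous_arc_speed snoc)
  then have "speed A g q integrable_on {b..c}"
    by (rule integrable_spike_finite[of "{b, c}", rotated 2]) (auto intro: speed_interior)
  then show ?case
    using snoc piecewise_C1_less[OF snoc.hyps(1)] by (intro Henstock_Kurzweil_Integration.integrable_combine[of a b c]) auto
qed

lemma piecewise_C1_differentiable: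
  assumes "piecewise_C1 q a b"
  shows "\<exists>F. finite F \<and> (\<forall>t. a < t \<and> t < b \<and> t \<notin> F \<longrightarrow>
    isCont q t \<and> (\<forall>c\<in>A. q t \<in> fst c \<longrightarrow> (\<exists>D. ((\<lambda>s. snd c (q s)) has_vector_derivative D) (at t))))" using assms
proof (induction rule: piecewise_C1.induct)
  have int: "isCont q t \<and> (\<forall>c\<in>A. q t \<in> fst c \<longrightarrow> (\<exists>D. ((\<lambda>s. snd c (q s)) has_vector_derivative D) (at t)))"
    if arc: "C1_arc A q a b" and t: "a < t" "t < b" for a b t
  proof (intro conjI ballI impI)
    have "continuous_on {a..b} q" using arc unfolding C1_arc_def by blast
    then show "isCont q t" using t at_within_Icc_at[OF t] by (metis continuous_on_eq_continuous_within atLeastAtMost_iff less_imp_le)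
    fix c assume c: "c \<in> A" "q t \<in> fst c"
    obtain D where "\<And>t. t \<in> {a..b} \<Longrightarrow> q t \<in> fst c \<Longrightarrow> ((\<lambda>s. snd c (q s)) has_vector_derivative D t) (at t within {a..b})"
      using C1_arcD[OF arc c(1)] by metis
    then show "\<exists>D. ((\<lambda>s. snd c (q s)) has_vector_derivative D) (at t)"
      using t c at_within_Icc_at[OF t] by (metis atLeastAtMost_iff less_imp_le)
  qed
  {
    case (arc a b)
    then show ?case using int by (intro exI[of _ "{}"]) blast
  next
    case (snoc a b c)
    then obtain F where F: "finite F" "\<And>t. a < t \<Longrightarrow> t < b \<Longrightarrow> t \<notin> F \<Longrightarrow>
      isCont q t \<and> (\<forall>c\<in>A. q t \<in> fst c \<longrightarrow> (\<exists>D. ((\<lambda>s. snd c (q s)) has_vector_derivative D) (at t)))" by blast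
    show ?case
    proof (intro exI[of _ "insert b F"] conjI allI impI)
      fix t assume "a < t \<and> t < c \<and> t \<notin> insert b F"
      then consider "a < t" "t < b" "t \<notin> F" | "b < t" "t < c" by fastforce
      then show "isCont q t" "\<forall>c\<in>A. q t \<in> fst c \<longrightarrow> (\<exists>D. ((\<lambda>s. snd c (q s)) has_vector_derivative D) (at t))"
        using F(2) int[OF snoc.hyps(3)] by (cases; blast)+
    qed (use F in auto)
  }
qed

lemma speed_nonneg: "0 \<le> speed A g q t" unfolding speed_eq_arc_speed by (rule arc_speed_nonneg)

lemma dist_le_curve_length:
  assumes "piecewise_C1_path A q"
  shows "dist (q 0) (q 1) \<le> curve_length A g q" unfolding dist_eq_riemannian_dist riemannian_dist_def
proof (rule cInf_lower)
  show "curve_length A g q \<in> {curve_length A g q' |q'. piecewise_C1_path A q' \<and> pathstart q' = q 0 \<and> pathfinish q' = q 1}"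
    using assms by (auto simp: pathstart_def pathfinish_def)
  show "bdd_below {curve_length A g q' |q'. piecewise_C1_path A q' \<and> pathstart q' = q 0 \<and> pathfinish q' = q 1}"
    by (rule bdd_belowI[of _ 0])
      (auto simp: curve_length_def piecewise_C1_path_iff intro!: integral_nonneg piecewise_C1_speed_integrable speed_nonneg)
qed

text \<open>The Riemannian distance is defined by curves on \<open>[0, 1]\<close>, so the curve is
  rescaled affinely; its speed is multiplied by \<open>m\<close> off a finite set, which the
  integral does not see.\<close>

lemma dist_le_integral_speed:
  assumes pw: "piecewise_C1 q a b"
  shows "dist (q a) (q b) \<le> integral {a..b} (speed A g q)"
proof -
  have ab: "a < b" by (rule piecewise_C1_less[OF pw])
  define m where "m = b - a"
  have m: "0 < m" unfolding m_def using ab by simp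
  define q' where "q' s = q (m * s + a)" for s
  have pw': "piecewise_C1 q' 0 1" unfolding q'_def by (rule piecewise_C1_affine[OF pw m]) (auto simp: m_def)
  then have "dist (q' 0) (q' 1) \<le> integral {0..1} (speed A g q')"
    using dist_le_curve_length unfolding piecewise_C1_path_iff curve_length_def by blast
  moreover have "integral {0..1} (speed A g q') = integral {a..b} (speed A g q)"
  proof -
    obtain F where F: "finite F" "\<And>t. a < t \<Longrightarrow> t < b \<Longrightarrow> t \<notin> F \<Longrightarrow>
        isCont q t \<and> (\<forall>c\<in>A. q t \<in> fst c \<longrightarrow> (\<exists>D. ((\<lambda>s. snd c (q s)) has_vector_derivative D) (at t)))"
      using piecewise_C1_differentiable[OF pw] by blast
    define F' where "F' = {0, 1} \<union> (\<lambda>t. (t - a) / m) ` F"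
    have eq: "speed A g q' s = m * speed A g q (m * s + a)" if s: "s \<in> {0..1} - F'" for s
    proof -
      have "0 < s" "s < 1" "m * s + a \<notin> F" using s m unfolding F'_def by (auto simp: image_iff)
      moreover have "m * s < m * 1" using \<open>s < 1\<close> m by (intro mult_strict_left_mono) auto
      moreover have "m * 1 + a = b" "0 < m * s" using m \<open>0 < s\<close> unfolding m_def by auto
      ultimately have t: "a < m * s + a" "m * s + a < b" "m * s + a \<notin> F" by linarith+
      obtain c where c: "c \<in> A" "q (m * s + a) \<in> fst c" by (rule chart_cover)
      then obtain D where D: "((\<lambda>s. snd c (q s)) has_vector_derivative D) (at (m * s + a))" and ct: "isCont q (m * s + a)"
        using F(2)[OF t] by blast
      have lin: "((\<lambda>s. m * s + a) has_vector_derivative m) (at s)"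
        by (auto intro!: derivative_eq_intros simp: has_real_derivative_iff_has_vector_derivative[symmetric])
      have D': "((\<lambda>s. snd c (q' s)) has_vector_derivative m *\<^sub>R D) (at s)"
        using vector_diff_chain_at[OF lin D] unfolding q'_def by (simp add: o_def)
      have ct': "isCont q' s" unfolding q'_def by (rule isCont_o2[where f = "\<lambda>s. m * s + a", OF _ ct]) (auto intro: continuous_intros)
      interpret coordinate_metric c g "snd c ` fst c" by (rule coordinate_metric[OF c(1)])
      have "speed A g q' s = sqrt (g c (snd c (q' s)) (m *\<^sub>R D) (m *\<^sub>R D))" unfolding speed_eq_arc_speed
        by (rule arc_speed_chart[OF c(1)]) (use c D' ct' in \<open>auto simp: q'_def\<close>)
      also have "\<dots> = sqrt (m^2 * g c (snd c (q (m * s + a))) D D)"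
        using c unfolding q'_def by (simp add: algebra power2_eq_square mult.assoc)
      also have "\<dots> = m * sqrt (g c (snd c (q (m * s + a))) D D)" using m by (simp add: real_sqrt_mult)
      also have "sqrt (g c (snd c (q (m * s + a))) D D) = speed A g q (m * s + a)" unfolding speed_eq_arc_speed
        by (rule arc_speed_chart[OF c(1), symmetric]) (use c D ct in auto)
      finally show ?thesis .
    qed
    have "(speed A g q has_integral integral {a..b} (speed A g q)) (cbox a b)"
      using piecewise_C1_speed_integrable[OF pw] by (simp add: integrable_integral)
    from has_integral_affinity[OF this, of m a]
    have "((\<lambda>s. speed A g q (m * s + a)) has_integral (1 / m) * integral {a..b} (speed A g q))
        ((\<lambda>x. (1 / m) *\<^sub>R x + - ((1 / m) *\<^sub>R a)) ` {a..b})" using m by simp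
    moreover have "(\<lambda>x. (1 / m) *\<^sub>R x + - ((1 / m) *\<^sub>R a)) ` {a..b} = {0..1}"
    proof -
      have "(\<lambda>x. (1 / m) * x + - ((1 / m) * a)) ` {a..b} = {(1 / m) * a + - ((1 / m) * a)..(1 / m) * b + - ((1 / m) * a)}"
        using m ab by (subst image_affinity_atLeastAtMost) auto
      also have "(1 / m) * b + - ((1 / m) * a) = 1" using m unfolding m_def by (simp add: diff_divide_distrib[symmetric])
      finally show ?thesis by simp
    qed
    ultimately have "((\<lambda>s. speed A g q (m * s + a)) has_integral (1 / m) * integral {a..b} (speed A g q)) {0..1}" by simp
    from has_integral_mult_right[OF this, of m]
    have "((\<lambda>s. m * speed A g q (m * s + a)) has_integral integral {a..b} (speed A g q)) {0..1}" using m by simp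
    then have "(speed A g q' has_integral integral {a..b} (speed A g q)) {0..1}"
      by (rule has_integral_spike_finite[of F', rotated 2]) (use F(1) eq in \<open>auto simp: F'_def\<close>)
    then show ?thesis by (rule integral_unique)
  qed
  ultimately show ?thesis unfolding q'_def m_def by simp
qed

lemma C1_arc_chart_inv:
  assumes c: "c \<in> A" and ab: "a < b" and y: "\<And>t. t \<in> {a..b} \<Longrightarrow> y t \<in> snd c ` fst c"
    and D: "\<And>t. t \<in> {a..b} \<Longrightarrow> (y has_vector_derivative D t) (at t within {a..b})" and cont_D: "continuous_on {a..b} D"
  shows "C1_arc A (\<lambda>t. chart_inv c (y t)) a b"
    and "\<And>t. a < t \<Longrightarrow> t < b \<Longrightarrow> speed A g (\<lambda>t. chart_inv c (y t)) t = sqrt (g c (y t) (D t) (D t))"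
proof -
  let ?q = "\<lambda>t. chart_inv c (y t)"
  have cont_y: "continuous_on {a..b} y" by (rule continuous_on_vector_derivative[OF D])
  have cont: "continuous_on {a..b} ?q" by (rule continuous_on_compose2[OF chart_inv(5)[OF c] cont_y]) (use y in auto)
  have in': "?q t \<in> fst c" "snd c (?q t) = y t" if "t \<in> {a..b}" for t using chart_inv(2,3)[OF c y[OF that]] by auto
  have D': "((\<lambda>s. snd c (?q s)) has_vector_derivative D t) (at t within {a..b})" if t: "t \<in> {a..b}" for t
    by (rule has_vector_derivative_transform[OF t _ D[OF t]]) (simp add: in')
  show "C1_arc A ?q a b"
  proof (rule C1_arcI[OF cont])
    fix c' assume c': "c' \<in> A"
    define T where "T = {t \<in> {a..b}. ?q t \<in> fst c'}"
    show "\<exists>D. continuous_on {t \<in> {a..b}. ?q t \<in> fst c'} D \<and>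
        (\<forall>t\<in>{a..b}. ?q t \<in> fst c' \<longrightarrow> ((\<lambda>s. snd c' (?q s)) has_vector_derivative D t) (at t within {a..b}))"
    proof (intro exI[of _ "\<lambda>t. trans_deriv c c' (?q t) (D t)"] conjI ballI impI)
      show "((\<lambda>s. snd c' (?q s)) has_vector_derivative trans_deriv c c' (?q t) (D t)) (at t within {a..b})"
        if "t \<in> {a..b}" "?q t \<in> fst c'" for t
        using transition_curve_derivative[OF c c' in'(1)[OF that(1)] _ that(1) _ D'[OF that(1)]] that cont
        by (auto simp: continuous_on_eq_continuous_within)
      have "continuous_on T (\<lambda>t. \<Sum>i\<in>Basis. (D t \<bullet> i) *\<^sub>R trans_deriv c c' (?q t) i)"
      proof (intro continuous_intros continuous_on_subset[OF cont_D])
        show "continuous_on T (\<lambda>t. trans_deriv c c' (?q t) i)" for i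
          by (rule continuous_on_compose2[OF continuous_on_trans_deriv[OF c c'] continuous_on_subset[OF cont]])
            (use in' in \<open>auto simp: T_def\<close>)
      qed (auto simp: T_def)
      then have "continuous_on T (\<lambda>t. trans_deriv c c' (?q t) (D t))"
      proof (rule continuous_on_eq)
        fix t assume "t \<in> T"
        then have "linear (trans_deriv c c' (?q t))"
          using has_derivative_linear[OF transition_derivative[OF c c']] in' unfolding T_def by auto
        then show "(\<Sum>i\<in>Basis. (D t \<bullet> i) *\<^sub>R trans_deriv c c' (?q t) i) = trans_deriv c c' (?q t) (D t)"
          using linear_sum[of "trans_deriv c c' (?q t)" "\<lambda>i. (D t \<bullet> i) *\<^sub>R i" Basis] linear_cmul
          by (simp add: euclidean_representation linear_cmul)
      qed
      then show "continuous_on {t \<in> {a..b}. ?q t \<in> fst c'} (\<lambda>t. trans_deriv c c' (?q t) (D t))" unfolding T_def .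
    qed
  qed
  fix t assume t: "a < t" "t < b"
  then have t': "t \<in> {a..b}" by simp
  have "arc_speed {a..b} ?q t = sqrt (g c (snd c (?q t)) (D t) (D t))"
    by (rule arc_speed_chart[OF c in'(1)[OF t'] t' at_within_Icc_neq_bot[OF ab t'] _ D'[OF t']])
      (use cont t' in \<open>auto simp: continuous_on_eq_continuous_within\<close>)
  then show "speed A g ?q t = sqrt (g c (y t) (D t) (D t))" using speed_interior[OF t] in'(2)[OF t'] by simp
qed

lemma dist_le_of_coordinate_speed:
  assumes c: "c \<in> A" and ab: "a < b" and y: "\<And>t. t \<in> {a..b} \<Longrightarrow> y t \<in> snd c ` fst c"
    and D: "\<And>t. t \<in> {a..b} \<Longrightarrow> (y has_vector_derivative D t) (at t within {a..b})" and cont_D: "continuous_on {a..b} D"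
    and k: "\<And>t. t \<in> {a..b} \<Longrightarrow> sqrt (g c (y t) (D t) (D t)) \<le> k"
  shows "dist (chart_inv c (y a)) (chart_inv c (y b)) \<le> k * (b - a)"
proof -
  let ?q = "\<lambda>t. chart_inv c (y t)"
  note arc = C1_arc_chart_inv[OF c ab y D cont_D]
  have pw: "piecewise_C1 ?q a b" using arc(1) ab by (rule piecewise_C1.arc[rotated])
  have "dist (?q a) (?q b) \<le> integral {a..b} (speed A g ?q)" by (rule dist_le_integral_speed[OF pw])
  \<comment> \<open>At the two ends the one-sided derivatives do not control \<open>speed\<close>,
    so it is overwritten by \<open>k\<close>.\<close>
  also have "\<dots> = integral {a..b} (\<lambda>t. if t = a \<or> t = b then k else speed A g ?q t)"
    by (rule integral_spike[of "{a, b}"]) auto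
  also have "\<dots> \<le> integral {a..b} (\<lambda>t. k)"
  proof (rule integral_le)
    show "(\<lambda>t. if t = a \<or> t = b then k else speed A g ?q t) integrable_on {a..b}"
      by (rule integrable_spike_finite[OF _ _ piecewise_C1_speed_integrable[OF pw], of "{a, b}"]) auto
    show "(if t = a \<or> t = b then k else speed A g ?q t) \<le> k" if "t \<in> {a..b}" for t using arc(2)[of t] k[OF that] that by auto
  qed auto
  finally show ?thesis using ab by (simp add: mult.commute)
qed

end

context hadamard_space
begin

lemma C1_arc_cong:
  assumes arc: "C1_arc A q a b" and eq: "\<And>t. t \<in> {a..b} \<Longrightarrow> q t = q' t"
  shows "C1_arc A q' a b"
proof (rule C1_arcI)
  show "continuous_on {a..b} q'" using arc eq unfolding C1_arc_def by (auto intro: continuous_on_eq)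
  fix c assume c: "c \<in> A"
  obtain D where D: "continuous_on {t\<in>{a..b}. q t \<in> fst c} D"
    "\<And>t. t \<in> {a..b} \<Longrightarrow> q t \<in> fst c \<Longrightarrow> ((\<lambda>s. snd c (q s)) has_vector_derivative D t) (at t within {a..b})"
    using C1_arcD[OF arc c] by metis
  have S: "{t\<in>{a..b}. q t \<in> fst c} = {t\<in>{a..b}. q' t \<in> fst c}" using eq by auto
  show "\<exists>D. continuous_on {t\<in>{a..b}. q' t \<in> fst c} D \<and>
      (\<forall>t\<in>{a..b}. q' t \<in> fst c \<longrightarrow> ((\<lambda>s. snd c (q' s)) has_vector_derivative D t) (at t within {a..b}))"
  proof (intro exI[of _ D] conjI ballI impI)
    show "continuous_on {t\<in>{a..b}. q' t \<in> fst c} D" using D(1) S by simp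
    show "((\<lambda>s. snd c (q' s)) has_vector_derivative D t) (at t within {a..b})"
      if t: "t \<in> {a..b}" "q' t \<in> fst c" for t
      by (rule has_vector_derivative_transform[OF t(1) _ D(2)[OF t(1)]]) (use t eq in auto)
  qed
qed

lemma piecewise_C1_cong:
  assumes "piecewise_C1 q a b" "\<And>t. t \<in> {a..b} \<Longrightarrow> q t = q' t"
  shows "piecewise_C1 q' a b" using assms
proof (induction rule: piecewise_C1.induct)
  case (arc a b)
  then show ?case using C1_arc_cong by (blast intro: piecewise_C1.arc)
next
  case (snoc a b c)
  show ?case
  proof (rule piecewise_C1.snoc)
    show "piecewise_C1 q' a b" by (rule snoc.IH) (use snoc.prems snoc.hyps(2) in auto)
    show "C1_arc A q' b c" by (rule C1_arc_cong[OF snoc.hyps(3)]) (use snoc.prems piecewise_C1_less[OF snoc.hyps(1)] in auto)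
  qed (rule snoc.hyps)
qed

lemma piecewise_C1_join:
  assumes "piecewise_C1 q1 0 1" "piecewise_C1 q2 0 1" "q1 1 = q2 0"
  shows "\<exists>q. piecewise_C1 q 0 1 \<and> q 0 = q1 0 \<and> q 1 = q2 1"
proof -
  define q where "q t = (if t \<le> 1 then q1 t else q2 (t - 1))" for t :: real
  have "piecewise_C1 q 0 1" by (rule piecewise_C1_cong[OF assms(1)]) (auto simp: q_def)
  moreover have "piecewise_C1 (\<lambda>s. q2 (1 * s + (-1))) 1 2" by (rule piecewise_C1_affine[OF assms(2)]) auto
  then have "piecewise_C1 q 1 2" by (rule piecewise_C1_cong) (use assms(3) in \<open>auto simp: q_def\<close>)
  ultimately have "piecewise_C1 q 0 2" using piecewise_C1_append by blast
  then have "piecewise_C1 (\<lambda>s. q (2 * s + 0)) 0 1" by (rule piecewise_C1_affine) auto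
  then show ?thesis by (intro exI[of _ "\<lambda>s. q (2 * s + 0)"]) (auto simp: q_def)
qed

text \<open>Any two constant loops are homotopic in a simply connected space, and the track of the
  base point is a path.\<close>

lemma path_connected_space: "path_connected (UNIV :: 'a set)" unfolding path_connected_component
proof (intro ballI)
  fix x y :: 'a
  have "path (\<lambda>_. x)" "path (\<lambda>_. y)" by (simp_all add: path_def)
  then have "homotopic_loops UNIV (\<lambda>_. x) (\<lambda>_. y)"
    using simply_connected_UNIV unfolding simply_connected_def by (simp add: pathstart_def pathfinish_def)
  from homotopic_loops_imp_path_component_value[OF this, of 0]
  show "path_component UNIV x y" by simp
qed

text \<open>Being joined by a piecewise C1 curve is an equivalence relation with open classes, by
  straight lines in charts, and the space is connected. This makes the infimum defining the distance
  one over a nonempty set.\<close>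

lemma path_exists: "\<exists>q. piecewise_C1 q 0 1 \<and> q 0 = x \<and> q 1 = y"
proof -
  define P where "P x y \<longleftrightarrow> (\<exists>q. piecewise_C1 q 0 1 \<and> q 0 = x \<and> q 1 = y)" for x y
  have trans: "P x z" if xy: "P x y" and yz: "P y z" for x y z
  proof -
    obtain q1 where 1: "piecewise_C1 q1 0 1" "q1 0 = x" "q1 1 = y" using xy[unfolded P_def] by blast
    obtain q2 where 2: "piecewise_C1 q2 0 1" "q2 0 = y" "q2 1 = z" using yz[unfolded P_def] by blast
    show ?thesis using piecewise_C1_join[OF 1(1) 2(1)] 1 2 unfolding P_def by simp
  qed
  have "P x y \<and> P y x"
  proof (rule connected_equivalence_relation[where S = UNIV and R = "\<lambda>x y. P x y \<and> P y x"])
    show "connected (UNIV :: 'a set)" by (rule path_connected_imp_connected[OF path_connected_space])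
    fix x :: 'a
    obtain c where c: "c \<in> A" "x \<in> fst c" by (rule chart_cover)
    obtain e where e: "0 < e" "ball (snd c x) e \<subseteq> snd c ` fst c"
      using chart_openD(2)[OF c(1)] c(2) open_contains_ball by blast
    define T where "T = fst c \<inter> snd c -` ball (snd c x) e"
    have "open T" unfolding T_def by (rule continuous_open_preimage[OF chart_inv(4)[OF c(1)] chart_openD(1)[OF c(1)]]) auto
    moreover have "x \<in> T" using c e unfolding T_def by simp
    moreover have line: "P y z" if y: "y \<in> T" and z: "z \<in> T" for y z
    proof -
      define l where "l t = snd c y + t *\<^sub>R (snd c z - snd c y)" for t :: real
      have l: "l t \<in> snd c ` fst c" if "t \<in> {0..1}" for t
      proof -
        have "l t = (1 - t) *\<^sub>R snd c y + t *\<^sub>R snd c z" unfolding l_def by (simp add: algebra_simps)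
        then have "l t \<in> ball (snd c x) e"
          using convexD_alt[OF convex_ball[of "snd c x" e], of "snd c y" "snd c z" t] y z that unfolding T_def by simp
        then show ?thesis using e by blast
      qed
      have "C1_arc A (\<lambda>t. chart_inv c (l t)) 0 1"
      proof (rule C1_arc_chart_inv(1)[OF c(1) zero_less_one l, where D = "\<lambda>_. snd c z - snd c y"])
        show "(l has_vector_derivative snd c z - snd c y) (at t within {0..1})" for t
          unfolding l_def by (auto intro!: derivative_eq_intros)
      qed auto
      then have "piecewise_C1 (\<lambda>t. chart_inv c (l t)) 0 1" by (intro piecewise_C1.arc) auto
      moreover have "chart_inv c (l 0) = y" "chart_inv c (l 1) = z"
        using y z chart_inv(1)[OF c(1)] unfolding l_def T_def by auto
      ultimately show ?thesis unfolding P_def by blast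
    qed
    ultimately show "\<exists>T. openin (top_of_set UNIV) T \<and> x \<in> T \<and> (\<forall>y\<in>T. P x y \<and> P y x)" by (intro exI[of _ T]) auto
  qed (use trans in auto)
  then show ?thesis unfolding P_def by blast
qed

lemma short_path:
  assumes "0 < e" obtains q where "piecewise_C1 q 0 1" "q 0 = x" "q 1 = y" "integral {0..1} (speed A g q) < dist x y + e"
proof -
  define L where "L = {curve_length A g q |q. piecewise_C1_path A q \<and> pathstart q = x \<and> pathfinish q = y}"
  have "L \<noteq> {}" using path_exists[of x y] unfolding L_def piecewise_C1_path_iff pathstart_def pathfinish_def by blast
  moreover have "Inf L < dist x y + e" using assms unfolding dist_eq_riemannian_dist riemannian_dist_def L_def by simp
  ultimately obtain l where "l \<in> L" "l < dist x y + e" using cInf_lessD by blast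
  then show ?thesis using that unfolding L_def piecewise_C1_path_iff pathstart_def pathfinish_def curve_length_def by blast
qed

text \<open>By continuity an almost shortest curve contains a point at distance \<open>r\<close>
  from \<open>x\<close>, and the rest of its length bounds the distance from there to
  \<open>y\<close>. This is the link to \<open>length_space\<close>.\<close>

lemma approximate_intermediate_point:
  fixes x y :: 'a
  assumes "0 < e" and r: "0 \<le> r" "r \<le> dist x y"
  shows "\<exists>z. dist x z = r \<and> dist z y \<le> dist x y - r + e"
proof (cases "r = 0 \<or> r = dist x y")
  case True
  then show ?thesis
  proof
    assume "r = 0"
    then show ?thesis using assms(1) by (intro exI[of _ x]) auto
  next
    assume "r = dist x y"
    then show ?thesis using assms(1) by (intro exI[of _ y]) auto
  qed
next
  case False
  obtain q where q: "piecewise_C1 q 0 1" "q 0 = x" "q 1 = y" "integral {0..1} (speed A g q) < dist x y + e"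
    by (rule short_path[OF assms(1)])
  have "continuous_on {0..1} (\<lambda>t. dist x (q t))" by (intro continuous_intros piecewise_C1_continuous[OF q(1)])
  then obtain t where t: "0 \<le> t" "t \<le> 1" "dist x (q t) = r" using IVT'[of "\<lambda>t. dist x (q t)" 0 r 1] q r by auto
  have "t \<noteq> 0" "t \<noteq> 1" using t q False by auto
  then have t': "0 < t" "t < 1" using t by auto
  have "dist x (q t) \<le> integral {0..t} (speed A g q)" "dist (q t) y \<le> integral {t..1} (speed A g q)"
    using dist_le_integral_speed[OF piecewise_C1_subset[OF q(1)], of 0 t]
      dist_le_integral_speed[OF piecewise_C1_subset[OF q(1)], of t 1] t' q by auto
  moreover have "integral {0..t} (speed A g q) + integral {t..1} (speed A g q) = integral {0..1} (speed A g q)"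
    using t' by (intro Henstock_Kurzweil_Integration.integral_combine piecewise_C1_speed_integrable[OF q(1)]) auto
  ultimately show ?thesis using q(4) t(3) by (intro exI[of _ "q t"]) auto
qed

lemma locally_compact_ball: "\<exists>r>0. compact (cball (x :: 'a) r)"
proof -
  obtain c where c: "c \<in> A" "x \<in> fst c" by (rule chart_cover)
  obtain e where e: "0 < e" "cball (snd c x) e \<subseteq> snd c ` fst c"
    using chart_openD(2)[OF c(1)] c(2) open_contains_cball by blast
  define K where "K = chart_inv c ` cball (snd c x) e"
  have K: "compact K"
    unfolding K_def using e chart_inv(5)[OF c(1)] by (intro compact_continuous_image) (auto elim: continuous_on_subset)
  define T where "T = fst c \<inter> snd c -` ball (snd c x) e"
  have "open T" unfolding T_def by (rule continuous_open_preimage[OF chart_inv(4)[OF c(1)] chart_openD(1)[OF c(1)]]) auto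
  moreover have "x \<in> T" using c e unfolding T_def by simp
  ultimately obtain r where r: "0 < r" "cball x r \<subseteq> T" using open_contains_cball by blast
  have "T \<subseteq> K"
  proof
    fix y assume "y \<in> T"
    then have "y = chart_inv c (snd c y)" "snd c y \<in> cball (snd c x) e" using chart_inv(1)[OF c(1)] unfolding T_def by auto
    then show "y \<in> K" unfolding K_def by blast
  qed
  then have "cball x r = K \<inter> cball x r" using r by auto
  then show ?thesis using compact_Int_closed[OF K, of "cball x r"] r by auto
qed

end

context inner_product_family
begin

definition ipnorm :: "'e \<Rightarrow> 'e \<Rightarrow> real" where "ipnorm p u = sqrt (g p u u)"

lemma ipnorm_nonneg [simp]: "p \<in> W \<Longrightarrow> 0 \<le> ipnorm p u" unfolding ipnorm_def using nonneg by simp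

lemma ipnorm_sq: "p \<in> W \<Longrightarrow> (ipnorm p u)^2 = g p u u" unfolding ipnorm_def using nonneg by simp

lemma ip_le_ipnorm: assumes p: "p \<in> W" shows "g p u v \<le> ipnorm p u * ipnorm p v"
proof -
  have "(g p u v)^2 \<le> (ipnorm p u * ipnorm p v)^2"
    using cauchy_schwarz[OF p] by (simp add: power_mult_distrib ipnorm_sq[OF p])
  then show ?thesis using p by (meson abs_le_square_iff abs_ge_self abs_of_nonneg ipnorm_nonneg mult_nonneg_nonneg order_trans power2_le_imp_le)
qed

lemma ipnorm_triangle: assumes p: "p \<in> W" shows "ipnorm p (u + v) \<le> ipnorm p u + ipnorm p v"
proof (rule power2_le_imp_le)
  have "(ipnorm p (u + v))^2 = g p u u + 2 * g p u v + g p v v"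
    using p sym[OF p, of v u] by (simp add: ipnorm_sq[OF p] algebra)
  also have "\<dots> \<le> (ipnorm p u + ipnorm p v)^2" using ip_le_ipnorm[OF p, of u v] by (simp add: power2_sum ipnorm_sq[OF p])
  finally show "(ipnorm p (u + v))^2 \<le> (ipnorm p u + ipnorm p v)^2" .
  show "0 \<le> ipnorm p u + ipnorm p v" using p by simp
qed

lemma ipnorm_scale: "p \<in> W \<Longrightarrow> ipnorm p (r *\<^sub>R u) = \<bar>r\<bar> * ipnorm p u"
  unfolding ipnorm_def by (simp add: algebra real_sqrt_mult mult.assoc[symmetric])

lemma ipnorm_minus: "p \<in> W \<Longrightarrow> ipnorm p (- u) = ipnorm p u" using ipnorm_scale[of p "-1" u] by simp

lemma continuous_ipnorm: assumes p: "p \<in> W" shows "continuous_on UNIV (ipnorm p)"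
proof -
  have "continuous_on UNIV (\<lambda>u. g p u u)"
    by (rule continuous_on_bilinear_family[where y = "\<lambda>_. p" and B = g, OF bil cont]) (use p in auto)
  then show ?thesis unfolding ipnorm_def[abs_def] by (intro continuous_intros)
qed

lemma local_upper_bound:
  assumes "cball p r \<subseteq> W" "0 < r" obtains C where "0 < C" "\<And>q u. q \<in> cball p r \<Longrightarrow> g q u u \<le> C * (norm u)^2"
proof -
  have "compact (cball p r \<times> sphere (0::'e) 1)" by (intro compact_Times) auto
  moreover have "continuous_on (cball p r \<times> sphere (0::'e) 1) (\<lambda>x. g (fst x) (snd x) (snd x))"
    by (rule continuous_on_bilinear_family[OF bil cont]) (use assms in \<open>auto intro!: continuous_intros\<close>)
  ultimately obtain B where B: "\<And>x. x \<in> cball p r \<times> sphere (0::'e) 1 \<Longrightarrow> norm (g (fst x) (snd x) (snd x)) \<le> B"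
    using compact_continuous_norm_bound by blast
  have "g q u u \<le> max B 1 * (norm u)^2" if q: "q \<in> cball p r" for q u
  proof (cases "u = 0")
    case True
    then show ?thesis using q assms by (simp add: algebra subsetD)
  next
    case False
    have q': "q \<in> W" using q assms by blast
    have "g q u u / (norm u)^2 = g q (u /\<^sub>R norm u) (u /\<^sub>R norm u)"
      using q' by (simp add: algebra power2_eq_square field_simps)
    also have "\<dots> \<le> max B 1" using B[of "(q, u /\<^sub>R norm u)"] q False by simp
    finally show ?thesis using False by (simp add: field_simps)
  qed
  then show ?thesis using that[of "max B 1"] by simp
qed

end

section \<open>Normal coordinates\<close>

text \<open>\<open>f\<close> plays the role of the exponential map at \<open>f 0\<close>, defined on the set \<open>V\<close> of short tangent vectors; \<open>b\<close> is the
  inner product of the tangent space. The second condition on distances expresses nonpositive curvature.\<close>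

definition normal_coordinates ::
  "('e::euclidean_space \<Rightarrow> 'e \<Rightarrow> real) \<Rightarrow> ('e \<Rightarrow> 'a::metric_space) \<Rightarrow> 'e set \<Rightarrow> bool" where
  "normal_coordinates b f V \<longleftrightarrow> inner_product_family UNIV (\<lambda>_. b) \<and> 0 \<in> V \<and>
     (\<forall>u\<in>V. \<forall>t\<in>{0..1}. t *\<^sub>R u \<in> V) \<and>
     (\<forall>u\<in>V. \<forall>w\<in>V. sqrt (b (u - w) (u - w)) \<le> dist (f u) (f w)) \<and>
     (\<forall>u\<in>V. \<forall>t\<in>{0..1}. \<exists>v\<in>V. dist (f 0) (f v) \<le> t * sqrt (b u u) \<and> dist (f v) (f u) \<le> (1 - t) * sqrt (b u u)) \<and>
     (\<forall>u\<in>V. \<forall>w\<in>V. \<forall>\<epsilon>>0. \<exists>t. 0 < t \<and> t \<le> 1 \<and> dist (f (t *\<^sub>R u)) (f (t *\<^sub>R w)) \<le> t * (sqrt (b (u - w) (u - w)) + \<epsilon>))"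

text \<open>Solutions are the fixed points of \<open>v - E v + q\<close>. This map halves distances
  because \<open>E'\<close> is within 1/2 of the identity, and the condition on \<open>q\<close>
  keeps the ball invariant.\<close>

lemma solve_near_identity:
  fixes E :: "'e::euclidean_space \<Rightarrow> 'e"
  assumes der: "\<And>v. v \<in> cball 0 r \<Longrightarrow> (E has_derivative E' v) (at v)"
    and near: "\<And>v w. v \<in> cball 0 r \<Longrightarrow> norm (E' v w - w) \<le> norm w / 2" and q: "norm (q - E 0) \<le> r / 2"
  obtains v where "v \<in> cball 0 r" "E v = q"
proof -
  have r: "0 \<le> r" using q norm_ge_zero[of "q - E 0"] by linarith
  define \<Phi> where "\<Phi> v = v - E v + q" for v
  have lip: "dist (\<Phi> v) (\<Phi> w) \<le> (1 / 2) * dist v w" if v: "v \<in> cball 0 r" and w: "w \<in> cball 0 r" for v w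
  proof -
    have "norm ((v - E v) - (w - E w)) \<le> (1 / 2) * norm (v - w)"
    proof (rule differentiable_bound[OF convex_cball _ _ v w])
      show "((\<lambda>v. v - E v) has_derivative (\<lambda>h. h - E' x h)) (at x within cball 0 r)" if "x \<in> cball 0 r" for x
        by (intro has_derivative_diff has_derivative_ident has_derivative_at_withinI[OF der[OF that]])
      show "onorm (\<lambda>h. h - E' x h) \<le> 1 / 2" if "x \<in> cball 0 r" for x
        by (rule onorm_bound) (use near[OF that] in \<open>auto simp: norm_minus_commute\<close>)
    qed
    then show ?thesis unfolding \<Phi>_def dist_norm by (simp add: algebra_simps)
  qed
  have "\<exists>!v\<in>cball 0 r. \<Phi> v = v"
  proof (rule Banach_fix[OF _ _ _ _ _ lip])
    show "complete (cball (0::'e) r)" using complete_eq_closed by blast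
    show "cball (0::'e) r \<noteq> {}" using r by simp
    show "\<Phi> ` cball 0 r \<subseteq> cball 0 r"
    proof clarify
      fix v :: 'e assume v: "v \<in> cball 0 r"
      have "norm (\<Phi> v) \<le> norm (\<Phi> v - \<Phi> 0) + norm (\<Phi> 0)" by (metis diff_add_cancel norm_triangle_ineq)
      also have "\<dots> \<le> (1 / 2) * norm v + r / 2"
        using lip[OF v, of 0] r q unfolding \<Phi>_def by (simp add: dist_norm norm_minus_commute)
      finally show "\<Phi> v \<in> cball 0 r" using v by simp
    qed
  qed auto
  then show ?thesis using that unfolding \<Phi>_def by (metis add_diff_cancel_left' diff_add_cancel add.commute diff_diff_eq2)
qed

context hadamard_space
begin

text \<open>The inequality of Bruhat and Tits at a dividing point \<open>n\<close> is read off in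
  coordinates centred at \<open>n\<close>, so one ball must be covered by the coordinates around
  each of its points. Hence the uniformity of \<open>exponential_map\<close> in the base
  point.\<close>

lemma normal_coordinates_exist:
  fixes x0 :: 'a
  shows "\<exists>\<sigma>>0. \<forall>n\<in>ball x0 \<sigma>. \<exists>(b :: 'e \<Rightarrow> 'e \<Rightarrow> real) f V. normal_coordinates b f V \<and> f 0 = n \<and> ball x0 \<sigma> \<subseteq> f ` V"
proof -
  obtain c where c: "c \<in> A" "x0 \<in> fst c" by (rule chart_cover)
  define W where "W = snd c ` fst c"
  interpret coordinate_metric c g W unfolding W_def by (rule coordinate_metric[OF c(1)])
  define p0 where "p0 = snd c x0"
  have p0: "p0 \<in> W" unfolding p0_def W_def using c by simp
  note chart = chart_inv[OF c(1), folded W_def]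
  show ?thesis
  proof (rule exponential_map[OF p0], rule local_bounds[OF p0])
    fix r E E' r2 k
    assume r: "0 < r" and E: "\<And>p v. p \<in> ball p0 r \<Longrightarrow> v \<in> ball 0 r \<Longrightarrow> E p v \<in> W"
        "\<And>p v. p \<in> ball p0 r \<Longrightarrow> v \<in> ball 0 r \<Longrightarrow> (E p has_derivative E' p v) (at v)"
        "\<And>p w. p \<in> ball p0 r \<Longrightarrow> continuous_on (ball 0 r) (\<lambda>v. E' p v w)"
        "\<And>p v w. p \<in> ball p0 r \<Longrightarrow> v \<in> ball 0 r \<Longrightarrow> norm (E' p v w - w) \<le> norm w / 2"
        "\<And>p. p \<in> ball p0 r \<Longrightarrow> E p 0 = p"
        "\<And>p w. p \<in> ball p0 r \<Longrightarrow> E' p 0 w = w"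
        "\<And>p v w. p \<in> ball p0 r \<Longrightarrow> v \<in> ball 0 r \<Longrightarrow> g c p w w \<le> g c (E p v) (E' p v w) (E' p v w)"
      and radial: "\<And>p v. p \<in> ball p0 r \<Longrightarrow> v \<in> ball 0 r \<Longrightarrow> \<exists>\<tau> y y'. 0 < \<tau> \<and> y 0 = p \<and> y \<tau> = E p v \<and> continuous_on {0..\<tau>} y' \<and>
         (\<forall>t\<in>{0..\<tau>}. y t \<in> W \<and> (y has_vector_derivative y' t) (at t within {0..\<tau>}) \<and>
         g c (y t) (y' t) (y' t) = g c p v v / \<tau>^2)"
      and r2: "0 < r2" and k: "0 < k" "cball p0 r2 \<subseteq> W" "\<And>q u. q \<in> cball p0 r2 \<Longrightarrow> k * (norm u)^2 \<le> g c q u u"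
    obtain C where C: "0 < C" "\<And>q u. q \<in> cball p0 r2 \<Longrightarrow> g c q u u \<le> C * (norm u)^2"
      using local_upper_bound[OF k(2) r2] by blast
    \<comment> \<open>Tangent vectors of \<open>g\<close>-norm below \<open>R\<close> are shorter
      than \<open>r\<close> in the Euclidean norm, hence in the domain of the exponential
      map.\<close>
    define R where "R = sqrt k * r"
    have R: "0 < R" unfolding R_def using k r by simp
    \<comment> \<open>Chosen so that the vectors needed to reach \<open>ball x0 \<sigma>\<close>
      have \<open>g\<close>-norm at most \<open>R / 12\<close>, which is less than
      \<open>R / 3\<close>.\<close>
    define r1 where "r1 = R / (6 * sqrt C)"
    have r1: "0 < r1" unfolding r1_def using R C by simp
    define s where "s = min (min r r2) (min (r1 / 8) (r / 8))"
    have s: "0 < s" "s \<le> r" "s \<le> r2" "s \<le> r1 / 8" "s \<le> r / 8" unfolding s_def using r r2 r1 by auto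
    define T where "T = fst c \<inter> snd c -` ball p0 s"
    have "open T" unfolding T_def by (rule continuous_open_preimage[OF chart(4) chart_openD(1)[OF c(1)]]) auto
    moreover have "x0 \<in> T" unfolding T_def p0_def using c s by simp
    ultimately obtain \<sigma> where \<sigma>: "0 < \<sigma>" "ball x0 \<sigma> \<subseteq> T" using open_contains_ball by blast
    have "\<exists>(b :: 'e \<Rightarrow> 'e \<Rightarrow> real) f V. normal_coordinates b f V \<and> f 0 = n \<and> ball x0 \<sigma> \<subseteq> f ` V" if n: "n \<in> ball x0 \<sigma>" for n
    proof -
      define p where "p = snd c n"
      have nc: "n \<in> fst c" "p \<in> ball p0 s" using n \<sigma> unfolding T_def p_def by auto
      have p: "p \<in> ball p0 r" "p \<in> cball p0 r2" "p \<in> W" using nc s unfolding W_def p_def by auto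
      define N where "N = ipnorm p"
      have N0: "0 \<le> N u" for u unfolding N_def using p by simp
      have Nscale: "N (a *\<^sub>R u) = \<bar>a\<bar> * N u" for a u unfolding N_def using ipnorm_scale p by blast
      have Ntri: "N (u + v) \<le> N u + N v" for u v unfolding N_def using ipnorm_triangle p by blast
      have Nminus: "N (u - v) = N (v - u)" for u v unfolding N_def using ipnorm_minus[OF p(3), of "u - v"] by simp
      have NC: "N u \<le> sqrt C * norm u" for u
        unfolding N_def ipnorm_def using real_sqrt_le_mono[OF C(2)[OF p(2), of u]] by (simp add: real_sqrt_mult)
      have Nk: "sqrt k * norm u \<le> N u" for u
        unfolding N_def ipnorm_def using real_sqrt_le_mono[OF k(3)[OF p(2), of u]] by (simp add: real_sqrt_mult)
      have Nsmall: "u \<in> ball 0 r" if "N u < R" for u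
      proof -
        have "sqrt k * norm u < sqrt k * r" using Nk[of u] that unfolding R_def by linarith
        then show ?thesis using k(1) by simp
      qed
      have Ncont: "continuous_on UNIV N" unfolding N_def by (rule continuous_ipnorm[OF p(3)])
      define BR where "BR = {u. N u < R}"
      have BR: "BR \<subseteq> ball 0 r" "open BR" unfolding BR_def using Nsmall
        by (auto intro!: open_Collect_less Ncont continuous_intros)
      define F where "F = E p"
      have Fcont: "continuous_on (ball 0 r) F"
        unfolding F_def using E(2)[OF p(1)] by (meson continuous_at_imp_continuous_on has_derivative_continuous)
      have FW: "F v \<in> W" if "v \<in> ball 0 r" for v unfolding F_def using E(1)[OF p(1) that] .
      \<comment> \<open>The derivative stays within 1/2 of the identity, so the exponential map is
        injective on the Euclidean ball, and invariance of domain provides a continuous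
        inverse.\<close>
      have Finj: "inj_on F (ball 0 r)"
      proof (rule inj_onI)
        fix v w assume v: "v \<in> ball 0 r" and w: "w \<in> ball 0 r" and eq: "F v = F w"
        have "norm ((v - F v) - (w - F w)) \<le> (1 / 2) * norm (v - w)"
        proof (rule differentiable_bound[OF convex_ball _ _ v w])
          show "((\<lambda>v. v - F v) has_derivative (\<lambda>h. h - E' p x h)) (at x within ball 0 r)" if "x \<in> ball 0 r" for x
            unfolding F_def by (intro has_derivative_diff has_derivative_ident has_derivative_at_withinI[OF E(2)[OF p(1) that]])
          show "onorm (\<lambda>h. h - E' p x h) \<le> 1 / 2" if "x \<in> ball 0 r" for x
            by (rule onorm_bound) (use E(4)[OF p(1) that] in \<open>auto simp: norm_minus_commute\<close>)
        qed
        then show "v = w" using eq by simp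
      qed
      obtain Fi where Fi: "homeomorphism (ball 0 r) (F ` ball 0 r) F Fi"
        using invariance_of_domain_homeomorphism[OF open_ball Fcont _ Finj] by auto
      have Fopen: "open (F ` S)" if "open S" "S \<subseteq> ball 0 r" for S
        by (rule invariance_of_domain[OF continuous_on_subset[OF Fcont that(2)] that(1) inj_on_subset[OF Finj that(2)]])
      have FiF: "Fi (F v) = v" if "v \<in> ball 0 r" for v using Fi that unfolding homeomorphism_def by auto
      have FiCont: "continuous_on (F ` ball 0 r) Fi" using Fi unfolding homeomorphism_def by auto
      define f where "f v = chart_inv c (F v)" for v
      have snd_f: "snd c (f v) = F v" "f v \<in> fst c" if "v \<in> ball 0 r" for v
        unfolding f_def using chart(2,3) FW[OF that] by auto
      have finj: "v = w" if "f v = f w" "v \<in> ball 0 r" "w \<in> ball 0 r" for v w using that snd_f inj_onD[OF Finj] by metis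
      have f0: "f 0 = n" unfolding f_def F_def E(5)[OF p(1)] using chart(1)[OF nc(1)] by (simp add: p_def)
      have fcont: "continuous_on (ball 0 r) f"
        unfolding f_def by (rule continuous_on_compose2[OF chart(5) Fcont]) (use FW in auto)
      have fimage: "f ` S = fst c \<inter> snd c -` (F ` S)" if "S \<subseteq> ball 0 r" for S
      proof (intro equalityI subsetI)
        fix x assume "x \<in> f ` S"
        then show "x \<in> fst c \<inter> snd c -` (F ` S)" using snd_f that by auto
      next
        fix x assume "x \<in> fst c \<inter> snd c -` (F ` S)"
        then obtain v where v: "v \<in> S" "snd c x = F v" "x \<in> fst c" by auto
        then have "x = f v" unfolding f_def using chart(1) by metis
        then show "x \<in> f ` S" using v by blast
      qed
      have fopen: "open (f ` S)" if "open S" "S \<subseteq> ball 0 r" for S unfolding fimage[OF that(2)]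
        by (rule continuous_open_preimage[OF chart(4) chart_openD(1)[OF c(1)] Fopen[OF that]])

      \<comment> \<open>The exponential map does not shrink vectors, so the curve \<open>u\<close>
        in the tangent space is no longer than \<open>\<gamma>\<close>. Its total displacement
        \<open>w\<close> is measured with the linear function \<open>g(w, u)\<close>, whose
        derivative is at most \<open>N w\<close> times the speed of \<open>\<gamma>\<close>.\<close>
      have inside: "N (Fi (snd c (\<gamma> t2)) - Fi (snd c (\<gamma> t1))) \<le> integral {t1..t2} (speed A g \<gamma>)"
        if pw: "piecewise_C1 \<gamma> t1 t2" and in': "\<And>t. t \<in> {t1..t2} \<Longrightarrow> \<gamma> t \<in> f ` ball 0 r" for \<gamma> t1 t2
      proof -
        define u where "u t = Fi (snd c (\<gamma> t))" for t
        have \<gamma>: "\<gamma> t \<in> fst c" "snd c (\<gamma> t) \<in> F ` ball 0 r" "F (u t) = snd c (\<gamma> t)" "u t \<in> ball 0 r" if "t \<in> {t1..t2}" for t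
          using in'[OF that] snd_f FiF unfolding u_def by auto
        have t12: "t1 < t2" by (rule piecewise_C1_less[OF pw])
        have cu: "continuous_on {t1..t2} u" unfolding u_def
          by (intro continuous_on_compose2[OF FiCont] continuous_on_compose2[OF chart(4)] piecewise_C1_continuous[OF pw])
            (use \<gamma> in auto)
        define w where "w = u t2 - u t1"
        define h where "h t = g c p w (u t)" for t
        have ch: "continuous_on {t1..t2} h"
          unfolding h_def by (rule continuous_on_bilinear_family[where y = "\<lambda>_. p" and B = "g c" and U = "\<lambda>_. w", OF bil cont])
            (use p cu in auto)
        obtain X where X: "finite X" "\<And>t. t1 < t \<Longrightarrow> t < t2 \<Longrightarrow> t \<notin> X \<Longrightarrow>
            isCont \<gamma> t \<and> (\<forall>c\<in>A. \<gamma> t \<in> fst c \<longrightarrow> (\<exists>D. ((\<lambda>s. snd c (\<gamma> s)) has_vector_derivative D) (at t)))"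
          using piecewise_C1_differentiable[OF pw] by blast
        have "\<exists>h'. (h has_vector_derivative h') (at t) \<and> h' \<le> N w * speed A g \<gamma> t" if t: "t \<in> {t1<..<t2} - X" for t
        proof -
          have t': "t \<in> {t1..t2}" using t by auto
          obtain D where D: "isCont \<gamma> t" "((\<lambda>s. snd c (\<gamma> s)) has_vector_derivative D) (at t)"
            using X(2)[of t] t c(1) \<gamma>(1)[OF t'] by auto
          define L where "L = E' p (u t)"
          have linL: "linear L" unfolding L_def by (rule has_derivative_linear[OF E(2)[OF p(1) \<gamma>(4)[OF t']]])
          have injL: "inj L"
          proof (rule linear_injective_0[OF linL, THEN iffD2], intro allI impI)
            fix x assume "L x = 0"
            then show "x = 0" using E(4)[OF p(1) \<gamma>(4)[OF t'], of x] unfolding L_def by simp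
          qed
          obtain L' where L': "linear L'" "L' \<circ> L = id" using linear_injective_left_inverse[OF linL injL] by blast
          have LL': "L (L' x) = x" for x
            using linear_injective_imp_surjective[OF linL injL] L'(2) by (metis comp_apply id_apply surjD)
          have "(Fi has_derivative L') (at (snd c (\<gamma> t)))"
          proof (rule has_derivative_inverse_basic[where f = F and f' = L and T = "F ` ball 0 r"])
            show "(F has_derivative L) (at (Fi (snd c (\<gamma> t))))" using E(2)[OF p(1) \<gamma>(4)[OF t']] unfolding F_def L_def u_def .
            show "bounded_linear L'" using L'(1) linear_conv_bounded_linear by blast
            show "open (F ` ball 0 r)" by (rule Fopen) auto
            then show "continuous (at (snd c (\<gamma> t))) Fi" using FiCont \<gamma>(2)[OF t'] continuous_on_eq_continuous_at by blast
            show "F (Fi z) = z" if "z \<in> F ` ball 0 r" for z using that FiF by auto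
          qed (use L' \<gamma>(2)[OF t'] in auto)
          then have "((\<lambda>s. Fi (snd c (\<gamma> s))) has_derivative (\<lambda>h. L' (h *\<^sub>R D))) (at t)"
            by (rule has_derivative_compose[OF D(2)[unfolded has_vector_derivative_def]])
          then have u': "(u has_vector_derivative L' D) (at t)"
            unfolding has_vector_derivative_def u_def[abs_def] using linear_cmul[OF L'(1)] by simp
          have "(h has_vector_derivative 0 + g c p 0 (u t) + g c p w (L' D)) (at t)" unfolding h_def[abs_def]
            by (rule has_vector_derivative_bilinear_family[where y = "\<lambda>_. p" and B' = "dg p" and w = 0 and U = "\<lambda>_. w" and B = "g c",
                  OF open_W p(3) bil dg[OF p(3)], THEN has_vector_derivative_eq_rhs])
              (use u' p(3) linear_0[OF linear_dg[OF p(3)]] in auto)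
          then have h': "(h has_vector_derivative g c p w (L' D)) (at t)" by (simp add: algebra[OF p(3)])
          have "speed A g \<gamma> t = sqrt (g c (snd c (\<gamma> t)) D D)"
            unfolding speed_eq_arc_speed by (rule arc_speed_chart[OF c(1)]) (use \<gamma>(1)[OF t'] D in auto)
          also have "\<dots> \<ge> N (L' D)" unfolding N_def ipnorm_def
            using E(7)[OF p(1) \<gamma>(4)[OF t'], of "L' D"] LL'[of D] \<gamma>(3)[OF t'] unfolding L_def F_def
            by (intro real_sqrt_le_mono) simp
          finally have "N (L' D) \<le> speed A g \<gamma> t" .
          then have "g c p w (L' D) \<le> N w * speed A g \<gamma> t"
            using ip_le_ipnorm[OF p(3), of w "L' D"] mult_left_mono[of "N (L' D)" "speed A g \<gamma> t" "N w"] N0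
            unfolding N_def by force
          then show ?thesis using h' by blast
        qed
        then obtain h' where h': "\<And>t. t \<in> {t1<..<t2} - X \<Longrightarrow> (h has_vector_derivative h' t) (at t)"
          "\<And>t. t \<in> {t1<..<t2} - X \<Longrightarrow> h' t \<le> N w * speed A g \<gamma> t" by metis
        have hi: "(h' has_integral (h t2 - h t1)) {t1..t2}"
          by (rule fundamental_theorem_of_calculus_interior_strong[OF X(1) less_imp_le[OF t12] h'(1) ch])
        have si: "((\<lambda>t. N w * speed A g \<gamma> t) has_integral N w * integral {t1..t2} (speed A g \<gamma>)) {t1..t2}"
          by (intro has_integral_mult_right integrable_integral piecewise_C1_speed_integrable[OF pw])
        define Y where "Y = X \<union> {t1, t2}"
        have "((\<lambda>t. if t \<in> Y then N w * speed A g \<gamma> t else h' t) has_integral (h t2 - h t1)) {t1..t2}"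
          by (rule has_integral_spike_finite[OF _ _ hi, of Y]) (use X(1) in \<open>auto simp: Y_def\<close>)
        then have "h t2 - h t1 \<le> N w * integral {t1..t2} (speed A g \<gamma>)"
          by (rule has_integral_le[OF _ si]) (use h'(2) in \<open>auto simp: Y_def\<close>)
        moreover have "h t2 - h t1 = N w * N w" unfolding h_def using ipnorm_sq[OF p(3), of w] algebra[OF p(3)]
          by (simp add: w_def N_def power2_eq_square)
        ultimately have "N w * N w \<le> N w * integral {t1..t2} (speed A g \<gamma>)" by simp
        moreover have "0 \<le> integral {t1..t2} (speed A g \<gamma>)"
          by (rule integral_nonneg[OF piecewise_C1_speed_integrable[OF pw] speed_nonneg])
        ultimately show ?thesis using N0[of w] unfolding w_def u_def by (metis mult_le_cancel_left_pos order_le_less)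
      qed
      \<comment> \<open>A short curve cannot leave the coordinate ball: before a first exit time
        \<open>inside\<close> confines it to the image of \<open>{u. N u \<le> R'}\<close> with
        \<open>R' < R\<close>, which is compact, so the exit point would lie in it as well.\<close>
      have stay: "\<exists>v. \<gamma> t2 = f v \<and> N (v - v0) \<le> integral {t1..t2} (speed A g \<gamma>)"
        if pw: "piecewise_C1 \<gamma> t1 t2" and st: "\<gamma> t1 = f v0" and short: "N v0 + integral {t1..t2} (speed A g \<gamma>) < R" for \<gamma> t1 t2 v0
      proof -
        define l where "l = integral {t1..t2} (speed A g \<gamma>)"
        have t12: "t1 < t2" by (rule piecewise_C1_less[OF pw])
        have mono: "integral {t1..t} (speed A g \<gamma>) \<le> l" if "t1 \<le> t" "t \<le> t2" for t unfolding l_def using that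
          by (intro integral_subset_le integrable_subinterval_real[OF piecewise_C1_speed_integrable[OF pw]]
              piecewise_C1_speed_integrable[OF pw]) (auto simp: speed_nonneg)
        have l0: "0 \<le> l" unfolding l_def by (rule integral_nonneg[OF piecewise_C1_speed_integrable[OF pw] speed_nonneg])
        then have Nv0: "N v0 < R" using short l_def by simp
        define R' where "R' = N v0 + l"
        have R': "0 \<le> R'" "R' < R" using short l_def l0 N0[of v0] unfolding R'_def by auto
        define K where "K = f ` {u. N u \<le> R'}"
        have KB: "{u. N u \<le> R'} \<subseteq> BR" unfolding BR_def using R' by auto
        have "compact {u. N u \<le> R'}"
        proof -
          have "closed {u. N u \<le> R'}" by (intro closed_Collect_le Ncont continuous_intros)
          moreover have "bounded {u. N u \<le> R'}" using KB BR(1) bounded_subset[OF bounded_ball] by blast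
          ultimately show ?thesis using compact_eq_bounded_closed by blast
        qed
        then have Kcl: "closed K"
          unfolding K_def using KB BR(1) by (intro compact_imp_closed compact_continuous_image continuous_on_subset[OF fcont]) auto
        define Cc where "Cc = {t \<in> {t1..t2}. \<gamma> t \<notin> f ` BR}"
        have good: "\<gamma> t \<in> K" "N (Fi (snd c (\<gamma> t)) - v0) \<le> integral {t1..t} (speed A g \<gamma>)"
          if t: "t1 < t" "t \<le> t2" and in': "\<And>t'. t' \<in> {t1..t} \<Longrightarrow> \<gamma> t' \<in> f ` BR" for t
        proof -
          have "\<gamma> t' \<in> f ` ball 0 r" if "t' \<in> {t1..t}" for t' using in'[OF that] BR(1) by blast
          from inside[OF piecewise_C1_subset[OF pw _ t] this]
          have le: "N (Fi (snd c (\<gamma> t)) - Fi (snd c (\<gamma> t1))) \<le> integral {t1..t} (speed A g \<gamma>)" by simp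
          have "Fi (snd c (\<gamma> t1)) = v0" unfolding st using snd_f(1) FiF Nsmall[OF Nv0] by simp
          with le show le': "N (Fi (snd c (\<gamma> t)) - v0) \<le> integral {t1..t} (speed A g \<gamma>)" by simp
          obtain v where v: "v \<in> BR" "\<gamma> t = f v" using in'[of t] t by auto
          have vF: "Fi (snd c (\<gamma> t)) = v" using v BR(1) snd_f(1) FiF by auto
          have "N v \<le> N v0 + l" using Ntri[of "v - v0" v0] le' mono[of t] t unfolding vF by simp
          then show "\<gamma> t \<in> K" unfolding K_def R'_def using v by auto
        qed
        have "Cc = {}"
        proof (rule ccontr)
          assume ne: "Cc \<noteq> {}"
          have "Cc = {t1..t2} \<inter> \<gamma> -` (- (f ` BR))" unfolding Cc_def by auto
          moreover have "closed \<dots>"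
            by (rule continuous_closed_preimage[OF piecewise_C1_continuous[OF pw]]) (use fopen[OF BR(2,1)] in auto)
          ultimately have "closed Cc" by simp
          moreover have bdd: "bdd_below Cc" unfolding Cc_def by (rule bdd_belowI[of _ t1]) auto
          ultimately have "Inf Cc \<in> Cc" using closed_contains_Inf ne by blast
          then have i: "Inf Cc \<in> {t1..t2}" "\<gamma> (Inf Cc) \<notin> f ` BR" unfolding Cc_def by auto
          have "t1 \<noteq> Inf Cc" using i(2) st Nv0 unfolding BR_def by force
          then have i1: "t1 < Inf Cc" using i by simp
          have before: "\<gamma> t \<in> f ` BR" if "t1 \<le> t" "t < Inf Cc" for t
          proof (rule ccontr)
            assume "\<gamma> t \<notin> f ` BR"
            then have "t \<in> Cc" unfolding Cc_def using that i by auto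
            then show False using cInf_lower[OF _ bdd, of t] that by simp
          qed
          define Z where "Z = {t1..t2} \<inter> \<gamma> -` K"
          have "closed Z" unfolding Z_def by (rule continuous_closed_preimage[OF piecewise_C1_continuous[OF pw] _ Kcl]) auto
          moreover have "{t1<..<Inf Cc} \<subseteq> Z"
          proof
            fix t assume t: "t \<in> {t1<..<Inf Cc}"
            then have "\<gamma> t \<in> K" using i before by (intro good(1)) auto
            then show "t \<in> Z" unfolding Z_def using t i by auto
          qed
          ultimately have "closure {t1<..<Inf Cc} \<subseteq> Z" by (rule closure_minimal[rotated])
          then have "Inf Cc \<in> Z" using i1 by (simp add: closure_greaterThanLessThan subset_iff)
          then show False using i(2) KB unfolding Z_def K_def by auto
        qed
        then have in': "\<gamma> t \<in> f ` BR" if "t \<in> {t1..t2}" for t using that unfolding Cc_def by auto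
        obtain v where v: "v \<in> BR" "\<gamma> t2 = f v" using in'[of t2] t12 by auto
        have "Fi (snd c (\<gamma> t2)) = v" using v BR(1) snd_f(1) FiF by auto
        then show ?thesis using good(2)[OF t12 order_refl in'] v by auto
      qed
      \<comment> \<open>A curve from \<open>f u\<close> shorter than \<open>N (u - w)\<close>, with
        both vectors in \<open>V\<close>, stays within norm \<open>R / 3 + 2 * R / 3 = R\<close>,
        where \<open>stay\<close> applies.\<close>
      define V where "V = {u. N u < R / 3}"
      have VR: "N u < R" "u \<in> ball 0 r" if "u \<in> V" for u using that R Nsmall unfolding V_def by auto
      have lower: "N (u - w) \<le> dist (f u) (f w)" if u: "u \<in> V" and w: "w \<in> V" for u w
      proof (rule ccontr)
        assume "\<not> ?thesis"
        then have "0 < N (u - w) - dist (f u) (f w)" by simp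
        then obtain \<gamma> where \<gamma>: "piecewise_C1 \<gamma> 0 1" "\<gamma> 0 = f u" "\<gamma> 1 = f w" "integral {0..1} (speed A g \<gamma>) < N (u - w)"
          using short_path[of "N (u - w) - dist (f u) (f w)" "f u" "f w"] by auto
        have "N (u - w) \<le> N u + N w" using Ntri[of u "- w"] ipnorm_minus[OF p(3), of w] unfolding N_def by simp
        then have "N u + integral {0..1} (speed A g \<gamma>) < R" using u w \<gamma>(4) unfolding V_def by simp
        from stay[OF \<gamma>(1,2) this] obtain v where v: "f w = f v" "N (v - u) \<le> integral {0..1} (speed A g \<gamma>)" using \<gamma>(3) by auto
        have "N v \<le> N (v - u) + N u" using Ntri[of "v - u" u] by simp
        then have "N v < R" using v(2) \<open>N u + integral {0..1} (speed A g \<gamma>) < R\<close> by linarith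
        then have "v = w" using finj[OF v(1)[symmetric] Nsmall VR(2)[OF w]] by simp
        then show False using v \<gamma>(4) Nminus[of u w] by simp
      qed
      \<comment> \<open>The radial geodesic has constant speed, so its point at time
        \<open>t * \<tau>\<close> divides the distances in the right ratio; \<open>stay\<close>
        shows that this point has coordinates in \<open>V\<close>.\<close>
      have rad: "\<exists>v\<in>V. dist (f 0) (f v) \<le> t * N u \<and> dist (f v) (f u) \<le> (1 - t) * N u" if u: "u \<in> V" and t: "t \<in> {0..1}" for u t
      proof -
        obtain \<tau> y y' where y: "0 < \<tau>" "y 0 = p" "y \<tau> = F u" "continuous_on {0..\<tau>} y'"
          "\<forall>t\<in>{0..\<tau>}. y t \<in> W \<and> (y has_vector_derivative y' t) (at t within {0..\<tau>}) \<and> g c (y t) (y' t) (y' t) = g c p u u / \<tau>^2"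
          using radial[OF p(1) VR(2)[OF u]] unfolding F_def by blast
        define \<gamma> where "\<gamma> s = chart_inv c (y s)" for s
        have sp: "sqrt (g c (y s) (y' s) (y' s)) = N u / \<tau>" if "s \<in> {0..\<tau>}" for s
          using y that unfolding N_def ipnorm_def by (simp add: real_sqrt_divide)
        have yd: "\<And>s. s \<in> {a..b} \<Longrightarrow> y s \<in> snd c ` fst c" "\<And>s. s \<in> {a..b} \<Longrightarrow> (y has_vector_derivative y' s) (at s within {a..b})"
           "continuous_on {a..b} y'" "\<And>s. s \<in> {a..b} \<Longrightarrow> sqrt (g c (y s) (y' s) (y' s)) \<le> N u / \<tau>"
          if "0 \<le> a" "b \<le> \<tau>" for a b
        proof -
          have sub: "{a..b} \<subseteq> {0..\<tau>}" using that by auto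
          show "y s \<in> snd c ` fst c" "(y has_vector_derivative y' s) (at s within {a..b})"
            "sqrt (g c (y s) (y' s) (y' s)) \<le> N u / \<tau>" if "s \<in> {a..b}" for s
            using y(5) sp[of s] sub that has_vector_derivative_within_subset[of y "y' s" s "{0..\<tau>}" "{a..b}"]
            unfolding W_def by auto
          show "continuous_on {a..b} y'" using y(4) sub by (rule continuous_on_subset)
        qed
        have dle: "dist (\<gamma> a) (\<gamma> b) \<le> N u / \<tau> * (b - a)" if "0 \<le> a" "a \<le> b" "b \<le> \<tau>" for a b
        proof (cases "a = b")
          case False
          then have ab: "a < b" using that by simp
          show ?thesis unfolding \<gamma>_def
            by (rule dist_le_of_coordinate_speed[OF c(1) ab yd(1)[OF that(1,3)] yd(2)[OF that(1,3)] yd(3)[OF that(1,3)] yd(4)[OF that(1,3)]])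
        qed simp
        define s where "s = t * \<tau>"
        have s: "0 \<le> s" "s \<le> \<tau>" unfolding s_def using t y(1) by (auto simp: mult_left_le_one_le)
        have \<gamma>0: "\<gamma> 0 = f 0" unfolding \<gamma>_def y(2) f_def F_def E(5)[OF p(1)] ..
        have \<gamma>\<tau>: "\<gamma> \<tau> = f u" unfolding \<gamma>_def y(3) f_def ..
        have d1: "dist (f 0) (\<gamma> s) \<le> t * N u" using dle[of 0 s] s y(1) unfolding \<gamma>0 s_def by (simp add: mult.commute)
        have d2: "dist (\<gamma> s) (f u) \<le> (1 - t) * N u"
        proof -
          have "N u / \<tau> * (\<tau> - s) = (1 - t) * N u" unfolding s_def using y(1) by (simp add: field_simps)
          then show ?thesis using dle[of s \<tau>] s unfolding \<gamma>\<tau> by simp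
        qed
        have "\<exists>v\<in>V. \<gamma> s = f v"
        proof (cases "s = 0")
          case True
          then show ?thesis using \<gamma>0 R Nscale[of 0 0] unfolding V_def by (intro bexI[of _ 0]) auto
        next
          case False
          then have s0: "0 < s" using s by simp
          have pw: "piecewise_C1 \<gamma> 0 s"
            unfolding \<gamma>_def using C1_arc_chart_inv(1)[OF c(1) s0 yd(1)[of 0 s] yd(2)[of 0 s] yd(3)[of 0 s]] s s0 by (intro piecewise_C1.arc) auto
          have "integral {0..s} (speed A g \<gamma>) = integral {0..s} (\<lambda>_. N u / \<tau>)"
          proof (rule integral_spike[of "{0, s}"])
            fix x assume x: "x \<in> {0..s} - {0, s}"
            have "speed A g \<gamma> x = sqrt (g c (y x) (y' x) (y' x))"
              unfolding \<gamma>_def using x s by (intro C1_arc_chart_inv(2)[OF c(1) s0 yd(1)[of 0 s] yd(2)[of 0 s] yd(3)[of 0 s]]) auto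
            then show "N u / \<tau> = speed A g \<gamma> x" using sp x s by auto
          qed auto
          also have "\<dots> = t * N u" using s0 y(1) unfolding s_def by simp
          finally have int: "integral {0..s} (speed A g \<gamma>) = t * N u" .
          have tN: "t * N u \<le> N u" using t N0[of u] by (auto simp: mult_left_le_one_le)
          have "N 0 = 0" using Nscale[of 0 0] by simp
          then have "N 0 + integral {0..s} (speed A g \<gamma>) < R" using int tN VR(1)[OF u] by simp
          from stay[OF pw \<gamma>0 this] obtain v where "\<gamma> s = f v" "N v \<le> t * N u" using int by auto
          then show ?thesis using tN u unfolding V_def by (intro bexI[of _ v]) auto
        qed
        then show ?thesis using d1 d2 by auto
      qed
      \<comment> \<open>Near 0 the pulled-back metric is close to the inner product of the tangent
        space, so the image of the straight segment from \<open>t *\<^sub>R u\<close> to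
        \<open>t *\<^sub>R w\<close> is hardly longer than the segment itself.\<close>
      have infinitesimal: "\<exists>t. 0 < t \<and> t \<le> 1 \<and> dist (f (t *\<^sub>R u)) (f (t *\<^sub>R w)) \<le> t * (N (u - w) + \<eta>)"
        if u: "u \<in> V" and w: "w \<in> V" and \<eta>: "0 < \<eta>" for u w \<eta>
      proof -
        define z where "z = w - u"
        define G where "G v = sqrt (g c (F v) (E' p v z) (E' p v z))" for v
        have "continuous_on (ball 0 r) (\<lambda>v. g c (F v) (E' p v z) (E' p v z))"
          by (rule continuous_on_bilinear_family[where y = F and B = "g c", OF bil cont])
            (use Fcont FW E(3)[OF p(1)] in auto)
        then have "continuous_on (ball 0 r) G" unfolding G_def by (intro continuous_intros)
        then have "isCont G 0" using r by (auto simp: continuous_on_eq_continuous_at)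
        moreover have "G 0 = N z" unfolding G_def F_def N_def ipnorm_def E(5)[OF p(1)] E(6)[OF p(1)] ..
        ultimately obtain d where d: "0 < d" "\<And>v. norm v < d \<Longrightarrow> \<bar>G v - N z\<bar> < \<eta>"
          using \<eta> unfolding continuous_at_eps_delta by (auto simp: dist_norm)
        define M where "M = norm u + norm w + 1"
        have M: "0 < M" unfolding M_def by (simp add: add_nonneg_pos)
        define t where "t = min 1 (d / (2 * M))"
        have t: "0 < t" "t \<le> 1" "t * M < d"
        proof -
          show "0 < t" "t \<le> 1" unfolding t_def using d M by auto
          have "t * M \<le> d / (2 * M) * M" unfolding t_def using M by (intro mult_right_mono) auto
          also have "\<dots> = d / 2" using M by simp
          finally show "t * M < d" using d by simp
        qed
        define y where "y s = F (t *\<^sub>R (u + s *\<^sub>R z))" for s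
        define D where "D s = t *\<^sub>R E' p (t *\<^sub>R (u + s *\<^sub>R z)) z" for s
        have small: "t *\<^sub>R (u + s *\<^sub>R z) \<in> ball 0 r" "norm (t *\<^sub>R (u + s *\<^sub>R z)) < d" if s: "s \<in> {0..1}" for s
        proof -
          have e: "u + s *\<^sub>R z = (1 - s) *\<^sub>R u + s *\<^sub>R w" unfolding z_def by (simp add: algebra_simps)
          have "u + s *\<^sub>R z \<in> ball 0 r" unfolding e using convexD_alt[OF convex_ball VR(2)[OF u] VR(2)[OF w]] s by auto
          then have "norm (u + s *\<^sub>R z) < r" by simp
          moreover have "norm (t *\<^sub>R (u + s *\<^sub>R z)) \<le> norm (u + s *\<^sub>R z)" using t by (simp add: mult_left_le_one_le)
          ultimately show "t *\<^sub>R (u + s *\<^sub>R z) \<in> ball 0 r" by simp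
          have "norm (u + s *\<^sub>R z) \<le> norm ((1 - s) *\<^sub>R u) + norm (s *\<^sub>R w)" unfolding e by (rule norm_triangle_ineq)
          also have "\<dots> \<le> norm u + norm w" using s by (intro add_mono) (auto simp: mult_left_le_one_le)
          also have "\<dots> \<le> M" unfolding M_def by simp
          finally have "t * norm (u + s *\<^sub>R z) \<le> t * M" using t by (intro mult_left_mono) auto
          then show "norm (t *\<^sub>R (u + s *\<^sub>R z)) < d" using t by (simp only: norm_scaleR)
        qed
        have "dist (chart_inv c (y 0)) (chart_inv c (y 1)) \<le> (t * (N z + \<eta>)) * (1 - 0)"
        proof (rule dist_le_of_coordinate_speed[OF c(1), where D = D])
          fix s :: real assume s: "s \<in> {0..1}"
          show "y s \<in> snd c ` fst c" unfolding y_def using FW[OF small(1)[OF s]] unfolding W_def .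
          have "((\<lambda>s. t *\<^sub>R (u + s *\<^sub>R z)) has_derivative (\<lambda>h. t *\<^sub>R h *\<^sub>R z)) (at s within {0..1})"
            by (auto intro!: derivative_eq_intros)
          from has_derivative_compose[OF this E(2)[OF p(1) small(1)[OF s]]]
          have "(y has_derivative (\<lambda>h. E' p (t *\<^sub>R (u + s *\<^sub>R z)) (t *\<^sub>R h *\<^sub>R z))) (at s within {0..1})"
            unfolding y_def F_def .
          moreover have "E' p (t *\<^sub>R (u + s *\<^sub>R z)) (t *\<^sub>R h *\<^sub>R z) = h *\<^sub>R D s" for h
            unfolding D_def using linear_cmul[OF has_derivative_linear[OF E(2)[OF p(1) small(1)[OF s]]]] by (simp add: mult.commute)
          ultimately show "(y has_vector_derivative D s) (at s within {0..1})" unfolding has_vector_derivative_def by simp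
          have Fs: "F (t *\<^sub>R (u + s *\<^sub>R z)) \<in> W" using FW[OF small(1)[OF s]] .
          have "sqrt (g c (y s) (D s) (D s)) = t * G (t *\<^sub>R (u + s *\<^sub>R z))"
            unfolding y_def D_def G_def using Fs t by (simp add: algebra real_sqrt_mult mult.assoc[symmetric])
          also have "\<dots> \<le> t * (N z + \<eta>)" using d(2)[OF small(2)[OF s]] t by (intro mult_left_mono) auto
          finally show "sqrt (g c (y s) (D s) (D s)) \<le> t * (N z + \<eta>)" .
        next
          show "continuous_on {0..1} D" unfolding D_def
            by (intro continuous_intros continuous_on_compose2[OF E(3)[OF p(1)]]) (use small(1) in auto)
        qed auto
        then have "dist (f (t *\<^sub>R u)) (f (t *\<^sub>R w)) \<le> t * (N (u - w) + \<eta>)"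
          unfolding y_def f_def z_def using Nminus[of u w] by simp
        then show ?thesis using t by blast
      qed
      have onto: "x \<in> f ` V" if x: "x \<in> ball x0 \<sigma>" for x
      proof -
        define \<rho> where "\<rho> = min (r1 / 2) (r / 2)"
        have \<rho>: "0 < \<rho>" "\<rho> \<le> r1 / 2" "\<rho> \<le> r / 2" "s \<le> \<rho> / 4" using r1 r s unfolding \<rho>_def by auto
        have xc: "x \<in> fst c" "snd c x \<in> ball p0 s" using x \<sigma> unfolding T_def by auto
        have "dist (snd c x) p < s + s" using xc(2) nc(2) dist_triangle[of "snd c x" p p0] by (simp add: dist_commute)
        then have "norm (snd c x - E p 0) \<le> \<rho> / 2" using \<rho> E(5)[OF p(1)] by (simp add: dist_norm)
        moreover have "v \<in> ball 0 r" if "v \<in> cball 0 \<rho>" for v :: 'e using that \<rho> r by auto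
        ultimately obtain v where v: "v \<in> cball 0 \<rho>" "E p v = snd c x"
          using solve_near_identity[of \<rho> "E p" "E' p" "snd c x"] E(2)[OF p(1)] E(4)[OF p(1)] by metis
        have "N v \<le> sqrt C * norm v" by (rule NC)
        also have "\<dots> \<le> sqrt C * (r1 / 2)" using v(1) \<rho> C by (intro mult_left_mono) auto
        also have "\<dots> = R / 12" unfolding r1_def using C by simp
        finally have "v \<in> V" unfolding V_def using R by simp
        moreover have "f v = x" unfolding f_def F_def v(2) using chart(1)[OF xc(1)] .
        ultimately show ?thesis by blast
      qed
      have "normal_coordinates (g c p) f V" unfolding normal_coordinates_def
      proof (intro conjI ballI allI impI)
        show "inner_product_family UNIV (\<lambda>_. g c p)" by standard (use p bil sym pos in auto)
        show "0 \<in> V" unfolding V_def using R Nscale[of 0 0] by simp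
        show "t *\<^sub>R u \<in> V" if "u \<in> V" "t \<in> {0..1}" for u t
          using that N0[of u] mult_left_le_one_le[of "N u" t] unfolding V_def by (auto simp: Nscale)
      qed (use lower rad infinitesimal in \<open>auto simp: N_def ipnorm_def\<close>)
      then show ?thesis using f0 onto by blast
    qed
    then show ?thesis using \<sigma>(1) by blast
  qed
qed

end

section \<open>Comparison in normal coordinates\<close>

locale normal_chart =
  fixes b :: "'e::euclidean_space \<Rightarrow> 'e \<Rightarrow> real" and f :: "'e \<Rightarrow> 'a::metric_space" and V :: "'e set"
  assumes coords: "normal_coordinates b f V"
begin

sublocale ip: inner_product_family UNIV "\<lambda>_::'e. b" using coords unfolding normal_coordinates_def by blast

abbreviation N :: "'e \<Rightarrow> real" where "N u \<equiv> sqrt (b u u)"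

lemma zero: "0 \<in> V" and lower: "u \<in> V \<Longrightarrow> w \<in> V \<Longrightarrow> N (u - w) \<le> dist (f u) (f w)"
  and scale: "u \<in> V \<Longrightarrow> 0 \<le> t \<Longrightarrow> t \<le> 1 \<Longrightarrow> t *\<^sub>R u \<in> V" using coords unfolding normal_coordinates_def by auto

lemma radial: "u \<in> V \<Longrightarrow> 0 \<le> t \<Longrightarrow> t \<le> 1 \<Longrightarrow> \<exists>v\<in>V. dist (f 0) (f v) \<le> t * N u \<and> dist (f v) (f u) \<le> (1 - t) * N u"
  using coords unfolding normal_coordinates_def by auto

lemma infinitesimal:
  "u \<in> V \<Longrightarrow> w \<in> V \<Longrightarrow> 0 < e \<Longrightarrow> \<exists>t. 0 < t \<and> t \<le> 1 \<and> dist (f (t *\<^sub>R u)) (f (t *\<^sub>R w)) \<le> t * (N (u - w) + e)"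
  using coords unfolding normal_coordinates_def by blast

lemmas ip_algebra = ip.algebra[OF UNIV_I]

lemma ip_sym: "b u v = b v u" by (rule ip.sym[OF UNIV_I])

lemma N_nonneg: "0 \<le> N u" using ip.nonneg[of 0] by simp

lemma N_sq: "(N u)^2 = b u u" using ip.nonneg[of 0] by simp

lemma dist_center: "u \<in> V \<Longrightarrow> dist (f 0) (f u) = N u"
proof (rule antisym)
  assume u: "u \<in> V"
  show "N u \<le> dist (f 0) (f u)" using lower[OF u zero] by (simp add: dist_commute)
  show "dist (f 0) (f u) \<le> N u" using radial[OF u, of 1] by auto
qed

text \<open>\<open>radial\<close> provides a vector \<open>v\<close> with the right bounds on two
  norms but says nothing of its direction. In an inner product space the equality case of the
  triangle inequality forces \<open>v = t *\<^sub>R u\<close>.\<close>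

lemma dist_segment:
  assumes u: "u \<in> V" and t: "0 \<le> t" "t \<le> 1"
  shows "dist (f (t *\<^sub>R u)) (f u) \<le> (1 - t) * N u"
proof -
  obtain v where v: "v \<in> V" "dist (f 0) (f v) \<le> t * N u" "dist (f v) (f u) \<le> (1 - t) * N u" using radial[OF u t] by blast
  have 1: "b v v \<le> t^2 * b u u"
    using power_mono[of "N v" "t * N u" 2] v(2) dist_center[OF v(1)] N_nonneg[of v] N_sq by (simp add: power_mult_distrib)
  have "N (v - u) \<le> (1 - t) * N u" using lower[OF v(1) u] v(3) by linarith
  then have 2: "b (v - u) (v - u) \<le> (1 - t)^2 * b u u"
    using power_mono[of "N (v - u)" "(1 - t) * N u" 2] N_nonneg[of "v - u"] N_sq by (simp add: power_mult_distrib)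
  have 3: "b (v - u) (v - u) = b v v - 2 * b u v + b u u" using ip_sym[of v u] by (simp add: ip_algebra)
  have "b (v - t *\<^sub>R u) (v - t *\<^sub>R u) = b v v - 2 * t * b u v + t^2 * b u u"
    using ip_sym[of v u] by (simp add: ip_algebra power2_eq_square algebra_simps)
  also have "\<dots> \<le> (1 - t) * (b v v - t^2 * b u u)"
  proof -
    have "b v v + b u u - (1 - t)^2 * b u u \<le> 2 * b u v" using 2 3 by simp
    then have "t * (b v v + b u u - (1 - t)^2 * b u u) \<le> t * (2 * b u v)" using t by (intro mult_left_mono) auto
    then show ?thesis by (simp add: power2_eq_square algebra_simps)
  qed
  also have "\<dots> \<le> 0" using 1 t by (simp add: mult_nonneg_nonpos)
  finally have "v = t *\<^sub>R u" using ip.eq_0_iff[of 0 "v - t *\<^sub>R u"] ip.nonneg[of 0 "v - t *\<^sub>R u"] by simp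
  then show ?thesis using v(3) by simp
qed

text \<open>The path from \<open>f u\<close> radially inward to scale \<open>t\<close>, across, and
  outward to \<open>f w\<close> has radial parts of total length \<open>(1 - t)\<close> times
  \<open>dist (f u) (f w)\<close>. What remains is that this distance is at most
  \<open>N (u - w)\<close>, so the two vectors realize equality in the triangle inequality.\<close>

lemma opposite:
  assumes u: "u \<in> V" and w: "w \<in> V" and l: "0 \<le> l" "l \<le> 1"
    and D: "dist (f 0) (f u) = l * dist (f u) (f w)" "dist (f 0) (f w) = (1 - l) * dist (f u) (f w)"
  shows "(1 - l) *\<^sub>R u + l *\<^sub>R w = 0"
proof -
  define d where "d = dist (f u) (f w)"
  have Nd: "N u = l * d" "N w = (1 - l) * d" using D dist_center[OF u] dist_center[OF w] unfolding d_def by auto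
  have "d \<le> N (u - w)"
  proof (rule field_le_epsilon)
    fix e :: real assume "0 < e"
    then obtain t where t: "0 < t" "t \<le> 1" "dist (f (t *\<^sub>R u)) (f (t *\<^sub>R w)) \<le> t * (N (u - w) + e)"
      using infinitesimal[OF u w] by blast
    have "d \<le> dist (f u) (f (t *\<^sub>R u)) + dist (f (t *\<^sub>R u)) (f (t *\<^sub>R w)) + dist (f (t *\<^sub>R w)) (f w)"
      unfolding d_def using dist_triangle[of "f u" "f w" "f (t *\<^sub>R w)"] dist_triangle[of "f u" "f (t *\<^sub>R w)" "f (t *\<^sub>R u)"] by simp
    also have "\<dots> \<le> (1 - t) * N u + t * (N (u - w) + e) + (1 - t) * N w"
      using dist_segment[OF u, of t] dist_segment[OF w, of t] t by (intro add_mono) (auto simp: dist_commute)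
    finally have "t * d \<le> t * (N (u - w) + e)" unfolding Nd by (simp add: algebra_simps)
    then show "d \<le> N (u - w) + e" using t by simp
  qed
  then have "d^2 \<le> b (u - w) (u - w)" using power_mono[of d "N (u - w)" 2] N_sq unfolding d_def by simp
  also have "\<dots> = (N u)^2 - 2 * b u w + (N w)^2" unfolding N_sq using ip_sym[of w u] by (simp add: ip_algebra)
  finally have "2 * b u w \<le> (l * d)^2 + ((1 - l) * d)^2 - d^2" unfolding Nd by simp
  then have uw: "b u w \<le> - (l * (1 - l) * d^2)" by (simp add: power2_eq_square algebra_simps)
  have "b ((1 - l) *\<^sub>R u + l *\<^sub>R w) ((1 - l) *\<^sub>R u + l *\<^sub>R w) = (1 - l)^2 * (N u)^2 + 2 * (l * (1 - l)) * b u w + l^2 * (N w)^2"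
    unfolding N_sq using ip_sym[of w u] by (simp add: ip_algebra power2_eq_square algebra_simps)
  also have "\<dots> \<le> (1 - l)^2 * (N u)^2 + 2 * (l * (1 - l)) * (- (l * (1 - l) * d^2)) + l^2 * (N w)^2"
    using uw l by (intro add_mono mult_left_mono) auto
  also have "\<dots> = 0" unfolding Nd by (simp add: power2_eq_square algebra_simps)
  finally show ?thesis using ip.eq_0_iff[of 0 "(1 - l) *\<^sub>R u + l *\<^sub>R w"] ip.nonneg[of 0 "(1 - l) *\<^sub>R u + l *\<^sub>R w"] by simp
qed

text \<open>For opposite vectors Stewart's formula is an identity of the inner product. Distances
  from the centre are exact, and the other distances are at least those in the tangent
  space.\<close>

lemma cn_center:
  assumes u: "u \<in> V" and w: "w \<in> V" and q: "q \<in> V" and l: "0 \<le> l" "l \<le> 1"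
    and D: "dist (f 0) (f u) = l * dist (f u) (f w)" "dist (f 0) (f w) = (1 - l) * dist (f u) (f w)"
  shows "(dist (f q) (f 0))^2 \<le> (1 - l) * (dist (f q) (f u))^2 + l * (dist (f q) (f w))^2 - l * (1 - l) * (dist (f u) (f w))^2"
proof -
  define d where "d = dist (f u) (f w)"
  have Nd: "b u u = (l * d)^2" "b w w = ((1 - l) * d)^2"
    using D dist_center[OF u] dist_center[OF w] N_sq unfolding d_def by metis+
  have op: "(1 - l) * b q u + l * b q w = 0"
  proof -
    have "(1 - l) * b q u + l * b q w = b q ((1 - l) *\<^sub>R u + l *\<^sub>R w)" by (simp add: ip_algebra)
    then show ?thesis unfolding opposite[OF u w l D] by (simp add: ip_algebra)
  qed
  have "b (q - u) (q - u) \<le> (dist (f q) (f u))^2" "b (q - w) (q - w) \<le> (dist (f q) (f w))^2"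
    using power_mono[OF lower[OF q u] N_nonneg, of 2] power_mono[OF lower[OF q w] N_nonneg, of 2] unfolding N_sq by auto
  then have "(1 - l) * b (q - u) (q - u) + l * b (q - w) (q - w) \<le> (1 - l) * (dist (f q) (f u))^2 + l * (dist (f q) (f w))^2"
    using l by (intro add_mono mult_left_mono) auto
  moreover have "(1 - l) * b (q - u) (q - u) + l * b (q - w) (q - w) = b q q - 2 * ((1 - l) * b q u + l * b q w) + (1 - l) * b u u + l * b w w"
    using ip_sym[of u q] ip_sym[of w q] by (simp add: ip_algebra algebra_simps)
  moreover have "(dist (f q) (f 0))^2 = b q q" using dist_center[OF q] N_sq by (simp add: dist_commute)
  ultimately show ?thesis unfolding op Nd d_def[symmetric] by (simp add: power2_eq_square algebra_simps)
qed

end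

context hadamard_space
begin

text \<open>Coordinates are centred at the dividing point \<open>n\<close>, or at the point
  \<open>n\<close> where a geodesic might branch; in the second case both continuations are opposite
  to the same vector. The radius \<open>r / 3\<close> keeps dividing points within \<open>r\<close>
  of \<open>x0\<close>.\<close>

lemma local_geometry:
  fixes x0 :: 'a
  shows "\<exists>r>0. cn_on (ball x0 r) \<and> nonbranching_on (ball x0 r)"
proof -
  obtain r where r: "0 < r" "\<And>n. n \<in> ball x0 r \<Longrightarrow>
      \<exists>(b :: 'e \<Rightarrow> 'e \<Rightarrow> real) f V. normal_coordinates b f V \<and> f 0 = n \<and> ball x0 r \<subseteq> f ` V"
    using normal_coordinates_exist[of x0] by blast
  have "cn_on (ball x0 (r / 3))" unfolding cn_on_def
  proof (intro ballI allI impI, elim conjE)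
    fix x y z n l
    assume S: "x \<in> ball x0 (r / 3)" "y \<in> ball x0 (r / 3)" "z \<in> ball x0 (r / 3)" and l: "0 \<le> l" "l \<le> 1"
      and n: "dist x n = l * dist x y" "dist n y = (1 - l) * dist x y"
    have "dist x y < 2 * (r / 3)" using S dist_triangle_half_l[of x0 x "2 * (r / 3)" y] dist_triangle[of x y x0] by (auto simp: dist_commute)
    moreover have "l * dist x y \<le> dist x y" using l by (simp add: mult_left_le_one_le)
    ultimately have "n \<in> ball x0 r" using S(1) n(1) dist_triangle[of x0 n x] by simp
    from r(2)[OF this] obtain b :: "'e \<Rightarrow> 'e \<Rightarrow> real" and f V where
      nc: "normal_coordinates b f V" "f 0 = n" "ball x0 r \<subseteq> f ` V" by blast
    interpret normal_chart b f V by standard (rule nc)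
    have "ball x0 (r / 3) \<subseteq> f ` V" using nc(3) r(1) subset_ball[of "r / 3" r x0] by auto
    then have pre: "\<exists>v\<in>V. s = f v" if "s \<in> ball x0 (r / 3)" for s using that by blast
    obtain u w q where u: "u \<in> V" "w \<in> V" "q \<in> V" "x = f u" "y = f w" "z = f q"
      using pre[OF S(1)] pre[OF S(2)] pre[OF S(3)] by metis
    show "(dist z n)^2 \<le> (1 - l) * (dist z x)^2 + l * (dist z y)^2 - l * (1 - l) * (dist x y)^2"
      using cn_center[OF u(1-3) l] n u nc(2) by (simp add: dist_commute)
  qed
  moreover have "nonbranching_on (ball x0 (r / 3))" unfolding nonbranching_on_def
  proof (intro ballI allI impI, elim conjE)
    fix x n y y'
    assume S: "x \<in> ball x0 (r / 3)" "n \<in> ball x0 (r / 3)" "y \<in> ball x0 (r / 3)" "y' \<in> ball x0 (r / 3)"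
      and xn: "x \<noteq> n" and y: "dist x y = dist x n + dist n y" "dist x y' = dist x n + dist n y'" "dist n y = dist n y'"
    have "n \<in> ball x0 r" using S(2) r(1) by auto
    from r(2)[OF this] obtain b :: "'e \<Rightarrow> 'e \<Rightarrow> real" and f V where
      nc: "normal_coordinates b f V" "f 0 = n" "ball x0 r \<subseteq> f ` V" by blast
    interpret normal_chart b f V by standard (rule nc)
    have "ball x0 (r / 3) \<subseteq> f ` V" using nc(3) r(1) subset_ball[of "r / 3" r x0] by auto
    then have pre: "\<exists>v\<in>V. s = f v" if "s \<in> ball x0 (r / 3)" for s using that by blast
    obtain u w w' where u: "u \<in> V" "w \<in> V" "w' \<in> V" "x = f u" "y = f w" "y' = f w'"
      using pre[OF S(1)] pre[OF S(3)] pre[OF S(4)] by metis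
    define D where "D = dist x n + dist n y"
    have D: "0 < D" unfolding D_def using xn by (simp add: add_pos_nonneg)
    define l where "l = dist x n / D"
    have l: "0 \<le> l" "l \<le> 1" "0 < l" unfolding l_def using D xn by (auto simp: D_def)
    have lD: "dist x n = l * D" "dist n y = (1 - l) * D" unfolding l_def using D by (auto simp: D_def field_simps)
    have "dist (f 0) (f u) = l * dist (f u) (f w)" "dist (f 0) (f w) = (1 - l) * dist (f u) (f w)"
      "dist (f 0) (f u) = l * dist (f u) (f w')" "dist (f 0) (f w') = (1 - l) * dist (f u) (f w')"
      using lD y unfolding D_def u(4-6)[symmetric] nc(2) by (simp_all add: dist_commute)
    then have "(1 - l) *\<^sub>R u + l *\<^sub>R w = 0" "(1 - l) *\<^sub>R u + l *\<^sub>R w' = 0"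
      using opposite[OF u(1,2) l(1,2)] opposite[OF u(1,3) l(1,2)] by blast+
    then have "l *\<^sub>R w = l *\<^sub>R w'" by (metis add_left_cancel)
    then show "y = y'" using l u by simp
  qed
  ultimately show ?thesis using r(1) by (intro exI[of _ "r / 3"]) auto
qed

end

section \<open>Hadamard manifolds are CAT(0) spaces\<close>

theorem (in hadamard_space) cat0: "cat0_space TYPE('a)"
proof -
  interpret L: length_space "TYPE('a)"
    by standard (use complete_UNIV locally_compact_ball approximate_intermediate_point in auto)
  interpret C: locally_cat0 "TYPE('a)" by standard (use L.proper L.geodesic local_geometry simply_connected_UNIV in blast)+
  show ?thesis by standard (use L.proper L.geodesic C.cn_UNIV local_geometry in blast)+
qed

sublocale hadamard_space \<subseteq> cat0_space "TYPE('a)" by (rule cat0)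

section \<open>Quotients\<close>

context regular_quotient
begin

lemma G_id: "id \<in> G"
proof -
  have "\<one>\<^bsub>BijGroup UNIV\<^esub> \<in> G" using subgroup.one_closed[OF subgroup_G] .
  moreover have "\<one>\<^bsub>BijGroup UNIV\<^esub> = (id :: 'a \<Rightarrow> 'a)" unfolding BijGroup_def by auto
  ultimately show ?thesis by simp
qed

lemma G_Bij: "h \<in> G \<Longrightarrow> h \<in> Bij UNIV" using subgroup.subset[OF subgroup_G] unfolding BijGroup_def by auto

lemma G_comp: "h \<in> G \<Longrightarrow> k \<in> G \<Longrightarrow> h \<circ> k \<in> G"
  using subgroup.m_closed[OF subgroup_G, of h k] G_Bij unfolding BijGroup_def by (simp add: compose_def comp_def restrict_def)

lemma G_inv:
  assumes h: "h \<in> G" obtains k where "k \<in> G" "\<And>x. k (h x) = x" "\<And>x. h (k x) = x"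
proof
  have "inv\<^bsub>BijGroup UNIV\<^esub> h \<in> G" using subgroup.m_inv_closed[OF subgroup_G h] .
  then show "inv_into UNIV h \<in> G" using inv_BijGroup[OF G_Bij[OF h]] by (simp add: restrict_def)
  have "bij h" using G_Bij[OF h] unfolding Bij_def by simp
  then show "inv_into UNIV h (h x) = x" "h (inv_into UNIV h x) = x" for x
    by (simp_all add: bij_is_inj bij_is_surj surj_f_inv_f)
qed

lemma G_dist_swap:
  assumes "h \<in> G" "k \<in> G" obtains l where "l \<in> G" "\<And>x y. dist (h x) (k y) = dist x (l y)"
proof -
  obtain h' where h': "h' \<in> G" "\<And>x. h' (h x) = x" using G_inv[OF assms(1)] by metis
  have "dist (h x) (k y) = dist x ((h' \<circ> k) y)" for x y using isometry_G[OF h'(1), of "h x" "k y"] h'(2) by simp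
  then show ?thesis using that G_comp[OF h'(1) assms(2)] by blast
qed

text \<open>Discreteness for pointwise convergence provides finitely many points \<open>F\<close>
  and a scale \<open>\<eta>\<close> such that only the identity moves all of them by less than
  \<open>\<eta>\<close>. As closed balls are totally bounded, infinitely many elements of bounded
  displacement would include two different ones that nearly agree on \<open>F\<close>, and their
  quotient would be the identity.\<close>

lemma finite_displacement: "finite {h \<in> G. dist x (h y) \<le> R}"
proof (rule ccontr)
  assume inf: "infinite {h \<in> G. dist x (h y) \<le> R}"
  have "id isolated_in G" using discrete_G G_id unfolding discrete_def by blast
  then obtain T where T: "open T" "T \<inter> G = {id}" unfolding isolated_in_def by blast
  have idT: "id \<in> T" using T by blast
  have "openin (product_topology (\<lambda>i. euclidean) UNIV) T" using T(1) unfolding open_fun_def .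
  from product_topology_open_contains_basis[OF this idT]
  obtain U where U: "id \<in> (\<Pi>\<^sub>E i\<in>UNIV. U i)" "\<And>i. openin euclidean (U i)" "finite {i. U i \<noteq> topspace euclidean}" "(\<Pi>\<^sub>E i\<in>UNIV. U i) \<subseteq> T" by blast
  define F where "F = {i. U i \<noteq> UNIV}"
  have F: "finite F" using U(3) unfolding F_def by simp
  have "\<exists>e>0. ball p e \<subseteq> U p" for p
  proof -
    have "p \<in> U p" using PiE_mem[OF U(1), of p] by simp
    moreover have "open (U p)" using U(2)[of p] by (simp add: open_openin[symmetric])
    ultimately show ?thesis using open_contains_ball by blast
  qed
  then obtain e where e: "\<And>p. 0 < e p" "\<And>p. ball p (e p) \<subseteq> U p" by metis
  define \<eta> where "\<eta> = Min (insert 1 (e ` F))"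
  have \<eta>0: "0 < \<eta>" unfolding \<eta>_def using F e(1) by simp
  have \<eta>le: "\<eta> \<le> e p" if "p \<in> F" for p unfolding \<eta>_def by (rule Min_le) (use F that in auto)
  have triv: "h = id" if h: "h \<in> G" "\<And>p. p \<in> F \<Longrightarrow> dist p (h p) < \<eta>" for h
  proof -
    have "h p \<in> U p" for p
    proof (cases "p \<in> F")
      case True
      then have "h p \<in> ball p (e p)" using h(2)[OF True] \<eta>le[OF True] by simp
      then show ?thesis using e(2) by blast
    qed (simp add: F_def)
    then have "h \<in> (\<Pi>\<^sub>E i\<in>UNIV. U i)" by (simp add: PiE_UNIV_domain)
    then have "h \<in> T" using U(4) by blast
    then show ?thesis using T(2) h(1) by blast
  qed
  have "\<exists>k. finite k \<and> cball x (R + dist y p) \<subseteq> (\<Union>w\<in>k. ball w (\<eta> / 2))" for p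
    using proper[of x "R + dist y p"] \<eta>0 unfolding compact_eq_totally_bounded by (meson half_gt_zero)
  then obtain net where net: "\<And>p. finite (net p)" "\<And>p. cball x (R + dist y p) \<subseteq> (\<Union>w\<in>net p. ball w (\<eta> / 2))" by metis
  have "\<exists>w\<in>net p. dist w (h p) < \<eta> / 2" if "h \<in> G" "dist x (h y) \<le> R" for h p
  proof -
    have "h p \<in> cball x (R + dist y p)" using that dist_triangle[of x "h p" "h y"] isometry_G[OF that(1), of y p] by simp
    then show ?thesis using net(2) by fastforce
  qed
  then obtain f where f: "\<And>h p. h \<in> G \<Longrightarrow> dist x (h y) \<le> R \<Longrightarrow> f h p \<in> net p \<and> dist (f h p) (h p) < \<eta> / 2" by metis
  have "(\<lambda>h. restrict (f h) F) ` {h \<in> G. dist x (h y) \<le> R} \<subseteq> PiE F net" using f by auto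
  moreover have "finite (PiE F net)" using F net(1) by (intro finite_PiE) auto
  ultimately have "finite ((\<lambda>h. restrict (f h) F) ` {h \<in> G. dist x (h y) \<le> R})" by (rule finite_subset)
  then have "\<not> inj_on (\<lambda>h. restrict (f h) F) {h \<in> G. dist x (h y) \<le> R}" using inf finite_imageD by blast
  then obtain h k where hk: "h \<in> G" "dist x (h y) \<le> R" "k \<in> G" "dist x (k y) \<le> R" "h \<noteq> k" "restrict (f h) F = restrict (f k) F"
    unfolding inj_on_def by blast
  obtain h' where h': "h' \<in> G" "\<And>x. h' (h x) = x" "\<And>x. h (h' x) = x" using G_inv[OF hk(1)] by metis
  have "h' \<circ> k = id"
  proof (rule triv[OF G_comp[OF h'(1) hk(3)]])
    fix p assume p: "p \<in> F"
    have "f h p = f k p" using hk(6) p by (metis restrict_apply')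
    then have "dist (h p) (k p) < \<eta>" using f[OF hk(1,2), of p] f[OF hk(3,4), of p] dist_triangle[of "h p" "k p" "f h p"] by (simp add: dist_commute)
    then show "dist p ((h' \<circ> k) p) < \<eta>" using isometry_G[OF h'(1), of "h p" "k p"] h'(2) by simp
  qed
  then have "k z = h z" for z using h'(3)[of "k z"] by (metis comp_apply id_apply)
  then show False using hk(5) by auto
qed

text \<open>The powers of \<open>h\<close> all fix \<open>x\<close>, so they are finite in number
  and two of them coincide; absence of torsion excludes this unless \<open>h\<close> is the
  identity.\<close>

lemma free_action:
  assumes h: "h \<in> G" and fix_x: "h x = x"
  shows "h = id"
proof (rule ccontr)
  assume ne: "h \<noteq> id"
  have pw: "h ^^ n \<in> G \<and> (h ^^ n) x = x" for n
  proof (induction n)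
    case 0
    then show ?case using G_id by (simp add: id_def)
  next
    case (Suc n)
    then show ?case using G_comp[OF h, of "h ^^ n"] fix_x by (simp add: comp_def)
  qed
  then have "range (\<lambda>n. h ^^ n) \<subseteq> {h \<in> G. dist x (h x) \<le> 0}" by auto
  then have "finite (range (\<lambda>n. h ^^ n))" using finite_displacement finite_subset by blast
  then have "\<not> inj (\<lambda>n. h ^^ n)" using finite_imageD infinite_UNIV_nat by blast
  then obtain i j where ij: "h ^^ i = h ^^ j" "i < j" unfolding inj_on_def by (metis linorder_neqE_nat)
  obtain k where k: "k \<in> G" "\<And>x. k ((h ^^ i) x) = x" "\<And>x. (h ^^ i) (k x) = x" using G_inv[of "h ^^ i"] pw by metis
  have "(h ^^ (j - i)) z = z" for z
  proof -
    have "(h ^^ (j - i)) ((h ^^ i) w) = (h ^^ i) w" for w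
      using ij funpow_add[of "j - i" i h] by (metis comp_apply le_add_diff_inverse2 less_imp_le)
    then show ?thesis using k(3) by metis
  qed
  then have "h ^^ (j - i) = id" by auto
  then show False using torsion_free_G[OF h ne, of "j - i"] ij(2) by simp
qed

lemma injectivity_radius: "\<exists>r>0. \<forall>h\<in>G. h \<noteq> id \<longrightarrow> r \<le> dist x (h x)"
proof -
  define S where "S = {h \<in> G. dist x (h x) \<le> 1} - {id}"
  have fin: "finite S" unfolding S_def using finite_displacement by simp
  define r where "r = Min (insert 1 ((\<lambda>h. dist x (h x)) ` S))"
  have "0 < dist x (h x)" if "h \<in> S" for h using free_action[of h x] that unfolding S_def by auto
  then have "0 < r" unfolding r_def using fin by auto
  moreover have "r \<le> dist x (h x)" if "h \<in> G" "h \<noteq> id" for h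
  proof (cases "h \<in> S")
    case True
    then show ?thesis unfolding r_def using fin by (intro Min_le) auto
  next
    case False
    then have "1 < dist x (h x)" using that unfolding S_def by auto
    moreover have "r \<le> 1" unfolding r_def using fin by (intro Min_le) auto
    ultimately show ?thesis by simp
  qed
  ultimately show ?thesis by blast
qed

lemma proj_G: "h \<in> G \<Longrightarrow> proj G (h x) = proj G x"
proof -
  assume h: "h \<in> G"
  obtain k where k: "k \<in> G" "\<And>x. k (h x) = x" using G_inv[OF h] by metis
  have "l x \<in> proj G (h x)" if "l \<in> G" for l
    using G_comp[OF that k(1)] k(2) unfolding proj_def by (intro CollectI exI[of _ "l \<circ> k"]) auto
  moreover have "l (h x) \<in> proj G x" if "l \<in> G" for l
    using G_comp[OF that h] unfolding proj_def by (intro CollectI exI[of _ "l \<circ> h"]) auto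
  ultimately show ?thesis unfolding proj_def by blast
qed

lemma proj_in: "proj G x \<in> quotient_space G" unfolding quotient_space_def by blast

text \<open>Elements that do at least as well as the identity have bounded displacement, so finitely
  many compete. Minimizing over both orbits reduces to moving \<open>y\<close> alone, by
  \<open>G_dist_swap\<close>.\<close>

lemma quotient_dist_attained: "\<exists>h\<in>G. quotient_dist (proj G x) (proj G y) = dist x (h y)"
proof -
  define S where "S = {h \<in> G. dist x (h y) \<le> dist x y}"
  have "finite S" "S \<noteq> {}" unfolding S_def using finite_displacement G_id by auto
  then obtain h where h: "h \<in> S" "\<And>k. k \<in> S \<Longrightarrow> dist x (h y) \<le> dist x (k y)"
    using ex_is_arg_min_if_finite[of S "\<lambda>h. dist x (h y)"] unfolding is_arg_min_linorder by blast
  have le: "dist x (h y) \<le> dist x (k y)" if "k \<in> G" for k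
  proof (cases "k \<in> S")
    case False
    then show ?thesis using h(1) that unfolding S_def by auto
  qed (use h in blast)
  have "setdist (proj G x) (proj G y) = dist x (h y)"
  proof (rule setdist_unique)
    show "x \<in> proj G x" unfolding proj_def using G_id by (intro CollectI exI[of _ id]) simp
    show "h y \<in> proj G y" unfolding proj_def using h(1) unfolding S_def by blast
    fix a b assume "a \<in> proj G x \<and> b \<in> proj G y"
    then obtain k l where kl: "k \<in> G" "l \<in> G" "a = k x" "b = l y" unfolding proj_def by blast
    obtain m where "m \<in> G" "\<And>x y. dist (k x) (l y) = dist x (m y)" using G_dist_swap[OF kl(1,2)] by blast
    then show "dist x (h y) \<le> dist a b" using le kl by simp
  qed
  then show ?thesis unfolding quotient_dist_def using h(1) unfolding S_def by blast
qed

lemma quotient_dist_le: "h \<in> G \<Longrightarrow> quotient_dist (proj G x) (proj G y) \<le> dist x (h y)"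
  using setdist_le_dist[of x "proj G x" "h y" "proj G y"] G_id unfolding quotient_dist_def proj_def by force

lemma quotient_dist_le': "quotient_dist (proj G x) (proj G y) \<le> dist x y" using quotient_dist_le[OF G_id, of x y] by simp

sublocale Q: pseudo_metric "quotient_space G" quotient_dist
proof
  fix P Q R assume "P \<in> quotient_space G" "Q \<in> quotient_space G" "R \<in> quotient_space G"
  then obtain x y z where x: "P = proj G x" "Q = proj G y" "R = proj G z" unfolding quotient_space_def by blast
  obtain h where h: "h \<in> G" "quotient_dist P Q = dist x (h y)" using quotient_dist_attained x by metis
  obtain k where k: "k \<in> G" "quotient_dist Q R = dist y (k z)" using quotient_dist_attained x by metis
  have "quotient_dist P R \<le> dist x ((h \<circ> k) z)" unfolding x by (rule quotient_dist_le[OF G_comp[OF h(1) k(1)]])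
  also have "\<dots> \<le> dist x (h y) + dist y (k z)" using dist_triangle[of x "h (k z)" "h y"] isometry_G[OF h(1), of y "k z"] by simp
  finally show "quotient_dist P R \<le> quotient_dist P Q + quotient_dist Q R" using h k by simp
next
  fix P assume "P \<in> quotient_space G"
  then obtain x where x: "P = proj G x" unfolding quotient_space_def by blast
  show "quotient_dist P P = 0" using quotient_dist_le'[of x x] setdist_pos_le[of P P] unfolding x quotient_dist_def by simp
qed (simp add: quotient_dist_def setdist_sym)

text \<open>Elements other than the identity move \<open>c t\<close> by at least \<open>r\<close>.
  For two points within \<open>r / 4\<close> of \<open>c t\<close> they cannot realize the quotient
  distance, so the projection is isometric there.\<close>

lemma half_geodesic_proj:
  assumes c: "ray UNIV dist c"
  shows "half_geodesic (quotient_space G) quotient_dist (proj G \<circ> c)" unfolding half_geodesic_def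
proof (intro conjI allI impI)
  show "(proj G \<circ> c) t \<in> quotient_space G" for t using proj_in by simp
  fix t :: real assume t: "0 \<le> t"
  obtain r where r: "0 < r" "\<And>h. h \<in> G \<Longrightarrow> h \<noteq> id \<Longrightarrow> r \<le> dist (c t) (h (c t))" using injectivity_radius by blast
  have "quotient_dist ((proj G \<circ> c) p) ((proj G \<circ> c) s) = \<bar>p - s\<bar>"
    if ps: "0 \<le> p" "0 \<le> s" "\<bar>p - t\<bar> < r / 4" "\<bar>s - t\<bar> < r / 4" for p s
  proof -
    have d: "dist (c p) (c s) = \<bar>p - s\<bar>" "dist (c t) (c p) < r / 4" "dist (c t) (c s) < r / 4"
      using ray_unit_speed[OF c] ps t by (auto simp: abs_minus_commute)
    obtain h where h: "h \<in> G" "quotient_dist (proj G (c p)) (proj G (c s)) = dist (c p) (h (c s))" using quotient_dist_attained by blast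
    have "h = id"
    proof (rule ccontr)
      assume "h \<noteq> id"
      then have "r \<le> dist (c t) (h (c t))" using r h by blast
      moreover have "dist (c p) (h (c s)) \<le> dist (c p) (c s)" using h quotient_dist_le' by metis
      moreover have "dist (h (c s)) (h (c t)) = dist (c t) (c s)" using isometry_G[OF h(1)] by (simp add: dist_commute)
      ultimately show False
        using d dist_triangle[of "c t" "h (c t)" "h (c s)"] dist_triangle[of "c t" "h (c s)" "c p"] dist_triangle[of "c p" "c s" "c t"]
        by (simp add: dist_commute)
    qed
    then show ?thesis using h d by simp
  qed
  then show "\<exists>e>0. \<forall>p\<ge>0. \<forall>s\<ge>0. \<bar>p - t\<bar> < e \<and> \<bar>s - t\<bar> < e \<longrightarrow>
      quotient_dist ((proj G \<circ> c) p) ((proj G \<circ> c) s) = \<bar>p - s\<bar>" using r(1) by (intro exI[of _ "r / 4"]) auto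
qed


subsection \<open>Lifting rays\<close>

lemma quotient_dist_zero: "quotient_dist (proj G x) (proj G y) = 0 \<Longrightarrow> proj G x = proj G y"
  using quotient_dist_attained[of x y] proj_G by auto

lemma continuous_quotient_dist: "continuous_on UNIV (\<lambda>y. quotient_dist (proj G y) (proj G x))"
proof (rule lipschitz_on_continuous_on[of 1], rule lipschitz_onI)
  fix y z :: 'a
  have "quotient_dist (proj G y) (proj G x) \<le> dist y z + quotient_dist (proj G z) (proj G x)" for y z
    using Q.triangle[OF proj_in proj_in proj_in, of y x z] quotient_dist_le'[of y z] by simp
  from this[of y z] this[of z y]
  show "dist (quotient_dist (proj G y) (proj G x)) (quotient_dist (proj G z) (proj G x)) \<le> 1 * dist y z"
    by (simp add: dist_real_def abs_le_iff dist_commute)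
qed simp

text \<open>A ray of the quotient minimizes, so a lift of \<open>\<alpha> s\<close> can be continued
  by a nearest lift of \<open>\<alpha> t\<close>, and distances above are bounded below by those in
  the quotient. The lift is a ray at once, with no appeal to covering spaces.\<close>

lemma ray_lift_exists:
  assumes \<alpha>: "ray (quotient_space G) quotient_dist \<alpha>"
  shows "\<exists>q. ray_lift G \<alpha> q"
proof -
  have "\<exists>z. proj G z = \<alpha> t" if "0 \<le> t" for t using Q.ray_in[OF \<alpha> that] unfolding quotient_space_def by auto
  then obtain z where z: "\<And>t. 0 \<le> t \<Longrightarrow> proj G (z t) = \<alpha> t" by metis
  show ?thesis
  proof (rule isometric_curve_exists[of "{0..}" "\<lambda>t y. proj G y = \<alpha> t" "z 0", OF proper])
    fix t :: real assume t: "t \<in> {0..}"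
    have "{y. proj G y = \<alpha> t} = {y. quotient_dist (proj G y) (proj G (z t)) = 0}"
    proof -
      have "proj G y = proj G (z t) \<longleftrightarrow> quotient_dist (proj G y) (proj G (z t)) = 0" for y
        using quotient_dist_zero Q.refl[OF proj_in] by metis
      then show ?thesis unfolding z[of t, OF t[unfolded atLeast_iff], symmetric] by simp
    qed
    also have "closed \<dots>" by (intro closed_Collect_eq continuous_quotient_dist continuous_intros)
    finally show "closed {y. proj G y = \<alpha> t}" .
  next
    fix s t :: real and y assume st: "s \<in> {0..}" "t \<in> {0..}" "s < t" and y: "proj G y = \<alpha> s"
    have d: "quotient_dist (proj G y) (proj G (z t)) = t - s" using Q.ray_dist[OF \<alpha>, of s t] z[of t] st y by simp
    obtain h where h: "h \<in> G" "quotient_dist (proj G y) (proj G (z t)) = dist y (h (z t))" using quotient_dist_attained by blast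
    show "\<exists>w. proj G w = \<alpha> t \<and> dist y w = t - s" using h d proj_G[OF h(1)] z[of t] st by (intro exI[of _ "h (z t)"]) simp
    show "t - s \<le> dist y w" if "proj G w = \<alpha> t" for w using quotient_dist_le'[of y w] d that z[of t] st by simp
  next
    fix c assume "\<And>t. t \<in> {0..} \<Longrightarrow> proj G (c t) = \<alpha> t" "\<And>s t. s \<in> {0..} \<Longrightarrow> t \<in> {0..} \<Longrightarrow> dist (c s) (c t) = \<bar>s - t\<bar>"
    then have "ray_lift G \<alpha> c" unfolding ray_lift_def dist_metric.ray_iff by simp
    then show ?thesis by blast
  qed (use z in auto)
qed

end

section \<open>Corays and weak equivalence\<close>

context regular_quotient
begin

lemma ray_comp:
  assumes "h \<in> G" "ray UNIV dist q"
  shows "ray UNIV dist (h \<circ> q)" using assms(2) isometry_G[OF assms(1)] unfolding dist_metric.ray_iff by simp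

lemma horo_comp: "h \<in> G \<Longrightarrow> dist_metric.horo (h \<circ> q) (h x) = dist_metric.horo q x"
  unfolding dist_metric.horo_def by (simp add: isometry_G)

lemma act_boundary_point:
  assumes h: "h \<in> G"
  shows "act_boundary h (point_at_infinity q) = point_at_infinity (h \<circ> q)"
proof -
  obtain k where k: "k \<in> G" "\<And>x. k (h x) = x" "\<And>x. h (k x) = x" using G_inv[OF h] by metis
  have comp: "asymptotic (l \<circ> e) (l \<circ> e') \<longleftrightarrow> asymptotic e e'" if "l \<in> G" for l e e'
    unfolding asymptotic_def using isometry_G[OF that] by simp
  have "e \<in> act_boundary h (point_at_infinity q)" if e: "e \<in> point_at_infinity (h \<circ> q)" for e
  proof -
    have ek: "e = h \<circ> (k \<circ> e)" using k(3) by auto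
    have "asymptotic q (k \<circ> e)" using e ek comp[OF h, of q "k \<circ> e"] unfolding mem_point_at_infinity by metis
    then have "k \<circ> e \<in> point_at_infinity q" using e ray_comp[OF k(1)] unfolding mem_point_at_infinity by blast
    then show ?thesis unfolding act_boundary_def using ek by blast
  qed
  moreover have "h \<circ> e \<in> point_at_infinity (h \<circ> q)" if "e \<in> point_at_infinity q" for e
    using that ray_comp[OF h] comp[OF h] unfolding mem_point_at_infinity by blast
  ultimately show ?thesis unfolding act_boundary_def by blast
qed

section \<open>The Busemann function of a quotient ray as an infimum over \<open>G\<close>\<close>

context
  fixes \<beta> and b :: "real \<Rightarrow> 'a"
  assumes \<beta>: "ray (quotient_space G) quotient_dist \<beta>" and lift_b: "ray_lift G \<beta> b"
begin

lemma ray_b: "ray UNIV dist b" and proj_b: "0 \<le> t \<Longrightarrow> proj G (b t) = \<beta> t" using lift_b unfolding ray_lift_def by auto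

abbreviation "u x \<equiv> Q.horo \<beta> (proj G x)"

lemma horo_proj_le:
  assumes h: "h \<in> G"
  shows "u x \<le> dist_metric.horo (h \<circ> b) x"
proof (rule tendsto_le[OF trivial_limit_at_top_linorder dist_metric.horo_tendsto[OF ray_comp[OF h ray_b]] Q.horo_tendsto[OF \<beta> proj_in]])
  show "\<forall>\<^sub>F t in at_top. quotient_dist (proj G x) (\<beta> t) - t \<le> dist x ((h \<circ> b) t) - t"
    using quotient_dist_le[OF h] by (intro eventually_at_top_linorderI[of 0]) (simp flip: proj_b)
qed simp

text \<open>An element realizing the distance from \<open>x\<close> to the orbit of
  \<open>b t\<close>, for large \<open>t\<close>, is an almost minimizer, since a Busemann function
  lies below its approximations.\<close>

lemma horo_proj_approx:
  assumes e: "0 < e" obtains h where "h \<in> G" "dist_metric.horo (h \<circ> b) x \<le> u x + e"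
proof -
  have "\<forall>\<^sub>F t in at_top. quotient_dist (proj G x) (\<beta> t) - t < u x + e"
    using order_tendstoD(2)[OF Q.horo_tendsto[OF \<beta> proj_in, of x], of "u x + e"] e by simp
  then have "\<forall>\<^sub>F t in at_top. quotient_dist (proj G x) (\<beta> t) - t < u x + e \<and> 0 \<le> t"
    using eventually_ge_at_top by (rule eventually_conj)
  then obtain t where t: "quotient_dist (proj G x) (\<beta> t) - t < u x + e" "0 \<le> t" by (auto dest: eventually_happens)
  obtain h where h: "h \<in> G" "quotient_dist (proj G x) (proj G (b t)) = dist x (h (b t))" using quotient_dist_attained by blast
  have "dist_metric.horo (h \<circ> b) x \<le> dist x ((h \<circ> b) t) - t" by (rule dist_metric.horo_le[OF ray_comp[OF h(1) ray_b] _ t(2)]) simp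
  then have "dist_metric.horo (h \<circ> b) x \<le> u x + e" using h(2) t proj_b[OF t(2)] by simp
  then show ?thesis using that h(1) by blast
qed

lemma horo_ray_to:
  assumes "h \<in> G" "0 \<le> t"
  shows "dist_metric.horo (h \<circ> b) (ray_to x (point_at_infinity (h \<circ> b)) t) = dist_metric.horo (h \<circ> b) x - t"
  using horo_along[OF ray_comp[OF assms(1) ray_b] ray_to(1,3)[OF ray_comp[OF assms(1) ray_b]] assms(2)]
    ray_to(2)[OF ray_comp[OF assms(1) ray_b]] by simp

text \<open>A ray towards \<open>h \<xi>\<close> has small excess if \<open>h\<close> almost realizes the infimum defining the Busemann function at its
  origin.\<close>

lemma length_excess_ray_to_le:
  assumes h: "h \<in> G" and e: "dist_metric.horo (h \<circ> b) x \<le> u x + e"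
  shows "length_excess quotient_dist (proj G \<circ> ray_to x (point_at_infinity (h \<circ> b))) \<le> ereal e"
proof (rule Q.length_excess_le)
  define c where "c = ray_to x (point_at_infinity (h \<circ> b))"
  have c: "ray UNIV dist c" "c 0 = x" unfolding c_def using ray_to[OF ray_comp[OF h ray_b]] by auto
  have le: "t - s - e \<le> quotient_dist (proj G (c s)) (proj G (c t))" if "0 \<le> s" "0 \<le> t" for s t
  proof -
    have "u x - u (c s) \<le> quotient_dist (proj G x) (proj G (c s))" by (rule Q.horo_lipschitz[OF \<beta> proj_in proj_in])
    also have "\<dots> \<le> dist (c 0) (c s)" unfolding c(2) by (rule quotient_dist_le')
    also have "\<dots> = s" using ray_unit_speed[OF c(1), of 0 s] that by simp
    finally have 1: "u x - s \<le> u (c s)" by simp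
    have 2: "u (c t) \<le> u x + e - t" using horo_proj_le[OF h, of "c t"] horo_ray_to[OF h that(2), of x] e unfolding c_def by simp
    show ?thesis using Q.horo_lipschitz[OF \<beta> proj_in proj_in, of "c s" "c t"] 1 2 by simp
  qed
  fix s t :: real assume st: "0 \<le> s" "0 \<le> t"
  show "\<bar>t - s\<bar> - quotient_dist ((proj G \<circ> c) t) ((proj G \<circ> c) s) \<le> e"
    using le[OF st] le[OF st(2,1)] Q.sym[OF proj_in proj_in, of "c s" "c t"] by (simp add: abs_le_iff abs_if)
qed

text \<open>The converse of \<open>length_excess_ray_to_le\<close>. For a competitor
  \<open>k\<close> the element \<open>m = h \<circ> k'\<close> takes \<open>x\<close> to a point
  where the Busemann function of \<open>h \<circ> b\<close> has the value of that of
  \<open>k \<circ> b\<close> at \<open>x\<close>. Small excess means that the points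
  \<open>c t\<close> are not much nearer to \<open>m x\<close> than to \<open>x\<close>, and
  \<open>horo_asymptotic\<close> converts this into a comparison of the two values.\<close>

lemma horo_le_length_excess:
  assumes h: "h \<in> G" and r: "length_excess quotient_dist (proj G \<circ> ray_to x (point_at_infinity (h \<circ> b))) \<le> ereal r"
  shows "dist_metric.horo (h \<circ> b) x \<le> u x + r"
proof (rule field_le_epsilon)
  fix e :: real assume "0 < e"
  then obtain k where k: "k \<in> G" "dist_metric.horo (k \<circ> b) x \<le> u x + e" using horo_proj_approx by blast
  define c where "c = ray_to x (point_at_infinity (h \<circ> b))"
  note hb = ray_comp[OF h ray_b]
  have c: "ray UNIV dist c" "c 0 = x" "asymptotic (h \<circ> b) c" unfolding c_def using ray_to[OF hb] by auto
  obtain k' where k': "k' \<in> G" "\<And>x. k' (k x) = x" "\<And>x. k (k' x) = x" using G_inv[OF k(1)] by metis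
  define m where "m = h \<circ> k'"
  have m: "m \<in> G" unfolding m_def by (rule G_comp[OF h k'(1)])
  have "m \<circ> (k \<circ> b) = h \<circ> b" unfolding m_def using k'(2) by auto
  then have 1: "dist_metric.horo (h \<circ> b) (m x) = dist_metric.horo (k \<circ> b) x" using horo_comp[OF m, of "k \<circ> b" x] by simp
  have "- r \<le> dist_metric.horo c (m x)"
  proof (rule tendsto_lowerbound[OF dist_metric.horo_tendsto[OF c(1)]])
    have "- r \<le> dist (m x) (c t) - t" if t: "0 \<le> t" for t
    proof -
      have "ereal (\<bar>t - 0\<bar> - quotient_dist ((proj G \<circ> c) t) ((proj G \<circ> c) 0)) \<le> ereal r"
        using Q.le_length_excess[of 0 t "proj G \<circ> c"] r t unfolding c_def[symmetric] by (meson order_refl order_trans)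
      then have "t - quotient_dist (proj G (c t)) (proj G x) \<le> r" using t c(2) by simp
      then show ?thesis using quotient_dist_le[OF m, of "c t" x] by (simp add: dist_commute)
    qed
    then show "\<forall>\<^sub>F t in at_top. - r \<le> dist (m x) (c t) - t" by (rule eventually_at_top_linorderI)
  qed auto
  moreover have "dist_metric.horo (h \<circ> b) (m x) - dist_metric.horo (h \<circ> b) x = dist_metric.horo c (m x)"
    using horo_asymptotic[OF hb c(1,3), of "m x"] c(2) by simp
  ultimately show "dist_metric.horo (h \<circ> b) x \<le> u x + r + e" using 1 k(2) by simp
qed

text \<open>Along \<open>c n\<close> the Busemann function of \<open>h n \<circ> b\<close> drops at
  unit speed, lies above \<open>u\<close>, and exceeds \<open>u\<close> at the origin by at most the
  excess. These rays converge to \<open>a\<close>, so \<open>u\<close> drops along \<open>a\<close>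
  at least as fast.\<close>

lemma weakly_equivalent_calibrated:
  assumes a: "ray_lift G \<alpha> a" and h: "\<And>n :: nat. h n \<in> G"
    and lim: "limitin cone_topology (\<lambda>n. point_at_infinity (h n \<circ> b)) (point_at_infinity a) sequentially"
    and ex: "(\<lambda>n. length_excess quotient_dist (proj G \<circ> ray_to (a 0) (point_at_infinity (h n \<circ> b)))) \<longlonglongrightarrow> 0"
  shows "Q.calibrated \<alpha> \<beta>" unfolding Q.calibrated_def
proof (intro allI impI)
  fix t :: real assume t: "0 \<le> t"
  have ray_a: "ray UNIV dist a" and proj_a: "\<And>t. 0 \<le> t \<Longrightarrow> proj G (a t) = \<alpha> t" using a unfolding ray_lift_def by auto
  define c where "c n = ray_to (a 0) (point_at_infinity (h n \<circ> b))" for n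
  have "(\<lambda>n. c n t) \<longlonglongrightarrow> a t"
    using limitin_cone_topologyD[OF lim boundaryI[OF ray_a] t, of "a 0"] ray_to_eq[OF ray_a t] unfolding c_def by simp
  then have ct: "(\<lambda>n. dist (a t) (c n t)) \<longlonglongrightarrow> 0" using tendsto_dist[OF tendsto_const, of "\<lambda>n. c n t" "a t" sequentially "a t"] by simp
  have "t \<le> u (a 0) - u (a t) + e" if e: "0 < e" for e
  proof -
    have "\<forall>\<^sub>F n in sequentially. length_excess quotient_dist (proj G \<circ> c n) < ereal (e / 2)"
      using order_tendstoD(2)[OF ex, of "ereal (e / 2)"] e unfolding c_def by simp
    moreover have "\<forall>\<^sub>F n in sequentially. dist (a t) (c n t) < e / 2" using order_tendstoD(2)[OF ct, of "e / 2"] e by simp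
    ultimately have "\<forall>\<^sub>F n in sequentially. length_excess quotient_dist (proj G \<circ> c n) < ereal (e / 2) \<and> dist (a t) (c n t) < e / 2"
      by (rule eventually_conj)
    then obtain n where n: "length_excess quotient_dist (proj G \<circ> c n) < ereal (e / 2)" "dist (a t) (c n t) < e / 2"
      by (auto dest: eventually_happens)
    have 1: "dist_metric.horo (h n \<circ> b) (a 0) \<le> u (a 0) + e / 2"
      using horo_le_length_excess[OF h[of n], where x = "a 0" and r = "e / 2"] n(1) unfolding c_def by simp
    have "u (a t) \<le> dist_metric.horo (h n \<circ> b) (a t)" by (rule horo_proj_le[OF h])
    also have "\<dots> \<le> dist_metric.horo (h n \<circ> b) (c n t) + dist (a t) (c n t)"
      using dist_metric.horo_lipschitz[OF ray_comp[OF h[of n] ray_b], of "a t" "c n t"] by simp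
    also have "dist_metric.horo (h n \<circ> b) (c n t) = dist_metric.horo (h n \<circ> b) (a 0) - t" unfolding c_def by (rule horo_ray_to[OF h t])
    finally show ?thesis using 1 n(2) by simp
  qed
  then have "t \<le> u (a 0) - u (a t)" by (rule field_le_epsilon)
  moreover have "u (a 0) - u (a t) \<le> t"
    using Q.horo_lipschitz[OF \<beta> proj_in proj_in, of "a 0" "a t"] quotient_dist_le'[of "a 0" "a t"] ray_unit_speed[OF ray_a, of 0 t] t by simp
  ultimately show "Q.horo \<beta> (\<alpha> 0) - Q.horo \<beta> (\<alpha> t) = t" using proj_a[of 0] proj_a[OF t] by simp
qed

text \<open>An element almost optimal at the distant point \<open>a (N n)\<close> is almost optimal
  at \<open>a 0\<close> too, because \<open>u\<close> drops by the full distance in between; this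
  bounds the excess. The distant point is then nearly on the ray \<open>c n\<close>, and
  \<open>fan\<close> carries the closeness back to compact parts.\<close>

lemma calibrated_weakly_equivalent:
  assumes \<alpha>: "ray (quotient_space G) quotient_dist \<alpha>" and cal: "Q.calibrated \<alpha> \<beta>"
  shows "weakly_equivalent G \<alpha> \<beta>"
proof -
  obtain a where a: "ray_lift G \<alpha> a" using ray_lift_exists[OF \<alpha>] by blast
  have ray_a: "ray UNIV dist a" and proj_a: "\<And>t. 0 \<le> t \<Longrightarrow> proj G (a t) = \<alpha> t" using a unfolding ray_lift_def by auto
  have drop: "u (a 0) - u (a t) = t" if "0 \<le> t" for t using cal that proj_a[of 0] proj_a[OF that] unfolding Q.calibrated_def by simp
  define N where "N n = real (Suc n)" for n
  have N: "1 \<le> N n" for n unfolding N_def by simp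
  have "\<exists>h\<in>G. dist_metric.horo (h \<circ> b) (a (N n)) \<le> u (a (N n)) + 1 / N n" for n
    using horo_proj_approx[of "1 / N n" "a (N n)"] N[of n] by (metis less_le_trans zero_less_divide_1_iff zero_less_one)
  then obtain h where h: "\<And>n. h n \<in> G" "\<And>n. dist_metric.horo (h n \<circ> b) (a (N n)) \<le> u (a (N n)) + 1 / N n" by metis
  define c where "c n = ray_to (a 0) (point_at_infinity (h n \<circ> b))" for n
  have hb: "ray UNIV dist (h n \<circ> b)" for n by (rule ray_comp[OF h(1) ray_b])
  have c: "ray UNIV dist (c n)" "c n 0 = a 0" "asymptotic (h n \<circ> b) (c n)" for n unfolding c_def using ray_to[OF hb] by auto
  have pai: "point_at_infinity (c n) = act_boundary (h n) (point_at_infinity b)" for n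
    using point_at_infinity_eq[OF c(3)] act_boundary_point[OF h(1)] by simp
  have b0: "dist_metric.horo (h n \<circ> b) (a 0) \<le> u (a 0) + 1 / N n" for n
    using dist_metric.horo_lipschitz[OF hb, of "a 0" "a (N n)" n] ray_unit_speed[OF ray_a, of 0 "N n"] h(2)[of n] drop[of "N n"] N[of n] by simp
  have "dist (a s) (c n s) \<le> 2 * s / N n" if s: "0 \<le> s" "s \<le> N n" for n s
  proof -
    have "dist_metric.horo (c n) (a (N n)) \<le> 1 / N n - N n"
      using horo_asymptotic[OF hb c(1,3), of n "a (N n)"] h(2)[of n] horo_proj_le[OF h(1), of "a 0" n] drop[of "N n"] N[of n] c(2)[of n] by simp
    \<comment> \<open>The doubled error makes the inequality strict, so that it holds already at
      some finite time \<open>t\<close> of the ray.\<close>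
    moreover have "1 / N n < 2 / N n" using N[of n] by (intro divide_strict_right_mono) auto
    ultimately have "dist_metric.horo (c n) (a (N n)) < 2 / N n - N n" by linarith
    then have "\<forall>\<^sub>F t in at_top. dist (a (N n)) (c n t) - t < 2 / N n - N n"
      by (intro order_tendstoD(2)[OF dist_metric.horo_tendsto[OF c(1)]]) auto
    then have "\<forall>\<^sub>F t in at_top. dist (a (N n)) (c n t) - t < 2 / N n - N n \<and> N n \<le> t"
      using eventually_ge_at_top by (rule eventually_conj)
    then obtain t where t: "dist (a (N n)) (c n t) - t < 2 / N n - N n" "N n \<le> t" by (auto dest: eventually_happens)
    define d where "d = (dist (a s) (c n s))^2"
    have cn: "dist (a 0) (c n t) = t" "dist (a 0) (c n s) = s" "dist (c n s) (c n t) = t - s"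
      using ray_unit_speed[OF c(1), of 0 t n] ray_unit_speed[OF c(1), of 0 s n] ray_unit_speed[OF c(1), of s t n] c(2)[of n] s t N[of n] by auto
    have "d * (dist (a 0) (a (N n)) * dist (a 0) (c n t))
        \<le> s^2 * ((dist (a (N n)) (c n t))^2 - (dist (a 0) (a (N n)) - dist (a 0) (c n t))^2)" unfolding d_def
      by (rule fan) (use ray_unit_speed[OF ray_a] cn s t N[of n] in auto)
    also have "dist (a 0) (a (N n)) = N n" using ray_unit_speed[OF ray_a, of 0 "N n"] N[of n] by simp
    also note cn(1)
    finally have "d * (N n * t) \<le> s^2 * ((dist (a (N n)) (c n t))^2 - (N n - t)^2)" .
    \<comment> \<open>The bracket is the defect of the triangle with vertices \<open>a 0\<close>,
      \<open>a (N n)\<close>, \<open>c n t\<close>. It is at most \<open>4 * t / N n\<close>, while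
      the product of the two sides is \<open>N n * t\<close>; this gives the rate
      \<open>2 * s / N n\<close>.\<close>
    also have "\<dots> \<le> s^2 * ((t - N n + 2 / N n)^2 - (N n - t)^2)"
      using t by (intro mult_left_mono diff_right_mono power_mono) auto
    also have "(t - N n + 2 / N n)^2 - (N n - t)^2 = 2 / N n * (2 * t + (2 / N n - 2 * N n))"
      by (simp add: power2_eq_square algebra_simps)
    also have "s^2 * (2 / N n * (2 * t + (2 / N n - 2 * N n))) \<le> s^2 * (2 / N n * (2 * t + 0))"
    proof -
      have "2 / N n \<le> 2 / 1" using N[of n] by (intro divide_left_mono) auto
      then show ?thesis using N[of n] by (intro mult_left_mono add_left_mono) auto
    qed
    also have "\<dots> = (4 * s^2 / N n) * t" by simp
    finally have "d * N n * t \<le> (4 * s^2 / N n) * t" by (simp only: mult.assoc)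
    then have "d * N n \<le> 4 * s^2 / N n" by (rule mult_right_le_imp_le) (use t N[of n] in simp)
    then have "d \<le> (2 * s / N n)^2" using N[of n] by (simp add: field_simps power2_eq_square)
    then show ?thesis unfolding d_def by (rule power2_le_imp_le) (use s N[of n] in simp)
  qed
  note close = this
  have N_lim: "filterlim N at_top sequentially" unfolding N_def
    using filterlim_compose[OF filterlim_real_sequentially filterlim_Suc] .
  have conv: "(\<lambda>n. c n s) \<longlonglongrightarrow> a s" if s: "0 \<le> s" for s
  proof (subst tendsto_dist_iff, rule tendsto_sandwich[of "\<lambda>_. 0" _ _ "\<lambda>n. 2 * s / N n"])
    have "\<forall>\<^sub>F n in sequentially. s \<le> N n" using N_lim unfolding filterlim_at_top by blast
    then show "\<forall>\<^sub>F n in sequentially. dist (c n s) (a s) \<le> 2 * s / N n"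
      by eventually_elim (use close s in \<open>simp add: dist_commute\<close>)
    show "(\<lambda>n. 2 * s / N n) \<longlonglongrightarrow> 0" by (rule tendsto_divide_0[OF tendsto_const filterlim_at_top_imp_at_infinity[OF N_lim]])
  qed auto
  have "limitin cone_topology (\<lambda>n. point_at_infinity (c n)) (point_at_infinity a) sequentially"
    by (rule limitin_cone_topologyI[OF c(1) ray_a c(2) conv])
  moreover have ex: "length_excess quotient_dist (proj G \<circ> c n) \<le> ereal (1 / N n)" for n
    unfolding c_def by (rule length_excess_ray_to_le[OF h(1) b0])
  have "quasi_ray (quotient_space G) quotient_dist (proj G \<circ> c n)" for n
    unfolding quasi_ray_def using half_geodesic_proj[OF c(1)] ex[of n] by (auto intro: le_less_trans)
  moreover have "(\<lambda>n. length_excess quotient_dist (proj G \<circ> c n)) \<longlonglongrightarrow> 0"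
  proof (rule tendsto_sandwich[of "\<lambda>_. 0" _ _ "\<lambda>n. ereal (1 / N n)"])
    show "\<forall>\<^sub>F n in sequentially. length_excess quotient_dist (proj G \<circ> c n) \<le> ereal (1 / N n)" using ex by simp
    show "\<forall>\<^sub>F n in sequentially. 0 \<le> length_excess quotient_dist (proj G \<circ> c n)" using Q.length_excess_nonneg half_geodesic_proj c(1) by simp
    have "(\<lambda>n. 1 / N n) \<longlonglongrightarrow> 0" by (rule tendsto_divide_0[OF tendsto_const filterlim_at_top_imp_at_infinity[OF N_lim]])
    then show "(\<lambda>n. ereal (1 / N n)) \<longlonglongrightarrow> 0" by (simp add: zero_ereal_def)
  qed auto
  moreover have "ray_to (a 0) (act_boundary (h n) (point_at_infinity b)) = c n" for n
    unfolding c_def act_boundary_point[OF h(1)] ..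
  ultimately show ?thesis unfolding weakly_equivalent_def Let_def
    using Q.ray_quasi_ray[OF \<alpha>] Q.ray_quasi_ray[OF \<beta>] a lift_b h(1) unfolding pai
    by (intro conjI exI[of _ a] exI[of _ b] exI[of _ h]) auto
qed

end

end

section \<open>Calibrated rays are corays\<close>

context regular_quotient
begin

context
  fixes \<alpha> \<beta> and a b :: "real \<Rightarrow> 'a"
  assumes \<alpha>: "ray (quotient_space G) quotient_dist \<alpha>" and \<beta>: "ray (quotient_space G) quotient_dist \<beta>"
    and lift_a: "ray_lift G \<alpha> a" and lift_b: "ray_lift G \<beta> b" and cal: "Q.calibrated \<alpha> \<beta>"
begin

lemma ray_a: "ray UNIV dist a" and proj_a: "0 \<le> t \<Longrightarrow> proj G (a t) = \<alpha> t" and proj_b': "0 \<le> t \<Longrightarrow> proj G (b t) = \<beta> t"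
  using lift_a lift_b unfolding ray_lift_def by auto

text \<open>Minimal segments from \<open>\<alpha>(s)\<close> to \<open>\<beta>(n)\<close> form almost geodesics together with \<open>\<alpha>\<close> restricted to \<open>[0, s]\<close>; since
  geodesics do not branch, they converge to \<open>\<alpha>\<close>.\<close>

lemma segments_converge:
  assumes s: "0 < s" and t: "0 \<le> t" and h: "\<And>n :: nat. h n \<in> G"
    and min: "\<And>n. quotient_dist (\<alpha> s) (\<beta> (real n)) = dist (a s) (h n (b (real n)))"
  shows "(\<lambda>n. seg (a s) (h n (b (real n))) t) \<longlonglongrightarrow> a (s + t)"
proof (rule ccontr)
  define l where "l n = dist (a s) (h n (b (real n)))" for n
  define e where "e n = seg (a s) (h n (b (real n)))" for n
  define u where "u x = Q.horo \<beta> (proj G x)" for x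
  assume "\<not> (\<lambda>n. seg (a s) (h n (b (real n))) t) \<longlonglongrightarrow> a (s + t)"
  then obtain \<eta> where \<eta>: "0 < \<eta>" "\<And>N. \<exists>n\<ge>N. \<eta> \<le> dist (e n t) (a (s + t))" unfolding lim_sequentially e_def by (meson not_le)
  have l_lim: "(\<lambda>n. l n - real n) \<longlonglongrightarrow> u (a s)" unfolding l_def u_def min[symmetric]
    using filterlim_compose[OF Q.horo_tendsto[OF \<beta> proj_in, of "a s"] filterlim_real_sequentially] proj_a[of s] s by simp
  have l_ge: "u (a s) + real n \<le> l n" for n
    unfolding l_def u_def min[symmetric] using Q.horo_le[OF \<beta> proj_in, of "real n" "a s"] proj_a[of s] s by simp
  obtain N where N: "t - u (a s) \<le> real N" using real_arch_simple by blast
  have tl: "t \<le> l n" if "N \<le> n" for n using l_ge[of n] N that by simp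
  have et: "dist (a s) (e n t) = t" "dist (e n t) (h n (b (real n))) = l n - t" if "N \<le> n" for n
    unfolding e_def using seg_dist[OF t tl[OF that, unfolded l_def]] unfolding l_def by auto
  have a0s: "dist (a 0) (a s) = s" using ray_unit_speed[OF ray_a, of 0 s] s by simp
  \<comment> \<open>The point \<open>e n t\<close> is at distance \<open>l n - t\<close> from a
    point of the orbit of \<open>b (real n)\<close>, which bounds \<open>u\<close> there from above.
    As \<open>u\<close> is 1-Lipschitz and drops by \<open>s\<close> from \<open>a 0\<close> to
    \<open>a s\<close>, the broken path from \<open>a 0\<close> through \<open>a s\<close> is almost
    minimizing.\<close>
  have lower: "s + t - (l n - real n - u (a s)) \<le> dist (a 0) (e n t)" if n: "N \<le> n" for n
  proof -
    have "u (e n t) \<le> quotient_dist (proj G (e n t)) (\<beta> (real n)) - real n" unfolding u_def by (rule Q.horo_le[OF \<beta> proj_in]) simp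
    also have "quotient_dist (proj G (e n t)) (\<beta> (real n)) \<le> l n - t"
      using quotient_dist_le[OF h, of "e n t" "b (real n)" n] proj_b'[of "real n"] et(2)[OF n] by simp
    finally have "u (e n t) \<le> l n - t - real n" by simp
    moreover have "u (a 0) - u (e n t) \<le> dist (a 0) (e n t)"
      unfolding u_def using Q.horo_lipschitz[OF \<beta> proj_in proj_in, of "a 0" "e n t"] quotient_dist_le'[of "a 0" "e n t"] by simp
    moreover have "u (a 0) - u (a s) = s" unfolding u_def using cal s proj_a[of 0] proj_a[of s] unfolding Q.calibrated_def by simp
    ultimately show ?thesis by simp
  qed
  have "(\<lambda>n. s + t - (l n - real n - u (a s))) \<longlonglongrightarrow> s + t - (u (a s) - u (a s))" by (intro tendsto_intros l_lim)
  then have lim: "(\<lambda>n. s + t - (l n - real n - u (a s))) \<longlonglongrightarrow> s + t" by simp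
  have a0: "(\<lambda>n. dist (a 0) (e n t)) \<longlonglongrightarrow> s + t"
  proof (rule tendsto_sandwich[OF _ _ lim tendsto_const])
    show "\<forall>\<^sub>F n in sequentially. s + t - (l n - real n - u (a s)) \<le> dist (a 0) (e n t)" using lower eventually_sequentially by blast
    have "dist (a 0) (e n t) \<le> s + t" if "N \<le> n" for n using dist_triangle[of "a 0" "e n t" "a s"] et(1)[OF that] a0s by simp
    then show "\<forall>\<^sub>F n in sequentially. dist (a 0) (e n t) \<le> s + t" using eventually_sequentially by blast
  qed
  define S where "S = {n. N \<le> n \<and> \<eta> \<le> dist (e n t) (a (s + t))}"
  have "\<exists>n\<ge>m. n \<in> S" for m using \<eta>(2)[of "max m N"] unfolding S_def by auto
  then have "infinite S" unfolding infinite_nat_iff_unbounded_le by blast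
  from infinite_enumerate[OF this] obtain r :: "nat \<Rightarrow> nat" where r: "strict_mono r" "\<And>n. r n \<in> S" by blast
  have mem: "e (r n) t \<in> cball (a s) t" for n using et(1)[of "r n"] r(2)[of n] unfolding S_def by simp
  then obtain z r' where z: "strict_mono r'" "((\<lambda>n. e (r n) t) \<circ> r') \<longlonglongrightarrow> z"
    using proper[of "a s" t, unfolded compact_def, rule_format, of "\<lambda>n. e (r n) t"] mem by blast
  then have z': "(\<lambda>n. e (r (r' n)) t) \<longlonglongrightarrow> z" by (simp add: comp_def)
  have sub: "strict_mono (r \<circ> r')" using r(1) z(1) by (rule strict_mono_o)
  have "(\<lambda>n. dist (a 0) (e (r (r' n)) t)) \<longlonglongrightarrow> s + t" using LIMSEQ_subseq_LIMSEQ[OF a0 sub] by (simp add: comp_def)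
  then have z0: "dist (a 0) z = s + t" by (rule LIMSEQ_unique[OF tendsto_dist[OF tendsto_const z']])
  have "(\<lambda>n. dist (a s) (e (r (r' n)) t)) \<longlonglongrightarrow> t" using et(1) r(2) unfolding S_def by (intro tendsto_eventually) auto
  then have zs: "dist (a s) z = t" by (rule LIMSEQ_unique[OF tendsto_dist[OF tendsto_const z']])
  have "z = a (s + t)"
  proof (rule nonbranching[of "a 0" "a s"])
    show "a 0 \<noteq> a s" using a0s s by auto
  qed (use z0 zs a0s ray_unit_speed[OF ray_a] s t in auto)
  moreover have "\<eta> \<le> dist z (a (s + t))"
    by (rule tendsto_lowerbound[OF tendsto_dist[OF z' tendsto_const]]) (use r(2) in \<open>auto simp: S_def\<close>)
  ultimately show False using \<eta>(1) by simp
qed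

text \<open>The lifted segment is as long as the quotient distance of its ends, so no part of it can
  be shortened in the quotient and its projection minimizes. Closeness at the single time
  \<open>T\<close> spreads to \<open>[0, T]\<close> because both curves start at
  \<open>a s\<close>.\<close>

lemma close_segment:
  assumes s: "0 < s" and T: "0 < T" and \<eta>: "0 < \<eta>"
  obtains r l e where "R \<le> r" "0 \<le> r" "T \<le> l" "minimizing_segment (quotient_space G) quotient_dist (proj G \<circ> e) l (\<alpha> s) (\<beta> r)"
    "\<And>t. t \<in> {0..T} \<Longrightarrow> dist (e t) (a (s + t)) < \<eta>"
proof -
  have "\<exists>k\<in>G. quotient_dist (\<alpha> s) (\<beta> (real n)) = dist (a s) (k (b (real n)))" for n
    using quotient_dist_attained[of "a s" "b (real n)"] proj_a[of s] proj_b'[of "real n"] s by simp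
  then obtain h where h: "\<And>n :: nat. h n \<in> G" "\<And>n. quotient_dist (\<alpha> s) (\<beta> (real n)) = dist (a s) (h n (b (real n)))" by metis
  define l where "l n = dist (a s) (h n (b (real n)))" for n
  define e where "e n = seg (a s) (h n (b (real n)))" for n
  have "\<forall>\<^sub>F n in sequentially. dist (e n T) (a (s + T)) < \<eta>"
    using tendstoD[OF segments_converge[OF s less_imp_le[OF T] h] \<eta>] unfolding e_def .
  moreover have "\<forall>\<^sub>F n in sequentially. max R (T - Q.horo \<beta> (\<alpha> s)) \<le> real n"
    using filterlim_real_sequentially unfolding filterlim_at_top by blast
  ultimately have "\<forall>\<^sub>F n in sequentially. dist (e n T) (a (s + T)) < \<eta> \<and> max R (T - Q.horo \<beta> (\<alpha> s)) \<le> real n" by (rule eventually_conj)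
  then obtain n where n: "dist (e n T) (a (s + T)) < \<eta>" "R \<le> real n" "T - Q.horo \<beta> (\<alpha> s) \<le> real n"
    by (auto dest: eventually_happens)
  have l: "T \<le> l n" unfolding l_def h(2)[symmetric] using Q.horo_le[OF \<beta> Q.ray_in[OF \<alpha>], of s "real n"] n(3) s by simp
  have iso: "dist (e n p) (e n q) = \<bar>p - q\<bar>" if "p \<in> {0..l n}" "q \<in> {0..l n}" for p q
    using seg(3) that unfolding e_def l_def by blast
  have ends: "e n 0 = a s" "e n (l n) = h n (b (real n))" unfolding e_def l_def using seg(1,2) by auto
  have pr: "proj G (e n 0) = \<alpha> s" "proj G (e n (l n)) = \<beta> (real n)"
    unfolding ends using proj_a[of s] s proj_G[OF h(1)] proj_b'[of "real n"] by auto
  have lb: "p - q \<le> quotient_dist (proj G (e n q)) (proj G (e n p))" if pq: "p \<in> {0..l n}" "q \<in> {0..l n}" "q \<le> p" for p q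
  proof -
    have "l n = quotient_dist (proj G (e n 0)) (proj G (e n (l n)))" using pr h(2)[of n] unfolding l_def by simp
    also have "\<dots> \<le> quotient_dist (proj G (e n 0)) (proj G (e n q)) + quotient_dist (proj G (e n q)) (proj G (e n p)) + quotient_dist (proj G (e n p)) (proj G (e n (l n)))"
      using Q.triangle[OF proj_in proj_in proj_in, of "e n 0" "e n q" "e n p"] Q.triangle[OF proj_in proj_in proj_in, of "e n 0" "e n p" "e n (l n)"]
        Q.triangle[OF proj_in proj_in proj_in, of "e n 0" "e n p" "e n q"] Q.triangle[OF proj_in proj_in proj_in, of "e n 0" "e n (l n)" "e n p"] by simp
    also have "\<dots> \<le> q + quotient_dist (proj G (e n q)) (proj G (e n p)) + (l n - p)"
      using quotient_dist_le'[of "e n 0" "e n q"] quotient_dist_le'[of "e n p" "e n (l n)"] iso[of 0 q] iso[of p "l n"] pq by simp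
    finally show ?thesis by simp
  qed
  have "quotient_dist (proj G (e n p)) (proj G (e n q)) = \<bar>p - q\<bar>" if "p \<in> {0..l n}" "q \<in> {0..l n}" for p q
    using quotient_dist_le'[of "e n p" "e n q"] iso[OF that] Q.sym[OF proj_in proj_in, of "e n p" "e n q"] lb[OF that] lb[OF that(2,1)]
    by (cases "p \<le> q") auto
  then have "minimizing_segment (quotient_space G) quotient_dist (proj G \<circ> e n) (l n) (\<alpha> s) (\<beta> (real n))"
    unfolding minimizing_segment_def using l T pr proj_in by auto
  moreover have "dist (e n t) (a (s + t)) < \<eta>" if t: "t \<in> {0..T}" for t
  proof -
    define k where "k = t / T"
    have k: "0 \<le> k" "k \<le> 1" "t = k * T" unfolding k_def using t T by auto
    have "dist (e n t) (a (s + t)) \<le> k * dist (e n T) (a (s + T))"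
    proof (rule cn_on_two_sides_eq[OF cn _ _ _ _ k(1,2)])
      show "dist (a s) (e n t) = k * dist (a s) (e n T)" "dist (e n t) (e n T) = (1 - k) * dist (a s) (e n T)"
        using iso[of 0 t] iso[of 0 T] iso[of t T] ends(1) t l T by (auto simp: left_diff_distrib k(3)[symmetric])
      show "dist (a s) (a (s + t)) = k * dist (a s) (a (s + T))" "dist (a (s + t)) (a (s + T)) = (1 - k) * dist (a s) (a (s + T))"
        using ray_unit_speed[OF ray_a] s t T k(3) by (auto simp: algebra_simps)
    qed auto
    also have "\<dots> \<le> dist (e n T) (a (s + T))" using k by (simp add: mult_left_le_one_le)
    finally show ?thesis using n(1) by simp
  qed
  ultimately show ?thesis using that[of "real n" "l n" "e n"] n(2) l by simp
qed

text \<open>Nonbranching needs a piece of \<open>\<alpha>\<close> before the segments begin, so they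
  start at \<open>\<alpha> (s k)\<close> rather than at the origin; moving origins are permitted for
  corays. The delay \<open>s k\<close> along \<open>\<alpha>\<close> costs another
  \<open>s k\<close> in the distance.\<close>

lemma calibrated_coray: "coray (quotient_space G) quotient_dist \<alpha> \<beta>"
proof -
  define s where "s k = 1 / real (Suc k)" for k
  have s: "0 < s k" for k unfolding s_def by simp
  have "\<exists>r l e. real k \<le> r \<and> real (Suc k) \<le> l \<and> minimizing_segment (quotient_space G) quotient_dist (proj G \<circ> e) l (\<alpha> (s k)) (\<beta> r) \<and>
      (\<forall>t\<in>{0..real (Suc k)}. dist (e t) (a (s k + t)) < s k)" for k
    using close_segment[OF s[of k] _ s[of k], of "real (Suc k)" "real k"] by (metis of_nat_0_less_iff zero_less_Suc)
  then obtain r l e where f: "\<And>k. real k \<le> r k" "\<And>k. real (Suc k) \<le> l k"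
    "\<And>k. minimizing_segment (quotient_space G) quotient_dist (proj G \<circ> e k) (l k) (\<alpha> (s k)) (\<beta> (r k))"
    "\<And>k. \<forall>t\<in>{0..real (Suc k)}. dist (e k t) (a (s k + t)) < s k" by metis
  have s_lim: "s \<longlonglongrightarrow> 0" unfolding s_def by (rule LIMSEQ_Suc[OF lim_1_over_n])
  have "(\<lambda>k. quotient_dist (\<alpha> (s k)) (\<alpha> 0)) \<longlonglongrightarrow> 0" using s_lim Q.ray_dist[OF \<alpha>, of "s _" 0] s by (simp add: less_imp_le)
  moreover have "filterlim r at_top sequentially"
    by (rule filterlim_at_top_mono[OF filterlim_real_sequentially]) (use f(1) in simp)
  moreover have "\<forall>\<^sub>F k in sequentially. T \<le> l k \<and> (\<forall>t\<in>{0..T}. quotient_dist ((proj G \<circ> e k) t) (\<alpha> t) < h)" if "0 \<le> T" "0 < h" for T h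
  proof -
    have "\<forall>\<^sub>F k in sequentially. s k < h / 2" using order_tendstoD(2)[OF s_lim, of "h / 2"] that by simp
    moreover have "\<forall>\<^sub>F k in sequentially. T \<le> real k" using filterlim_real_sequentially unfolding filterlim_at_top by blast
    ultimately show ?thesis
    proof eventually_elim
      case (elim k)
      have "quotient_dist (proj G (e k t)) (\<alpha> t) < h" if t: "t \<in> {0..T}" for t
      proof -
        have "quotient_dist (proj G (e k t)) (\<alpha> t) \<le> dist (e k t) (a t)" using quotient_dist_le'[of "e k t" "a t"] proj_a[of t] t by simp
        also have "\<dots> \<le> dist (e k t) (a (s k + t)) + dist (a (s k + t)) (a t)" by (rule dist_triangle)
        also have "dist (a (s k + t)) (a t) = s k" using ray_unit_speed[OF ray_a, of "s k + t" t] s[of k] t by simp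
        also have "dist (e k t) (a (s k + t)) < s k" using f(4)[of k] t elim by auto
        finally show ?thesis using elim by simp
      qed
      then show ?case using f(2)[of k] elim by simp
    qed
  qed
  moreover have "0 \<le> r k" for k using f(1)[of k] by linarith
  then have "\<forall>k. 0 \<le> r k \<and> minimizing_segment (quotient_space G) quotient_dist (proj G \<circ> e k) (l k) (\<alpha> (s k)) (\<beta> (r k))"
    using f(3) by blast
  moreover have "half_geodesic (quotient_space G) quotient_dist \<alpha>" using \<alpha> unfolding ray_def by blast
  ultimately show ?thesis unfolding coray_def using Q.ray_quasi_ray[OF \<beta>]
    by (intro conjI exI[of _ "\<lambda>k. proj G \<circ> e k"] exI[of _ l] exI[of _ "\<lambda>k. \<alpha> (s k)"] exI[of _ r] allI impI) simp_all
qed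

end

lemma coray_iff_calibrated:
  assumes "ray (quotient_space G) quotient_dist \<alpha>" "ray (quotient_space G) quotient_dist \<beta>"
  shows "coray (quotient_space G) quotient_dist \<alpha> \<beta> \<longleftrightarrow> Q.calibrated \<alpha> \<beta>"
proof
  assume "Q.calibrated \<alpha> \<beta>"
  moreover obtain a where "ray_lift G \<alpha> a" using ray_lift_exists[OF assms(1)] by blast
  moreover obtain b where "ray_lift G \<beta> b" using ray_lift_exists[OF assms(2)] by blast
  ultimately show "coray (quotient_space G) quotient_dist \<alpha> \<beta>" using calibrated_coray[OF assms] by blast
qed (rule Q.coray_calibrated[OF _ assms(2)])

lemma weakly_equivalent_iff_calibrated:
  assumes \<alpha>: "ray (quotient_space G) quotient_dist \<alpha>" and \<beta>: "ray (quotient_space G) quotient_dist \<beta>"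
  shows "weakly_equivalent G \<alpha> \<beta> \<longleftrightarrow> Q.calibrated \<alpha> \<beta>"
proof
  assume "weakly_equivalent G \<alpha> \<beta>"
  then have "\<exists>a b h. ray_lift G \<alpha> a \<and> ray_lift G \<beta> b \<and> (\<forall>n :: nat. h n \<in> G) \<and>
      limitin cone_topology (\<lambda>n. act_boundary (h n) (point_at_infinity b)) (point_at_infinity a) sequentially \<and>
      (\<forall>n. quasi_ray (quotient_space G) quotient_dist (proj G \<circ> ray_to (a 0) (act_boundary (h n) (point_at_infinity b)))) \<and>
      (\<lambda>n. length_excess quotient_dist (proj G \<circ> ray_to (a 0) (act_boundary (h n) (point_at_infinity b)))) \<longlonglongrightarrow> 0"
    unfolding weakly_equivalent_def Let_def by (elim conjE)
  then obtain a b h where l: "ray_lift G \<alpha> a" "ray_lift G \<beta> b" and h0: "\<forall>n :: nat. h n \<in> G"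
    and lim: "limitin cone_topology (\<lambda>n. act_boundary (h n) (point_at_infinity b)) (point_at_infinity a) sequentially"
    and ex: "(\<lambda>n. length_excess quotient_dist (proj G \<circ> ray_to (a 0) (act_boundary (h n) (point_at_infinity b)))) \<longlonglongrightarrow> 0"
    by (elim exE conjE)
  note h = h0[rule_format]
  show "Q.calibrated \<alpha> \<beta>"
    by (rule weakly_equivalent_calibrated[OF \<beta> l(2,1) h lim[unfolded act_boundary_point[OF h]] ex[unfolded act_boundary_point[OF h]]])
next
  assume "Q.calibrated \<alpha> \<beta>"
  then show "weakly_equivalent G \<alpha> \<beta>" using calibrated_weakly_equivalent[OF \<beta> _ \<alpha>] ray_lift_exists[OF \<beta>] by blast
qed

end

theorem theorem28:
  fixes A :: "('a::metric_space, 'e::euclidean_space) chart set"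
    and g :: "('a, 'e) metric_tensor"
    and G :: "('a \<Rightarrow> 'a) set"
    and \<alpha> \<beta> :: "real \<Rightarrow> 'a set"
  assumes "regular_quotient A g G"
    and "ray (quotient_space G) quotient_dist \<alpha>"
    and "ray (quotient_space G) quotient_dist \<beta>"
  shows "(coray (quotient_space G) quotient_dist \<alpha> \<beta> \<longleftrightarrow> weakly_equivalent G \<alpha> \<beta>) \<and>
    ((\<forall>x\<in>quotient_space G. \<forall>y\<in>quotient_space G.
        busemann quotient_dist \<alpha> x y = busemann quotient_dist \<beta> x y) \<longleftrightarrow>
     weakly_equivalent G \<alpha> \<beta> \<and> weakly_equivalent G \<beta> \<alpha> \<and>
     busemann quotient_dist \<alpha> (\<alpha> 0) (\<beta> 0) = busemann quotient_dist \<beta> (\<alpha> 0) (\<beta> 0))"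
proof -
  interpret regular_quotient A g G by (rule assms(1))
  show ?thesis
    using Q.busemann_eq_iff coray_iff_calibrated weakly_equivalent_iff_calibrated assms(2,3) by simp
qed

end
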